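(* Let $n\ge 1$. Consider the following procedure. Step 1: choose vectors $\tilde v_n,\tilde w_n\in\mathbb{Q}^n$ with all coordinates positive and $\langle \tilde v_n,\tilde w_n\rangle=1$. Step 2: choose a basis $\{\tilde v_1,\dots,\tilde v_{n-1}\}$ of $\tilde w_n^{\perp}\subset\mathbb{Q}^n$, and let $\tilde A$ be the (invertible) matrix with columns $\tilde v_1,\dots,\tilde v_n$. Step 3: choose a natural number $\tilde\lambda\ge 2$ such that all entries of $\tilde A M_{\tilde\lambda}\tilde A^{-1}$ are non-negative rational numbers. Step 4: choose an integer $m\ge 1$ such that $m\tilde A M_{\tilde\lambda}\tilde A^{-1}$ has non-negative integer entries, and let $Q$ be the quiver with $n$ vertices and adjacency matrix $m\tilde A M_{\tilde\lambda}\tilde A^{-1}$. Then: (a) Steps 3 and 4 can always be carried out, i.e. such $\tilde\lambda$ and $m$ exist for every choice made in Steps 1 and 2; (b) every quiver $Q$ produced by the procedure satisfies $\phi\dim\left(\frac{\Bbbk Q}{J^2}\right)=n$; (c) every radical square zero algebra $\frac{\Bbbk Q}{J^2}$ with $|Q_0|=n$ and $\phi\dim\left(\frac{\Bbbk Q}{J^2}\right)=n$ (the maximal possible value) has a quiver $Q$ which is produced by the procedure.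
   Context: $\Bbbk$ is a field, quivers are finite and connected, $\Bbbk Q$ is the path algebra and $J$ is the ideal generated by the arrows. The adjacency matrix of $Q$ has $(i,j)$ entry equal to the number of arrows from $i$ to $j$. For a number $\lambda$, $M_\lambda$ is the $n\times n$ matrix with entries $(M_\lambda)_{i+1,i}=1$ for $1\le i\le n-2$, $(M_\lambda)_{n,n}=\lambda$, and all other entries $0$ (a nilpotent Jordan block of size $n-1$ together with a $1\times1$ block $\lambda$). $\langle\cdot,\cdot\rangle$ is the standard bilinear form on $\mathbb{Q}^n$. Definition of $\phi\dim$. For a finite dimensional algebra $A$, modules are finitely generated right $A$-modules. $K_0(A)$ is the abelian group generated by symbols $[M]$, one for each finitely generated module $M$, modulo $[M]-[M']-[M'']$ whenever $M\cong M'\oplus M''$, and $[P]$ for each projective $P$. The syzygy $\Omega$ induces an endomorphism $\bar\Omega$ of $K_0(A)$. For a module $M$, $\langle\mathrm{add}\,M\rangle$ is the subgroup of $K_0(A)$ generated by the classes of the indecomposable direct summands of $M$, and $\phi(M)=\min\{l\in\mathbb{N}:\bar\Omega|_{\bar\Omega^{l+s}\langle\mathrm{add}\,M\rangle}\text{ is a monomorphism for all }s\in\mathbb{N}\}$, with $0\in\mathbb{N}$. Finally $\phi\dim(A)=\sup\{\phi(M): M \text{ a finitely generated } A\text{-module}\}$. *)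

theory Defs
  imports
    "Jordan_Normal_Form.Gauss_Jordan_Elimination"
    "Jordan_Normal_Form.VS_Connect"
    "Graph_Theory.Graph_Theory"
    "HOL-Algebra.Ideal_Product"
    "HOL-Algebra.QuotRing"
    "HOL-Algebra.Free_Abelian_Groups"
    "HOL-Library.Extended_Nat"
begin

section \<open>Right modules over a (not necessarily commutative) ring\<close>

text \<open>As in \<^theory>\<open>HOL-Algebra.Module\<close>, a module extends the record of rings and its
  multiplicative fields are ignored.\<close>

record ('r, 'm) rmodule = "'m ring" +
  ract :: "'m \<Rightarrow> 'r \<Rightarrow> 'm" (infixl \<open>\<ltimes>\<index>\<close> 70)

locale right_module = R?: ring R + M?: abelian_group M
  for R :: "('r, 'z) ring_scheme" (structure)
    and M :: "('r, 'm, 'c) rmodule_scheme" (structure) +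
  assumes ract_closed: "x \<in> carrier M \<Longrightarrow> r \<in> carrier R \<Longrightarrow> x \<ltimes>\<^bsub>M\<^esub> r \<in> carrier M"
    and ract_add_left: "x \<in> carrier M \<Longrightarrow> y \<in> carrier M \<Longrightarrow> r \<in> carrier R \<Longrightarrow>
      (x \<oplus>\<^bsub>M\<^esub> y) \<ltimes>\<^bsub>M\<^esub> r = (x \<ltimes>\<^bsub>M\<^esub> r) \<oplus>\<^bsub>M\<^esub> (y \<ltimes>\<^bsub>M\<^esub> r)"
    and ract_add_right: "x \<in> carrier M \<Longrightarrow> r \<in> carrier R \<Longrightarrow> s \<in> carrier R \<Longrightarrow>
      x \<ltimes>\<^bsub>M\<^esub> (r \<oplus>\<^bsub>R\<^esub> s) = (x \<ltimes>\<^bsub>M\<^esub> r) \<oplus>\<^bsub>M\<^esub> (x \<ltimes>\<^bsub>M\<^esub> s)"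
    and ract_mult: "x \<in> carrier M \<Longrightarrow> r \<in> carrier R \<Longrightarrow> s \<in> carrier R \<Longrightarrow>
      x \<ltimes>\<^bsub>M\<^esub> (r \<otimes>\<^bsub>R\<^esub> s) = (x \<ltimes>\<^bsub>M\<^esub> r) \<ltimes>\<^bsub>M\<^esub> s"
    and ract_one: "x \<in> carrier M \<Longrightarrow> x \<ltimes>\<^bsub>M\<^esub> \<one>\<^bsub>R\<^esub> = x"

definition rsubmodule ::
  "('r, 'z) ring_scheme \<Rightarrow> 'm set \<Rightarrow> ('r, 'm, 'c) rmodule_scheme \<Rightarrow> bool" where
  "rsubmodule R N M \<longleftrightarrow> additive_subgroup N M \<and>
     (\<forall>x\<in>N. \<forall>r\<in>carrier R. x \<ltimes>\<^bsub>M\<^esub> r \<in> N)"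

definition rfin_gen :: "('r, 'z) ring_scheme \<Rightarrow> ('r, 'm, 'c) rmodule_scheme \<Rightarrow> bool" where
  "rfin_gen R M \<longleftrightarrow> (\<exists>X. finite X \<and> X \<subseteq> carrier M \<and>
     (\<forall>N. rsubmodule R N M \<and> X \<subseteq> N \<longrightarrow> N = carrier M))"

definition rhom :: "('r, 'z) ring_scheme \<Rightarrow> ('r, 'm, 'c) rmodule_scheme \<Rightarrow>
    ('r, 'n, 'd) rmodule_scheme \<Rightarrow> ('m \<Rightarrow> 'n) set" where
  "rhom R M N = {f. f ` carrier M \<subseteq> carrier N \<and>
     (\<forall>x\<in>carrier M. \<forall>y\<in>carrier M. f (x \<oplus>\<^bsub>M\<^esub> y) = f x \<oplus>\<^bsub>N\<^esub> f y) \<and>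
     (\<forall>x\<in>carrier M. \<forall>r\<in>carrier R. f (x \<ltimes>\<^bsub>M\<^esub> r) = f x \<ltimes>\<^bsub>N\<^esub> r)}"

definition repi :: "('r, 'z) ring_scheme \<Rightarrow> ('r, 'm, 'c) rmodule_scheme \<Rightarrow>
    ('r, 'n, 'd) rmodule_scheme \<Rightarrow> ('m \<Rightarrow> 'n) set" where
  "repi R M N = {f \<in> rhom R M N. f ` carrier M = carrier N}"

definition riso :: "('r, 'z) ring_scheme \<Rightarrow> ('r, 'm, 'c) rmodule_scheme \<Rightarrow>
    ('r, 'n, 'd) rmodule_scheme \<Rightarrow> bool" where
  "riso R M N \<longleftrightarrow> (\<exists>f\<in>rhom R M N. bij_betw f (carrier M) (carrier N))"

definition rsum :: "('r, 'm, 'c) rmodule_scheme \<Rightarrow> ('r, 'n, 'd) rmodule_scheme \<Rightarrow>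
    ('r, 'm \<times> 'n) rmodule" where
  "rsum M N = \<lparr>carrier = carrier M \<times> carrier N, monoid.mult = undefined, monoid.one = undefined,
     ring.zero = (\<zero>\<^bsub>M\<^esub>, \<zero>\<^bsub>N\<^esub>),
     ring.add = (\<lambda>(x, y) (x', y'). (x \<oplus>\<^bsub>M\<^esub> x', y \<oplus>\<^bsub>N\<^esub> y')),
     ract = (\<lambda>(x, y) r. (x \<ltimes>\<^bsub>M\<^esub> r, y \<ltimes>\<^bsub>N\<^esub> r))\<rparr>"

section \<open>The category of finitely generated right modules\<close>

text \<open>The elements of our modules live in \<open>nat \<Rightarrow> 'r\<close>. This loses nothing: a module generated by
  \<open>n\<close> elements is a quotient of \<open>R\<^sup>n\<close>, so by choosing representatives its elements inject into
  \<open>nat \<Rightarrow> 'r\<close>, and the structure can be transported along this injection.\<close>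

type_synonym 'r fg_module = "('r, nat \<Rightarrow> 'r) rmodule"

definition fg_modules :: "('r, 'z) ring_scheme \<Rightarrow> 'r fg_module set" where
  "fg_modules R = {M. right_module R M \<and> rfin_gen R M}"

definition projective :: "('r, 'z) ring_scheme \<Rightarrow> 'r fg_module \<Rightarrow> bool" where
  "projective R P \<longleftrightarrow> P \<in> fg_modules R \<and>
     (\<forall>M\<in>fg_modules R. \<forall>N\<in>fg_modules R. \<forall>g\<in>repi R M N. \<forall>f\<in>rhom R P N.
        \<exists>h\<in>rhom R P M. \<forall>x\<in>carrier P. g (h x) = f x)"

definition indecomposable :: "('r, 'z) ring_scheme \<Rightarrow> 'r fg_module \<Rightarrow> bool" where
  "indecomposable R M \<longleftrightarrow> M \<in> fg_modules R \<and> carrier M \<noteq> {\<zero>\<^bsub>M\<^esub>} \<and>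
     (\<forall>M'\<in>fg_modules R. \<forall>M''\<in>fg_modules R. riso R M (rsum M' M'') \<longrightarrow>
        carrier M' = {\<zero>\<^bsub>M'\<^esub>} \<or> carrier M'' = {\<zero>\<^bsub>M''\<^esub>})"

definition direct_summand ::
  "('r, 'z) ring_scheme \<Rightarrow> 'r fg_module \<Rightarrow> 'r fg_module \<Rightarrow> bool" where
  "direct_summand R N M \<longleftrightarrow> N \<in> fg_modules R \<and> (\<exists>N'\<in>fg_modules R. riso R M (rsum N N'))"

text \<open>A projective cover is an essential epimorphism from a projective module: no proper
  submodule of its source is mapped onto its target.\<close>

definition projective_cover ::
  "('r, 'z) ring_scheme \<Rightarrow> 'r fg_module \<Rightarrow> ((nat \<Rightarrow> 'r) \<Rightarrow> (nat \<Rightarrow> 'r)) \<Rightarrow> 'r fg_module \<Rightarrow> bool" where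
  "projective_cover R P p M \<longleftrightarrow> projective R P \<and> p \<in> repi R P M \<and>
     (\<forall>N. rsubmodule R N P \<and> p ` N = carrier M \<longrightarrow> N = carrier P)"

text \<open>The syzygy is determined only up to isomorphism; we choose a representative.\<close>

definition syzygy :: "('r, 'z) ring_scheme \<Rightarrow> 'r fg_module \<Rightarrow> 'r fg_module" where
  "syzygy R M = (SOME K. \<exists>P p. projective_cover R P p M \<and> K = P\<lparr>carrier := a_kernel P M p\<rparr>)"

section \<open>The group $K_0$ and the Igusa--Todorov function\<close>

abbreviation K0_free :: "('r, 'z) ring_scheme \<Rightarrow> ('r fg_module \<Rightarrow>\<^sub>0 int) monoid" where
  "K0_free R \<equiv> free_Abelian_group (fg_modules R)"

definition K0_rel :: "('r, 'z) ring_scheme \<Rightarrow> ('r fg_module \<Rightarrow>\<^sub>0 int) set" where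
  "K0_rel R = generate (K0_free R)
     ({frag_of M - frag_of M' - frag_of M'' | M M' M''.
         M \<in> fg_modules R \<and> M' \<in> fg_modules R \<and> M'' \<in> fg_modules R \<and> riso R M (rsum M' M'')}
      \<union> {frag_of P | P. projective R P})"

definition K0 :: "('r, 'z) ring_scheme \<Rightarrow> ('r fg_module \<Rightarrow>\<^sub>0 int) set monoid" where
  "K0 R = K0_free R Mod K0_rel R"

definition K0_class :: "('r, 'z) ring_scheme \<Rightarrow> 'r fg_module \<Rightarrow> ('r fg_module \<Rightarrow>\<^sub>0 int) set" where
  "K0_class R M = K0_rel R #>\<^bsub>K0_free R\<^esub> frag_of M"

text \<open>The map induced on cosets by the endomorphism of the free group that sends the symbol of \<open>M\<close>
  to the symbol of its syzygy. All cosets in the union coincide, since that endomorphism maps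
  the subgroup of relations into itself.\<close>

definition Omega_bar :: "('r, 'z) ring_scheme \<Rightarrow>
    ('r fg_module \<Rightarrow>\<^sub>0 int) set \<Rightarrow> ('r fg_module \<Rightarrow>\<^sub>0 int) set" where
  "Omega_bar R X =
     (\<Union>c\<in>X. K0_rel R #>\<^bsub>K0_free R\<^esub> frag_extend (\<lambda>M. frag_of (syzygy R M)) c)"

definition add_subgroup ::
  "('r, 'z) ring_scheme \<Rightarrow> 'r fg_module \<Rightarrow> ('r fg_module \<Rightarrow>\<^sub>0 int) set set" where
  "add_subgroup R M = generate (K0 R)
     {K0_class R N | N. indecomposable R N \<and> direct_summand R N M}"

definition phi :: "('r, 'z) ring_scheme \<Rightarrow> 'r fg_module \<Rightarrow> nat" where
  "phi R M = (LEAST l. \<forall>s. inj_on (Omega_bar R) ((Omega_bar R ^^ (l + s)) ` add_subgroup R M))"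

definition phi_dim :: "('r, 'z) ring_scheme \<Rightarrow> enat" where
  "phi_dim R = (SUP M\<in>fg_modules R. enat (phi R M))"

section \<open>Path algebras and radical square zero algebras\<close>

text \<open>A path is a pair of its starting vertex and its list of arrows, so that vertices give
  paths of length zero. Paths are composed from left to right; hence right modules over
  the path algebra are representations of the quiver.\<close>

definition paths :: "('v, 'e) pre_digraph \<Rightarrow> ('v \<times> 'e list) set" where
  "paths Q = {(u, p). \<exists>v. pre_digraph.awalk Q u p v}"

definition path_algebra ::
  "('v, 'e) pre_digraph \<Rightarrow> ('v \<times> 'e list \<Rightarrow>\<^sub>0 'k::field) ring" where
  "path_algebra Q = \<lparr>carrier = {f. Poly_Mapping.keys f \<subseteq> paths Q},
     monoid.mult = (\<lambda>f g. \<Sum>(u, p)\<in>Poly_Mapping.keys f. \<Sum>(w, q)\<in>Poly_Mapping.keys g.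
        if pre_digraph.awlast Q u p = w
        then Poly_Mapping.single (u, p @ q)
          (Poly_Mapping.lookup f (u, p) * Poly_Mapping.lookup g (w, q))
        else 0),
     monoid.one = (\<Sum>v\<in>verts Q. Poly_Mapping.single (v, []) 1),
     ring.zero = 0, ring.add = (+)\<rparr>"

definition arrow_ideal :: "('v, 'e) pre_digraph \<Rightarrow> ('v \<times> 'e list \<Rightarrow>\<^sub>0 'k::field) set" where
  "arrow_ideal Q =
     Idl\<^bsub>path_algebra Q\<^esub> ((\<lambda>e. Poly_Mapping.single (tail Q e, [e]) 1) ` arcs Q)"

definition rad_square_zero_algebra ::
  "'k::field itself \<Rightarrow> ('v, 'e) pre_digraph \<Rightarrow> ('v \<times> 'e list \<Rightarrow>\<^sub>0 'k) set ring" where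
  "rad_square_zero_algebra _ Q =
     path_algebra Q Quot (arrow_ideal Q \<cdot>\<^bsub>path_algebra Q\<^esub> arrow_ideal Q)"

text \<open>The adjacency matrix with respect to a numbering \<open>\<nu>\<close> of the vertices by \<open>0, \<dots>, n - 1\<close>.\<close>

definition adjacency_matrix :: "nat \<Rightarrow> ('v, 'e) pre_digraph \<Rightarrow> (nat \<Rightarrow> 'v) \<Rightarrow> nat mat" where
  "adjacency_matrix n Q \<nu> =
     mat n n (\<lambda>(i, j). card {e \<in> arcs Q. tail Q e = \<nu> i \<and> head Q e = \<nu> j})"

section \<open>The procedure\<close>

text \<open>Matrix indices start at 0.\<close>

definition M_mat :: "nat \<Rightarrow> rat \<Rightarrow> rat mat" where
  "M_mat n l = mat n n (\<lambda>(i, j).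
     if i = Suc j \<and> Suc i < n then 1
     else if Suc i = n \<and> Suc j = n then l
     else 0)"

definition step1 :: "nat \<Rightarrow> rat vec \<Rightarrow> rat vec \<Rightarrow> bool" where
  "step1 n v w \<longleftrightarrow> v \<in> carrier_vec n \<and> w \<in> carrier_vec n \<and>
     (\<forall>i<n. v $ i > 0) \<and> (\<forall>i<n. w $ i > 0) \<and> v \<bullet> w = 1"

definition orth_compl :: "nat \<Rightarrow> rat vec \<Rightarrow> rat vec set" where
  "orth_compl n w = {x \<in> carrier_vec n. x \<bullet> w = 0}"

definition step2 :: "nat \<Rightarrow> rat vec \<Rightarrow> rat vec list \<Rightarrow> bool" where
  "step2 n w vs \<longleftrightarrow> length vs = n - 1 \<and> distinct vs \<and>
     vectorspace.basis class_ring
       ((module_vec TYPE(rat) n)\<lparr>carrier := orth_compl n w\<rparr>) (set vs)"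

definition A_mat :: "nat \<Rightarrow> rat vec list \<Rightarrow> rat vec \<Rightarrow> rat mat" where
  "A_mat n vs v = mat_of_cols n (vs @ [v])"

definition conj_mat :: "nat \<Rightarrow> rat vec list \<Rightarrow> rat vec \<Rightarrow> nat \<Rightarrow> rat mat" where
  "conj_mat n vs v l = A_mat n vs v * M_mat n (of_nat l) * the (mat_inverse (A_mat n vs v))"

definition step3 :: "nat \<Rightarrow> rat vec list \<Rightarrow> rat vec \<Rightarrow> nat \<Rightarrow> bool" where
  "step3 n vs v l \<longleftrightarrow> l \<ge> 2 \<and> (\<forall>i<n. \<forall>j<n. conj_mat n vs v l $$ (i, j) \<ge> 0)"

definition step4 :: "nat \<Rightarrow> rat vec list \<Rightarrow> rat vec \<Rightarrow> nat \<Rightarrow> nat \<Rightarrow> bool" where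
  "step4 n vs v l m \<longleftrightarrow> m \<ge> 1 \<and>
     (\<forall>i<n. \<forall>j<n. (of_nat m \<cdot>\<^sub>m conj_mat n vs v l) $$ (i, j) \<in> \<nat>)"

definition produced :: "nat \<Rightarrow> ('v, 'e) pre_digraph \<Rightarrow> (nat \<Rightarrow> 'v) \<Rightarrow> bool" where
  "produced n Q \<nu> \<longleftrightarrow> (\<exists>v w vs l m.
     step1 n v w \<and> step2 n w vs \<and> step3 n vs v l \<and> step4 n vs v l m \<and>
     map_mat of_nat (adjacency_matrix n Q \<nu>) = of_nat m \<cdot>\<^sub>m conj_mat n vs v l)"

end

theory Submission
  imports Defs "HOL-Library.Function_Algebras"
begin

text \<open>Over \<open>\<Bbbk>Q/J\<^sup>2\<close> every syzygy is semisimple, up to projective summands, and \<open>\<Omega>\<close> acts on the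
  classes of the simple modules by multiplication of row vectors with the adjacency matrix \<open>T\<close>;
  in \<open>K\<^sub>0\<close> the simple modules at the sinks vanish and the others are independent. Hence the
  \<open>\<phi>\<close>-dimension is governed by the stabilisation of the kernels of the powers of \<open>T\<close>.

  If it equals \<open>n \<ge> 2\<close>, there is an integral vector \<open>z\<close> with \<open>z T\<^sup>n\<^sup>-\<^sup>1 = 0\<close> and
  \<open>z T\<^sup>n\<^sup>-\<^sup>2 \<noteq> 0\<close> modulo the sinks, and a dimension count excludes sinks and sources. So \<open>T\<close> is the
  sum of a nilpotent Jordan block of size \<open>n - 1\<close> and a block of size 1 with entry \<open>\<mu>\<close>. The matrix
  \<open>T\<^sup>n\<^sup>-\<^sup>1\<close> has rank one and neither zero rows nor zero columns, so the two eigenvectors for \<open>\<mu>\<close> are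
  positive; its trace \<open>\<mu>\<^sup>n\<^sup>-\<^sup>1\<close> is an integer \<open>\<ge> n\<close>, so \<open>\<mu> \<ge> 2\<close> is an integer, and the procedure
  yields \<open>T\<close> with \<open>\<lambda> = \<mu>\<close> and \<open>m = 1\<close>. Conversely, the rows of the inverse of the matrix chosen in
  Step 2 are a Jordan basis for the matrix obtained in Step 4. Step 3 succeeds because the entries
  of the conjugate of \<open>M\<^sub>\<lambda>\<close> are affine functions of \<open>\<lambda>\<close> with slopes \<open>v\<^sub>i w\<^sub>j > 0\<close>.\<close>

section \<open>Right modules\<close>

text \<open>The obstacle is independence: in a group given by generators and relations, the classes
  of the simple modules at the non-sinks must be shown to have no relation. The detector is the
  multiplicity of \<open>S_j\<close> in \<open>M\<close>, taken as the rank of the pairing between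
  the homomorphisms to \<open>S_j\<close> and the \<open>S_j\<close>-part of the socle. It is
  additive on direct sums by linear algebra, and it vanishes on projectives as soon as an arrow
  leaves \<open>j\<close>.

  The value \<open>n\<close> arises as \<open>(n - 1) + 1\<close>: the nilpotent block accounts for
  \<open>n - 1\<close> steps, and one more is spent in passing from a module to its semisimple first
  syzygy. The modules \<open>Cyc i {a}\<close> show that this step loses nothing: their syzygy is
  the simple module at the target of \<open>a\<close>, so every integral vector on the targets of
  arrows is the class of a syzygy.

  For \<open>n = 1\<close> there is no nilpotent block, and the one step has another source. With
  \<open>d \<ge> 2\<close> loops the combination \<open>[S] - d [Cyc v {a}]\<close> is nonzero and
  killed by the syzygy map; with at most one loop every class is a multiple of \<open>[S]\<close>.

  Syzygies are fixed only by \<open>SOME\<close>, so they are computed from explicit covers whose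
  kernel lies in the radical.\<close>

context right_module
begin

lemma zero_ract [simp]: "r \<in> carrier R \<Longrightarrow> \<zero>\<^bsub>M\<^esub> \<ltimes>\<^bsub>M\<^esub> r = \<zero>\<^bsub>M\<^esub>"
  by (metis M.add.l_cancel_one ract_add_left ract_closed M.zero_closed M.r_zero)

lemma ract_zero [simp]: "x \<in> carrier M \<Longrightarrow> x \<ltimes>\<^bsub>M\<^esub> \<zero>\<^bsub>R\<^esub> = \<zero>\<^bsub>M\<^esub>"
  by (metis M.add.l_cancel_one ract_add_right ract_closed R.zero_closed R.r_zero)

lemma minus_ract: "x \<in> carrier M \<Longrightarrow> r \<in> carrier R \<Longrightarrow> (\<ominus>\<^bsub>M\<^esub> x) \<ltimes>\<^bsub>M\<^esub> r = \<ominus>\<^bsub>M\<^esub> (x \<ltimes>\<^bsub>M\<^esub> r)"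
  by (metis M.add.inv_closed M.l_neg M.minus_equality ract_add_left ract_closed zero_ract)

lemma ract_minus: "x \<in> carrier M \<Longrightarrow> r \<in> carrier R \<Longrightarrow> x \<ltimes>\<^bsub>M\<^esub> (\<ominus>\<^bsub>R\<^esub> r) = \<ominus>\<^bsub>M\<^esub> (x \<ltimes>\<^bsub>M\<^esub> r)"
  by (metis R.add.inv_closed R.l_neg M.minus_equality ract_add_right ract_closed ract_zero)

lemma minus_eq_zero_iff: "x \<in> carrier M \<Longrightarrow> y \<in> carrier M \<Longrightarrow> x \<ominus>\<^bsub>M\<^esub> y = \<zero>\<^bsub>M\<^esub> \<longleftrightarrow> x = y"
  by (metis M.a_inv_closed M.minus_equality M.minus_minus M.r_neg a_minus_def)

text \<open>Closure under negation comes for free: \<open>-x\<close> is the action of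
  \<open>-1\<close> on \<open>x\<close>.\<close>

lemma rsubmoduleI:
  assumes "N \<subseteq> carrier M" "\<zero>\<^bsub>M\<^esub> \<in> N" "\<And>x y. x \<in> N \<Longrightarrow> y \<in> N \<Longrightarrow> x \<oplus>\<^bsub>M\<^esub> y \<in> N"
    "\<And>x r. x \<in> N \<Longrightarrow> r \<in> carrier R \<Longrightarrow> x \<ltimes>\<^bsub>M\<^esub> r \<in> N"
  shows "rsubmodule R N M"
proof -
  have "\<ominus>\<^bsub>M\<^esub> x \<in> N" if "x \<in> N" for x
  proof -
    have "\<ominus>\<^bsub>M\<^esub> x = x \<ltimes>\<^bsub>M\<^esub> (\<ominus>\<^bsub>R\<^esub> \<one>\<^bsub>R\<^esub>)" using that assms(1) ract_minus ract_one by auto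
    then show ?thesis using assms(4)[OF that] by simp
  qed
  then have "subgroup N (add_monoid M)"
    using assms by (intro M.add.subgroupI) (auto simp: a_inv_def)
  then show ?thesis
    unfolding rsubmodule_def using additive_subgroupI assms(4) by blast
qed

lemma rsubmoduleD:
  assumes "rsubmodule R N M"
  shows "N \<subseteq> carrier M" "\<zero>\<^bsub>M\<^esub> \<in> N" "\<And>x y. x \<in> N \<Longrightarrow> y \<in> N \<Longrightarrow> x \<oplus>\<^bsub>M\<^esub> y \<in> N"
    "\<And>x r. x \<in> N \<Longrightarrow> r \<in> carrier R \<Longrightarrow> x \<ltimes>\<^bsub>M\<^esub> r \<in> N"
    "\<And>x. x \<in> N \<Longrightarrow> \<ominus>\<^bsub>M\<^esub> x \<in> N"
    "\<And>x y. x \<in> N \<Longrightarrow> y \<in> N \<Longrightarrow> x \<ominus>\<^bsub>M\<^esub> y \<in> N"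
proof -
  interpret N: additive_subgroup N M using assms by (simp add: rsubmodule_def)
  show 1: "N \<subseteq> carrier M" "\<zero>\<^bsub>M\<^esub> \<in> N" "\<And>x y. x \<in> N \<Longrightarrow> y \<in> N \<Longrightarrow> x \<oplus>\<^bsub>M\<^esub> y \<in> N"
    using N.a_subset by auto
  show "\<And>x r. x \<in> N \<Longrightarrow> r \<in> carrier R \<Longrightarrow> x \<ltimes>\<^bsub>M\<^esub> r \<in> N"
    using assms by (simp add: rsubmodule_def)
  show 2: "\<And>x. x \<in> N \<Longrightarrow> \<ominus>\<^bsub>M\<^esub> x \<in> N"
    using N.a_inv_closed M.abelian_group_axioms by auto
  show "\<And>x y. x \<in> N \<Longrightarrow> y \<in> N \<Longrightarrow> x \<ominus>\<^bsub>M\<^esub> y \<in> N"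
    unfolding a_minus_def using 1 2 by blast
qed

lemma rsubmodule_carrier: "rsubmodule R (carrier M) M"
  by (rule rsubmoduleI) (auto simp: ract_closed)

lemma rsubmodule_zero: "rsubmodule R {\<zero>\<^bsub>M\<^esub>} M"
  by (rule rsubmoduleI) auto

lemma rsubmodule_Int: "rsubmodule R N M \<Longrightarrow> rsubmodule R N' M \<Longrightarrow> rsubmodule R (N \<inter> N') M"
  by (rule rsubmoduleI) (auto dest: rsubmoduleD)

lemma submodule_right_module:
  assumes "rsubmodule R N M"
  shows "right_module R (M\<lparr>carrier := N\<rparr>)"
proof -
  note D = rsubmoduleD[OF assms]
  have "abelian_group (M\<lparr>carrier := N\<rparr>)"
  proof (rule abelian_groupI)
    fix x assume "x \<in> carrier (M\<lparr>carrier := N\<rparr>)"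
    then show "\<exists>y\<in>carrier (M\<lparr>carrier := N\<rparr>). y \<oplus>\<^bsub>M\<lparr>carrier := N\<rparr>\<^esub> x = \<zero>\<^bsub>M\<lparr>carrier := N\<rparr>\<^esub>"
      using D by (intro bexI[of _ "\<ominus>\<^bsub>M\<^esub> x"]) (auto simp: M.l_neg subset_iff)
  next
    fix x y assume "x \<in> carrier (M\<lparr>carrier := N\<rparr>)" "y \<in> carrier (M\<lparr>carrier := N\<rparr>)"
    then show "x \<oplus>\<^bsub>M\<lparr>carrier := N\<rparr>\<^esub> y = y \<oplus>\<^bsub>M\<lparr>carrier := N\<rparr>\<^esub> x"
      using D(1) by (auto intro: M.a_comm)
  qed (use D in \<open>auto simp: M.a_assoc subset_iff\<close>)
  then show ?thesis
    unfolding right_module_def right_module_axioms_def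
    using D R.ring_axioms by (auto simp: ract_add_left ract_add_right ract_mult ract_one subset_iff)
qed

end

section \<open>Homomorphisms and isomorphisms of right modules\<close>

lemma rhomD:
  assumes "f \<in> rhom R M N"
  shows "\<And>x. x \<in> carrier M \<Longrightarrow> f x \<in> carrier N"
    "\<And>x y. x \<in> carrier M \<Longrightarrow> y \<in> carrier M \<Longrightarrow> f (x \<oplus>\<^bsub>M\<^esub> y) = f x \<oplus>\<^bsub>N\<^esub> f y"
    "\<And>x r. x \<in> carrier M \<Longrightarrow> r \<in> carrier R \<Longrightarrow> f (x \<ltimes>\<^bsub>M\<^esub> r) = f x \<ltimes>\<^bsub>N\<^esub> r"
  using assms by (auto simp: rhom_def)

lemma rhomI:
  assumes "\<And>x. x \<in> carrier M \<Longrightarrow> f x \<in> carrier N"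
    "\<And>x y. x \<in> carrier M \<Longrightarrow> y \<in> carrier M \<Longrightarrow> f (x \<oplus>\<^bsub>M\<^esub> y) = f x \<oplus>\<^bsub>N\<^esub> f y"
    "\<And>x r. x \<in> carrier M \<Longrightarrow> r \<in> carrier R \<Longrightarrow> f (x \<ltimes>\<^bsub>M\<^esub> r) = f x \<ltimes>\<^bsub>N\<^esub> r"
  shows "f \<in> rhom R M N"
  using assms by (auto simp: rhom_def)

lemma rhom_zero:
  assumes "right_module R M" "right_module R N" "f \<in> rhom R M N"
  shows "f \<zero>\<^bsub>M\<^esub> = \<zero>\<^bsub>N\<^esub>"
proof -
  interpret M: right_module R M by fact
  interpret N: right_module R N by fact
  show ?thesis using rhomD[OF assms(3)]
    by (metis M.M.zero_closed M.R.zero_closed M.zero_ract N.ract_zero M.ract_zero)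
qed

lemma rhom_minus:
  assumes "right_module R M" "right_module R N" "f \<in> rhom R M N" "x \<in> carrier M"
  shows "f (\<ominus>\<^bsub>M\<^esub> x) = \<ominus>\<^bsub>N\<^esub> f x"
proof -
  interpret M: right_module R M by fact
  interpret N: right_module R N by fact
  show ?thesis using rhomD[OF assms(3)] rhom_zero[OF assms(1-3)] assms(4)
    by (metis M.M.a_inv_closed M.M.l_neg N.M.minus_equality)
qed

lemma rhom_diff:
  assumes "right_module R M" "right_module R N" "f \<in> rhom R M N" "x \<in> carrier M" "y \<in> carrier M"
  shows "f (x \<ominus>\<^bsub>M\<^esub> y) = f x \<ominus>\<^bsub>N\<^esub> f y"
proof -
  interpret M: right_module R M by fact
  show ?thesis using rhomD[OF assms(3)] rhom_minus[OF assms(1-3)] assms(4,5)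
    by (simp add: a_minus_def)
qed

lemma rhom_inj_iff:
  assumes "right_module R M" "right_module R N" "f \<in> rhom R M N"
  shows "inj_on f (carrier M) \<longleftrightarrow> (\<forall>x\<in>carrier M. f x = \<zero>\<^bsub>N\<^esub> \<longrightarrow> x = \<zero>\<^bsub>M\<^esub>)"
proof -
  interpret M: right_module R M by fact
  interpret N: right_module R N by fact
  show ?thesis
  proof
    assume "inj_on f (carrier M)"
    then show "\<forall>x\<in>carrier M. f x = \<zero>\<^bsub>N\<^esub> \<longrightarrow> x = \<zero>\<^bsub>M\<^esub>"
      using rhom_zero[OF assms] by (metis M.M.zero_closed inj_onD)
  next
    assume *: "\<forall>x\<in>carrier M. f x = \<zero>\<^bsub>N\<^esub> \<longrightarrow> x = \<zero>\<^bsub>M\<^esub>"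
    show "inj_on f (carrier M)"
    proof (rule inj_onI)
      fix x y assume xy: "x \<in> carrier M" "y \<in> carrier M" "f x = f y"
      then have "f (x \<ominus>\<^bsub>M\<^esub> y) = \<zero>\<^bsub>N\<^esub>"
        using rhom_diff[OF assms xy(1,2)] rhomD(1)[OF assms(3)] by (simp add: N.minus_eq_zero_iff)
      then have "x \<ominus>\<^bsub>M\<^esub> y = \<zero>\<^bsub>M\<^esub>" using * xy by simp
      then show "x = y" using xy by (simp add: M.minus_eq_zero_iff)
    qed
  qed
qed

lemma rhom_comp: "f \<in> rhom R M N \<Longrightarrow> g \<in> rhom R N L \<Longrightarrow> g \<circ> f \<in> rhom R M L"
  by (auto simp: rhom_def image_subset_iff)

lemma rhom_id: "id \<in> rhom R M M"
  by (auto simp: rhom_def)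

lemma repiD: "f \<in> repi R M N \<Longrightarrow> f \<in> rhom R M N" "f \<in> repi R M N \<Longrightarrow> f ` carrier M = carrier N"
  by (auto simp: repi_def)

lemma riso_imp_repi: "f \<in> rhom R M N \<Longrightarrow> bij_betw f (carrier M) (carrier N) \<Longrightarrow> f \<in> repi R M N"
  by (auto simp: repi_def bij_betw_def)

lemma riso_refl: "riso R M M"
  unfolding riso_def using rhom_id by (auto intro!: bexI[of _ id])

lemma riso_trans: "riso R M N \<Longrightarrow> riso R N L \<Longrightarrow> riso R M L"
  unfolding riso_def using rhom_comp bij_betw_trans by blast

lemma rhom_inv:
  assumes "right_module R M" "f \<in> rhom R M N" "bij_betw f (carrier M) (carrier N)"
  shows "inv_into (carrier M) f \<in> rhom R N M"
proof (rule rhomI)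
  interpret M: right_module R M by fact
  note f = rhomD[OF assms(2)]
  let ?g = "inv_into (carrier M) f"
  have inj: "inj_on f (carrier M)" and surj: "f ` carrier M = carrier N"
    using assms(3) by (auto simp: bij_betw_def)
  fix x assume "x \<in> carrier N"
  then obtain a where a: "a \<in> carrier M" "x = f a" using surj by auto
  show "?g x \<in> carrier M" using a inj by simp
  {
    fix y assume "y \<in> carrier N"
    then obtain b where b: "b \<in> carrier M" "y = f b" using surj by auto
    show "?g (x \<oplus>\<^bsub>N\<^esub> y) = ?g x \<oplus>\<^bsub>M\<^esub> ?g y"
      using a b inj f(2)[OF a(1) b(1), symmetric] by (simp add: inv_into_f_f)
  }
  {
    fix r assume r: "r \<in> carrier R"
    show "?g (x \<ltimes>\<^bsub>N\<^esub> r) = ?g x \<ltimes>\<^bsub>M\<^esub> r"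
      using a r inj f(3)[OF a(1) r, symmetric] by (simp add: inv_into_f_f M.ract_closed)
  }
qed

lemma riso_sym: "right_module R M \<Longrightarrow> riso R M N \<Longrightarrow> riso R N M"
  unfolding riso_def using rhom_inv bij_betw_inv_into by blast

section \<open>Images, preimages and finite generation\<close>

lemma rhom_image_rsubmodule:
  assumes "right_module R M" "right_module R N" "f \<in> rhom R M N" "rsubmodule R L M"
  shows "rsubmodule R (f ` L) N"
proof -
  interpret M: right_module R M by fact
  interpret N: right_module R N by fact
  note f = rhomD[OF assms(3)] and L = M.rsubmoduleD[OF assms(4)]
  show ?thesis
  proof (rule N.rsubmoduleI)
    show "f ` L \<subseteq> carrier N" using f L by auto
    show "\<zero>\<^bsub>N\<^esub> \<in> f ` L" using rhom_zero[OF assms(1-3)] L(2) by force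
  next
    fix x y assume "x \<in> f ` L" "y \<in> f ` L"
    then obtain a b where "a \<in> L" "b \<in> L" "x = f a" "y = f b" by auto
    then show "x \<oplus>\<^bsub>N\<^esub> y \<in> f ` L" using f(2)[of a b] L(1,3) by force
  next
    fix x r assume "x \<in> f ` L" "r \<in> carrier R"
    then obtain a where "a \<in> L" "x = f a" by auto
    then show "x \<ltimes>\<^bsub>N\<^esub> r \<in> f ` L" using f(3)[of a r] L(1,4) \<open>r \<in> carrier R\<close> by force
  qed
qed

lemma rhom_vimage_rsubmodule:
  assumes "right_module R M" "right_module R N" "f \<in> rhom R M N" "rsubmodule R L N"
  shows "rsubmodule R {x \<in> carrier M. f x \<in> L} M"
proof -
  interpret M: right_module R M by fact
  interpret N: right_module R N by fact
  note f = rhomD[OF assms(3)] and L = N.rsubmoduleD[OF assms(4)]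
  show ?thesis
    by (rule M.rsubmoduleI) (use f L rhom_zero[OF assms(1-3)] in \<open>auto simp: M.ract_closed\<close>)
qed

lemma a_kernel_eq: "a_kernel P M p = {x \<in> carrier P. p x = \<zero>\<^bsub>M\<^esub>}"
  by (simp add: a_kernel_def kernel_def)

lemma a_kernel_rsubmodule:
  assumes "right_module R M" "right_module R N" "f \<in> rhom R M N"
  shows "rsubmodule R (a_kernel M N f) M"
proof -
  interpret N: right_module R N by fact
  show ?thesis
    using rhom_vimage_rsubmodule[OF assms N.rsubmodule_zero] by (simp add: a_kernel_eq)
qed

lemma rfin_gen_epi:
  assumes "right_module R M" "right_module R N" "f \<in> repi R M N" "rfin_gen R M"
  shows "rfin_gen R N"
proof -
  obtain X where X: "finite X" "X \<subseteq> carrier M"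
    "\<And>L. rsubmodule R L M \<Longrightarrow> X \<subseteq> L \<Longrightarrow> L = carrier M"
    using assms(4) unfolding rfin_gen_def by blast
  have f: "f \<in> rhom R M N" "f ` carrier M = carrier N" using repiD[OF assms(3)] by auto
  show ?thesis unfolding rfin_gen_def
  proof (intro exI[of _ "f ` X"] conjI allI impI)
    show "finite (f ` X)" "f ` X \<subseteq> carrier N" using X f by auto
    fix L assume L: "rsubmodule R L N \<and> f ` X \<subseteq> L"
    then have "{x \<in> carrier M. f x \<in> L} = carrier M"
      using X rhom_vimage_rsubmodule[OF assms(1,2) f(1)] by (intro X(3)) auto
    moreover have "L \<subseteq> carrier N"
      using L right_module.rsubmoduleD(1)[OF assms(2)] by blast
    ultimately have "f ` carrier M \<subseteq> L" by blast
    then show "L = carrier N" using f(2) \<open>L \<subseteq> carrier N\<close> by simp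
  qed
qed

lemma fg_modulesD: "M \<in> fg_modules R \<Longrightarrow> right_module R M" "M \<in> fg_modules R \<Longrightarrow> rfin_gen R M"
  by (auto simp: fg_modules_def)

lemma fg_modules_epi:
  "M \<in> fg_modules R \<Longrightarrow> right_module R N \<Longrightarrow> f \<in> repi R M N \<Longrightarrow> N \<in> fg_modules R"
  using rfin_gen_epi fg_modulesD unfolding fg_modules_def by blast

lemma fg_modules_iso:
  "M \<in> fg_modules R \<Longrightarrow> right_module R N \<Longrightarrow> riso R M N \<Longrightarrow> N \<in> fg_modules R"
  using fg_modules_epi riso_imp_repi unfolding riso_def by blast

text \<open>The fibres of \<open>\<rho>\<close> form a congruence, so the operations can be computed
  at arbitrary preimages. This covers both quotients (a non-injective \<open>\<rho>\<close>) and
  transport to another element type (an injective \<open>\<rho>\<close>).\<close>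

lemma image_module:
  fixes \<rho> :: "'m \<Rightarrow> 'n" and M :: "('r, 'm, 'c) rmodule_scheme"
  assumes M: "right_module R M"
    and cong_add: "\<And>x x' y y'. \<lbrakk>x \<in> carrier M; x' \<in> carrier M; y \<in> carrier M; y' \<in> carrier M;
      \<rho> x = \<rho> x'; \<rho> y = \<rho> y'\<rbrakk> \<Longrightarrow> \<rho> (x \<oplus>\<^bsub>M\<^esub> y) = \<rho> (x' \<oplus>\<^bsub>M\<^esub> y')"
    and cong_ract: "\<And>x x' r. \<lbrakk>x \<in> carrier M; x' \<in> carrier M; r \<in> carrier R; \<rho> x = \<rho> x'\<rbrakk>
      \<Longrightarrow> \<rho> (x \<ltimes>\<^bsub>M\<^esub> r) = \<rho> (x' \<ltimes>\<^bsub>M\<^esub> r)"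
  obtains N :: "('r, 'n) rmodule" where "right_module R N" "\<rho> \<in> repi R M N" "\<rho> \<zero>\<^bsub>M\<^esub> = \<zero>\<^bsub>N\<^esub>"
proof
  interpret M: right_module R M by fact
  let ?g = "inv_into (carrier M) \<rho>"
  let ?N = "\<lparr>carrier = \<rho> ` carrier M, monoid.mult = undefined, monoid.one = undefined,
     ring.zero = \<rho> \<zero>\<^bsub>M\<^esub>, ring.add = (\<lambda>x y. \<rho> (?g x \<oplus>\<^bsub>M\<^esub> ?g y)),
     ract = (\<lambda>x r. \<rho> (?g x \<ltimes>\<^bsub>M\<^esub> r))\<rparr>"
  have g: "?g (\<rho> x) \<in> carrier M" "\<rho> (?g (\<rho> x)) = \<rho> x" if "x \<in> carrier M" for x
    using that by (auto intro: inv_into_into f_inv_into_f)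
  have add: "\<rho> (?g (\<rho> x) \<oplus>\<^bsub>M\<^esub> ?g (\<rho> y)) = \<rho> (x \<oplus>\<^bsub>M\<^esub> y)" if "x \<in> carrier M" "y \<in> carrier M" for x y
    by (rule cong_add) (use that g in auto)
  have act: "\<rho> (?g (\<rho> x) \<ltimes>\<^bsub>M\<^esub> r) = \<rho> (x \<ltimes>\<^bsub>M\<^esub> r)" if "x \<in> carrier M" "r \<in> carrier R" for x r
    by (rule cong_ract) (use that g in auto)
  have "abelian_group ?N"
  proof (rule abelian_groupI)
    fix x assume "x \<in> carrier ?N"
    then obtain a where a: "a \<in> carrier M" "x = \<rho> a" by auto
    then show "\<exists>y\<in>carrier ?N. y \<oplus>\<^bsub>?N\<^esub> x = \<zero>\<^bsub>?N\<^esub>"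
      by (intro bexI[of _ "\<rho> (\<ominus>\<^bsub>M\<^esub> a)"]) (auto simp: add M.M.l_neg)
  next
    fix x y assume "x \<in> carrier ?N" "y \<in> carrier ?N"
    then show "x \<oplus>\<^bsub>?N\<^esub> y = y \<oplus>\<^bsub>?N\<^esub> x" using M.M.a_comm by (auto simp: add)
  qed (auto simp: add M.M.a_assoc)
  then show "right_module R ?N"
    unfolding right_module_def right_module_axioms_def using M.R.ring_axioms
    by (auto simp: add act M.ract_add_left M.ract_add_right M.ract_mult M.ract_one M.ract_closed)
  show "\<rho> \<in> repi R M ?N"
    unfolding repi_def rhom_def by (auto simp: add act)
  show "\<rho> \<zero>\<^bsub>M\<^esub> = \<zero>\<^bsub>?N\<^esub>" by simp
qed

text \<open>Representatives of the cosets are chosen in the module itself, so the quotient keeps the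
  element type.\<close>

lemma quotient_module:
  fixes M :: "('r, 'm) rmodule"
  assumes M: "right_module R M" and N: "rsubmodule R N M"
  obtains Q :: "('r, 'm) rmodule" and f where "right_module R Q" "f \<in> repi R M Q" "a_kernel M Q f = N"
proof -
  interpret M: right_module R M by fact
  note N' = M.rsubmoduleD[OF N]
  define \<rho> where "\<rho> x = (SOME y. y \<in> carrier M \<and> x \<ominus>\<^bsub>M\<^esub> y \<in> N)" for x
  have 1: "\<rho> x \<in> carrier M \<and> x \<ominus>\<^bsub>M\<^esub> \<rho> x \<in> N" if "x \<in> carrier M" for x
    unfolding \<rho>_def by (rule someI[of _ x]) (use that N' in \<open>auto simp: M.M.r_neg a_minus_def\<close>)
  have diff3: "x \<ominus>\<^bsub>M\<^esub> z = (x \<ominus>\<^bsub>M\<^esub> y) \<oplus>\<^bsub>M\<^esub> (y \<ominus>\<^bsub>M\<^esub> z)"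
    if "x \<in> carrier M" "y \<in> carrier M" "z \<in> carrier M" for x y z
    using that by (simp add: a_minus_def M.M.a_assoc M.M.a_inv_closed) (metis M.M.a_inv_closed M.M.l_neg M.M.a_assoc M.M.l_zero)
  have sw: "x \<ominus>\<^bsub>M\<^esub> y = \<ominus>\<^bsub>M\<^esub> (y \<ominus>\<^bsub>M\<^esub> x)" if "x \<in> carrier M" "y \<in> carrier M" for x y
    using that by (simp add: a_minus_def M.M.minus_add M.M.a_comm)
  have eq: "\<rho> x = \<rho> y \<longleftrightarrow> x \<ominus>\<^bsub>M\<^esub> y \<in> N" if x: "x \<in> carrier M" and y: "y \<in> carrier M" for x y
  proof
    assume e: "\<rho> x = \<rho> y"
    have "\<rho> x \<ominus>\<^bsub>M\<^esub> y \<in> N" using sw[of "\<rho> x" y] 1[OF y] y e N'(5) by auto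
    then show "x \<ominus>\<^bsub>M\<^esub> y \<in> N" using diff3[of x "\<rho> x" y] 1[OF x] x y N'(3) by auto
  next
    assume n: "x \<ominus>\<^bsub>M\<^esub> y \<in> N"
    then have n': "y \<ominus>\<^bsub>M\<^esub> x \<in> N" using sw[of y x] x y N'(5) by auto
    \<comment> \<open>Elements of one coset satisfy the same predicate under \<open>SOME\<close>,
      hence receive the same representative.\<close>
    have "x \<ominus>\<^bsub>M\<^esub> z \<in> N \<longleftrightarrow> y \<ominus>\<^bsub>M\<^esub> z \<in> N" if z: "z \<in> carrier M" for z
      using diff3[OF x y z] diff3[OF y x z] n n' N'(3) by metis
    then show "\<rho> x = \<rho> y" unfolding \<rho>_def by (metis (mono_tags, lifting))
  qed
  obtain Q :: "('r, 'm) rmodule" where Q: "right_module R Q" "\<rho> \<in> repi R M Q" "\<rho> \<zero>\<^bsub>M\<^esub> = \<zero>\<^bsub>Q\<^esub>"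
  proof (rule image_module[OF M, of \<rho>])
    fix x x' y y' assume c: "x \<in> carrier M" "x' \<in> carrier M" "y \<in> carrier M" "y' \<in> carrier M"
      "\<rho> x = \<rho> x'" "\<rho> y = \<rho> y'"
    have "(x \<oplus>\<^bsub>M\<^esub> y) \<ominus>\<^bsub>M\<^esub> (x' \<oplus>\<^bsub>M\<^esub> y') = (x \<ominus>\<^bsub>M\<^esub> x') \<oplus>\<^bsub>M\<^esub> (y \<ominus>\<^bsub>M\<^esub> y')"
      using c by (simp add: a_minus_def M.M.minus_add M.M.a_ac)
    then show "\<rho> (x \<oplus>\<^bsub>M\<^esub> y) = \<rho> (x' \<oplus>\<^bsub>M\<^esub> y')" using c eq N'(3) by auto
  next
    fix x x' r assume c: "x \<in> carrier M" "x' \<in> carrier M" "r \<in> carrier R" "\<rho> x = \<rho> x'"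
    have "(x \<ltimes>\<^bsub>M\<^esub> r) \<ominus>\<^bsub>M\<^esub> (x' \<ltimes>\<^bsub>M\<^esub> r) = (x \<ominus>\<^bsub>M\<^esub> x') \<ltimes>\<^bsub>M\<^esub> r"
      using c by (simp add: a_minus_def M.ract_add_left M.minus_ract)
    then show "\<rho> (x \<ltimes>\<^bsub>M\<^esub> r) = \<rho> (x' \<ltimes>\<^bsub>M\<^esub> r)" using c eq N'(4) M.ract_closed by auto
  qed
  moreover have "a_kernel M Q \<rho> = N"
  proof -
    have "x \<ominus>\<^bsub>M\<^esub> \<zero>\<^bsub>M\<^esub> = x" if "x \<in> carrier M" for x
      using that M.M.minus_equality[of "\<zero>\<^bsub>M\<^esub>" "\<zero>\<^bsub>M\<^esub>"] by (simp add: a_minus_def)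
    then show ?thesis
      unfolding a_kernel_eq Q(3)[symmetric] using eq N'(1) by (auto simp: subset_iff)
  qed
  ultimately show thesis using that by blast
qed

text \<open>Two epimorphisms out of \<open>P\<close> with equal kernels have equal fibres, so
  lifting along one and applying the other gives a well-defined bijection. This is how
  \<open>Cyc\<close> is identified from its kernel.\<close>

lemma riso_same_kernel:
  assumes "right_module R P" "right_module R A" "right_module R B" "f \<in> repi R P A" "g \<in> repi R P B"
    and k: "a_kernel P A f = a_kernel P B g"
  shows "riso R A B"
proof -
  interpret P: right_module R P by fact
  interpret A: right_module R A by fact
  interpret B: right_module R B by fact
  note f = rhomD[OF repiD(1)[OF assms(4)]] and g = rhomD[OF repiD(1)[OF assms(5)]]
  have eq: "f x = f y \<longleftrightarrow> g x = g y" if "x \<in> carrier P" "y \<in> carrier P" for x y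
  proof -
    have "f x = f y \<longleftrightarrow> x \<ominus>\<^bsub>P\<^esub> y \<in> a_kernel P A f"
      using rhom_diff[OF assms(1,2) repiD(1)[OF assms(4)]] that f by (simp add: a_kernel_eq A.minus_eq_zero_iff)
    moreover have "g x = g y \<longleftrightarrow> x \<ominus>\<^bsub>P\<^esub> y \<in> a_kernel P B g"
      using rhom_diff[OF assms(1,3) repiD(1)[OF assms(5)]] that g by (simp add: a_kernel_eq B.minus_eq_zero_iff)
    ultimately show ?thesis using k by simp
  qed
  let ?i = "inv_into (carrier P) f"
  have i: "?i (f x) \<in> carrier P" "f (?i (f x)) = f x" if "x \<in> carrier P" for x
    using that by (auto intro: inv_into_into f_inv_into_f)
  have h: "g (?i (f x)) = g x" if "x \<in> carrier P" for x
    using that eq i by blast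
  have surjA: "\<exists>x\<in>carrier P. a = f x" if "a \<in> carrier A" for a using that repiD(2)[OF assms(4)] by auto
  have "g \<circ> ?i \<in> rhom R A B"
  proof (rule rhomI)
    fix a assume "a \<in> carrier A"
    then obtain x where x: "x \<in> carrier P" "a = f x" using surjA by blast
    show "(g \<circ> ?i) a \<in> carrier B" using x i g by auto
    show "(g \<circ> ?i) (a \<ltimes>\<^bsub>A\<^esub> r) = (g \<circ> ?i) a \<ltimes>\<^bsub>B\<^esub> r" if "r \<in> carrier R" for r
      using x h g that f(3)[OF x(1) that, symmetric] by (simp add: P.ract_closed)
    fix b assume "b \<in> carrier A"
    then obtain y where y: "y \<in> carrier P" "b = f y" using surjA by blast
    show "(g \<circ> ?i) (a \<oplus>\<^bsub>A\<^esub> b) = (g \<circ> ?i) a \<oplus>\<^bsub>B\<^esub> (g \<circ> ?i) b"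
      using x y h g f(2)[OF x(1) y(1), symmetric] by simp
  qed
  moreover have "bij_betw (g \<circ> ?i) (carrier A) (carrier B)"
    unfolding bij_betw_def
  proof
    show "inj_on (g \<circ> ?i) (carrier A)"
    proof (rule inj_onI)
      fix a b assume ab: "a \<in> carrier A" "b \<in> carrier A" "(g \<circ> ?i) a = (g \<circ> ?i) b"
      then obtain x y where "x \<in> carrier P" "a = f x" "y \<in> carrier P" "b = f y" using surjA by metis
      then show "a = b" using ab h eq by simp
    qed
    show "(g \<circ> ?i) ` carrier A = carrier B"
    proof -
      have "(g \<circ> ?i) ` carrier A = (\<lambda>x. g (?i (f x))) ` carrier P"
        by (simp add: image_image flip: repiD(2)[OF assms(4)])
      also have "\<dots> = g ` carrier P" using h by (intro image_cong) auto
      finally show ?thesis using repiD(2)[OF assms(5)] by simp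
    qed
  qed
  ultimately show ?thesis unfolding riso_def by blast
qed

section \<open>Direct sums\<close>

lemma rsum_simps [simp]:
  "carrier (rsum M N) = carrier M \<times> carrier N"
  "\<zero>\<^bsub>rsum M N\<^esub> = (\<zero>\<^bsub>M\<^esub>, \<zero>\<^bsub>N\<^esub>)"
  "(a, b) \<oplus>\<^bsub>rsum M N\<^esub> (c, d) = (a \<oplus>\<^bsub>M\<^esub> c, b \<oplus>\<^bsub>N\<^esub> d)"
  "(a, b) \<ltimes>\<^bsub>rsum M N\<^esub> r = (a \<ltimes>\<^bsub>M\<^esub> r, b \<ltimes>\<^bsub>N\<^esub> r)"
  by (simp_all add: rsum_def)

lemma right_module_rsum:
  assumes "right_module R M" "right_module R N"
  shows "right_module R (rsum M N)"
proof -
  interpret M: right_module R M by fact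
  interpret N: right_module R N by fact
  have "abelian_group (rsum M N)"
  proof (rule abelian_groupI)
    fix x assume x: "x \<in> carrier (rsum M N)"
    then obtain a b where "x = (a, b)" "a \<in> carrier M" "b \<in> carrier N" by auto
    then show "\<exists>y\<in>carrier (rsum M N). y \<oplus>\<^bsub>rsum M N\<^esub> x = \<zero>\<^bsub>rsum M N\<^esub>"
      by (intro bexI[of _ "(\<ominus>\<^bsub>M\<^esub> a, \<ominus>\<^bsub>N\<^esub> b)"]) (auto simp: M.M.l_neg N.M.l_neg)
  next
    fix x y assume "x \<in> carrier (rsum M N)" "y \<in> carrier (rsum M N)"
    then show "x \<oplus>\<^bsub>rsum M N\<^esub> y = y \<oplus>\<^bsub>rsum M N\<^esub> x"
      by (auto intro: M.M.a_comm N.M.a_comm)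
  qed (auto simp: M.M.a_assoc N.M.a_assoc)
  then show ?thesis
    unfolding right_module_def right_module_axioms_def using M.R.ring_axioms
    by (auto simp: M.ract_closed N.ract_closed M.ract_add_left N.ract_add_left M.ract_add_right
        N.ract_add_right M.ract_mult N.ract_mult M.ract_one N.ract_one)
qed

lemma fst_repi:
  assumes "right_module R M" "right_module R N"
  shows "fst \<in> repi R (rsum M N) M"
proof -
  interpret N: right_module R N by fact
  have "carrier N \<noteq> {}" using N.M.zero_closed by blast
  then show ?thesis by (auto simp: repi_def rhom_def fst_image_times)
qed

lemma snd_repi:
  assumes "right_module R M" "right_module R N"
  shows "snd \<in> repi R (rsum M N) N"
proof -
  interpret M: right_module R M by fact
  have "carrier M \<noteq> {}" using M.M.zero_closed by blast
  then show ?thesis by (auto simp: repi_def rhom_def snd_image_times)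
qed

lemma rfin_gen_rsum:
  assumes "right_module R M" "right_module R N" "rfin_gen R M" "rfin_gen R N"
  shows "rfin_gen R (rsum M N)"
proof -
  interpret M: right_module R M by fact
  interpret N: right_module R N by fact
  interpret S: right_module R "rsum M N" using right_module_rsum assms by blast
  obtain X where X: "finite X" "X \<subseteq> carrier M"
    "\<And>L. rsubmodule R L M \<Longrightarrow> X \<subseteq> L \<Longrightarrow> L = carrier M"
    using assms(3) unfolding rfin_gen_def by blast
  obtain Y where Y: "finite Y" "Y \<subseteq> carrier N"
    "\<And>L. rsubmodule R L N \<Longrightarrow> Y \<subseteq> L \<Longrightarrow> L = carrier N"
    using assms(4) unfolding rfin_gen_def by blast
  have iM: "(\<lambda>x. (x, \<zero>\<^bsub>N\<^esub>)) \<in> rhom R M (rsum M N)" and iN: "(\<lambda>y. (\<zero>\<^bsub>M\<^esub>, y)) \<in> rhom R N (rsum M N)"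
    by (auto intro!: rhomI)
  let ?Z = "(\<lambda>x. (x, \<zero>\<^bsub>N\<^esub>)) ` X \<union> (\<lambda>y. (\<zero>\<^bsub>M\<^esub>, y)) ` Y"
  show ?thesis unfolding rfin_gen_def
  proof (intro exI[of _ ?Z] conjI allI impI)
    show "finite ?Z" "?Z \<subseteq> carrier (rsum M N)" using X Y by auto
    fix L assume L: "rsubmodule R L (rsum M N) \<and> ?Z \<subseteq> L"
    have 1: "{x \<in> carrier M. (x, \<zero>\<^bsub>N\<^esub>) \<in> L} = carrier M"
      by (rule X(3), rule rhom_vimage_rsubmodule[OF assms(1) S.right_module_axioms iM])
         (use L X in auto)
    have 2: "{y \<in> carrier N. (\<zero>\<^bsub>M\<^esub>, y) \<in> L} = carrier N"
      by (rule Y(3), rule rhom_vimage_rsubmodule[OF assms(2) S.right_module_axioms iN])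
         (use L Y in auto)
    have "(x, y) \<in> L" if "x \<in> carrier M" "y \<in> carrier N" for x y
    proof -
      have "(x, \<zero>\<^bsub>N\<^esub>) \<in> L" "(\<zero>\<^bsub>M\<^esub>, y) \<in> L" using 1 2 that by auto
      then have "(x, \<zero>\<^bsub>N\<^esub>) \<oplus>\<^bsub>rsum M N\<^esub> (\<zero>\<^bsub>M\<^esub>, y) \<in> L" using S.rsubmoduleD(3) L by blast
      then show ?thesis using that by simp
    qed
    then show "L = carrier (rsum M N)" using S.rsubmoduleD(1) L by auto
  qed
qed

lemma fg_modules_rsum:
  assumes M: "M \<in> fg_modules R" and N: "N \<in> fg_modules R"
  obtains L where "L \<in> fg_modules R" "riso R L (rsum M N)"
proof -
  note M' = fg_modulesD[OF M] and N' = fg_modulesD[OF N]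
  note S = right_module_rsum[OF M'(1) N'(1)]
  \<comment> \<open>The sum has pairs as elements, but members of \<open>fg_modules\<close> live on
    \<open>nat \<Rightarrow> 'r\<close>. Interleaving the two sequences at even and odd places is an
    injection back into that type.\<close>
  define \<rho> :: "(nat \<Rightarrow> 'a) \<times> (nat \<Rightarrow> 'a) \<Rightarrow> (nat \<Rightarrow> 'a)"
    where "\<rho> = (\<lambda>(f, g) n. if even n then f (n div 2) else g (n div 2))"
  have inj: "inj \<rho>"
  proof (rule injI, clarsimp)
    fix f g f' g' assume e: "\<rho> (f, g) = \<rho> (f', g')"
    have "f k = f' k" "g k = g' k" for k
      using fun_cong[OF e, of "2 * k"] fun_cong[OF e, of "2 * k + 1"] by (auto simp: \<rho>_def)
    then show "f = f' \<and> g = g'" by auto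
  qed
  obtain L :: "('a, nat \<Rightarrow> 'a) rmodule" where L: "right_module R L" "\<rho> \<in> repi R (rsum M N) L"
    by (rule image_module[OF S, of \<rho>]) (simp_all add: inj_eq[OF inj])
  have "bij_betw \<rho> (carrier (rsum M N)) (carrier L)"
    using repiD(2)[OF L(2)] inj by (auto simp: bij_betw_def intro: inj_on_subset)
  then have iso: "riso R (rsum M N) L" using repiD(1)[OF L(2)] by (auto simp: riso_def)
  have "rfin_gen R L" using rfin_gen_epi[OF S L(1,2)] rfin_gen_rsum M' N' by blast
  then have "L \<in> fg_modules R" using L by (simp add: fg_modules_def)
  then show thesis using that riso_sym[OF S iso] by blast
qed

lemma riso_rsum_cong:
  assumes "riso R M M'" "riso R N N'"
  shows "riso R (rsum M N) (rsum M' N')"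
proof -
  obtain f g where f: "f \<in> rhom R M M'" "bij_betw f (carrier M) (carrier M')"
    and g: "g \<in> rhom R N N'" "bij_betw g (carrier N) (carrier N')"
    using assms by (auto simp: riso_def)
  have "map_prod f g \<in> rhom R (rsum M N) (rsum M' N')"
    using rhomD[OF f(1)] rhomD[OF g(1)] by (auto intro!: rhomI)
  moreover have "bij_betw (map_prod f g) (carrier (rsum M N)) (carrier (rsum M' N'))"
    using bij_betw_map_prod[OF f(2) g(2)] by (simp add: map_prod_def)
  ultimately show ?thesis by (auto simp: riso_def)
qed

lemma riso_rsum_comm: "riso R (rsum M N) (rsum N M)"
  unfolding riso_def
  by (intro bexI[of _ "\<lambda>(x, y). (y, x)"] rhomI) (auto simp: bij_betw_def inj_on_def)

lemma riso_rsum_assoc: "riso R (rsum (rsum A B) C) (rsum A (rsum B C))"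
  unfolding riso_def
  by (intro bexI[of _ "\<lambda>((x, y), z). (x, y, z)"] rhomI) (auto simp: bij_betw_def inj_on_def image_iff)

lemma riso_internal_sum:
  assumes "right_module R M" "rsubmodule R A M" "rsubmodule R B M"
    and "A \<inter> B \<subseteq> {\<zero>\<^bsub>M\<^esub>}" and K: "K = {a \<oplus>\<^bsub>M\<^esub> b | a b. a \<in> A \<and> b \<in> B}"
  shows "riso R (M\<lparr>carrier := K\<rparr>) (rsum (M\<lparr>carrier := A\<rparr>) (M\<lparr>carrier := B\<rparr>))"
proof -
  interpret M: right_module R M by fact
  note A = M.rsubmoduleD[OF assms(2)] and B = M.rsubmoduleD[OF assms(3)]
  let ?S = "rsum (M\<lparr>carrier := A\<rparr>) (M\<lparr>carrier := B\<rparr>)"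
  let ?K = "M\<lparr>carrier := K\<rparr>"
  let ?f = "\<lambda>(a, b). a \<oplus>\<^bsub>M\<^esub> b"
  have S: "right_module R ?S"
    using right_module_rsum M.submodule_right_module assms(2,3) by blast
  have f: "?f \<in> rhom R ?S ?K"
  proof (rule rhomI; clarsimp)
    show "\<And>a b. a \<in> A \<Longrightarrow> b \<in> B \<Longrightarrow> a \<oplus>\<^bsub>M\<^esub> b \<in> K" using K by auto
    show "\<And>a b a' b'. \<lbrakk>a \<in> A; b \<in> B; a' \<in> A; b' \<in> B\<rbrakk>
       \<Longrightarrow> a \<oplus>\<^bsub>M\<^esub> a' \<oplus>\<^bsub>M\<^esub> (b \<oplus>\<^bsub>M\<^esub> b') = a \<oplus>\<^bsub>M\<^esub> b \<oplus>\<^bsub>M\<^esub> (a' \<oplus>\<^bsub>M\<^esub> b')"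
      using A(1) B(1) by (simp add: M.M.a_ac subset_iff)
    show "\<And>a b r. \<lbrakk>a \<in> A; b \<in> B; r \<in> carrier R\<rbrakk>
       \<Longrightarrow> a \<ltimes>\<^bsub>M\<^esub> r \<oplus>\<^bsub>M\<^esub> b \<ltimes>\<^bsub>M\<^esub> r = (a \<oplus>\<^bsub>M\<^esub> b) \<ltimes>\<^bsub>M\<^esub> r"
      using A(1) B(1) by (simp add: M.ract_add_left subset_iff)
  qed
  have "inj_on ?f (A \<times> B)"
  proof (rule inj_onI, clarsimp)
    fix a b a' b' assume h: "a \<in> A" "b \<in> B" "a' \<in> A" "b' \<in> B" "a \<oplus>\<^bsub>M\<^esub> b = a' \<oplus>\<^bsub>M\<^esub> b'"
    have c: "a \<in> carrier M" "b \<in> carrier M" "a' \<in> carrier M" "b' \<in> carrier M" using h A B by auto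
    \<comment> \<open>The difference of two decompositions of one element lies in both summands,
      hence in the zero intersection.\<close>
    have "a \<ominus>\<^bsub>M\<^esub> a' = (\<ominus>\<^bsub>M\<^esub> a' \<oplus>\<^bsub>M\<^esub> (a \<oplus>\<^bsub>M\<^esub> b)) \<oplus>\<^bsub>M\<^esub> \<ominus>\<^bsub>M\<^esub> b"
      using c by (simp add: a_minus_def M.M.a_assoc M.M.r_neg M.M.a_comm[of a "\<ominus>\<^bsub>M\<^esub> a'"])
    also have "\<dots> = b' \<ominus>\<^bsub>M\<^esub> b"
      unfolding h(5) using c by (simp add: a_minus_def M.M.a_assoc[symmetric] M.M.l_neg)
    finally have e: "a \<ominus>\<^bsub>M\<^esub> a' = b' \<ominus>\<^bsub>M\<^esub> b" .
    have "a \<ominus>\<^bsub>M\<^esub> a' \<in> A" "b' \<ominus>\<^bsub>M\<^esub> b \<in> B" using h A(6) B(6) by auto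
    then have "a \<ominus>\<^bsub>M\<^esub> a' = \<zero>\<^bsub>M\<^esub>" "b' \<ominus>\<^bsub>M\<^esub> b = \<zero>\<^bsub>M\<^esub>" using e assms(4) by auto
    then show "a = a' \<and> b = b'" using c M.minus_eq_zero_iff by metis
  qed
  then have "bij_betw ?f (carrier ?S) (carrier ?K)"
    using K by (force simp: bij_betw_def image_iff)
  then have "riso R ?S ?K" using f by (auto simp: riso_def)
  then show ?thesis using riso_sym[OF S] by blast
qed

text \<open>\<open>L\<close> is a copy of the sum of \<open>X\<close> and \<open>M\<close>; an
  earlier summand \<open>Y\<close> of \<open>M\<close> survives because its complement can absorb
  \<open>X\<close> after reassociation.\<close>

lemma direct_summand_step:
  assumes M: "M \<in> fg_modules R" and X: "X \<in> fg_modules R"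
  obtains L where "L \<in> fg_modules R" "direct_summand R X L"
    "\<And>Y. direct_summand R Y M \<Longrightarrow> direct_summand R Y L"
proof -
  obtain L where L: "L \<in> fg_modules R" "riso R L (rsum X M)"
    using fg_modules_rsum[OF X M] by blast
  have 1: "direct_summand R X L"
    using L M X unfolding direct_summand_def by blast
  have 2: "direct_summand R Y L" if Y: "direct_summand R Y M" for Y
  proof -
    obtain N where N: "Y \<in> fg_modules R" "N \<in> fg_modules R" "riso R M (rsum Y N)"
      using Y unfolding direct_summand_def by blast
    obtain L' where L': "L' \<in> fg_modules R" "riso R L' (rsum N X)"
      using fg_modules_rsum[OF N(2) X] by blast
    have "riso R L (rsum (rsum Y N) X)"
      by (rule riso_trans[OF L(2) riso_trans[OF riso_rsum_comm riso_rsum_cong[OF N(3) riso_refl]]])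
    moreover have "riso R (rsum N X) L'"
      using riso_sym[OF _ L'(2)] fg_modulesD(1)[OF L'(1)] by blast
    ultimately have "riso R L (rsum Y L')"
      using riso_trans[OF _ riso_trans[OF riso_rsum_assoc riso_rsum_cong[OF riso_refl]]] by blast
    then show ?thesis using L' N unfolding direct_summand_def by blast
  qed
  show thesis using that L(1) 1 2 by blast
qed

text \<open>The function \<open>phi\<close> sees one module at a time. To test a relation between
  several indecomposables, all of them have to be summands of a single module.\<close>

lemma direct_summands_exist:
  assumes "finite \<X>" "\<X> \<subseteq> fg_modules R" "\<X> \<noteq> {}"
  obtains M where "M \<in> fg_modules R" "\<And>X. X \<in> \<X> \<Longrightarrow> direct_summand R X M"
proof -
  have "\<exists>M\<in>fg_modules R. \<forall>X\<in>\<X>. direct_summand R X M"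
    using assms(1,3,2)
  proof (induction rule: finite_ne_induct)
    case (singleton X)
    then show ?case using direct_summand_step[of X R X] by auto
  next
    case (insert X F)
    then obtain M where M: "M \<in> fg_modules R" "\<And>X. X \<in> F \<Longrightarrow> direct_summand R X M" by auto
    have X: "X \<in> fg_modules R" using insert.prems by simp
    obtain L where "L \<in> fg_modules R" "direct_summand R X L"
      "\<And>Y. direct_summand R Y M \<Longrightarrow> direct_summand R Y L"
      using direct_summand_step[OF M(1) X] by metis
    then show ?case using M(2) by auto
  qed
  then show thesis using that by blast
qed

section \<open>Projective covers and syzygies\<close>

lemma projective_coverD:
  assumes "projective_cover R P p M"
  shows "projective R P" "P \<in> fg_modules R" "right_module R P" "p \<in> repi R P M"
    "\<And>N. rsubmodule R N P \<Longrightarrow> p ` N = carrier M \<Longrightarrow> N = carrier P"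
  using assms fg_modulesD(1) by (auto simp: projective_cover_def projective_def)

lemma projective_lift:
  assumes "projective R P" "M \<in> fg_modules R" "N \<in> fg_modules R" "g \<in> repi R M N" "f \<in> rhom R P N"
  obtains h where "h \<in> rhom R P M" "\<And>x. x \<in> carrier P \<Longrightarrow> g (h x) = f x"
  using assms unfolding projective_def by blast

text \<open>A lift \<open>h\<close> of \<open>p\<close> along \<open>p'\<close> has an image that
  still covers \<open>M\<close>, so essentiality makes it onto. Projectivity of \<open>P'\<close>
  then splits \<open>h\<close> by some \<open>g\<close>, and the image of \<open>g\<close> again
  covers \<open>M\<close>. Hence \<open>g\<close> is onto as well, which makes \<open>h\<close>
  injective.\<close>

lemma projective_cover_unique:
  assumes 1: "projective_cover R P p M" and 2: "projective_cover R P' p' M" and M: "M \<in> fg_modules R"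
  shows "riso R (P\<lparr>carrier := a_kernel P M p\<rparr>) (P'\<lparr>carrier := a_kernel P' M p'\<rparr>)"
proof -
  note P = projective_coverD[OF 1] and P' = projective_coverD[OF 2]
  obtain h where h: "h \<in> rhom R P P'" "\<And>x. x \<in> carrier P \<Longrightarrow> p' (h x) = p x"
    using projective_lift[OF P(1) P'(2) M P'(4) repiD(1)[OF P(4)]] by blast
  interpret P: right_module R P by (rule P)
  interpret P': right_module R P' by (rule P')
  have "h ` carrier P = carrier P'"
  proof (rule P'(5))
    show "rsubmodule R (h ` carrier P) P'"
      using rhom_image_rsubmodule P(3) P'(3) h(1) P.rsubmodule_carrier by blast
    have "p' ` h ` carrier P = p ` carrier P" unfolding image_image using h(2) by (intro image_cong) auto
    then show "p' ` h ` carrier P = carrier M" using repiD(2)[OF P(4)] by simp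
  qed
  then have hepi: "h \<in> repi R P P'" using h(1) by (simp add: repi_def)
  obtain g where g: "g \<in> rhom R P' P" "\<And>y. y \<in> carrier P' \<Longrightarrow> h (g y) = id y"
    using projective_lift[OF P'(1) P(2) P'(2) hepi rhom_id] by blast
  have gP: "g ` carrier P' = carrier P"
  proof (rule P(5))
    show "rsubmodule R (g ` carrier P') P"
      using rhom_image_rsubmodule P(3) P'(3) g(1) P'.rsubmodule_carrier by blast
    have "p (g y) = p' y" if "y \<in> carrier P'" for y
      using h(2)[of "g y"] g(2)[OF that] rhomD(1)[OF g(1) that] by simp
    then have "p ` g ` carrier P' = p' ` carrier P'" unfolding image_image by (intro image_cong) auto
    then show "p ` g ` carrier P' = carrier M" using repiD(2)[OF P'(4)] by simp
  qed
  have inj: "inj_on h (carrier P)"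
  proof (rule inj_onI)
    fix x y assume "x \<in> carrier P" "y \<in> carrier P" and e: "h x = h y"
    then obtain a b where "a \<in> carrier P'" "x = g a" "b \<in> carrier P'" "y = g b" using gP by blast
    then show "x = y" using e g(2) by simp
  qed
  let ?K = "P\<lparr>carrier := a_kernel P M p\<rparr>" and ?K' = "P'\<lparr>carrier := a_kernel P' M p'\<rparr>"
  have "h \<in> rhom R ?K ?K'"
    using rhomD[OF h(1)] h(2) by (auto intro!: rhomI simp: a_kernel_eq)
  moreover have "bij_betw h (carrier ?K) (carrier ?K')"
  proof -
    have "h ` a_kernel P M p = a_kernel P' M p'"
    proof (intro equalityI subsetI)
      fix y assume "y \<in> h ` a_kernel P M p"
      then show "y \<in> a_kernel P' M p'" using h rhomD(1)[OF h(1)] by (auto simp: a_kernel_eq)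
    next
      fix y assume y: "y \<in> a_kernel P' M p'"
      then obtain x where "x \<in> carrier P" "y = h x" using \<open>h ` carrier P = carrier P'\<close>
        by (auto simp: a_kernel_eq)
      then show "y \<in> h ` a_kernel P M p" using y h(2)[of x] by (auto simp: a_kernel_eq)
    qed
    moreover have "inj_on h (a_kernel P M p)"
      by (rule inj_on_subset[OF inj]) (auto simp: a_kernel_eq)
    ultimately show ?thesis by (simp add: bij_betw_def)
  qed
  ultimately show ?thesis by (auto simp: riso_def)
qed

lemma kernel_right_module:
  assumes "projective_cover R P p M" "M \<in> fg_modules R"
  shows "right_module R (P\<lparr>carrier := a_kernel P M p\<rparr>)"
  using assms right_module.submodule_right_module a_kernel_rsubmodule projective_coverD(3,4)
    fg_modulesD(1) repiD(1) by metis

text \<open>\<open>syzygy\<close> is the kernel of an unspecified cover; uniqueness allows it to be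
  replaced by the kernel of whichever cover is at hand.\<close>

lemma syzygy_iso:
  assumes "projective_cover R P p M" "M \<in> fg_modules R"
  shows "right_module R (syzygy R M)" "riso R (syzygy R M) (P\<lparr>carrier := a_kernel P M p\<rparr>)"
proof -
  have "\<exists>K P p. projective_cover R P p M \<and> K = P\<lparr>carrier := a_kernel P M p\<rparr>"
    using assms by blast
  then have "\<exists>P p. projective_cover R P p M \<and> syzygy R M = P\<lparr>carrier := a_kernel P M p\<rparr>"
    unfolding syzygy_def by (rule someI_ex)
  then obtain P' p' where P': "projective_cover R P' p' M"
    and s: "syzygy R M = P'\<lparr>carrier := a_kernel P' M p'\<rparr>" by blast
  show "right_module R (syzygy R M)" unfolding s by (rule kernel_right_module[OF P' assms(2)])
  show "riso R (syzygy R M) (P\<lparr>carrier := a_kernel P M p\<rparr>)"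
    unfolding s by (rule projective_cover_unique[OF P' assms])
qed

lemma projective_cover_id: "projective R P \<Longrightarrow> projective_cover R P id P"
  by (auto simp: projective_cover_def repi_def rhom_def)

lemma projective_iso:
  assumes "projective R P" "M \<in> fg_modules R" "riso R M P"
  shows "projective R M"
proof -
  obtain f where f: "f \<in> rhom R M P" "bij_betw f (carrier M) (carrier P)"
    using assms(3) by (auto simp: riso_def)
  note M = fg_modulesD(1)[OF assms(2)]
  let ?g = "inv_into (carrier M) f"
  have g: "?g \<in> rhom R P M" using rhom_inv[OF M f] .
  show ?thesis unfolding projective_def
  proof (intro conjI ballI)
    fix A B a b assume *: "A \<in> fg_modules R" "B \<in> fg_modules R" "a \<in> repi R A B" "b \<in> rhom R M B"
    obtain h where h: "h \<in> rhom R P A" "\<And>x. x \<in> carrier P \<Longrightarrow> a (h x) = (b \<circ> ?g) x"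
      using projective_lift[OF assms(1) *(1-3) rhom_comp[OF g *(4)]] by blast
    show "\<exists>h\<in>rhom R M A. \<forall>x\<in>carrier M. a (h x) = b x"
    proof (intro bexI[of _ "h \<circ> f"] ballI rhom_comp[OF f(1) h(1)])
      fix x assume x: "x \<in> carrier M"
      have "?g (f x) = x" using f(2) x by (meson bij_betw_inv_into_left)
      then show "a ((h \<circ> f) x) = b x" using h(2)[of "f x"] rhomD(1)[OF f(1) x] by simp
    qed
  qed fact
qed

section \<open>Congruence modulo the relations of $K_0$\<close>

text \<open>Working on representatives keeps ordinary arithmetic of formal combinations available.
  The cosets return only with \<open>K0_coset\<close>.\<close>

definition K0_eq :: "('r, 'z) ring_scheme \<Rightarrow> ('r fg_module \<Rightarrow>\<^sub>0 int) \<Rightarrow> ('r fg_module \<Rightarrow>\<^sub>0 int) \<Rightarrow> bool" where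
  "K0_eq R x y \<longleftrightarrow> x - y \<in> K0_rel R"

abbreviation K0_gens :: "('r, 'z) ring_scheme \<Rightarrow> ('r fg_module \<Rightarrow>\<^sub>0 int) set" where
  "K0_gens R \<equiv> {frag_of M - frag_of M' - frag_of M'' | M M' M''.
         M \<in> fg_modules R \<and> M' \<in> fg_modules R \<and> M'' \<in> fg_modules R \<and> riso R M (rsum M' M'')}
      \<union> {frag_of P | P. projective R P}"

lemma K0_gens_carrier: "K0_gens R \<subseteq> carrier (K0_free R)"
proof
  fix x assume "x \<in> K0_gens R"
  then consider M M' M'' where "x = frag_of M - frag_of M' - frag_of M''"
      "M \<in> fg_modules R" "M' \<in> fg_modules R" "M'' \<in> fg_modules R"
    | P where "x = frag_of P" "P \<in> fg_modules R" by (auto simp: projective_def)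
  then show "x \<in> carrier (K0_free R)"
  proof cases
    case 1
    have "Poly_Mapping.keys (frag_of M - frag_of M' - frag_of M'') \<subseteq> {M, M', M''}"
      using keys_diff[of "frag_of M - frag_of M'" "frag_of M''"] keys_diff[of "frag_of M" "frag_of M'"]
      by (auto simp: keys_frag_of)
    then show ?thesis using 1 by auto
  qed (auto simp: keys_frag_of)
qed

lemma K0_rel_subgroup: "subgroup (K0_rel R) (K0_free R)"
  unfolding K0_rel_def by (rule group.generate_is_subgroup[OF group_free_Abelian_group K0_gens_carrier])

lemma K0_rel_carrier: "x \<in> K0_rel R \<Longrightarrow> Poly_Mapping.keys x \<subseteq> fg_modules R"
  using subsetD[OF subgroup.subset[OF K0_rel_subgroup], of x R] by simp

lemma K0_rel_zero: "0 \<in> K0_rel R"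
  using subgroup.one_closed[OF K0_rel_subgroup] by simp

lemma K0_rel_add: "x \<in> K0_rel R \<Longrightarrow> y \<in> K0_rel R \<Longrightarrow> x + y \<in> K0_rel R"
  using subgroup.m_closed[OF K0_rel_subgroup, of x _ y] by simp

lemma K0_rel_minus: "x \<in> K0_rel R \<Longrightarrow> - x \<in> K0_rel R"
  using subgroup.m_inv_closed[OF K0_rel_subgroup, of x] K0_rel_carrier by fastforce

text \<open>Checking a map on the generating relations is enough. It is applied to
  \<open>Om\<close>, with \<open>H\<close> the relations themselves, and to the multiplicities, with
  \<open>H = {0}\<close>.\<close>

lemma K0_rel_hom:
  fixes f :: "('r fg_module \<Rightarrow>\<^sub>0 int) \<Rightarrow> 'b::ab_group_add"
  assumes f: "\<And>x y. f (x + y) = f x + f y"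
    and H: "0 \<in> H" "\<And>x y. x \<in> H \<Longrightarrow> y \<in> H \<Longrightarrow> x + y \<in> H" "\<And>x. x \<in> H \<Longrightarrow> - x \<in> H"
    and sum: "\<And>M M' M''. \<lbrakk>M \<in> fg_modules R; M' \<in> fg_modules R; M'' \<in> fg_modules R;
      riso R M (rsum M' M'')\<rbrakk> \<Longrightarrow> f (frag_of M) - f (frag_of M') - f (frag_of M'') \<in> H"
    and proj: "\<And>P. projective R P \<Longrightarrow> f (frag_of P) \<in> H"
    and x: "x \<in> K0_rel R"
  shows "f x \<in> H"
proof -
  have f0: "f 0 = 0" using f[of 0 0] by simp
  have fm: "f (- x) = - f x" for x using f[of x "- x"] f0 by (simp add: eq_neg_iff_add_eq_0 add.commute)
  have fd: "f (x - y) = f x - f y" for x y using f[of x "- y"] fm by simp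
  have gen: "f h \<in> H" if "h \<in> K0_gens R" for h
    using that sum proj by (auto simp: fd) 
  show ?thesis using x unfolding K0_rel_def
  proof (induction rule: generate.induct)
    case (inv h)
    then have "Poly_Mapping.keys h \<subseteq> fg_modules R" using subsetD[OF K0_gens_carrier, of h R] by simp
    then show ?case using gen[OF inv] H(3) fm by simp
  qed (auto simp: f0 H f gen)
qed

lemma K0_eq_refl [simp]: "K0_eq R x x"
  by (simp add: K0_eq_def K0_rel_zero)

lemma K0_eq_sym: "K0_eq R x y \<Longrightarrow> K0_eq R y x"
  unfolding K0_eq_def using K0_rel_minus[of "x - y" R] by simp

lemma K0_eq_trans [trans]: "K0_eq R x y \<Longrightarrow> K0_eq R y z \<Longrightarrow> K0_eq R x z"
  unfolding K0_eq_def using K0_rel_add[of "x - y" R "y - z"] by simp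

lemma K0_eq_add: "K0_eq R x y \<Longrightarrow> K0_eq R x' y' \<Longrightarrow> K0_eq R (x + x') (y + y')"
  unfolding K0_eq_def using K0_rel_add[of "x - y" R "x' - y'"] by (simp add: algebra_simps)

lemma K0_eq_minus: "K0_eq R x y \<Longrightarrow> K0_eq R (- x) (- y)"
  unfolding K0_eq_def using K0_rel_minus[of "x - y" R] by (simp add: algebra_simps)

lemma K0_eq_diff: "K0_eq R x y \<Longrightarrow> K0_eq R x' y' \<Longrightarrow> K0_eq R (x - x') (y - y')"
  using K0_eq_add[OF _ K0_eq_minus, of R x y x' y'] by simp

lemma K0_eq_cmul: 
  assumes "K0_eq R x y" shows "K0_eq R (frag_cmul c x) (frag_cmul c y)"
proof -
  have nat: "K0_eq R (frag_cmul (int n) x) (frag_cmul (int n) y)" for n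
    by (induction n) (auto simp: frag_cmul_distrib assms intro!: K0_eq_add)
  show ?thesis
  proof (cases c rule: int_cases2)
    case (nonneg n) then show ?thesis using nat by simp
  next
    case (nonpos n) then show ?thesis using K0_eq_minus[OF nat[of n]] by simp
  qed
qed

lemma K0_eq_rsum:
  assumes "M \<in> fg_modules R" "M' \<in> fg_modules R" "M'' \<in> fg_modules R" "riso R M (rsum M' M'')"
  shows "K0_eq R (frag_of M) (frag_of M' + frag_of M'')"
proof -
  have "frag_of M - frag_of M' - frag_of M'' \<in> K0_gens R" using assms by blast
  then show ?thesis unfolding K0_eq_def K0_rel_def diff_diff_add[symmetric] by (rule generate.incl)
qed

lemma K0_eq_projective:
  assumes "projective R P" shows "K0_eq R (frag_of P) 0"
proof -
  have "frag_of P \<in> K0_gens R" using assms by blast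
  then show ?thesis unfolding K0_eq_def K0_rel_def diff_zero by (rule generate.incl)
qed

text \<open>A zero module is isomorphic to the sum of two copies of itself, so its class equals its
  double.\<close>

lemma K0_eq_zero_module:
  assumes "M \<in> fg_modules R" "carrier M = {\<zero>\<^bsub>M\<^esub>}"
  shows "K0_eq R (frag_of M) 0"
proof -
  interpret M: right_module R M using fg_modulesD assms by blast
  have "riso R M (rsum M M)"
    unfolding riso_def
    by (intro bexI[of _ "\<lambda>x. (x, x)"] rhomI) (auto simp: assms(2) bij_betw_def)
  then have "K0_eq R (frag_of M - frag_of M) (frag_of M + frag_of M - frag_of M)"
    using K0_eq_rsum[OF assms(1) assms(1) assms(1)] K0_eq_diff K0_eq_refl by blast
  then show ?thesis using K0_eq_sym by fastforce
qed

lemma zero_submodule_fg: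
  assumes "right_module R (M :: 'r fg_module)" shows "M\<lparr>carrier := {\<zero>\<^bsub>M\<^esub>}\<rparr> \<in> fg_modules R"
proof -
  interpret M: right_module R M by fact
  interpret Z: right_module R "M\<lparr>carrier := {\<zero>\<^bsub>M\<^esub>}\<rparr>"
    using M.submodule_right_module[OF M.rsubmodule_zero] .
  have "rfin_gen R (M\<lparr>carrier := {\<zero>\<^bsub>M\<^esub>}\<rparr>)"
    unfolding rfin_gen_def using Z.rsubmoduleD(1) by (intro exI[of _ "{\<zero>\<^bsub>M\<^esub>}"]) fastforce
  then show ?thesis using Z.right_module_axioms by (simp add: fg_modules_def)
qed

text \<open>Isomorphism is not among the generating relations; it is recovered from the
  decomposition of \<open>N\<close> into \<open>N\<close> and a zero module.\<close>

lemma K0_eq_riso: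
  assumes "M \<in> fg_modules R" "N \<in> fg_modules R" "riso R M N"
  shows "K0_eq R (frag_of M) (frag_of N)"
proof -
  interpret N: right_module R N using fg_modulesD assms by blast
  let ?Z = "N\<lparr>carrier := {\<zero>\<^bsub>N\<^esub>}\<rparr>"
  have Z: "?Z \<in> fg_modules R" using zero_submodule_fg N.right_module_axioms by blast
  have "riso R N (rsum N ?Z)"
    unfolding riso_def
    by (intro bexI[of _ "\<lambda>x. (x, \<zero>\<^bsub>N\<^esub>)"] rhomI) (auto simp: bij_betw_def inj_on_def)
  then have "K0_eq R (frag_of M) (frag_of N + frag_of ?Z)"
    using K0_eq_rsum[OF assms(1,2) Z] assms(3) riso_trans by blast
  also have "K0_eq R (frag_of N + frag_of ?Z) (frag_of N + 0)"
    using K0_eq_zero_module[OF Z] by (intro K0_eq_add) auto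
  finally show ?thesis by simp
qed

section \<open>Finite sums in abelian groups\<close>

primrec lsum :: "('a, 'b) ring_scheme \<Rightarrow> (nat \<Rightarrow> 'a) \<Rightarrow> nat \<Rightarrow> 'a" where
  "lsum G f 0 = \<zero>\<^bsub>G\<^esub>"
| "lsum G f (Suc t) = lsum G f t \<oplus>\<^bsub>G\<^esub> f t"

context abelian_group
begin

lemma lsum_closed: "(\<And>k. k < t \<Longrightarrow> f k \<in> carrier G) \<Longrightarrow> lsum G f t \<in> carrier G"
  by (induction t) auto

lemma lsum_cong: "(\<And>k. k < t \<Longrightarrow> f k = g k) \<Longrightarrow> lsum G f t = lsum G g t"
  by (induction t) auto

lemma lsum_add:
  assumes "\<And>k. k < t \<Longrightarrow> f k \<in> carrier G" "\<And>k. k < t \<Longrightarrow> g k \<in> carrier G"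
  shows "lsum G (\<lambda>k. f k \<oplus> g k) t = lsum G f t \<oplus> lsum G g t"
  using assms
proof (induction t)
  case (Suc t)
  then have "lsum G f t \<in> carrier G" "lsum G g t \<in> carrier G" by (auto intro!: lsum_closed)
  then show ?case using Suc by (simp add: a_ac)
qed auto

lemma lsum_zero: "(\<And>k. k < t \<Longrightarrow> f k = \<zero>) \<Longrightarrow> lsum G f t = \<zero>"
  by (induction t) auto

lemma lsum_single:
  assumes "k < t" "\<And>l. l < t \<Longrightarrow> l \<noteq> k \<Longrightarrow> f l = \<zero>" "f k \<in> carrier G"
  shows "lsum G f t = f k"
  using assms
proof (induction t)
  case (Suc t)
  show ?case
  proof (cases "k = t")
    case True
    then show ?thesis using Suc.prems by (simp add: lsum_zero)
  next
    case False
    then show ?thesis using Suc by simp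
  qed
qed auto

lemma lsum_append:
  assumes "\<And>k. k < t + s \<Longrightarrow> f k \<in> carrier G"
  shows "lsum G f (t + s) = lsum G f t \<oplus> lsum G (\<lambda>k. f (t + k)) s"
  using assms
proof (induction s)
  case 0
  then show ?case by (simp add: lsum_closed)
next
  case (Suc s)
  have "lsum G f t \<in> carrier G" "lsum G (\<lambda>k. f (t + k)) s \<in> carrier G"
    using Suc.prems by (auto intro!: lsum_closed)
  then show ?case using Suc by (simp add: a_assoc)
qed

text \<open>The renumbering of the remaining indices is the one by which \<open>skip_family\<close>
  deletes a generator.\<close>

lemma lsum_skip:
  assumes "k \<le> t" "\<And>l. l < Suc t \<Longrightarrow> f l \<in> carrier G"
  shows "lsum G f (Suc t) = lsum G (\<lambda>l. f (if l < k then l else Suc l)) t \<oplus> f k"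
  using assms
proof (induction t)
  case (Suc t)
  show ?case
  proof (cases "k = Suc t")
    case True
    then have "lsum G (\<lambda>l. f (if l < k then l else Suc l)) (Suc t) = lsum G f (Suc t)"
      by (intro lsum_cong) auto
    then show ?thesis using True by simp
  next
    case False
    then have k: "k \<le> t" using Suc.prems by simp
    let ?g = "\<lambda>l. f (if l < k then l else Suc l)"
    have c: "lsum G ?g t \<in> carrier G" "f k \<in> carrier G" "f (Suc t) \<in> carrier G"
      using Suc.prems k by (auto intro!: lsum_closed)
    have "lsum G f (Suc (Suc t)) = (lsum G ?g t \<oplus> f k) \<oplus> f (Suc t)"
      using Suc.IH[OF k] Suc.prems(2) by simp
    also have "\<dots> = (lsum G ?g t \<oplus> ?g t) \<oplus> f k"
      using c k by (simp add: a_ac)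
    finally show ?thesis by simp
  qed
qed auto

end

context right_module
begin

lemma lsum_ract:
  assumes "\<And>k. k < t \<Longrightarrow> f k \<in> carrier M" "r \<in> carrier R"
  shows "lsum M f t \<ltimes>\<^bsub>M\<^esub> r = lsum M (\<lambda>k. f k \<ltimes>\<^bsub>M\<^esub> r) t"
  using assms
proof (induction t)
  case (Suc t)
  then have "lsum M f t \<in> carrier M" by (auto intro!: M.lsum_closed)
  then show ?case using Suc by (simp add: ract_add_left)
qed auto

lemma lsum_rsubmodule: "rsubmodule R N M \<Longrightarrow> (\<And>k. k < t \<Longrightarrow> f k \<in> N) \<Longrightarrow> lsum M f t \<in> N"
  by (induction t) (auto dest: rsubmoduleD(2,3))

end

lemma rhom_lsum:
  assumes "right_module R M" "right_module R N" "f \<in> rhom R M N" "\<And>k. k < t \<Longrightarrow> g k \<in> carrier M"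
  shows "f (lsum M g t) = lsum N (\<lambda>k. f (g k)) t"
proof -
  interpret M: right_module R M by fact
  show ?thesis using assms(4)
  proof (induction t)
    case 0 then show ?case using rhom_zero[OF assms(1-3)] by simp
  next
    case (Suc t)
    then have "lsum M g t \<in> carrier M" by (auto intro!: M.M.lsum_closed)
    then show ?case using Suc rhomD(2)[OF assms(3)] by simp
  qed
qed

section \<open>Radical square zero algebras in coordinates\<close>

text \<open>An element of \<open>\<Bbbk>Q/J\<^sup>2\<close> is determined by its coefficients \<open>cv\<close> at the
  vertices and \<open>ca\<close> at the arrows.\<close>

locale rad_square_zero =
  fixes R :: "('r, 'z) ring_scheme" (structure) and V :: "'v set" and E :: "'e set"
    and src tgt :: "'e \<Rightarrow> 'v" and cv :: "'r \<Rightarrow> 'v \<Rightarrow> 'k::field" and ca :: "'r \<Rightarrow> 'e \<Rightarrow> 'k"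
    and mk :: "('v \<Rightarrow> 'k) \<Rightarrow> ('e \<Rightarrow> 'k) \<Rightarrow> 'r"
  assumes ring_R: "ring R" and finite_V: "finite V" and finite_E: "finite E"
    and src_V: "e \<in> E \<Longrightarrow> src e \<in> V" and tgt_V: "e \<in> E \<Longrightarrow> tgt e \<in> V"
    and mk_closed: "mk f g \<in> carrier R"
    and cv_mk: "v \<in> V \<Longrightarrow> cv (mk f g) v = f v" and ca_mk: "e \<in> E \<Longrightarrow> ca (mk f g) e = g e"
    and coords_ext: "\<lbrakk>r \<in> carrier R; s \<in> carrier R; \<And>v. v \<in> V \<Longrightarrow> cv r v = cv s v;
      \<And>e. e \<in> E \<Longrightarrow> ca r e = ca s e\<rbrakk> \<Longrightarrow> r = s"
    and cv_add: "\<lbrakk>r \<in> carrier R; s \<in> carrier R; v \<in> V\<rbrakk> \<Longrightarrow> cv (r \<oplus> s) v = cv r v + cv s v"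
    and ca_add: "\<lbrakk>r \<in> carrier R; s \<in> carrier R; e \<in> E\<rbrakk> \<Longrightarrow> ca (r \<oplus> s) e = ca r e + ca s e"
    and cv_mult: "\<lbrakk>r \<in> carrier R; s \<in> carrier R; v \<in> V\<rbrakk> \<Longrightarrow> cv (r \<otimes> s) v = cv r v * cv s v"
    and ca_mult: "\<lbrakk>r \<in> carrier R; s \<in> carrier R; e \<in> E\<rbrakk>
      \<Longrightarrow> ca (r \<otimes> s) e = cv r (src e) * ca s e + ca r e * cv s (tgt e)"
    and cv_one: "v \<in> V \<Longrightarrow> cv \<one> v = 1" and ca_one: "e \<in> E \<Longrightarrow> ca \<one> e = 0"
begin

sublocale R: ring R by (rule ring_R)

lemma cv_zero: "v \<in> V \<Longrightarrow> cv \<zero> v = 0" and ca_zero: "e \<in> E \<Longrightarrow> ca \<zero> e = 0"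
  by (metis R.r_zero R.zero_closed add_cancel_right_right cv_add)
    (metis R.r_zero R.zero_closed add_cancel_right_right ca_add)

definition idem :: "'v \<Rightarrow> 'r" where
  "idem v = mk (\<lambda>u. if u = v then 1 else 0) (\<lambda>_. 0)"

definition arr :: "'e \<Rightarrow> 'r" where
  "arr e = mk (\<lambda>_. 0) (\<lambda>e'. if e' = e then 1 else 0)"

definition sc :: "'k \<Rightarrow> 'r" where
  "sc c = mk (\<lambda>_. c) (\<lambda>_. 0)"

lemma gen_closed [simp]: "idem v \<in> carrier R" "arr e \<in> carrier R" "sc c \<in> carrier R" "mk f g \<in> carrier R"
  by (simp_all add: idem_def arr_def sc_def mk_closed)

lemma coords_gen [simp]:
  "v \<in> V \<Longrightarrow> cv (idem u) v = (if v = u then 1 else 0)" "e \<in> E \<Longrightarrow> ca (idem u) e = 0"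
  "v \<in> V \<Longrightarrow> cv (arr e') v = 0" "e \<in> E \<Longrightarrow> ca (arr e') e = (if e = e' then 1 else 0)"
  "v \<in> V \<Longrightarrow> cv (sc c) v = c" "e \<in> E \<Longrightarrow> ca (sc c) e = 0"
  by (simp_all add: idem_def arr_def sc_def cv_mk ca_mk)

lemmas coords [simp] = cv_add ca_add cv_mult ca_mult cv_one ca_one cv_zero ca_zero src_V tgt_V cv_mk ca_mk

lemma sc_mult: "sc c \<otimes> sc d = sc (c * d)" and sc_add: "sc c \<oplus> sc d = sc (c + d)"
  and sc_one: "sc 1 = \<one>" and sc_zero: "sc 0 = \<zero>"
  by (rule coords_ext; simp)+

lemma idem_idem: "idem v \<otimes> idem v = idem v"
  by (rule coords_ext) auto

text \<open>Describes the right ideal generated by the vertex \<open>v\<close>: left multiplication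
  by the idempotent keeps the coefficients at \<open>v\<close> and at the arrows leaving
  \<open>v\<close>.\<close>

lemma idem_mult_iff:
  assumes "r \<in> carrier R"
  shows "idem v \<otimes> r = r \<longleftrightarrow> (\<forall>u\<in>V. u \<noteq> v \<longrightarrow> cv r u = 0) \<and> (\<forall>e\<in>E. src e \<noteq> v \<longrightarrow> ca r e = 0)"
proof
  assume *: "idem v \<otimes> r = r"
  show "(\<forall>u\<in>V. u \<noteq> v \<longrightarrow> cv r u = 0) \<and> (\<forall>e\<in>E. src e \<noteq> v \<longrightarrow> ca r e = 0)"
  proof (intro conjI ballI impI)
    fix u assume "u \<in> V" "u \<noteq> v"
    then show "cv r u = 0" using arg_cong[OF *, of "\<lambda>r. cv r u"] assms by simp
  next
    fix e assume "e \<in> E" "src e \<noteq> v"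
    then show "ca r e = 0" using arg_cong[OF *, of "\<lambda>r. ca r e"] assms by simp
  qed
next
  assume *: "(\<forall>u\<in>V. u \<noteq> v \<longrightarrow> cv r u = 0) \<and> (\<forall>e\<in>E. src e \<noteq> v \<longrightarrow> ca r e = 0)"
  show "idem v \<otimes> r = r"
    by (rule coords_ext) (use * assms in auto)
qed

text \<open>The ring is local at each vertex: outside the radical, elements of the right ideal of
  \<open>v\<close> are invertible up to the idempotent.\<close>

lemma right_inverse_idem:
  assumes "r \<in> carrier R" "idem v \<otimes> r = r" "cv r v \<noteq> 0" "v \<in> V"
  shows "\<exists>s\<in>carrier R. r \<otimes> s = idem v"
proof
  \<comment> \<open>The geometric series \<open>1/c - a/c^2\<close> for the inverse of
    \<open>c + a\<close>, exact because products of arrows vanish. Only loops at \<open>v\<close>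
    enter, since an arrow to another vertex is already killed by the vertex part of
    \<open>?s\<close>.\<close>
  let ?s = "mk (\<lambda>u. if u = v then inverse (cv r v) else 0)
    (\<lambda>e. if tgt e = v then - inverse (cv r v) * inverse (cv r v) * ca r e else 0)"
  show "?s \<in> carrier R" by simp
  have *: "\<forall>u\<in>V. u \<noteq> v \<longrightarrow> cv r u = 0" "\<forall>e\<in>E. src e \<noteq> v \<longrightarrow> ca r e = 0"
    using idem_mult_iff assms by auto
  show "r \<otimes> ?s = idem v"
  proof (rule coords_ext)
    fix e assume e: "e \<in> E"
    show "ca (r \<otimes> ?s) e = ca (idem v) e"
      using e * assms by (cases "src e = v") auto
  qed (use * assms in auto)
qed

section \<open>Standard projective modules\<close>

text \<open>The direct sum of the right ideals generated by the vertices
  \<open>i 0, ..., i (t - 1)\<close>, with repetitions allowed. Entries from \<open>t\<close> on are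
  fixed to zero so that vectors are honest functions on \<open>nat\<close>.\<close>

definition Proj :: "nat \<Rightarrow> (nat \<Rightarrow> 'v) \<Rightarrow> 'r fg_module" where
  "Proj t i = \<lparr>carrier = {x. \<forall>k. x k \<in> carrier R \<and> (if k < t then idem (i k) \<otimes> x k = x k else x k = \<zero>)},
     monoid.mult = undefined, monoid.one = undefined, ring.zero = (\<lambda>_. \<zero>),
     ring.add = (\<lambda>x y k. x k \<oplus> y k), ract = (\<lambda>x r k. x k \<otimes> r)\<rparr>"

lemma Proj_simps [simp]:
  "\<zero>\<^bsub>Proj t i\<^esub> = (\<lambda>_. \<zero>)" "x \<oplus>\<^bsub>Proj t i\<^esub> y = (\<lambda>k. x k \<oplus> y k)" "x \<ltimes>\<^bsub>Proj t i\<^esub> r = (\<lambda>k. x k \<otimes> r)"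
  by (simp_all add: Proj_def)

lemma Proj_carrier:
  "x \<in> carrier (Proj t i) \<longleftrightarrow> (\<forall>k. x k \<in> carrier R) \<and> (\<forall>k<t. idem (i k) \<otimes> x k = x k) \<and> (\<forall>k\<ge>t. x k = \<zero>)"
  by (auto simp: Proj_def not_less)

lemma right_module_Proj: "right_module R (Proj t i)"
proof -
  have "abelian_group (Proj t i)"
  proof (rule abelian_groupI)
    fix x assume "x \<in> carrier (Proj t i)"
    then show "\<exists>y\<in>carrier (Proj t i). y \<oplus>\<^bsub>Proj t i\<^esub> x = \<zero>\<^bsub>Proj t i\<^esub>"
      by (intro bexI[of _ "\<lambda>k. \<ominus> x k"]) (auto simp: Proj_carrier R.l_neg R.r_minus)
  qed (auto simp: Proj_carrier R.r_distr R.a_assoc intro: R.a_comm)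
  then show ?thesis
    unfolding right_module_def right_module_axioms_def using ring_R
    by (auto simp: Proj_carrier R.l_distr R.r_distr R.m_assoc[symmetric])
qed

sublocale Pj: right_module R "Proj t i" for t i by (rule right_module_Proj)

lemma Proj_cv: "x \<in> carrier (Proj t i) \<Longrightarrow> k < t \<Longrightarrow> v \<in> V \<Longrightarrow> v \<noteq> i k \<Longrightarrow> cv (x k) v = 0"
  using idem_mult_iff by (auto simp: Proj_carrier)

lemma Proj_ca: "x \<in> carrier (Proj t i) \<Longrightarrow> k < t \<Longrightarrow> e \<in> E \<Longrightarrow> src e \<noteq> i k \<Longrightarrow> ca (x k) e = 0"
  using idem_mult_iff by (auto simp: Proj_carrier)

definition unitv :: "(nat \<Rightarrow> 'v) \<Rightarrow> nat \<Rightarrow> nat \<Rightarrow> 'r" where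
  "unitv i k = (\<lambda>l. if l = k then idem (i k) else \<zero>)"

lemma unitv_closed: "k < t \<Longrightarrow> unitv i k \<in> carrier (Proj t i)"
  by (auto simp: Proj_carrier unitv_def idem_idem)

lemma Proj_lsum_apply: "lsum (Proj t i) g s l = lsum R (\<lambda>k. g k l) s"
  by (induction s) auto

lemma Proj_expand:
  assumes "x \<in> carrier (Proj t i)"
  shows "x = lsum (Proj t i) (\<lambda>k. unitv i k \<ltimes>\<^bsub>Proj t i\<^esub> x k) t"
proof
  fix l
  have c: "x k \<in> carrier R" for k using assms by (simp add: Proj_carrier)
  have "lsum R (\<lambda>k. unitv i k l \<otimes> x k) t = x l"
  proof (cases "l < t")
    case True
    have "lsum R (\<lambda>k. unitv i k l \<otimes> x k) t = unitv i l l \<otimes> x l"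
      by (rule R.lsum_single) (use True c in \<open>auto simp: unitv_def\<close>)
    also have "\<dots> = x l" using True assms by (simp add: unitv_def Proj_carrier)
    finally show ?thesis .
  next
    case False
    have "lsum R (\<lambda>k. unitv i k l \<otimes> x k) t = \<zero>"
      by (rule R.lsum_zero) (use False c in \<open>auto simp: unitv_def\<close>)
    then show ?thesis using False assms by (simp add: Proj_carrier)
  qed
  then show "x l = lsum (Proj t i) (\<lambda>k. unitv i k \<ltimes>\<^bsub>Proj t i\<^esub> x k) t l"
    by (simp add: Proj_lsum_apply)
qed

lemma Proj_fg: "Proj t i \<in> fg_modules R"
proof -
  have "rfin_gen R (Proj t i)" unfolding rfin_gen_def
  proof (intro exI[of _ "unitv i ` {..<t}"] conjI allI impI)
    fix N assume N: "rsubmodule R N (Proj t i) \<and> unitv i ` {..<t} \<subseteq> N"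
    have "x \<in> N" if x: "x \<in> carrier (Proj t i)" for x
    proof (subst Proj_expand[OF x], rule Pj.lsum_rsubmodule)
      show "rsubmodule R N (Proj t i)" using N by simp
      fix k assume "k < t"
      then show "unitv i k \<ltimes>\<^bsub>Proj t i\<^esub> x k \<in> N"
        using N x Pj.rsubmoduleD(4)[of N t i] by (simp add: Proj_carrier image_subset_iff)
    qed
    moreover have "N \<subseteq> carrier (Proj t i)" using N Pj.rsubmoduleD(1) by blast
    ultimately show "N = carrier (Proj t i)" by blast
  qed (auto simp: unitv_closed)
  then show ?thesis using right_module_Proj by (simp add: fg_modules_def)
qed

text \<open>The homomorphism out of a standard projective given by the images of its generators. The
  value on the \<open>k\<close>-th generator is \<open>m k\<close> once \<open>m k\<close> is fixed
  by the idempotent of \<open>i k\<close>, see \<open>pmap_unitv\<close>.\<close>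

definition pmap :: "('r, 'm, 'c) rmodule_scheme \<Rightarrow> nat \<Rightarrow> (nat \<Rightarrow> 'm) \<Rightarrow> (nat \<Rightarrow> 'r) \<Rightarrow> 'm" where
  "pmap M t m x = lsum M (\<lambda>k. m k \<ltimes>\<^bsub>M\<^esub> x k) t"

lemma pmap_rhom:
  assumes "right_module R M" "\<And>k. k < t \<Longrightarrow> m k \<in> carrier M"
  shows "pmap M t m \<in> rhom R (Proj t i) M"
proof -
  interpret M: right_module R M by fact
  show ?thesis
  proof (rule rhomI)
    fix x assume x: "x \<in> carrier (Proj t i)"
    then have x': "x k \<in> carrier R" for k by (simp add: Proj_carrier)
    show "pmap M t m x \<in> carrier M"
      unfolding pmap_def by (rule M.M.lsum_closed) (simp add: M.ract_closed assms x')
    show "pmap M t m (x \<ltimes>\<^bsub>Proj t i\<^esub> r) = pmap M t m x \<ltimes>\<^bsub>M\<^esub> r" if "r \<in> carrier R" for r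
      unfolding pmap_def using that x' assms
      by (subst M.lsum_ract) (auto intro!: M.M.lsum_cong simp: M.ract_mult M.ract_closed)
    fix y assume "y \<in> carrier (Proj t i)"
    then have y': "y k \<in> carrier R" for k by (simp add: Proj_carrier)
    show "pmap M t m (x \<oplus>\<^bsub>Proj t i\<^esub> y) = pmap M t m x \<oplus>\<^bsub>M\<^esub> pmap M t m y"
      unfolding pmap_def using x' y' assms
      by (subst M.M.lsum_add[symmetric]) (auto intro!: M.M.lsum_cong simp: M.ract_add_right M.ract_closed)
  qed
qed

lemma pmap_unique:
  assumes "right_module R M" "f \<in> rhom R (Proj t i) M" "x \<in> carrier (Proj t i)"
  shows "f x = pmap M t (\<lambda>k. f (unitv i k)) x"
proof -
  interpret M: right_module R M by fact
  have x: "x k \<in> carrier R" for k using assms(3) by (simp add: Proj_carrier)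
  have "f x = f (lsum (Proj t i) (\<lambda>k. unitv i k \<ltimes>\<^bsub>Proj t i\<^esub> x k) t)"
    using Proj_expand[OF assms(3)] by simp
  also have "\<dots> = lsum M (\<lambda>k. f (unitv i k \<ltimes>\<^bsub>Proj t i\<^esub> x k)) t"
    by (rule rhom_lsum[OF right_module_Proj assms(1,2)]) (use x in \<open>auto intro!: Pj.ract_closed unitv_closed simp del: Proj_simps\<close>)
  also have "\<dots> = pmap M t (\<lambda>k. f (unitv i k)) x"
    unfolding pmap_def using x rhomD(3)[OF assms(2)]
    by (intro M.M.lsum_cong) (auto simp: unitv_closed simp del: Proj_simps)
  finally show ?thesis .
qed

lemma pmap_unitv:
  assumes "right_module R M" "k < t" "m k \<in> carrier M" "m k \<ltimes>\<^bsub>M\<^esub> idem (i k) = m k"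
    "\<And>l. l < t \<Longrightarrow> m l \<in> carrier M"
  shows "pmap M t m (unitv i k) = m k"
proof -
  interpret M: right_module R M by fact
  have "pmap M t m (unitv i k) = m k \<ltimes>\<^bsub>M\<^esub> unitv i k k"
    unfolding pmap_def
    by (rule M.M.lsum_single) (use assms in \<open>auto simp: unitv_def M.ract_closed\<close>)
  then show ?thesis using assms by (simp add: unitv_def)
qed

lemma Proj_projective: "projective R (Proj t i)"
  unfolding projective_def
proof (intro conjI ballI Proj_fg)
  fix M N g f assume *: "M \<in> fg_modules R" "N \<in> fg_modules R" "g \<in> repi R M N" "f \<in> rhom R (Proj t i) N"
  note M = fg_modulesD(1)[OF *(1)] and N = fg_modulesD(1)[OF *(2)] and g = repiD[OF *(3)]
  interpret M: right_module R M by (rule M)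
  interpret N: right_module R N by (rule N)
  have "\<exists>y\<in>carrier M. g y = f (unitv i k)" if "k < t" for k
  proof -
    have "f (unitv i k) \<in> g ` carrier M" using g(2) rhomD(1)[OF *(4) unitv_closed[OF that]] by simp
    then show ?thesis by (auto simp: image_iff)
  qed
  then obtain y where y: "\<And>k. k < t \<Longrightarrow> y k \<in> carrier M \<and> g (y k) = f (unitv i k)" by metis
  have "g (pmap M t y x) = f x" if x: "x \<in> carrier (Proj t i)" for x
  proof -
    have x': "x k \<in> carrier R" for k using x by (simp add: Proj_carrier)
    have "g (pmap M t y x) = lsum N (\<lambda>k. g (y k \<ltimes>\<^bsub>M\<^esub> x k)) t"
      unfolding pmap_def by (rule rhom_lsum[OF M N g(1)]) (use y x' in \<open>auto simp: M.ract_closed\<close>)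
    also have "\<dots> = pmap N t (\<lambda>k. f (unitv i k)) x"
      unfolding pmap_def by (rule N.M.lsum_cong) (use y x' rhomD(3)[OF g(1)] in auto)
    also have "\<dots> = f x" using pmap_unique[OF N *(4) x] by simp
    finally show ?thesis .
  qed
  moreover have "pmap M t y \<in> rhom R (Proj t i) M" using pmap_rhom[OF M] y by blast
  ultimately show "\<exists>h\<in>rhom R (Proj t i) M. \<forall>x\<in>carrier (Proj t i). g (h x) = f x" by blast
qed

section \<open>Minimal projective covers\<close>

definition gen_family :: "('r, 'm, 'c) rmodule_scheme \<Rightarrow> nat \<Rightarrow> (nat \<Rightarrow> 'v) \<Rightarrow> (nat \<Rightarrow> 'm) \<Rightarrow> bool" where
  "gen_family M t i m \<longleftrightarrow> (\<forall>k<t. i k \<in> V \<and> m k \<in> carrier M \<and> m k \<ltimes>\<^bsub>M\<^esub> idem (i k) = m k) \<and>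
     pmap M t m ` carrier (Proj t i) = carrier M"

text \<open>The second clause places the kernel in the radical. It is a condition on coordinates,
  hence easy to check for sums and for cyclic modules, and it implies essentiality.\<close>

definition std_cover :: "('r, 'm, 'c) rmodule_scheme \<Rightarrow> nat \<Rightarrow> (nat \<Rightarrow> 'v) \<Rightarrow> (nat \<Rightarrow> 'm) \<Rightarrow> bool" where
  "std_cover M t i m \<longleftrightarrow> gen_family M t i m \<and>
     (\<forall>x\<in>carrier (Proj t i). pmap M t m x = \<zero>\<^bsub>M\<^esub> \<longrightarrow> (\<forall>k<t. \<forall>v\<in>V. cv (x k) v = 0))"

lemma gen_familyD:
  assumes "gen_family M t i m" "k < t"
  shows "i k \<in> V" "m k \<in> carrier M" "m k \<ltimes>\<^bsub>M\<^esub> idem (i k) = m k"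
  using assms by (auto simp: gen_family_def)

lemma gen_family_repi:
  assumes "right_module R M" "gen_family M t i m"
  shows "pmap M t m \<in> repi R (Proj t i) M"
  using assms pmap_rhom[OF assms(1), of t m i] by (auto simp: gen_family_def repi_def)

text \<open>The vertex idempotents add up to one, so an element is the sum of its components at the
  vertices.\<close>

lemma ract_expand:
  assumes "right_module R M" "rsubmodule R N M" "x \<in> carrier M" "\<And>v. v \<in> V \<Longrightarrow> x \<ltimes>\<^bsub>M\<^esub> idem v \<in> N"
  shows "x \<in> N"
proof -
  interpret M: right_module R M by fact
  note N = M.rsubmoduleD[OF assms(2)]
  have "x \<ltimes>\<^bsub>M\<^esub> mk (\<lambda>v. if v \<in> W then 1 else 0) (\<lambda>_. 0) \<in> N" if "finite W" "W \<subseteq> V" for W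
    using that
  proof (induction W rule: finite_induct)
    case empty
    have "mk (\<lambda>v. if v \<in> {} then 1 else 0) (\<lambda>_. 0) = \<zero>" by (rule coords_ext) auto
    then show ?case using N assms(3) by simp
  next
    case (insert w W)
    have "mk (\<lambda>v. if v \<in> insert w W then 1 else 0) (\<lambda>_. 0) = mk (\<lambda>v. if v \<in> W then 1 else 0) (\<lambda>_. 0) \<oplus> idem w"
      by (rule coords_ext) (use insert in auto)
    then show ?case using insert N assms by (simp add: M.ract_add_right)
  qed
  from this[OF finite_V] have "x \<ltimes>\<^bsub>M\<^esub> mk (\<lambda>v. if v \<in> V then 1 else 0) (\<lambda>_. 0) \<in> N" by simp
  moreover have "mk (\<lambda>v. if v \<in> V then 1 else 0) (\<lambda>_. 0) = \<one>" by (rule coords_ext) auto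
  ultimately show ?thesis using assms(3) M.ract_one by simp
qed

text \<open>Each generator is replaced by its components at all vertices, so that every member of
  the family belongs to one vertex.\<close>

lemma gen_family_exists:
  assumes "right_module R M" "rfin_gen R M"
  shows "\<exists>t i m. gen_family M t i m"
proof -
  interpret M: right_module R M by fact
  obtain X where X: "finite X" "X \<subseteq> carrier M" "\<And>N. rsubmodule R N M \<Longrightarrow> X \<subseteq> N \<Longrightarrow> N = carrier M"
    using assms(2) unfolding rfin_gen_def by blast
  have "finite (X \<times> V)" using X(1) finite_V by simp
  then obtain xs where xs: "set xs = X \<times> V" using finite_list by blast
  let ?t = "length xs" and ?i = "\<lambda>k. snd (xs ! k)" and ?m = "\<lambda>k. fst (xs ! k) \<ltimes>\<^bsub>M\<^esub> idem (snd (xs ! k))"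
  have nth: "fst (xs ! k) \<in> X" "snd (xs ! k) \<in> V" if "k < ?t" for k
  proof -
    have "xs ! k \<in> X \<times> V" using nth_mem[OF that] unfolding xs .
    then show "fst (xs ! k) \<in> X" "snd (xs ! k) \<in> V" by (simp_all add: mem_Times_iff)
  qed
  have fam: "?i k \<in> V \<and> ?m k \<in> carrier M \<and> ?m k \<ltimes>\<^bsub>M\<^esub> idem (?i k) = ?m k" if "k < ?t" for k
    using nth[OF that] X(2) by (auto simp: M.ract_closed M.ract_mult[symmetric] idem_idem subset_iff)
  have hom: "pmap M ?t ?m \<in> rhom R (Proj ?t ?i) M" using fam by (intro pmap_rhom assms) blast
  let ?N = "pmap M ?t ?m ` carrier (Proj ?t ?i)"
  have N: "rsubmodule R ?N M"
    by (rule rhom_image_rsubmodule[OF right_module_Proj assms(1) hom Pj.rsubmodule_carrier])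
  have "X \<subseteq> ?N"
  proof
    fix x assume x: "x \<in> X"
    show "x \<in> ?N"
    proof (rule ract_expand[OF assms(1) N])
      fix v assume "v \<in> V"
      then obtain k where k: "k < ?t" "xs ! k = (x, v)" using x xs by (metis SigmaI in_set_conv_nth)
      have "pmap M ?t ?m (unitv ?i k) = ?m k"
        using pmap_unitv[OF assms(1) k(1), of ?m ?i] fam k(1) by simp
      then have "?m k \<in> ?N" using imageI[OF unitv_closed[OF k(1), of ?i], of "pmap M ?t ?m"] by simp
      then show "x \<ltimes>\<^bsub>M\<^esub> idem v \<in> ?N" using k by simp
    qed (use x X in auto)
  qed
  then have "?N = carrier M" using X(3) N by blast
  then have "gen_family M ?t ?i ?m" unfolding gen_family_def using fam by simp
  then show ?thesis by (intro exI)
qed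

lemma lsum_carrier_update [simp]: "lsum (M\<lparr>carrier := N\<rparr>) f t = lsum M f t"
  for M :: "('r, 'm, 'c) rmodule_scheme"
  by (induction t) auto

text \<open>\<open>N\<close> is generated by all members but the \<open>k\<close>-th. Presenting it
  with \<open>t - 1\<close> generators lets it contradict minimality or feed an induction on the
  number of generators.\<close>

lemma skip_family:
  assumes "right_module R M" "k < t"
    and G: "\<And>l. l < t \<Longrightarrow> i l \<in> V \<and> m l \<in> carrier M \<and> m l \<ltimes>\<^bsub>M\<^esub> idem (i l) = m l"
  obtains N i' m' where "rsubmodule R N M" "gen_family (M\<lparr>carrier := N\<rparr>) (t - 1) i' m'"
    "\<And>l. l < t \<Longrightarrow> l \<noteq> k \<Longrightarrow> m l \<in> N"
proof -
  interpret M: right_module R M by fact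
  obtain s where s: "t = Suc s" using assms(2) by (cases t) auto
  let ?sk = "\<lambda>l. if l < k then l else Suc l"
  let ?i = "\<lambda>l. i (?sk l)" and ?m = "\<lambda>l. m (?sk l)"
  have fam: "?i l \<in> V \<and> ?m l \<in> carrier M \<and> ?m l \<ltimes>\<^bsub>M\<^esub> idem (?i l) = ?m l" if "l < s" for l
    using G[of "?sk l"] that s by auto
  have hom: "pmap M s ?m \<in> rhom R (Proj s ?i) M" using fam by (intro pmap_rhom assms) blast
  let ?N = "pmap M s ?m ` carrier (Proj s ?i)"
  have N: "rsubmodule R ?N M"
    by (rule rhom_image_rsubmodule[OF right_module_Proj assms(1) hom Pj.rsubmodule_carrier])
  have mem: "?m l \<in> ?N" if l: "l < s" for l
  proof -
    have "pmap M s ?m (unitv ?i l) = ?m l"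
      using pmap_unitv[OF assms(1) l, of ?m ?i] fam l by simp
    then show ?thesis using imageI[OF unitv_closed[OF l, of ?i], of "pmap M s ?m"] by simp
  qed
  have "gen_family (M\<lparr>carrier := ?N\<rparr>) s ?i ?m"
    unfolding gen_family_def using fam mem by (simp add: pmap_def)
  moreover have "m l \<in> ?N" if l: "l < t" "l \<noteq> k" for l
  proof -
    have "?sk (if l < k then l else l - 1) = l" using l by auto
    then show ?thesis using mem[of "if l < k then l else l - 1"] l assms(2) s by force
  qed
  ultimately show thesis using that[OF N] s by simp
qed

lemma gen_family_submodule:
  assumes "right_module R M" "gen_family M t i m" "rsubmodule R N M" "\<And>k. k < t \<Longrightarrow> m k \<in> N"
  shows "N = carrier M"
proof -
  interpret M: right_module R M by fact
  note N = M.rsubmoduleD[OF assms(3)]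
  have "carrier M \<subseteq> N"
  proof
    fix y assume "y \<in> carrier M"
    then obtain z where z: "z \<in> carrier (Proj t i)" "y = pmap M t m z"
      using assms(2) unfolding gen_family_def by blast
    have "m k \<ltimes>\<^bsub>M\<^esub> z k \<in> N" if "k < t" for k
      using N(4)[OF assms(4)[OF that], of "z k"] z(1) by (simp add: Proj_carrier)
    then show "y \<in> N" unfolding z(2) pmap_def[of M t] by (rule M.lsum_rsubmodule[OF assms(3)])
  qed
  then show ?thesis using N(1) by blast
qed

text \<open>If some coordinate of a relation between the generators has a nonzero vertex coefficient,
  then the corresponding generator is redundant.\<close>

lemma std_cover_exists:
  assumes "right_module R M" "rfin_gen R M"
  obtains t i m where "std_cover M t i m" "\<And>s i' m'. gen_family M s i' m' \<Longrightarrow> t \<le> s"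
proof -
  interpret M: right_module R M by fact
  define t where "t = (LEAST t. \<exists>i m. gen_family M t i m)"
  have "\<exists>i m. gen_family M t i m"
    unfolding t_def using gen_family_exists[OF assms] by (rule LeastI_ex)
  then obtain i m where G: "gen_family M t i m" by blast
  have min: "t \<le> s" if "gen_family M s i' m'" for s i' m'
    unfolding t_def using that by (intro Least_le) blast
  have "cv (x k) v = 0" if x: "x \<in> carrier (Proj t i)" "pmap M t m x = \<zero>\<^bsub>M\<^esub>" "k < t" "v \<in> V" for x k v
  proof (rule ccontr)
    assume nz: "cv (x k) v \<noteq> 0"
    have v: "v = i k" using Proj_cv[OF x(1,3,4)] nz by blast
    have xc: "x l \<in> carrier R" for l using x(1) by (simp add: Proj_carrier)
    \<comment> \<open>Invertibility of \<open>x k\<close> at its vertex makes it possible to solve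
      the relation for \<open>m k\<close>.\<close>
    obtain r where r: "r \<in> carrier R" "x k \<otimes> r = idem (i k)"
      using right_inverse_idem[of "x k" "i k"] x nz v by (auto simp: Proj_carrier)
    have mc: "m l \<in> carrier M" if "l < t" for l using gen_familyD(2)[OF G that] .
    obtain N i' m' where N: "rsubmodule R N M" "gen_family (M\<lparr>carrier := N\<rparr>) (t - 1) i' m'"
      and other: "\<And>l. l < t \<Longrightarrow> l \<noteq> k \<Longrightarrow> m l \<in> N"
      using skip_family[OF assms(1) x(3), of i m] gen_familyD[OF G] by metis
    note N' = M.rsubmoduleD[OF N(1)]
    obtain s where s: "t = Suc s" using x(3) by (cases t) auto
    let ?sk = "\<lambda>l. if l < k then l else Suc l"
    let ?rest = "lsum M (\<lambda>l. m (?sk l) \<ltimes>\<^bsub>M\<^esub> x (?sk l)) s"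
    have "\<zero>\<^bsub>M\<^esub> = ?rest \<oplus>\<^bsub>M\<^esub> m k \<ltimes>\<^bsub>M\<^esub> x k"
      using x(2) M.M.lsum_skip[of k s "\<lambda>l. m l \<ltimes>\<^bsub>M\<^esub> x l"] x(3) s mc xc
      by (simp add: pmap_def M.ract_closed)
    moreover have rest: "?rest \<in> N"
      by (rule M.lsum_rsubmodule[OF N(1)]) (use other s N'(4) xc in auto)
    moreover have "m k \<ltimes>\<^bsub>M\<^esub> x k \<in> carrier M" using mc x(3) xc by (simp add: M.ract_closed)
    moreover have "?rest \<in> carrier M" using rest N'(1) by blast
    ultimately have "m k \<ltimes>\<^bsub>M\<^esub> x k = \<ominus>\<^bsub>M\<^esub> ?rest"
      using M.M.minus_equality[of "m k \<ltimes>\<^bsub>M\<^esub> x k" ?rest] by (simp add: M.M.a_comm)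
    then have "m k \<ltimes>\<^bsub>M\<^esub> x k \<in> N" using N'(5)[OF rest] by simp
    then have "(m k \<ltimes>\<^bsub>M\<^esub> x k) \<ltimes>\<^bsub>M\<^esub> r \<in> N" using N'(4) r(1) by blast
    then have "m k \<ltimes>\<^bsub>M\<^esub> (x k \<otimes> r) \<in> N" using M.ract_mult[OF mc[OF x(3)] xc r(1)] by simp
    then have "m k \<in> N" using r(2) gen_familyD(3)[OF G x(3)] by simp
    then have all: "m l \<in> N" if "l < t" for l using other that by (cases "l = k") auto
    have "N = carrier M" by (rule gen_family_submodule[OF assms(1) G N(1) all])
    then show False using min[of "t - 1" i' m'] N(2) s by simp
  qed
  then have "std_cover M t i m" using G unfolding std_cover_def by blast
  then show thesis using that min by blast
qed

text \<open>A submodule \<open>N\<close> mapping onto \<open>M\<close> satisfies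
  \<open>P = N + kernel\<close>. Writing a generator as \<open>y + w\<close> with \<open>w\<close>
  in the kernel and multiplying by a radical element kills \<open>w\<close>, because the square of
  the radical is zero. So \<open>N\<close> contains the radical of \<open>P\<close>, therefore the
  kernel, therefore \<open>P\<close>.\<close>

lemma std_cover_projective_cover:
  assumes "M \<in> fg_modules R" "std_cover M t i m"
  shows "projective_cover R (Proj t i) (pmap M t m) M"
  unfolding projective_cover_def
proof (intro conjI allI impI Proj_projective)
  note M = fg_modulesD(1)[OF assms(1)]
  interpret M: right_module R M by (rule M)
  have G: "gen_family M t i m" using assms(2) by (simp add: std_cover_def)
  show epi: "pmap M t m \<in> repi R (Proj t i) M" by (rule gen_family_repi[OF M G])
  note hom = repiD(1)[OF epi]
  fix N assume *: "rsubmodule R N (Proj t i) \<and> pmap M t m ` N = carrier M"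
  note N = Pj.rsubmoduleD[OF conjunct1[OF *]]
  have ker: "cv (w k) v = 0" if "w \<in> carrier (Proj t i)" "pmap M t m w = \<zero>\<^bsub>M\<^esub>" "v \<in> V" for w k v
    using assms(2) that unfolding std_cover_def by (cases "k < t") (auto simp: Proj_carrier)
  have split: "\<exists>y\<in>N. \<exists>w\<in>carrier (Proj t i). x = y \<oplus>\<^bsub>Proj t i\<^esub> w \<and> pmap M t m w = \<zero>\<^bsub>M\<^esub>"
    if x: "x \<in> carrier (Proj t i)" for x
  proof -
    have "pmap M t m x \<in> pmap M t m ` N" using * rhomD(1)[OF hom x] by simp
    then obtain y where y: "y \<in> N" "pmap M t m x = pmap M t m y" by auto
    have yc: "y \<in> carrier (Proj t i)" using y N(1) by blast
    let ?w = "x \<ominus>\<^bsub>Proj t i\<^esub> y"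
    have "pmap M t m ?w = \<zero>\<^bsub>M\<^esub>"
      unfolding rhom_diff[OF right_module_Proj M hom x yc] y(2)
      using M.minus_eq_zero_iff rhomD(1)[OF hom yc] by blast
    moreover have "x = y \<oplus>\<^bsub>Proj t i\<^esub> ?w"
      using x yc Pj.M.a_comm[of y t i ?w] Pj.M.minus_closed[of x t i y]
      by (simp add: a_minus_def Pj.M.a_assoc Pj.M.l_neg del: Proj_simps)
    ultimately show ?thesis using y(1) x yc Pj.M.minus_closed by blast
  qed
  have rad: "z \<in> N" if z: "z \<in> carrier (Proj t i)" "\<And>k v. v \<in> V \<Longrightarrow> cv (z k) v = 0" for z
  proof (subst Proj_expand[OF z(1)], rule Pj.lsum_rsubmodule[OF conjunct1[OF *]])
    fix k assume k: "k < t"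
    have zc: "z k \<in> carrier R" using z by (simp add: Proj_carrier)
    obtain y w where yw: "y \<in> N" "w \<in> carrier (Proj t i)" "unitv i k = y \<oplus>\<^bsub>Proj t i\<^esub> w"
      "pmap M t m w = \<zero>\<^bsub>M\<^esub>" using split[OF unitv_closed[OF k]] by blast
    have "w l \<otimes> z k = \<zero>" for l
    proof (rule coords_ext)
      have wc: "w l \<in> carrier R" using yw by (simp add: Proj_carrier)
      show "w l \<otimes> z k \<in> carrier R" using wc zc by simp
      show "cv (w l \<otimes> z k) v = cv \<zero> v" if "v \<in> V" for v using that wc zc z(2) by simp
      show "ca (w l \<otimes> z k) e = ca \<zero> e" if "e \<in> E" for e
        using that wc zc z(2) ker[OF yw(2,4)] by simp
    qed simp
    then have "w \<ltimes>\<^bsub>Proj t i\<^esub> z k = \<zero>\<^bsub>Proj t i\<^esub>" by simp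
    moreover have yc: "y \<in> carrier (Proj t i)" using yw(1) N(1) by blast
    ultimately have "unitv i k \<ltimes>\<^bsub>Proj t i\<^esub> z k = y \<ltimes>\<^bsub>Proj t i\<^esub> z k"
      unfolding yw(3) Pj.ract_add_left[OF yc yw(2) zc] using Pj.ract_closed[OF yc zc] Pj.M.r_zero by metis
    then show "unitv i k \<ltimes>\<^bsub>Proj t i\<^esub> z k \<in> N" using N(4)[OF yw(1) zc] by simp
  qed
  show "N = carrier (Proj t i)"
  proof (rule equalityI[OF N(1)], rule subsetI)
    fix x assume "x \<in> carrier (Proj t i)"
    then obtain y w where "y \<in> N" "w \<in> carrier (Proj t i)" "x = y \<oplus>\<^bsub>Proj t i\<^esub> w" "pmap M t m w = \<zero>\<^bsub>M\<^esub>"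
      using split by blast
    then show "x \<in> N" using rad[of w] ker[of w] N(3) by blast
  qed
qed

end

text \<open>Finite generation of \<open>K\<close> is a conclusion: kernels are built up one simple
  summand at a time, and membership in \<open>fg_modules\<close> has to grow along with
  them.\<close>

lemma internal_sum_fg:
  fixes M :: "'r fg_module"
  assumes "right_module R M" "rsubmodule R A M" "rsubmodule R B M" "rsubmodule R K M"
    and "A \<inter> B \<subseteq> {\<zero>\<^bsub>M\<^esub>}" and "K = {a \<oplus>\<^bsub>M\<^esub> b | a b. a \<in> A \<and> b \<in> B}"
    and fg: "M\<lparr>carrier := A\<rparr> \<in> fg_modules R" "M\<lparr>carrier := B\<rparr> \<in> fg_modules R"
  shows "M\<lparr>carrier := K\<rparr> \<in> fg_modules R"
    "K0_eq R (frag_of (M\<lparr>carrier := K\<rparr>)) (frag_of (M\<lparr>carrier := A\<rparr>) + frag_of (M\<lparr>carrier := B\<rparr>))"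
proof -
  interpret M: right_module R M by fact
  have iso: "riso R (M\<lparr>carrier := K\<rparr>) (rsum (M\<lparr>carrier := A\<rparr>) (M\<lparr>carrier := B\<rparr>))"
    by (rule riso_internal_sum) fact+
  have K: "right_module R (M\<lparr>carrier := K\<rparr>)" using M.submodule_right_module assms(4) .
  note S = right_module_rsum[OF fg_modulesD(1)[OF fg(1)] fg_modulesD(1)[OF fg(2)]]
  obtain f where "f \<in> repi R (rsum (M\<lparr>carrier := A\<rparr>) (M\<lparr>carrier := B\<rparr>)) (M\<lparr>carrier := K\<rparr>)"
    using riso_sym[OF K iso] riso_imp_repi unfolding riso_def by blast
  then have "rfin_gen R (M\<lparr>carrier := K\<rparr>)"
    using rfin_gen_epi[OF S K] rfin_gen_rsum fg fg_modulesD by blast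
  then show 1: "M\<lparr>carrier := K\<rparr> \<in> fg_modules R" using K by (simp add: fg_modules_def)
  show "K0_eq R (frag_of (M\<lparr>carrier := K\<rparr>)) (frag_of (M\<lparr>carrier := A\<rparr>) + frag_of (M\<lparr>carrier := B\<rparr>))"
    by (rule K0_eq_rsum[OF 1 fg iso])
qed

context right_module
begin

lemma adjoin_rsubmodule:
  assumes "rsubmodule R N M" "b \<in> carrier M"
  shows "rsubmodule R {y \<oplus>\<^bsub>M\<^esub> b \<ltimes>\<^bsub>M\<^esub> r | y r. y \<in> N \<and> r \<in> carrier R} M"
    "N \<subseteq> {y \<oplus>\<^bsub>M\<^esub> b \<ltimes>\<^bsub>M\<^esub> r | y r. y \<in> N \<and> r \<in> carrier R}"
    "r \<in> carrier R \<Longrightarrow> b \<ltimes>\<^bsub>M\<^esub> r \<in> {y \<oplus>\<^bsub>M\<^esub> b \<ltimes>\<^bsub>M\<^esub> r | y r. y \<in> N \<and> r \<in> carrier R}"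
proof -
  let ?S = "{y \<oplus>\<^bsub>M\<^esub> b \<ltimes>\<^bsub>M\<^esub> r | y r. y \<in> N \<and> r \<in> carrier R}"
  note N = rsubmoduleD[OF assms(1)]
  show 1: "N \<subseteq> ?S"
  proof
    fix y assume "y \<in> N"
    then have "y = y \<oplus>\<^bsub>M\<^esub> b \<ltimes>\<^bsub>M\<^esub> \<zero>\<^bsub>R\<^esub>" using N(1) assms(2) by auto
    then show "y \<in> ?S" using \<open>y \<in> N\<close> R.zero_closed by blast
  qed
  show "b \<ltimes>\<^bsub>M\<^esub> r \<in> ?S" if "r \<in> carrier R"
  proof -
    have "b \<ltimes>\<^bsub>M\<^esub> r = \<zero>\<^bsub>M\<^esub> \<oplus>\<^bsub>M\<^esub> b \<ltimes>\<^bsub>M\<^esub> r" using assms(2) that by (simp add: ract_closed)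
    then show ?thesis using N(2) that by blast
  qed
  show "rsubmodule R ?S M"
  proof (rule rsubmoduleI)
    show "?S \<subseteq> carrier M" using N(1) assms(2) by (auto simp: ract_closed)
    show "\<zero>\<^bsub>M\<^esub> \<in> ?S" using 1 N(2) by blast
  next
    fix x x' assume "x \<in> ?S" "x' \<in> ?S"
    then obtain y r y' r' where *: "x = y \<oplus>\<^bsub>M\<^esub> b \<ltimes>\<^bsub>M\<^esub> r" "y \<in> N" "r \<in> carrier R"
      "x' = y' \<oplus>\<^bsub>M\<^esub> b \<ltimes>\<^bsub>M\<^esub> r'" "y' \<in> N" "r' \<in> carrier R" by blast
    then have "x \<oplus>\<^bsub>M\<^esub> x' = (y \<oplus>\<^bsub>M\<^esub> y') \<oplus>\<^bsub>M\<^esub> b \<ltimes>\<^bsub>M\<^esub> (r \<oplus>\<^bsub>R\<^esub> r')"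
      using N(1) assms(2) by (simp add: subset_iff ract_add_right ract_closed M.a_ac)
    then show "x \<oplus>\<^bsub>M\<^esub> x' \<in> ?S" using * N(3) by blast
  next
    fix x s assume "x \<in> ?S" and s: "s \<in> carrier R"
    then obtain y r where *: "x = y \<oplus>\<^bsub>M\<^esub> b \<ltimes>\<^bsub>M\<^esub> r" "y \<in> N" "r \<in> carrier R" by blast
    then have "x \<ltimes>\<^bsub>M\<^esub> s = y \<ltimes>\<^bsub>M\<^esub> s \<oplus>\<^bsub>M\<^esub> b \<ltimes>\<^bsub>M\<^esub> (r \<otimes>\<^bsub>R\<^esub> s)"
      using N(1) assms(2) s by (auto simp: subset_iff ract_add_left ract_closed ract_mult)
    then show "x \<ltimes>\<^bsub>M\<^esub> s \<in> ?S" using * N(4) s by blast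
  qed
qed

lemma rsubmodule_cyclic:
  assumes "b \<in> carrier M" shows "rsubmodule R {b \<ltimes>\<^bsub>M\<^esub> r | r. r \<in> carrier R} M"
proof -
  have "{\<zero>\<^bsub>M\<^esub> \<oplus>\<^bsub>M\<^esub> b \<ltimes>\<^bsub>M\<^esub> r | r. r \<in> carrier R} = {b \<ltimes>\<^bsub>M\<^esub> r | r. r \<in> carrier R}"
    using assms by (auto simp: ract_closed) (metis M.l_zero ract_closed)
  moreover have "{y \<oplus>\<^bsub>M\<^esub> b \<ltimes>\<^bsub>M\<^esub> r | y r. y \<in> {\<zero>\<^bsub>M\<^esub>} \<and> r \<in> carrier R} = {\<zero>\<^bsub>M\<^esub> \<oplus>\<^bsub>M\<^esub> b \<ltimes>\<^bsub>M\<^esub> r | r. r \<in> carrier R}"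
    by auto
  ultimately show ?thesis using adjoin_rsubmodule(1)[OF rsubmodule_zero assms] by simp
qed

end

context rad_square_zero
begin

section \<open>Cyclic modules with a single top vertex\<close>

text \<open>The span of those arrows of \<open>D\<close> that leave \<open>i\<close>: elements of
  the projective at \<open>i\<close> have no other arrow coefficients anyway.\<close>

definition cyc_ker :: "'v \<Rightarrow> 'e set \<Rightarrow> (nat \<Rightarrow> 'r) set" where
  "cyc_ker i D = {x \<in> carrier (Proj 1 (\<lambda>_. i)). cv (x 0) i = 0 \<and> (\<forall>e\<in>E - D. ca (x 0) e = 0)}"

text \<open>The projective at \<open>i\<close> modulo the arrows in \<open>D\<close>.
  \<open>D = E\<close> gives the simple module, \<open>D = {}\<close> a copy of the projective, and
  a single arrow leaving \<open>i\<close> gives a module with a simple syzygy.\<close>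

definition Cyc :: "'v \<Rightarrow> 'e set \<Rightarrow> 'r fg_module" where
  "Cyc i D = (SOME C. C \<in> fg_modules R \<and>
     (\<exists>f\<in>repi R (Proj 1 (\<lambda>_. i)) C. a_kernel (Proj 1 (\<lambda>_. i)) C f = cyc_ker i D))"

abbreviation Sim :: "'v \<Rightarrow> 'r fg_module" where "Sim i \<equiv> Cyc i E"

lemma cyc_ker_rsubmodule:
  assumes "i \<in> V" shows "rsubmodule R (cyc_ker i D) (Proj 1 (\<lambda>_. i))"
proof (rule Pj.rsubmoduleI)
  show "cyc_ker i D \<subseteq> carrier (Proj 1 (\<lambda>_. i))" by (auto simp: cyc_ker_def)
  show "\<zero>\<^bsub>Proj 1 (\<lambda>_. i)\<^esub> \<in> cyc_ker i D" using assms by (auto simp: cyc_ker_def Proj_carrier)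
next
  fix x y assume xy: "x \<in> cyc_ker i D" "y \<in> cyc_ker i D"
  then have "x \<oplus>\<^bsub>Proj 1 (\<lambda>_. i)\<^esub> y \<in> carrier (Proj 1 (\<lambda>_. i))"
    using Pj.M.a_closed by (auto simp: cyc_ker_def simp del: Proj_simps)
  then show "x \<oplus>\<^bsub>Proj 1 (\<lambda>_. i)\<^esub> y \<in> cyc_ker i D"
    using xy assms by (auto simp: cyc_ker_def Proj_carrier)
next
  fix x r assume xr: "x \<in> cyc_ker i D" "r \<in> carrier R"
  then have "x \<ltimes>\<^bsub>Proj 1 (\<lambda>_. i)\<^esub> r \<in> carrier (Proj 1 (\<lambda>_. i))"
    using Pj.ract_closed by (auto simp: cyc_ker_def simp del: Proj_simps)
  moreover have "cv (x 0) (src e) = 0" if "e \<in> E" for e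
    using xr that Proj_cv[of x 1 "\<lambda>_. i" 0 "src e"] by (cases "src e = i") (auto simp: cyc_ker_def)
  ultimately show "x \<ltimes>\<^bsub>Proj 1 (\<lambda>_. i)\<^esub> r \<in> cyc_ker i D"
    using xr assms by (auto simp: cyc_ker_def Proj_carrier)
qed

lemma Cyc_cover:
  assumes "i \<in> V"
  shows "Cyc i D \<in> fg_modules R"
    "\<exists>f\<in>repi R (Proj 1 (\<lambda>_. i)) (Cyc i D). a_kernel (Proj 1 (\<lambda>_. i)) (Cyc i D) f = cyc_ker i D"
proof -
  obtain Q :: "'r fg_module" and f where "right_module R Q" "f \<in> repi R (Proj 1 (\<lambda>_. i)) Q"
    "a_kernel (Proj 1 (\<lambda>_. i)) Q f = cyc_ker i D"
    using quotient_module[OF right_module_Proj cyc_ker_rsubmodule[OF assms]] by metis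
  then have "\<exists>C. C \<in> fg_modules R \<and>
     (\<exists>f\<in>repi R (Proj 1 (\<lambda>_. i)) C. a_kernel (Proj 1 (\<lambda>_. i)) C f = cyc_ker i D)"
    using fg_modules_epi[OF Proj_fg] by blast
  from someI_ex[OF this] show "Cyc i D \<in> fg_modules R"
    "\<exists>f\<in>repi R (Proj 1 (\<lambda>_. i)) (Cyc i D). a_kernel (Proj 1 (\<lambda>_. i)) (Cyc i D) f = cyc_ker i D"
    unfolding Cyc_def by blast+
qed

text \<open>A generator with the right annihilator characterises \<open>Cyc i D\<close> up to
  isomorphism, so that simple modules can be recognised inside other modules.\<close>

definition cyc_gen :: "('r, 'm, 'c) rmodule_scheme \<Rightarrow> 'v \<Rightarrow> 'e set \<Rightarrow> 'm \<Rightarrow> bool" where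
  "cyc_gen M i D c \<longleftrightarrow> c \<in> carrier M \<and> c \<ltimes>\<^bsub>M\<^esub> idem i = c \<and> (\<forall>x\<in>carrier M. \<exists>r\<in>carrier R. x = c \<ltimes>\<^bsub>M\<^esub> r) \<and>
     (\<forall>r\<in>carrier R. c \<ltimes>\<^bsub>M\<^esub> r = \<zero>\<^bsub>M\<^esub> \<longleftrightarrow> cv r i = 0 \<and> (\<forall>e\<in>E - D. src e = i \<longrightarrow> ca r e = 0))"

definition emb :: "'v \<Rightarrow> 'r \<Rightarrow> nat \<Rightarrow> 'r" where
  "emb i r = (\<lambda>l. if l = 0 then idem i \<otimes> r else \<zero>)"

lemma emb_closed: "r \<in> carrier R \<Longrightarrow> emb i r \<in> carrier (Proj 1 (\<lambda>_. i))"
  by (auto simp: emb_def Proj_carrier R.m_assoc[symmetric] idem_idem)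

lemma emb_in_cyc_ker:
  assumes "r \<in> carrier R" "i \<in> V"
  shows "emb i r \<in> cyc_ker i D \<longleftrightarrow> cv r i = 0 \<and> (\<forall>e\<in>E - D. src e = i \<longrightarrow> ca r e = 0)"
  using emb_closed[OF assms(1)] assms by (auto simp: cyc_ker_def emb_def)

lemma Proj1_emb:
  assumes "x \<in> carrier (Proj 1 (\<lambda>_. i))" shows "x = emb i (x 0)" "x 0 \<in> carrier R"
  using assms by (auto simp: emb_def Proj_carrier)

lemma Cyc_gen:
  assumes "i \<in> V"
  obtains c where "cyc_gen (Cyc i D) i D c"
proof -
  note C = fg_modulesD(1)[OF Cyc_cover(1)[OF assms, of D]]
  obtain f where f: "f \<in> repi R (Proj 1 (\<lambda>_. i)) (Cyc i D)"
    "a_kernel (Proj 1 (\<lambda>_. i)) (Cyc i D) f = cyc_ker i D" using Cyc_cover(2)[OF assms] by blast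
  note fh = rhomD[OF repiD(1)[OF f(1)]]
  let ?u = "emb i \<one>"
  have u: "?u \<in> carrier (Proj 1 (\<lambda>_. i))" by (rule emb_closed) simp
  have act: "f (emb i r) = f ?u \<ltimes>\<^bsub>Cyc i D\<^esub> r" if "r \<in> carrier R" for r
  proof -
    have "emb i r = ?u \<ltimes>\<^bsub>Proj 1 (\<lambda>_. i)\<^esub> r"
      using that by (auto simp: emb_def)
    then show ?thesis using fh(3)[OF u that] by simp
  qed
  have "emb i (idem i) = ?u" by (auto simp: emb_def idem_idem)
  then have "f ?u \<ltimes>\<^bsub>Cyc i D\<^esub> idem i = f ?u" using act[of "idem i"] by simp
  moreover have "\<exists>r\<in>carrier R. x = f ?u \<ltimes>\<^bsub>Cyc i D\<^esub> r" if x: "x \<in> carrier (Cyc i D)" for x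
  proof -
    obtain y where y: "y \<in> carrier (Proj 1 (\<lambda>_. i))" "x = f y"
      using x unfolding repiD(2)[OF f(1), symmetric] by auto
    have "x = f ?u \<ltimes>\<^bsub>Cyc i D\<^esub> y 0"
      using act[OF Proj1_emb(2)[OF y(1)]] unfolding y(2) Proj1_emb(1)[OF y(1), symmetric] .
    then show ?thesis using Proj1_emb(2)[OF y(1)] by (rule bexI)
  qed
  moreover have "f ?u \<ltimes>\<^bsub>Cyc i D\<^esub> r = \<zero>\<^bsub>Cyc i D\<^esub> \<longleftrightarrow> cv r i = 0 \<and> (\<forall>e\<in>E - D. src e = i \<longrightarrow> ca r e = 0)"
    if r: "r \<in> carrier R" for r
  proof -
    have "f ?u \<ltimes>\<^bsub>Cyc i D\<^esub> r = \<zero>\<^bsub>Cyc i D\<^esub> \<longleftrightarrow> emb i r \<in> a_kernel (Proj 1 (\<lambda>_. i)) (Cyc i D) f"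
      unfolding a_kernel_eq act[OF r, symmetric] using emb_closed[OF r, of i] by blast
    then show ?thesis unfolding f(2) emb_in_cyc_ker[OF r assms] .
  qed
  ultimately have "cyc_gen (Cyc i D) i D (f ?u)" unfolding cyc_gen_def using fh(1)[OF u] by blast
  then show thesis using that by blast
qed

lemma cyc_gen_pmap:
  assumes M: "right_module R M" and c: "cyc_gen M i D c" and i: "i \<in> V"
  shows "pmap M 1 (\<lambda>_. c) \<in> repi R (Proj 1 (\<lambda>_. i)) M"
    "a_kernel (Proj 1 (\<lambda>_. i)) M (pmap M 1 (\<lambda>_. c)) = cyc_ker i D"
proof -
  interpret M: right_module R M by fact
  have cc: "c \<in> carrier M" "c \<ltimes>\<^bsub>M\<^esub> idem i = c" using c by (auto simp: cyc_gen_def)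
  have p: "pmap M 1 (\<lambda>_. c) (emb i r) = c \<ltimes>\<^bsub>M\<^esub> r" if "r \<in> carrier R" for r
    using that cc by (simp add: pmap_def emb_def M.ract_closed M.ract_mult)
  have hom: "pmap M 1 (\<lambda>_. c) \<in> rhom R (Proj 1 (\<lambda>_. i)) M" by (rule pmap_rhom[OF M]) (rule cc)
  have "carrier M \<subseteq> pmap M 1 (\<lambda>_. c) ` carrier (Proj 1 (\<lambda>_. i))"
  proof
    fix x assume "x \<in> carrier M"
    then obtain r where "r \<in> carrier R" "x = c \<ltimes>\<^bsub>M\<^esub> r" using c by (auto simp: cyc_gen_def)
    then show "x \<in> pmap M 1 (\<lambda>_. c) ` carrier (Proj 1 (\<lambda>_. i))" using p emb_closed by (metis imageI)
  qed
  then show "pmap M 1 (\<lambda>_. c) \<in> repi R (Proj 1 (\<lambda>_. i)) M" using hom by (auto simp: repi_def rhom_def)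
  show "a_kernel (Proj 1 (\<lambda>_. i)) M (pmap M 1 (\<lambda>_. c)) = cyc_ker i D"
  proof -
    have "x \<in> cyc_ker i D \<longleftrightarrow> pmap M 1 (\<lambda>_. c) x = \<zero>\<^bsub>M\<^esub>" if x: "x \<in> carrier (Proj 1 (\<lambda>_. i))" for x
    proof -
      have "x \<in> cyc_ker i D \<longleftrightarrow> cv (x 0) i = 0 \<and> (\<forall>e\<in>E - D. src e = i \<longrightarrow> ca (x 0) e = 0)"
        using emb_in_cyc_ker[OF Proj1_emb(2)[OF x] i] Proj1_emb(1)[OF x] by simp
      also have "\<dots> \<longleftrightarrow> c \<ltimes>\<^bsub>M\<^esub> x 0 = \<zero>\<^bsub>M\<^esub>" using c Proj1_emb(2)[OF x] by (auto simp: cyc_gen_def)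
      also have "c \<ltimes>\<^bsub>M\<^esub> x 0 = pmap M 1 (\<lambda>_. c) x" using p[OF Proj1_emb(2)[OF x]] Proj1_emb(1)[OF x] by simp
      finally show ?thesis .
    qed
    then show ?thesis by (auto simp: a_kernel_eq cyc_ker_def)
  qed
qed

lemma cyc_gen_iso:
  fixes M :: "'r fg_module"
  assumes "right_module R M" "cyc_gen M i D c" "i \<in> V"
  shows "M \<in> fg_modules R" "riso R M (Cyc i D)"
proof -
  note p = cyc_gen_pmap[OF assms]
  show "M \<in> fg_modules R" by (rule fg_modules_epi[OF Proj_fg assms(1) p(1)])
  obtain f where "f \<in> repi R (Proj 1 (\<lambda>_. i)) (Cyc i D)"
    "a_kernel (Proj 1 (\<lambda>_. i)) (Cyc i D) f = cyc_ker i D" using Cyc_cover(2)[OF assms(3)] by blast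
  then show "riso R M (Cyc i D)"
    using riso_same_kernel[OF right_module_Proj assms(1) _ p(1)] p(2) Cyc_cover(1)[OF assms(3)] fg_modulesD(1)
    by metis
qed

lemma Cyc_std_cover:
  assumes "i \<in> V"
  obtains c where "std_cover (Cyc i D) 1 (\<lambda>_. i) (\<lambda>_. c)"
    "a_kernel (Proj 1 (\<lambda>_. i)) (Cyc i D) (pmap (Cyc i D) 1 (\<lambda>_. c)) = cyc_ker i D"
proof -
  obtain c where c: "cyc_gen (Cyc i D) i D c" using Cyc_gen[OF assms] .
  note p = cyc_gen_pmap[OF fg_modulesD(1)[OF Cyc_cover(1)[OF assms]] c assms]
  have "gen_family (Cyc i D) 1 (\<lambda>_. i) (\<lambda>_. c)"
    using c assms repiD(2)[OF p(1)] by (auto simp: gen_family_def cyc_gen_def)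
  moreover have "cv (x 0) v = 0" if "x \<in> carrier (Proj 1 (\<lambda>_. i))"
    "pmap (Cyc i D) 1 (\<lambda>_. c) x = \<zero>\<^bsub>Cyc i D\<^esub>" "v \<in> V" for x v
  proof -
    have "x \<in> cyc_ker i D" using that p(2) by (auto simp: a_kernel_eq)
    then show ?thesis using Proj_cv[OF that(1) _ that(3), of 0] by (cases "v = i") (auto simp: cyc_ker_def)
  qed
  ultimately have "std_cover (Cyc i D) 1 (\<lambda>_. i) (\<lambda>_. c)" by (auto simp: std_cover_def)
  then show thesis using that p(2) by blast
qed

text \<open>Let the generator correspond to \<open>(a, b)\<close> in a decomposition; then
  \<open>(a, 0) = (a, b) r\<close> for some \<open>r\<close>. If \<open>r\<close> has coefficient
  zero at \<open>i\<close>, then \<open>1 - r\<close> is invertible at \<open>i\<close> and kills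
  \<open>a\<close>; otherwise \<open>r\<close> is invertible at \<open>i\<close> and kills
  \<open>b\<close>. So one component vanishes, and with it its summand.\<close>

lemma Cyc_indecomposable:
  assumes i: "i \<in> V" shows "indecomposable R (Cyc i D)"
proof -
  note C = Cyc_cover(1)[OF i, of D] and C' = fg_modulesD(1)[OF Cyc_cover(1)[OF i, of D]]
  obtain c where c: "cyc_gen (Cyc i D) i D c" using Cyc_gen[OF i] .
  interpret C: right_module R "Cyc i D" by (rule C')
  have cc: "c \<in> carrier (Cyc i D)" "c \<ltimes>\<^bsub>Cyc i D\<^esub> idem i = c" using c by (auto simp: cyc_gen_def)
  have "cv (idem i) i \<noteq> 0" using i by simp
  then have "c \<ltimes>\<^bsub>Cyc i D\<^esub> idem i \<noteq> \<zero>\<^bsub>Cyc i D\<^esub>"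
    using c gen_closed(1)[of i] unfolding cyc_gen_def by blast
  then have nz: "carrier (Cyc i D) \<noteq> {\<zero>\<^bsub>Cyc i D\<^esub>}" using cc by auto
  have kill: "x = \<zero>\<^bsub>M\<^esub>" if M: "right_module R M" and x: "x \<in> carrier M" "x \<ltimes>\<^bsub>M\<^esub> idem i = x"
    and r: "r \<in> carrier R" "x \<ltimes>\<^bsub>M\<^esub> r = \<zero>\<^bsub>M\<^esub>" "cv r i \<noteq> 0" for M :: "'r fg_module" and x r
  proof -
    interpret M: right_module R M by fact
    have "idem i \<otimes> (idem i \<otimes> r) = idem i \<otimes> r" using r by (simp add: R.m_assoc[symmetric] idem_idem)
    moreover have "cv (idem i \<otimes> r) i \<noteq> 0" using r i by simp
    ultimately obtain s where s: "s \<in> carrier R" "(idem i \<otimes> r) \<otimes> s = idem i"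
      using right_inverse_idem[of "idem i \<otimes> r" i] r i by auto
    have "x = x \<ltimes>\<^bsub>M\<^esub> ((idem i \<otimes> r) \<otimes> s)" using s x by simp
    also have "\<dots> = ((x \<ltimes>\<^bsub>M\<^esub> idem i) \<ltimes>\<^bsub>M\<^esub> r) \<ltimes>\<^bsub>M\<^esub> s"
      using x(1) r(1) s(1) by (simp only: M.ract_mult R.m_closed gen_closed)
    also have "\<dots> = \<zero>\<^bsub>M\<^esub>" using r s x by simp
    finally show ?thesis .
  qed
  show ?thesis unfolding indecomposable_def
  proof (intro conjI ballI impI C nz)
    fix A B assume A: "A \<in> fg_modules R" and B: "B \<in> fg_modules R" and iso: "riso R (Cyc i D) (rsum A B)"
    note A' = fg_modulesD(1)[OF A] and B' = fg_modulesD(1)[OF B]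
    interpret A: right_module R A by (rule A')
    interpret B: right_module R B by (rule B')
    obtain h where h: "h \<in> rhom R (Cyc i D) (rsum A B)" "h ` carrier (Cyc i D) = carrier (rsum A B)"
      using iso riso_imp_repi repiD unfolding riso_def by blast
    note hh = rhomD[OF h(1)]
    obtain a b where ab: "h c = (a, b)" by force
    have abc: "a \<in> carrier A" "b \<in> carrier B" using hh(1)[OF cc(1)] ab by auto
    have ai: "a \<ltimes>\<^bsub>A\<^esub> idem i = a" "b \<ltimes>\<^bsub>B\<^esub> idem i = b"
      using hh(3)[OF cc(1), of "idem i"] cc(2) ab by auto
    have all: "\<exists>r\<in>carrier R. x = a \<ltimes>\<^bsub>A\<^esub> r \<and> y = b \<ltimes>\<^bsub>B\<^esub> r" if "x \<in> carrier A" "y \<in> carrier B" for x y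
    proof -
      have "(x, y) \<in> h ` carrier (Cyc i D)" using that h(2) by simp
      then obtain z where "z \<in> carrier (Cyc i D)" "h z = (x, y)" by (auto simp: image_iff)
      moreover from this obtain r where "r \<in> carrier R" "z = c \<ltimes>\<^bsub>Cyc i D\<^esub> r"
        using c by (auto simp: cyc_gen_def)
      ultimately show ?thesis using hh(3)[OF cc(1)] ab by auto
    qed
    obtain r where r: "r \<in> carrier R" "a = a \<ltimes>\<^bsub>A\<^esub> r" "\<zero>\<^bsub>B\<^esub> = b \<ltimes>\<^bsub>B\<^esub> r"
      using all[OF abc(1) B.M.zero_closed] by blast
    have "a = \<zero>\<^bsub>A\<^esub> \<or> b = \<zero>\<^bsub>B\<^esub>"
    proof (cases "cv r i = 0")
      case True
      have 1: "\<ominus> r \<oplus> \<one> \<in> carrier R" using r by simp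
      have "cv (\<ominus> r \<oplus> r) i = cv (\<ominus> r) i + cv r i" using r i by (intro cv_add) auto
      then have "cv (\<ominus> r) i = 0" using r i True by (simp add: R.l_neg)
      then have "cv (\<ominus> r \<oplus> \<one>) i \<noteq> 0" using r i by simp
      moreover have "a \<ltimes>\<^bsub>A\<^esub> (\<ominus> r \<oplus> \<one>) = \<zero>\<^bsub>A\<^esub>"
        using r abc by (simp add: A.ract_add_right A.ract_minus A.ract_one A.M.l_neg flip: r(2))
      ultimately show ?thesis using kill[OF A' abc(1) ai(1) 1] by blast
    next
      case False
      then show ?thesis using kill[OF B' abc(2) ai(2) r(1)] r(3) by simp
    qed
    then show "carrier A = {\<zero>\<^bsub>A\<^esub>} \<or> carrier B = {\<zero>\<^bsub>B\<^esub>}"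
    proof
      assume "a = \<zero>\<^bsub>A\<^esub>"
      then show ?thesis using all[OF _ B.M.zero_closed] by fastforce
    next
      assume "b = \<zero>\<^bsub>B\<^esub>"
      then show ?thesis using all[OF A.M.zero_closed] by fastforce
    qed
  qed
qed

section \<open>Semisimple modules\<close>

text \<open>The part of \<open>M\<close> on which the algebra acts through the character
  \<open>r \<mapsto> cv r j\<close>; \<open>Soc\<close> is the annihilator of the whole radical, and
  \<open>Soc_soc\<close> cuts it into these parts by the idempotents.\<close>

definition soc :: "('r, 'm, 'c) rmodule_scheme \<Rightarrow> 'v \<Rightarrow> 'm set" where
  "soc M j = {b \<in> carrier M. \<forall>r\<in>carrier R. b \<ltimes>\<^bsub>M\<^esub> r = b \<ltimes>\<^bsub>M\<^esub> sc (cv r j)}"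

definition Soc :: "('r, 'm, 'c) rmodule_scheme \<Rightarrow> 'm set" where
  "Soc M = {b \<in> carrier M. \<forall>r\<in>carrier R. (\<forall>v\<in>V. cv r v = 0) \<longrightarrow> b \<ltimes>\<^bsub>M\<^esub> r = \<zero>\<^bsub>M\<^esub>}"

lemma socD: "b \<in> soc M j \<Longrightarrow> b \<in> carrier M"
  "b \<in> soc M j \<Longrightarrow> r \<in> carrier R \<Longrightarrow> b \<ltimes>\<^bsub>M\<^esub> r = b \<ltimes>\<^bsub>M\<^esub> sc (cv r j)"
  unfolding soc_def by blast+

lemma Soc_rsubmodule:
  assumes "right_module R M" shows "rsubmodule R (Soc M) M"
proof -
  interpret M: right_module R M by fact
  show ?thesis
    by (rule M.rsubmoduleI)
      (auto simp: Soc_def M.ract_add_left M.ract_closed M.ract_mult[symmetric])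
qed

lemma soc_Soc:
  assumes "right_module R M" "j \<in> V" shows "soc M j \<subseteq> Soc M"
proof -
  interpret M: right_module R M by fact
  show ?thesis
  proof
    fix b assume b: "b \<in> soc M j"
    have "b \<ltimes>\<^bsub>M\<^esub> r = \<zero>\<^bsub>M\<^esub>" if "r \<in> carrier R" "\<forall>v\<in>V. cv r v = 0" for r
      using socD(2)[OF b that(1)] that(2) assms(2) socD(1)[OF b] by (simp add: sc_zero)
    then show "b \<in> Soc M" using socD(1)[OF b] by (simp add: Soc_def)
  qed
qed

lemma Soc_soc:
  assumes "right_module R M" "j \<in> V" "x \<in> Soc M" shows "x \<ltimes>\<^bsub>M\<^esub> idem j \<in> soc M j"
proof -
  interpret M: right_module R M by fact
  have xc: "x \<in> carrier M" using assms(3) by (simp add: Soc_def)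
  have "(x \<ltimes>\<^bsub>M\<^esub> idem j) \<ltimes>\<^bsub>M\<^esub> r = (x \<ltimes>\<^bsub>M\<^esub> idem j) \<ltimes>\<^bsub>M\<^esub> sc (cv r j)" if r: "r \<in> carrier R" for r
  proof -
    let ?d = "mk (\<lambda>_. 0) (\<lambda>e. ca (idem j \<otimes> r) e)"
    have "idem j \<otimes> r = idem j \<otimes> sc (cv r j) \<oplus> ?d"
      by (rule coords_ext) (use r assms(2) in auto)
    moreover have "x \<ltimes>\<^bsub>M\<^esub> ?d = \<zero>\<^bsub>M\<^esub>" using assms(3) by (simp add: Soc_def)
    ultimately have "x \<ltimes>\<^bsub>M\<^esub> (idem j \<otimes> r) = x \<ltimes>\<^bsub>M\<^esub> (idem j \<otimes> sc (cv r j))"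
      using M.ract_add_right[OF xc, of "idem j \<otimes> sc (cv r j)" ?d] xc by (simp add: M.ract_closed)
    then show ?thesis using xc r by (simp add: M.ract_mult[symmetric])
  qed
  then show ?thesis using M.ract_closed[OF xc gen_closed(1)] unfolding soc_def by blast
qed

lemma soc_cyclic:
  fixes M :: "'r fg_module"
  assumes "right_module R M" "b \<in> soc M j" "b \<noteq> \<zero>\<^bsub>M\<^esub>" "j \<in> V"
  shows "M\<lparr>carrier := {b \<ltimes>\<^bsub>M\<^esub> r | r. r \<in> carrier R}\<rparr> \<in> fg_modules R"
    "riso R (M\<lparr>carrier := {b \<ltimes>\<^bsub>M\<^esub> r | r. r \<in> carrier R}\<rparr>) (Sim j)"
    "K0_eq R (frag_of (M\<lparr>carrier := {b \<ltimes>\<^bsub>M\<^esub> r | r. r \<in> carrier R}\<rparr>)) (frag_of (Sim j))"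
proof -
  interpret M: right_module R M by fact
  let ?B = "M\<lparr>carrier := {b \<ltimes>\<^bsub>M\<^esub> r | r. r \<in> carrier R}\<rparr>"
  have bc: "b \<in> carrier M" and b: "\<And>r. r \<in> carrier R \<Longrightarrow> b \<ltimes>\<^bsub>M\<^esub> r = b \<ltimes>\<^bsub>M\<^esub> sc (cv r j)"
    using socD[OF assms(2)] by blast+
  have B: "right_module R ?B" by (rule M.submodule_right_module[OF M.rsubmodule_cyclic[OF bc]])
  have "b \<ltimes>\<^bsub>M\<^esub> idem j = b" using b[of "idem j"] assms(4) bc by (simp add: sc_one M.ract_one)
  moreover have "b \<ltimes>\<^bsub>M\<^esub> r = \<zero>\<^bsub>M\<^esub> \<longleftrightarrow> cv r j = 0" if r: "r \<in> carrier R" for r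
  proof
    assume z: "b \<ltimes>\<^bsub>M\<^esub> r = \<zero>\<^bsub>M\<^esub>"
    show "cv r j = 0"
    proof (rule ccontr)
      assume nz: "cv r j \<noteq> 0"
      have "b = b \<ltimes>\<^bsub>M\<^esub> (sc (cv r j) \<otimes> sc (inverse (cv r j)))"
        using nz bc by (simp add: sc_mult sc_one M.ract_one)
      also have "\<dots> = (b \<ltimes>\<^bsub>M\<^esub> r) \<ltimes>\<^bsub>M\<^esub> sc (inverse (cv r j))" using b[OF r] bc by (simp add: M.ract_mult)
      also have "\<dots> = \<zero>\<^bsub>M\<^esub>" using z by simp
      finally show False using assms(3) by simp
    qed
  next
    assume "cv r j = 0"
    then show "b \<ltimes>\<^bsub>M\<^esub> r = \<zero>\<^bsub>M\<^esub>" using b[OF r] bc by (simp add: sc_zero)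
  qed
  moreover have "b \<in> carrier ?B"
    using M.ract_one[OF bc] by auto (metis R.one_closed)
  ultimately have "cyc_gen ?B j E b" by (auto simp: cyc_gen_def)
  from cyc_gen_iso[OF B this assms(4)]
  show 1: "?B \<in> fg_modules R" "riso R ?B (Sim j)" .
  show "K0_eq R (frag_of ?B) (frag_of (Sim j))"
    by (rule K0_eq_riso[OF 1(1) Cyc_cover(1)[OF assms(4)] 1(2)])
qed

primrec spn :: "('r, 'm, 'c) rmodule_scheme \<Rightarrow> (nat \<Rightarrow> 'm) \<Rightarrow> nat \<Rightarrow> 'm set" where
  "spn M b 0 = {\<zero>\<^bsub>M\<^esub>}"
| "spn M b (Suc s) = {y \<oplus>\<^bsub>M\<^esub> b s \<ltimes>\<^bsub>M\<^esub> r | y r. y \<in> spn M b s \<and> r \<in> carrier R}"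

lemma spn_rsubmodule:
  assumes "right_module R M" "\<And>l. l < s \<Longrightarrow> b l \<in> carrier M"
  shows "rsubmodule R (spn M b s) M"
  using assms(2) right_module.adjoin_rsubmodule(1)[OF assms(1)] right_module.rsubmodule_zero[OF assms(1)]
  by (induction s) (simp_all only: spn.simps less_Suc_eq, blast)

lemma spn_mem:
  assumes "right_module R M" "\<And>l. l < s \<Longrightarrow> b l \<in> carrier M" "l < s"
  shows "b l \<in> spn M b s"
  using assms(2,3)
proof (induction s)
  case (Suc s)
  interpret M: right_module R M by fact
  have N: "rsubmodule R (spn M b s) M" using Suc.prems by (intro spn_rsubmodule assms(1)) auto
  have b: "b s \<in> carrier M" using Suc.prems by simp
  show ?case
  proof (cases "l = s")
    case True
    then show ?thesis using M.adjoin_rsubmodule(3)[OF N b R.one_closed] M.ract_one[OF b] by simp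
  next
    case False
    then have "b l \<in> spn M b s" using Suc by simp
    then show ?thesis using M.adjoin_rsubmodule(2)[OF N b] by (simp only: spn.simps) blast
  qed
qed simp

text \<open>The formal class of a virtual semisimple module with prescribed multiplicities at the
  vertices.\<close>

abbreviation Sx :: "('v \<Rightarrow>\<^sub>0 int) \<Rightarrow> ('r fg_module \<Rightarrow>\<^sub>0 int)" where
  "Sx \<equiv> frag_extend (\<lambda>j. frag_of (Sim j))"

text \<open>Gaussian elimination with socle elements as pivots: if \<open>K\<close> is not inside
  the span of the first \<open>s\<close> elements, some element of \<open>K\<close> outside it spans
  a simple complement of the intersection of \<open>K\<close> with that span. Keeping
  \<open>K\<close> arbitrary in the induction covers kernels, which are not given by
  generators.\<close>

lemma semisimple_K0:
  fixes M :: "'r fg_module"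
  assumes M: "right_module R M"
    and "\<And>l. l < s \<Longrightarrow> b l \<in> soc M (j l) \<and> j l \<in> V" "rsubmodule R K M" "K \<subseteq> spn M b s"
  shows "M\<lparr>carrier := K\<rparr> \<in> fg_modules R \<and> (\<exists>z. Poly_Mapping.keys z \<subseteq> j ` {..<s} \<and>
    K0_eq R (frag_of (M\<lparr>carrier := K\<rparr>)) (Sx z))"
  using assms(2-)
proof (induction s arbitrary: K)
  case 0
  interpret M: right_module R M by fact
  have "K = {\<zero>\<^bsub>M\<^esub>}" using 0 M.rsubmoduleD(2) by fastforce
  then show ?case using zero_submodule_fg[OF M] K0_eq_zero_module[of "M\<lparr>carrier := {\<zero>\<^bsub>M\<^esub>}\<rparr>" R]
    by (auto intro!: exI[of _ 0])
next
  case (Suc s)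
  interpret M: right_module R M by fact
  have bsoc: "b l \<in> soc M (j l)" "j l \<in> V" if "l \<le> s" for l using Suc.prems(1) that by auto
  have bc: "b l \<in> carrier M" if "l \<le> s" for l by (rule socD(1)[OF bsoc(1)[OF that]])
  have BS: "rsubmodule R (spn M b s) M" by (rule spn_rsubmodule[OF M]) (simp add: bc)
  note B = M.rsubmoduleD[OF BS] and K = M.rsubmoduleD[OF Suc.prems(2)]
  have BSoc: "spn M b s \<subseteq> Soc M"
  proof -
    have "spn M b t \<subseteq> Soc M" if "t \<le> s" for t using that
    proof (induction t)
      case 0 then show ?case using M.rsubmoduleD(2)[OF Soc_rsubmodule[OF M]] by simp
    next
      case (Suc t)
      then have "b t \<in> Soc M" using soc_Soc[OF M] bsoc[of t] by auto
      then show ?case using Suc M.rsubmoduleD(3,4)[OF Soc_rsubmodule[OF M]] by auto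
    qed
    then show ?thesis by blast
  qed
  let ?K' = "K \<inter> spn M b s"
  have K': "rsubmodule R ?K' M" by (rule M.rsubmodule_Int[OF Suc.prems(2) BS])
  have IH: "M\<lparr>carrier := ?K'\<rparr> \<in> fg_modules R \<and> (\<exists>z. Poly_Mapping.keys z \<subseteq> j ` {..<s} \<and>
    K0_eq R (frag_of (M\<lparr>carrier := ?K'\<rparr>)) (Sx z))"
    using Suc.IH[OF _ K'] Suc.prems(1) by auto
  show ?case
  proof (cases "K \<subseteq> spn M b s")
    case True
    then have "?K' = K" by blast
    then show ?thesis using IH by (auto simp: lessThan_Suc)
  next
    case False
    then obtain x where x: "x \<in> K" "x \<notin> spn M b s" by blast
    then obtain y r where yr: "y \<in> spn M b s" "r \<in> carrier R" "x = y \<oplus>\<^bsub>M\<^esub> b s \<ltimes>\<^bsub>M\<^esub> r"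
      using Suc.prems(3) by auto
    define c where "c = cv r (j s)"
    have bs: "b s \<ltimes>\<^bsub>M\<^esub> r = b s \<ltimes>\<^bsub>M\<^esub> sc (cv r (j s))" if "r \<in> carrier R" for r
      by (rule socD(2)[OF bsoc(1)[OF order.refl] that])
    have bsn: "b s \<ltimes>\<^bsub>M\<^esub> sc c \<notin> spn M b s"
      using x(2) yr B(3) bs[OF yr(2)] by (auto simp: c_def)
    then have c0: "c \<noteq> 0" using B(2) bc[of s] by (auto simp: sc_zero)
    \<comment> \<open>Projecting to the vertex \<open>j s\<close> stays inside \<open>K\<close> and
      keeps the component along \<open>b s\<close>, and puts the pivot into a single isotypic part,
      so that it generates a simple module.\<close>
    define x' where "x' = x \<ltimes>\<^bsub>M\<^esub> idem (j s)"
    define y' where "y' = y \<ltimes>\<^bsub>M\<^esub> idem (j s)"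
    have yc: "y \<in> carrier M" using yr B(1) by blast
    have y': "y' \<in> spn M b s" "y' \<in> carrier M" using yr B by (auto simp: y'_def)
    have x'eq: "x' = y' \<oplus>\<^bsub>M\<^esub> b s \<ltimes>\<^bsub>M\<^esub> sc c"
    proof -
      have "x' = y' \<oplus>\<^bsub>M\<^esub> (b s \<ltimes>\<^bsub>M\<^esub> r) \<ltimes>\<^bsub>M\<^esub> idem (j s)"
        using yr yc bc[of s] by (simp add: x'_def y'_def M.ract_add_left M.ract_closed)
      also have "(b s \<ltimes>\<^bsub>M\<^esub> r) \<ltimes>\<^bsub>M\<^esub> idem (j s) = b s \<ltimes>\<^bsub>M\<^esub> sc c"
        using bs[of "r \<otimes> idem (j s)"] yr(2) bc[of s] bsoc(2)[of s] by (simp add: M.ract_mult[symmetric] c_def)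
      finally show ?thesis .
    qed
    have xSoc: "x \<in> Soc M"
    proof -
      have "b s \<in> Soc M" using soc_Soc[OF M] bsoc[of s] by auto
      then show ?thesis using yr BSoc M.rsubmoduleD(3,4)[OF Soc_rsubmodule[OF M]] by auto
    qed
    have x'soc: "x' \<in> soc M (j s)" unfolding x'_def by (rule Soc_soc[OF M _ xSoc]) (simp add: bsoc)
    have x'c: "x' \<in> carrier M" by (rule socD(1)[OF x'soc])
    have x'K: "x' \<in> K" using x K(4) by (simp add: x'_def)
    have x'n: "x' \<notin> spn M b s"
    proof
      assume "x' \<in> spn M b s"
      then have "x' \<ominus>\<^bsub>M\<^esub> y' \<in> spn M b s" using y' B(6) by blast
      moreover have "x' \<ominus>\<^bsub>M\<^esub> y' = b s \<ltimes>\<^bsub>M\<^esub> sc c"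
        using y'(2) bc[of s] M.ract_closed[of "b s" "sc c"]
        unfolding x'eq a_minus_def by (simp add: M.M.a_ac M.M.r_neg1 M.M.r_neg2)
      ultimately show False using bsn by simp
    qed
    let ?X = "{x' \<ltimes>\<^bsub>M\<^esub> r | r. r \<in> carrier R}"
    have X: "rsubmodule R ?X M" by (rule M.rsubmodule_cyclic[OF x'c])
    have x'r: "x' \<ltimes>\<^bsub>M\<^esub> r = x' \<ltimes>\<^bsub>M\<^esub> sc (cv r (j s))" if "r \<in> carrier R" for r
      by (rule socD(2)[OF x'soc that])
    have int: "?K' \<inter> ?X \<subseteq> {\<zero>\<^bsub>M\<^esub>}"
    proof
      fix u assume "u \<in> ?K' \<inter> ?X"
      then obtain r where r: "r \<in> carrier R" "u = x' \<ltimes>\<^bsub>M\<^esub> r" "u \<in> spn M b s" by blast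
      have "cv r (j s) = 0"
      proof (rule ccontr)
        assume nz: "cv r (j s) \<noteq> 0"
        have "x' = x' \<ltimes>\<^bsub>M\<^esub> (sc (cv r (j s)) \<otimes> sc (inverse (cv r (j s))))"
          using nz x'c by (simp add: sc_mult sc_one M.ract_one)
        also have "\<dots> = u \<ltimes>\<^bsub>M\<^esub> sc (inverse (cv r (j s)))"
          using x'r[OF r(1)] r(2) x'c by (simp add: M.ract_mult)
        finally show False using x'n B(4)[OF r(3), of "sc (inverse (cv r (j s)))"] by simp
      qed
      then show "u \<in> {\<zero>\<^bsub>M\<^esub>}" using x'r[OF r(1)] r(2) x'c by (simp add: sc_zero)
    qed
    have Keq: "K = {u \<oplus>\<^bsub>M\<^esub> w | u w. u \<in> ?K' \<and> w \<in> ?X}"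
    proof
      show "{u \<oplus>\<^bsub>M\<^esub> w | u w. u \<in> ?K' \<and> w \<in> ?X} \<subseteq> K" using K(3,4) x'K by blast
      show "K \<subseteq> {u \<oplus>\<^bsub>M\<^esub> w | u w. u \<in> ?K' \<and> w \<in> ?X}"
      proof
        fix u assume u: "u \<in> K"
        then obtain z q where zq: "z \<in> spn M b s" "q \<in> carrier R" "u = z \<oplus>\<^bsub>M\<^esub> b s \<ltimes>\<^bsub>M\<^esub> q"
          using Suc.prems(3) by auto
        \<comment> \<open>The multiple of the pivot \<open>x'\<close> that has the same component
          along \<open>b s\<close> as \<open>u\<close>.\<close>
        define d where "d = cv q (j s) * inverse c"
        have zc: "z \<in> carrier M" using zq B(1) by blast
        have e: "x' \<ltimes>\<^bsub>M\<^esub> sc d = y' \<ltimes>\<^bsub>M\<^esub> sc d \<oplus>\<^bsub>M\<^esub> b s \<ltimes>\<^bsub>M\<^esub> q"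
        proof -
          have "x' \<ltimes>\<^bsub>M\<^esub> sc d = y' \<ltimes>\<^bsub>M\<^esub> sc d \<oplus>\<^bsub>M\<^esub> b s \<ltimes>\<^bsub>M\<^esub> (sc c \<otimes> sc d)"
            unfolding x'eq using y'(2) bc[of s] by (simp add: M.ract_add_left M.ract_mult M.ract_closed)
          moreover have "c * d = cv q (j s)" using c0 by (simp add: d_def)
          ultimately show ?thesis using bs[OF zq(2)] by (simp add: sc_mult)
        qed
        define u' where "u' = z \<ominus>\<^bsub>M\<^esub> y' \<ltimes>\<^bsub>M\<^esub> sc d"
        have y'd: "y' \<ltimes>\<^bsub>M\<^esub> sc d \<in> spn M b s" "y' \<ltimes>\<^bsub>M\<^esub> sc d \<in> carrier M"
          using y' B(4) M.ract_closed by auto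
        have u'B: "u' \<in> spn M b s" unfolding u'_def using zq(1) y'd(1) B(6) by blast
        then have u'c: "u' \<in> carrier M" using B(1) by blast
        have sum: "u = u' \<oplus>\<^bsub>M\<^esub> x' \<ltimes>\<^bsub>M\<^esub> sc d"
        proof -
          have "u' \<oplus>\<^bsub>M\<^esub> x' \<ltimes>\<^bsub>M\<^esub> sc d = (u' \<oplus>\<^bsub>M\<^esub> y' \<ltimes>\<^bsub>M\<^esub> sc d) \<oplus>\<^bsub>M\<^esub> b s \<ltimes>\<^bsub>M\<^esub> q"
            unfolding e using u'c y'd(2) M.ract_closed[OF bc[of s] zq(2)] by (simp add: M.M.a_assoc)
          also have "u' \<oplus>\<^bsub>M\<^esub> y' \<ltimes>\<^bsub>M\<^esub> sc d = z"
            unfolding u'_def a_minus_def using zc y'd(2) by (simp add: M.M.a_assoc M.M.l_neg)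
          finally show ?thesis using zq(3) by simp
        qed
        have xdK: "x' \<ltimes>\<^bsub>M\<^esub> sc d \<in> K" using K(4)[OF x'K] by simp
        have "u' = u \<ominus>\<^bsub>M\<^esub> x' \<ltimes>\<^bsub>M\<^esub> sc d"
          unfolding sum a_minus_def using u'c xdK K(1) by (simp add: M.M.a_assoc M.M.r_neg subset_iff)
        then have "u' \<in> ?K'" using u'B K(6)[OF u xdK] by simp
        moreover have "x' \<ltimes>\<^bsub>M\<^esub> sc d \<in> ?X" using gen_closed(3) by blast
        ultimately show "u \<in> {u \<oplus>\<^bsub>M\<^esub> w | u w. u \<in> ?K' \<and> w \<in> ?X}" using sum by blast
      qed
    qed
    have x'0: "x' \<noteq> \<zero>\<^bsub>M\<^esub>" using x'n B(2) by blast
    have js: "j s \<in> V" by (simp add: bsoc)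
    note cyc = soc_cyclic[OF M x'soc x'0 js]
    note S = internal_sum_fg[OF M K' X Suc.prems(2) int Keq conjunct1[OF IH] cyc(1)]
    obtain z where z: "Poly_Mapping.keys z \<subseteq> j ` {..<s}" "K0_eq R (frag_of (M\<lparr>carrier := ?K'\<rparr>)) (Sx z)"
      using IH by blast
    have "K0_eq R (frag_of (M\<lparr>carrier := K\<rparr>)) (Sx (z + frag_of (j s)))"
      using K0_eq_trans[OF S(2) K0_eq_add[OF z(2) cyc(3)]] by (simp add: frag_extend_add)
    moreover have "Poly_Mapping.keys (z + frag_of (j s)) \<subseteq> j ` {..<Suc s}"
      using z(1) keys_add[of z "frag_of (j s)"] by (auto simp: keys_frag_of lessThan_Suc)
    ultimately show ?thesis using S(1) by blast
  qed
qed

end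

lemma keys_frag_extend_subset:
  assumes "\<And>x. x \<in> Poly_Mapping.keys c \<Longrightarrow> Poly_Mapping.keys (f x) \<subseteq> S"
  shows "Poly_Mapping.keys (frag_extend f c) \<subseteq> S"
  using keys_frag_extend[of f c] assms by blast

context rad_square_zero
begin

section \<open>Syzygies\<close>

lemma rad_ract:
  assumes "right_module R M" "rsubmodule R N M" "u \<in> carrier M" "\<And>e. e \<in> E \<Longrightarrow> u \<ltimes>\<^bsub>M\<^esub> arr e \<in> N"
    and r: "r \<in> carrier R" "\<And>v. v \<in> V \<Longrightarrow> cv r v = 0"
  shows "u \<ltimes>\<^bsub>M\<^esub> r \<in> N"
proof -
  interpret M: right_module R M by fact
  note N = M.rsubmoduleD[OF assms(2)]
  have "u \<ltimes>\<^bsub>M\<^esub> mk (\<lambda>_. 0) (\<lambda>e. if e \<in> W then ca r e else 0) \<in> N" if "finite W" "W \<subseteq> E" for W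
    using that
  proof (induction W rule: finite_induct)
    case empty
    have "mk (\<lambda>_. 0) (\<lambda>e. if e \<in> {} then ca r e else 0) = \<zero>" by (rule coords_ext) auto
    then show ?case using N assms(3) by simp
  next
    case (insert w W)
    have "mk (\<lambda>_. 0) (\<lambda>e. if e \<in> insert w W then ca r e else 0)
        = mk (\<lambda>_. 0) (\<lambda>e. if e \<in> W then ca r e else 0) \<oplus> arr w \<otimes> sc (ca r w)"
      by (rule coords_ext) (use insert in auto)
    moreover have "u \<ltimes>\<^bsub>M\<^esub> (arr w \<otimes> sc (ca r w)) \<in> N"
      using N(4)[OF assms(4)[of w], of "sc (ca r w)"] insert assms(3) by (simp add: M.ract_mult)
    ultimately show ?case using insert N(3) assms(3) by (simp add: M.ract_add_right)
  qed
  from this[OF finite_E] have "u \<ltimes>\<^bsub>M\<^esub> mk (\<lambda>_. 0) (\<lambda>e. if e \<in> E then ca r e else 0) \<in> N" by simp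
  moreover have "mk (\<lambda>_. 0) (\<lambda>e. if e \<in> E then ca r e else 0) = r"
    by (rule coords_ext) (use r in auto)
  ultimately show ?thesis by simp
qed

text \<open>The kernel lies in the radical, which is spanned by generators times arrows, and such a
  product belongs to the socle at the target of the arrow. Recording that only targets occur matters
  later: it makes source vertices invisible in syzygies.\<close>

lemma kernel_semisimple:
  assumes "right_module R M" "std_cover M t i m"
  shows "(Proj t i)\<lparr>carrier := a_kernel (Proj t i) M (pmap M t m)\<rparr> \<in> fg_modules R \<and>
    (\<exists>z. Poly_Mapping.keys z \<subseteq> tgt ` E \<and>
      K0_eq R (frag_of ((Proj t i)\<lparr>carrier := a_kernel (Proj t i) M (pmap M t m)\<rparr>)) (Sx z))"
proof -
  have G: "gen_family M t i m" using assms(2) by (simp add: std_cover_def)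
  let ?K = "a_kernel (Proj t i) M (pmap M t m)"
  note K = a_kernel_rsubmodule[OF right_module_Proj assms(1) repiD(1)[OF gen_family_repi[OF assms(1) G]]]
  have "finite ({..<t} \<times> E)" using finite_E by simp
  then obtain xs where xs: "set xs = {..<t} \<times> E" using finite_list by blast
  define b where "b l = unitv i (fst (xs ! l)) \<ltimes>\<^bsub>Proj t i\<^esub> arr (snd (xs ! l))" for l
  define j where "j l = tgt (snd (xs ! l))" for l
  have nth: "fst (xs ! l) < t" "snd (xs ! l) \<in> E" if "l < length xs" for l
  proof -
    have "xs ! l \<in> {..<t} \<times> E" using nth_mem[OF that] unfolding xs .
    then show "fst (xs ! l) < t" "snd (xs ! l) \<in> E" by (simp_all add: mem_Times_iff)
  qed
  have arr_r: "arr e \<otimes> r = arr e \<otimes> sc (cv r (tgt e))" if "e \<in> E" "r \<in> carrier R" for e r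
    by (rule coords_ext) (use that in auto)
  have bc: "b l \<in> carrier (Proj t i)" if "l < length xs" for l
    unfolding b_def using unitv_closed[OF nth(1)[OF that]] Pj.ract_closed gen_closed by blast
  have bsoc: "b l \<in> soc (Proj t i) (j l) \<and> j l \<in> V" if l: "l < length xs" for l
  proof
    have "b l \<ltimes>\<^bsub>Proj t i\<^esub> r = b l \<ltimes>\<^bsub>Proj t i\<^esub> sc (cv r (j l))" if r: "r \<in> carrier R" for r
      unfolding b_def j_def Pj.ract_mult[OF unitv_closed[OF nth(1)[OF l]] gen_closed(2) r, symmetric]
        Pj.ract_mult[OF unitv_closed[OF nth(1)[OF l]] gen_closed(2) gen_closed(3), symmetric]
      using arr_r[OF nth(2)[OF l] r] by (rule arg_cong)
    then show "b l \<in> soc (Proj t i) (j l)" using bc[OF l] unfolding soc_def by blast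
    show "j l \<in> V" unfolding j_def using nth[OF l] by simp
  qed
  have span: "?K \<subseteq> spn (Proj t i) b (length xs)"
  proof
    fix x assume x: "x \<in> ?K"
    then have xc: "x \<in> carrier (Proj t i)" by (simp add: a_kernel_eq)
    note S = spn_rsubmodule[OF right_module_Proj bc]
    show "x \<in> spn (Proj t i) b (length xs)"
    proof (subst Proj_expand[OF xc], rule Pj.lsum_rsubmodule[OF S])
      fix k assume k: "k < t"
      show "unitv i k \<ltimes>\<^bsub>Proj t i\<^esub> x k \<in> spn (Proj t i) b (length xs)"
      proof (rule rad_ract[OF right_module_Proj S unitv_closed[OF k]])
        fix e assume "e \<in> E"
        then have "(k, e) \<in> set xs" using xs k by simp
        then obtain l where l: "l < length xs" "xs ! l = (k, e)" by (auto simp: in_set_conv_nth)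
        have "b l \<in> spn (Proj t i) b (length xs)" by (rule spn_mem[OF right_module_Proj bc l(1)])
        then show "unitv i k \<ltimes>\<^bsub>Proj t i\<^esub> arr e \<in> spn (Proj t i) b (length xs)"
          unfolding b_def[of l] l(2) by simp
      next
        show "x k \<in> carrier R" using xc by (simp add: Proj_carrier)
        show "cv (x k) v = 0" if "v \<in> V" for v
          using assms(2) x k that unfolding std_cover_def a_kernel_eq by blast
      qed
    qed
  qed
  have "j ` {..<length xs} \<subseteq> tgt ` E" using nth(2) by (auto simp: j_def)
  then show ?thesis using semisimple_K0[OF right_module_Proj bsoc K span] by (meson order_trans)
qed

lemma syzygy_std:
  assumes M: "M \<in> fg_modules R" and S: "std_cover M t i m"
  shows "syzygy R M \<in> fg_modules R"
    "K0_eq R (frag_of (syzygy R M)) (frag_of ((Proj t i)\<lparr>carrier := a_kernel (Proj t i) M (pmap M t m)\<rparr>))"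
proof -
  note M' = fg_modulesD(1)[OF M]
  note s = syzygy_iso[OF std_cover_projective_cover[OF M S] M]
  note k = conjunct1[OF kernel_semisimple[OF M' S]]
  show 1: "syzygy R M \<in> fg_modules R" by (rule fg_modules_iso[OF k s(1) riso_sym[OF s]])
  show "K0_eq R (frag_of (syzygy R M)) (frag_of ((Proj t i)\<lparr>carrier := a_kernel (Proj t i) M (pmap M t m)\<rparr>))"
    by (rule K0_eq_riso[OF 1 k s(2)])
qed

lemma std_cover_fg:
  assumes "M \<in> fg_modules R"
  obtains t i m where "std_cover M t i m" "\<And>s i' m'. gen_family M s i' m' \<Longrightarrow> t \<le> s"
  using std_cover_exists[OF fg_modulesD[OF assms]] by metis

lemma syzygy_fg:
  assumes "M \<in> fg_modules R" shows "syzygy R M \<in> fg_modules R"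
proof -
  obtain t i m where S: "std_cover M t i m" using std_cover_fg[OF assms] by metis
  show ?thesis by (rule syzygy_std(1)[OF assms S])
qed

lemma syzygy_semisimple:
  assumes "M \<in> fg_modules R"
  shows "\<exists>z. Poly_Mapping.keys z \<subseteq> tgt ` E \<and> K0_eq R (frag_of (syzygy R M)) (Sx z)"
proof -
  obtain t i m where S: "std_cover M t i m" using std_cover_fg[OF assms] by metis
  show ?thesis
    using kernel_semisimple[OF fg_modulesD(1)[OF assms] S] syzygy_std(2)[OF assms S] K0_eq_trans by blast
qed

lemma syzygy_projective:
  assumes P: "projective R P"
  shows "K0_eq R (frag_of (syzygy R P)) 0"
proof -
  have fg: "P \<in> fg_modules R" using P by (simp add: projective_def)
  interpret P: right_module R P using fg_modulesD(1)[OF fg] .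
  have k: "a_kernel P P id = {\<zero>\<^bsub>P\<^esub>}" by (auto simp: a_kernel_eq)
  have Z: "P\<lparr>carrier := {\<zero>\<^bsub>P\<^esub>}\<rparr> \<in> fg_modules R" by (rule zero_submodule_fg[OF P.right_module_axioms])
  have "riso R (syzygy R P) (P\<lparr>carrier := {\<zero>\<^bsub>P\<^esub>}\<rparr>)"
    using syzygy_iso(2)[OF projective_cover_id[OF P] fg] unfolding k .
  then have "K0_eq R (frag_of (syzygy R P)) (frag_of (P\<lparr>carrier := {\<zero>\<^bsub>P\<^esub>}\<rparr>))"
    by (rule K0_eq_riso[OF syzygy_fg[OF fg] Z])
  also have "K0_eq R (frag_of (P\<lparr>carrier := {\<zero>\<^bsub>P\<^esub>}\<rparr>)) 0" by (rule K0_eq_zero_module[OF Z]) simp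
  finally show ?thesis .
qed

text \<open>Two standard covers placed side by side form a standard cover of the sum, because the
  radical condition is checked coordinate by coordinate. Its kernel is the sum of the two
  kernels.\<close>

lemma syzygy_rsum:
  assumes M: "M \<in> fg_modules R" and M1: "M1 \<in> fg_modules R" and M2: "M2 \<in> fg_modules R"
    and iso: "riso R M (rsum M1 M2)"
  shows "K0_eq R (frag_of (syzygy R M)) (frag_of (syzygy R M1) + frag_of (syzygy R M2))"
proof -
  note mM = fg_modulesD(1)[OF M] and mM1 = fg_modulesD(1)[OF M1] and mM2 = fg_modulesD(1)[OF M2]
  interpret M: right_module R M by (rule mM)
  interpret M1: right_module R M1 by (rule mM1)
  interpret M2: right_module R M2 by (rule mM2)
  note S = right_module_rsum[OF mM1 mM2]
  obtain g where g: "g \<in> rhom R (rsum M1 M2) M" "bij_betw g (carrier (rsum M1 M2)) (carrier M)"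
    using riso_sym[OF mM iso] by (auto simp: riso_def)
  note gh = rhomD[OF g(1)]
  obtain t1 i1 m1 where c1: "std_cover M1 t1 i1 m1" using std_cover_fg[OF M1] by metis
  obtain t2 i2 m2 where c2: "std_cover M2 t2 i2 m2" using std_cover_fg[OF M2] by metis
  have G1: "gen_family M1 t1 i1 m1" and G2: "gen_family M2 t2 i2 m2" using c1 c2 by (auto simp: std_cover_def)
  note D1 = gen_familyD[OF G1] and D2 = gen_familyD[OF G2]
  define t i m where "t = t1 + t2" and "i = (\<lambda>k. if k < t1 then i1 k else i2 (k - t1))"
    and "m = (\<lambda>k. if k < t1 then g (m1 k, \<zero>\<^bsub>M2\<^esub>) else g (\<zero>\<^bsub>M1\<^esub>, m2 (k - t1)))"
  define res where "res x = (\<lambda>k. if k < t1 then x k else \<zero>)" for x :: "nat \<Rightarrow> 'r"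
  define shf where "shf x = (\<lambda>k. x (t1 + k))" for x :: "nat \<Rightarrow> 'r"
  \<comment> \<open>\<open>res\<close> and \<open>shf\<close> cut a coordinate vector at
    \<open>t1\<close>; \<open>comb\<close> glues the two halves again.\<close>
  define comb where "comb y z = (\<lambda>k. if k < t1 then y k else z (k - t1))" for y z :: "nat \<Rightarrow> 'r"
  have rs: "res x \<in> carrier (Proj t1 i1)" "shf x \<in> carrier (Proj t2 i2)" "comb (res x) (shf x) = x"
    if "x \<in> carrier (Proj t i)" for x
    using that by (auto simp: Proj_carrier t_def i_def res_def shf_def comb_def fun_eq_iff split: if_splits)
      (metis add_diff_cancel_left' add_less_cancel_left not_add_less1)+
  have cb: "comb y z \<in> carrier (Proj t i)" "res (comb y z) = y" "shf (comb y z) = z"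
    if "y \<in> carrier (Proj t1 i1)" "z \<in> carrier (Proj t2 i2)" for y z
    using that by (auto simp: Proj_carrier t_def i_def res_def shf_def comb_def fun_eq_iff)
  have g1: "(\<lambda>a. g (a, \<zero>\<^bsub>M2\<^esub>)) \<in> rhom R M1 M"
    using gh by (intro rhomI) (auto simp flip: gh(2,3))
  have g2: "(\<lambda>b. g (\<zero>\<^bsub>M1\<^esub>, b)) \<in> rhom R M2 M"
    using gh by (intro rhomI) (auto simp flip: gh(2,3))
  have fam: "i k \<in> V \<and> m k \<in> carrier M \<and> m k \<ltimes>\<^bsub>M\<^esub> idem (i k) = m k" if k: "k < t" for k
  proof (cases "k < t1")
    case True
    then show ?thesis using D1[OF True] rhomD(1)[OF g1] rhomD(3)[OF g1, of "m1 k" "idem (i1 k)"] by (simp add: i_def m_def)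
  next
    case False
    then have "k - t1 < t2" using k by (simp add: t_def)
    from D2[OF this] show ?thesis
      using False rhomD(1)[OF g2] rhomD(3)[OF g2, of "m2 (k - t1)" "idem (i2 (k - t1))"] by (simp add: i_def m_def)
  qed
  have p: "pmap M t m x = g (pmap M1 t1 m1 (res x), pmap M2 t2 m2 (shf x))" if x: "x \<in> carrier (Proj t i)" for x
  proof -
    have xc: "x k \<in> carrier R" for k using x by (simp add: Proj_carrier)
    have "pmap M t m x = lsum M (\<lambda>k. m k \<ltimes>\<^bsub>M\<^esub> x k) t1 \<oplus>\<^bsub>M\<^esub> lsum M (\<lambda>k. m (t1 + k) \<ltimes>\<^bsub>M\<^esub> x (t1 + k)) t2"
      unfolding pmap_def t_def using fam xc by (intro M.M.lsum_append) (auto simp: t_def M.ract_closed)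
    also have "lsum M (\<lambda>k. m k \<ltimes>\<^bsub>M\<^esub> x k) t1 = lsum M (\<lambda>k. g (m1 k \<ltimes>\<^bsub>M1\<^esub> res x k, \<zero>\<^bsub>M2\<^esub>)) t1"
      using D1 xc rhomD(3)[OF g1] by (intro M.M.lsum_cong) (auto simp: m_def res_def)
    also have "\<dots> = g (pmap M1 t1 m1 (res x), \<zero>\<^bsub>M2\<^esub>)"
      unfolding pmap_def using D1 xc by (intro rhom_lsum[OF mM1 mM g1, symmetric]) (auto simp: res_def M1.ract_closed)
    also have "lsum M (\<lambda>k. m (t1 + k) \<ltimes>\<^bsub>M\<^esub> x (t1 + k)) t2 = lsum M (\<lambda>k. g (\<zero>\<^bsub>M1\<^esub>, m2 k \<ltimes>\<^bsub>M2\<^esub> shf x k)) t2"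
      using D2 xc rhomD(3)[OF g2] by (intro M.M.lsum_cong) (auto simp: m_def shf_def)
    also have "\<dots> = g (\<zero>\<^bsub>M1\<^esub>, pmap M2 t2 m2 (shf x))"
      unfolding pmap_def using D2 xc by (intro rhom_lsum[OF mM2 mM g2, symmetric]) (auto simp: shf_def M2.ract_closed)
    finally show ?thesis
      using rhomD(1)[OF pmap_rhom[OF mM1 D1(2)] rs(1)[OF x]] rhomD(1)[OF pmap_rhom[OF mM2 D2(2)] rs(2)[OF x]]
        gh(2)[of "(pmap M1 t1 m1 (res x), \<zero>\<^bsub>M2\<^esub>)" "(\<zero>\<^bsub>M1\<^esub>, pmap M2 t2 m2 (shf x))"]
      by simp
  qed
  have cl: "pmap M1 t1 m1 y \<in> carrier M1" if "y \<in> carrier (Proj t1 i1)" for y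
    using rhomD(1)[OF pmap_rhom[OF mM1 D1(2)] that] .
  have cl2: "pmap M2 t2 m2 y \<in> carrier M2" if "y \<in> carrier (Proj t2 i2)" for y
    using rhomD(1)[OF pmap_rhom[OF mM2 D2(2)] that] .
  have p0: "pmap M t m x = \<zero>\<^bsub>M\<^esub> \<longleftrightarrow> pmap M1 t1 m1 (res x) = \<zero>\<^bsub>M1\<^esub> \<and> pmap M2 t2 m2 (shf x) = \<zero>\<^bsub>M2\<^esub>"
    if x: "x \<in> carrier (Proj t i)" for x
  proof -
    have "g (a, b) = \<zero>\<^bsub>M\<^esub> \<longleftrightarrow> a = \<zero>\<^bsub>M1\<^esub> \<and> b = \<zero>\<^bsub>M2\<^esub>" if "a \<in> carrier M1" "b \<in> carrier M2" for a b
      using rhom_inj_iff[OF S mM g(1)] rhom_zero[OF S mM g(1)] g(2) that by (auto simp: bij_betw_def)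
    then show ?thesis using p[OF x] cl[OF rs(1)[OF x]] cl2[OF rs(2)[OF x]] by simp
  qed
  have surj: "pmap M t m ` carrier (Proj t i) = carrier M"
  proof
    have "pmap M t m \<in> rhom R (Proj t i) M" using fam by (intro pmap_rhom mM) blast
    then show "pmap M t m ` carrier (Proj t i) \<subseteq> carrier M" by (auto simp: rhom_def)
    show "carrier M \<subseteq> pmap M t m ` carrier (Proj t i)"
    proof
      fix w assume "w \<in> carrier M"
      then have "w \<in> g ` (carrier M1 \<times> carrier M2)" using g(2) by (simp add: bij_betw_def)
      then obtain a b where ab: "a \<in> carrier M1" "b \<in> carrier M2" "w = g (a, b)" by blast
      obtain y where y: "y \<in> carrier (Proj t1 i1)" "a = pmap M1 t1 m1 y"
        using ab(1) G1 unfolding gen_family_def by blast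
      obtain z where z: "z \<in> carrier (Proj t2 i2)" "b = pmap M2 t2 m2 z"
        using ab(2) G2 unfolding gen_family_def by blast
      have "pmap M t m (comb y z) = w"
        using p[OF cb(1)[OF y(1) z(1)]] cb(2,3)[OF y(1) z(1)] y z ab by simp
      then show "w \<in> pmap M t m ` carrier (Proj t i)" using cb(1)[OF y(1) z(1)] by blast
    qed
  qed
  have c: "std_cover M t i m" unfolding std_cover_def
  proof (intro conjI ballI impI allI)
    show "gen_family M t i m" using fam surj by (simp add: gen_family_def)
    fix x k v assume x: "x \<in> carrier (Proj t i)" "pmap M t m x = \<zero>\<^bsub>M\<^esub>" "k < t" "v \<in> V"
    have z: "pmap M1 t1 m1 (res x) = \<zero>\<^bsub>M1\<^esub>" "pmap M2 t2 m2 (shf x) = \<zero>\<^bsub>M2\<^esub>" using p0[OF x(1)] x(2) by auto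
    show "cv (x k) v = 0"
    proof (cases "k < t1")
      case True
      then have "cv (res x k) v = 0" using c1 rs(1)[OF x(1)] z(1) x(4) unfolding std_cover_def by blast
      then show ?thesis using True by (simp add: res_def)
    next
      case False
      then have "k - t1 < t2" using x(3) by (simp add: t_def)
      then have "cv (shf x (k - t1)) v = 0" using c2 rs(2)[OF x(1)] z(2) x(4) unfolding std_cover_def by blast
      then show ?thesis using False by (simp add: shf_def)
    qed
  qed
  let ?K = "(Proj t i)\<lparr>carrier := a_kernel (Proj t i) M (pmap M t m)\<rparr>"
  let ?K1 = "(Proj t1 i1)\<lparr>carrier := a_kernel (Proj t1 i1) M1 (pmap M1 t1 m1)\<rparr>"
  let ?K2 = "(Proj t2 i2)\<lparr>carrier := a_kernel (Proj t2 i2) M2 (pmap M2 t2 m2)\<rparr>"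
  have "(\<lambda>x. (res x, shf x)) \<in> rhom R ?K (rsum ?K1 ?K2)"
    using rs(1,2) p0 by (intro rhomI) (auto simp: a_kernel_eq res_def shf_def fun_eq_iff)
  moreover have "bij_betw (\<lambda>x. (res x, shf x)) (carrier ?K) (carrier (rsum ?K1 ?K2))"
  proof (rule bij_betw_byWitness[of _ "\<lambda>(y, z). comb y z"])
    show "\<forall>x\<in>carrier ?K. (\<lambda>(y, z). comb y z) (res x, shf x) = x" using rs(3) by (auto simp: a_kernel_eq)
    show "\<forall>w\<in>carrier (rsum ?K1 ?K2). (\<lambda>x. (res x, shf x)) ((\<lambda>(y, z). comb y z) w) = w"
      using cb by (auto simp: a_kernel_eq)
    show "(\<lambda>x. (res x, shf x)) ` carrier ?K \<subseteq> carrier (rsum ?K1 ?K2)"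
      using rs(1,2) p0 by (auto simp: a_kernel_eq)
    show "(\<lambda>(y, z). comb y z) ` carrier (rsum ?K1 ?K2) \<subseteq> carrier ?K"
      using cb p0 by (auto simp: a_kernel_eq)
  qed
  ultimately have "riso R ?K (rsum ?K1 ?K2)" by (auto simp: riso_def)
  then have "K0_eq R (frag_of ?K) (frag_of ?K1 + frag_of ?K2)"
    using kernel_semisimple[OF mM c] kernel_semisimple[OF mM1 c1] kernel_semisimple[OF mM2 c2]
    by (intro K0_eq_rsum) auto
  with syzygy_std(2)[OF M c] have "K0_eq R (frag_of (syzygy R M)) (frag_of ?K1 + frag_of ?K2)"
    by (rule K0_eq_trans)
  then show ?thesis
    using K0_eq_trans K0_eq_sym K0_eq_add[OF syzygy_std(2)[OF M1 c1] syzygy_std(2)[OF M2 c2]] by blast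
qed

abbreviation Om :: "('r fg_module \<Rightarrow>\<^sub>0 int) \<Rightarrow> ('r fg_module \<Rightarrow>\<^sub>0 int)" where
  "Om \<equiv> frag_extend (\<lambda>M. frag_of (syzygy R M))"

lemma Om_K0_rel: "x \<in> K0_rel R \<Longrightarrow> Om x \<in> K0_rel R"
proof (rule K0_rel_hom[where f = Om])
  show "Om (x + y) = Om x + Om y" for x y by (rule frag_extend_add)
  fix M M' M'' assume "M \<in> fg_modules R" "M' \<in> fg_modules R" "M'' \<in> fg_modules R" "riso R M (rsum M' M'')"
  from syzygy_rsum[OF this] show "Om (frag_of M) - Om (frag_of M') - Om (frag_of M'') \<in> K0_rel R"
    by (simp add: K0_eq_def diff_diff_add)
next
  fix P assume "projective R P"
  from syzygy_projective[OF this] show "Om (frag_of P) \<in> K0_rel R" by (simp add: K0_eq_def)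
qed (auto simp: K0_rel_zero K0_rel_add K0_rel_minus)

lemma Om_K0_eq: "K0_eq R x y \<Longrightarrow> K0_eq R (Om x) (Om y)"
  unfolding K0_eq_def frag_extend_diff[symmetric] by (rule Om_K0_rel)

lemma Om_carrier: "Poly_Mapping.keys c \<subseteq> fg_modules R \<Longrightarrow> Poly_Mapping.keys (Om c) \<subseteq> fg_modules R"
  by (rule keys_frag_extend_subset) (auto simp: keys_frag_of intro: syzygy_fg)

lemma Om_semisimple:
  assumes "Poly_Mapping.keys c \<subseteq> fg_modules R"
  shows "\<exists>z. Poly_Mapping.keys z \<subseteq> tgt ` E \<and> K0_eq R (Om c) (Sx z)"
  using assms
proof (induction c rule: frag_induction)
  case zero
  then show ?case by (intro exI[of _ 0]) simp
next
  case (one M)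
  then show ?case using syzygy_semisimple by simp
next
  case (diff a b)
  then obtain y z where "Poly_Mapping.keys y \<subseteq> tgt ` E" "K0_eq R (Om a) (Sx y)"
    "Poly_Mapping.keys z \<subseteq> tgt ` E" "K0_eq R (Om b) (Sx z)" by blast
  then show ?case using keys_diff[of y z]
    by (intro exI[of _ "y - z"]) (auto simp: frag_extend_diff intro: K0_eq_diff)
qed

text \<open>Each further arrow of \<open>D\<close> adds an independent copy of the simple module at
  its target.\<close>

lemma cyc_ker_K0:
  assumes i: "i \<in> V" and D: "D \<subseteq> {e \<in> E. src e = i}"
  shows "(Proj 1 (\<lambda>_. i))\<lparr>carrier := cyc_ker i D\<rparr> \<in> fg_modules R \<and>
    K0_eq R (frag_of ((Proj 1 (\<lambda>_. i))\<lparr>carrier := cyc_ker i D\<rparr>)) (\<Sum>e\<in>D. frag_of (Sim (tgt e)))"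
proof -
  let ?P = "Proj 1 (\<lambda>_. i)"
  have "finite D" using D finite_E finite_subset by fastforce
  then show ?thesis using D
  proof (induction D rule: finite_induct)
    case empty
    have "cyc_ker i {} = {\<zero>\<^bsub>?P\<^esub>}"
    proof (intro equalityI subsetI)
      fix x assume x: "x \<in> cyc_ker i {}"
      then have xc: "x \<in> carrier ?P" by (simp add: cyc_ker_def)
      have "x 0 = \<zero>"
        by (rule coords_ext) (use x xc Proj_cv[OF xc, of 0] i in \<open>auto simp: cyc_ker_def Proj_carrier\<close>)
      then have "x = \<zero>\<^bsub>?P\<^esub>" using Proj1_emb(1)[OF xc] by (auto simp: emb_def fun_eq_iff)
      then show "x \<in> {\<zero>\<^bsub>?P\<^esub>}" by simp
    qed (use Pj.rsubmoduleD(2)[OF cyc_ker_rsubmodule[OF i]] in auto)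
    then show ?case
      using zero_submodule_fg[OF right_module_Proj] K0_eq_zero_module[of "?P\<lparr>carrier := {\<zero>\<^bsub>?P\<^esub>}\<rparr>" R] by simp
  next
    case (insert e D)
    have e: "e \<in> E" "src e = i" and eV: "tgt e \<in> V" using insert.prems by auto
    let ?b = "emb i (arr e)"
    have ea: "idem i \<otimes> arr e = arr e" using e by (simp add: idem_mult_iff)
    have bc: "?b \<in> carrier ?P" by (rule emb_closed) simp
    have br: "?b \<ltimes>\<^bsub>?P\<^esub> r = emb i (arr e \<otimes> r)" if "r \<in> carrier R" for r
      using that by (auto simp: emb_def R.m_assoc)
    have arr_r: "arr e \<otimes> r = arr e \<otimes> sc (cv r (tgt e))" if "r \<in> carrier R" for r
      by (rule coords_ext) (use that e in auto)
    have "?b \<ltimes>\<^bsub>?P\<^esub> r = ?b \<ltimes>\<^bsub>?P\<^esub> sc (cv r (tgt e))" if "r \<in> carrier R" for r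
      unfolding br[OF that] br[OF gen_closed(3)] using arr_r[OF that] by (rule arg_cong)
    then have bsoc: "?b \<in> soc ?P (tgt e)" using bc unfolding soc_def by blast
    have b0: "?b \<noteq> \<zero>\<^bsub>?P\<^esub>"
    proof
      assume "?b = \<zero>\<^bsub>?P\<^esub>"
      then have "?b 0 = \<zero>" by simp
      then have "arr e = \<zero>" using ea by (simp add: emb_def)
      then show False using coords_gen(4)[OF e(1), of e] ca_zero[OF e(1)] by simp
    qed
    let ?X = "{?b \<ltimes>\<^bsub>?P\<^esub> r | r. r \<in> carrier R}"
    have X: "rsubmodule R ?X ?P" by (rule Pj.rsubmodule_cyclic[OF bc])
    note N = cyc_ker_rsubmodule[OF i, of D] and N' = cyc_ker_rsubmodule[OF i, of "insert e D"]
    have int: "cyc_ker i D \<inter> ?X \<subseteq> {\<zero>\<^bsub>?P\<^esub>}"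
    proof
      fix x assume "x \<in> cyc_ker i D \<inter> ?X"
      then obtain r where r: "r \<in> carrier R" "x = emb i (arr e \<otimes> r)" "x \<in> cyc_ker i D" using br by auto
      have "cv r (tgt e) = 0"
        using r emb_in_cyc_ker[of "arr e \<otimes> r" i D] i e insert.hyps by auto
      then have "arr e \<otimes> r = \<zero>" using arr_r[OF r(1)] by (simp add: sc_zero)
      then show "x \<in> {\<zero>\<^bsub>?P\<^esub>}" using r(2) by (auto simp: emb_def)
    qed
    have eq: "cyc_ker i (insert e D) = {a \<oplus>\<^bsub>?P\<^esub> b | a b. a \<in> cyc_ker i D \<and> b \<in> ?X}"
    proof
      have "?b \<in> cyc_ker i (insert e D)" using emb_in_cyc_ker[of "arr e" i] i by auto
      then have "?X \<subseteq> cyc_ker i (insert e D)" using Pj.rsubmoduleD(4)[OF N'] by blast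
      moreover have "cyc_ker i D \<subseteq> cyc_ker i (insert e D)" by (auto simp: cyc_ker_def)
      ultimately show "{a \<oplus>\<^bsub>?P\<^esub> b | a b. a \<in> cyc_ker i D \<and> b \<in> ?X} \<subseteq> cyc_ker i (insert e D)"
        using Pj.rsubmoduleD(3)[OF N'] by blast
      show "cyc_ker i (insert e D) \<subseteq> {a \<oplus>\<^bsub>?P\<^esub> b | a b. a \<in> cyc_ker i D \<and> b \<in> ?X}"
      proof
        fix x assume x: "x \<in> cyc_ker i (insert e D)"
        then have xc: "x \<in> carrier ?P" by (simp add: cyc_ker_def)
        have x0: "x 0 \<in> carrier R" by (rule Proj1_emb(2)[OF xc])
        let ?y = "mk (\<lambda>_. 0) (\<lambda>e'. if e' = e then 0 else ca (x 0) e')"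
        have "x 0 = ?y \<oplus> arr e \<otimes> sc (ca (x 0) e)"
          by (rule coords_ext) (use x x0 Proj_cv[OF xc, of 0] in \<open>auto simp: cyc_ker_def\<close>)
        then have "x = emb i (?y \<oplus> arr e \<otimes> sc (ca (x 0) e))" using Proj1_emb(1)[OF xc] by simp
        also have "\<dots> = emb i ?y \<oplus>\<^bsub>?P\<^esub> emb i (arr e \<otimes> sc (ca (x 0) e))"
          by (auto simp: emb_def R.r_distr)
        finally have "x = emb i ?y \<oplus>\<^bsub>?P\<^esub> ?b \<ltimes>\<^bsub>?P\<^esub> sc (ca (x 0) e)" using br by simp
        moreover have "emb i ?y \<in> cyc_ker i D"
          using x by (subst emb_in_cyc_ker[OF _ i]) (auto simp: cyc_ker_def i)
        ultimately show "x \<in> {a \<oplus>\<^bsub>?P\<^esub> b | a b. a \<in> cyc_ker i D \<and> b \<in> ?X}"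
          using gen_closed(3) by blast
      qed
    qed
    note cyc = soc_cyclic[OF right_module_Proj bsoc b0 eV]
    have IH: "?P\<lparr>carrier := cyc_ker i D\<rparr> \<in> fg_modules R"
      "K0_eq R (frag_of (?P\<lparr>carrier := cyc_ker i D\<rparr>)) (\<Sum>e\<in>D. frag_of (Sim (tgt e)))"
      using insert by auto
    note S = internal_sum_fg[OF right_module_Proj N X N' int eq IH(1) cyc(1)]
    have "K0_eq R (frag_of (?P\<lparr>carrier := cyc_ker i (insert e D)\<rparr>)) ((\<Sum>e\<in>D. frag_of (Sim (tgt e))) + frag_of (Sim (tgt e)))"
      by (rule K0_eq_trans[OF S(2) K0_eq_add[OF IH(2) cyc(3)]])
    then show ?case using S(1) insert.hyps by (simp add: add.commute)
  qed
qed

lemma syzygy_Cyc: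
  assumes "i \<in> V" "D \<subseteq> {e \<in> E. src e = i}"
  shows "K0_eq R (frag_of (syzygy R (Cyc i D))) (\<Sum>e\<in>D. frag_of (Sim (tgt e)))"
proof -
  obtain c where c: "std_cover (Cyc i D) 1 (\<lambda>_. i) (\<lambda>_. c)"
    "a_kernel (Proj 1 (\<lambda>_. i)) (Cyc i D) (pmap (Cyc i D) 1 (\<lambda>_. c)) = cyc_ker i D"
    using Cyc_std_cover[OF assms(1)] .
  show ?thesis
    using K0_eq_trans[OF syzygy_std(2)[OF Cyc_cover(1)[OF assms(1)] c(1)]] cyc_ker_K0[OF assms] c(2) by simp
qed

text \<open>\<open>syzygy_Cyc\<close> counts the arrows in \<open>D\<close> and so asks that they
  leave \<open>i\<close>, whereas \<open>Sim\<close> is defined with all of \<open>E\<close>; both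
  sets give the same kernel.\<close>

lemma Sim_out: "Sim i = Cyc i {e \<in> E. src e = i}"
proof -
  have "cyc_ker i E = cyc_ker i {e \<in> E. src e = i}"
  proof -
    have "ca (x 0) e = 0" if "x \<in> carrier (Proj 1 (\<lambda>_. i))" "e \<in> E - {e \<in> E. src e = i}" for x e
      using Proj_ca[OF that(1), of 0 e] that(2) by auto
    then show ?thesis unfolding cyc_ker_def by blast
  qed
  then show ?thesis by (simp add: Cyc_def)
qed

text \<open>The syzygy map on classes of simple modules; \<open>rvec_Tz\<close> identifies it with
  multiplication of row vectors by the adjacency matrix.\<close>

definition Tz :: "('v \<Rightarrow>\<^sub>0 int) \<Rightarrow> ('v \<Rightarrow>\<^sub>0 int)" where
  "Tz = frag_extend (\<lambda>i. \<Sum>e\<in>{e \<in> E. src e = i}. frag_of (tgt e))"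

lemma Tz_keys: "Poly_Mapping.keys (Tz z) \<subseteq> tgt ` E"
  unfolding Tz_def
proof (rule keys_frag_extend_subset)
  fix i
  show "Poly_Mapping.keys (\<Sum>e\<in>{e \<in> E. src e = i}. frag_of (tgt e)) \<subseteq> tgt ` E"
    using Poly_Mapping.keys_sum[of "\<lambda>e. frag_of (tgt e)" "{e \<in> E. src e = i}"] by (auto simp: keys_frag_of)
qed

lemma Om_Sx:
  assumes "Poly_Mapping.keys z \<subseteq> V"
  shows "K0_eq R (Om (Sx z)) (Sx (Tz z))"
  using assms
proof (induction z rule: frag_induction)
  case (one i)
  have sum: "Sx (\<Sum>e\<in>D. frag_of (tgt e)) = (\<Sum>e\<in>D. frag_of (Sim (tgt e)))" if "finite D" for D
    using that by (induction D rule: finite_induct) (auto simp: frag_extend_add)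
  have "i \<in> V" using one by simp
  then have "K0_eq R (frag_of (syzygy R (Sim i))) (\<Sum>e\<in>{e \<in> E. src e = i}. frag_of (Sim (tgt e)))"
    unfolding Sim_out[of i] by (rule syzygy_Cyc) simp
  then show ?case using finite_E by (simp add: Tz_def sum)
next
  case (diff a b)
  then show ?case by (simp add: frag_extend_diff K0_eq_diff Tz_def)
qed (simp add: Tz_def)

text \<open>At a sink there is no arrow to divide out, so the simple module is the projective
  itself.\<close>

lemma Sim_sink:
  assumes "i \<in> V" "\<And>e. e \<in> E \<Longrightarrow> src e \<noteq> i"
  shows "K0_eq R (frag_of (Sim i)) 0"
proof -
  have C: "Cyc i {} \<in> fg_modules R" by (rule Cyc_cover(1)[OF assms(1)])
  obtain f where f: "f \<in> repi R (Proj 1 (\<lambda>_. i)) (Cyc i {})"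
    "a_kernel (Proj 1 (\<lambda>_. i)) (Cyc i {}) f = cyc_ker i {}" using Cyc_cover(2)[OF assms(1)] by blast
  let ?P = "Proj 1 (\<lambda>_. i)"
  have "x = \<zero>\<^bsub>?P\<^esub>" if x: "x \<in> cyc_ker i {}" for x
  proof -
    have xc: "x \<in> carrier ?P" using x by (simp add: cyc_ker_def)
    have "x 0 = \<zero>"
      by (rule coords_ext) (use x xc Proj_cv[OF xc, of 0] in \<open>auto simp: cyc_ker_def Proj_carrier\<close>)
    then show ?thesis using Proj1_emb(1)[OF xc] by (auto simp: emb_def fun_eq_iff)
  qed
  then have "inj_on f (carrier ?P)"
    using rhom_inj_iff[OF right_module_Proj fg_modulesD(1)[OF C] repiD(1)[OF f(1)]] f(2) unfolding a_kernel_eq by blast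
  then have "riso R ?P (Cyc i {})" using f(1) by (auto simp: riso_def repi_def bij_betw_def)
  then have "riso R (Cyc i {}) ?P" using riso_sym right_module_Proj by blast
  then have "projective R (Cyc i {})" using projective_iso[OF Proj_projective C] by blast
  moreover have "Sim i = Cyc i {}" using Sim_out[of i] assms(2) by (metis (mono_tags, lifting) Collect_empty_eq)
  ultimately show ?thesis using K0_eq_projective by simp
qed

lemma Sx_sinks:
  assumes "Poly_Mapping.keys z \<subseteq> V - src ` E"
  shows "K0_eq R (Sx z) 0"
  using assms
proof (induction z rule: frag_induction)
  case (one i)
  then show ?case using Sim_sink[of i] by auto
next
  case (diff a b)
  then have "K0_eq R (Sx a - Sx b) (0 - 0)" by (intro K0_eq_diff)
  then show ?case by (simp add: frag_extend_diff)
qed simp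

end

section \<open>Spaces of functions\<close>

text \<open>One structure serves two purposes: functionals on modules, for the multiplicities, and
  rational vectors indexed by \<open>nat\<close>, for the adjacency matrix.\<close>

interpretation fv: vector_space "\<lambda>(c :: 'k::field) (f :: 'x \<Rightarrow> 'k) x. c * f x"
  by unfold_locales (auto simp: fun_eq_iff algebra_simps)

interpretation fvp: vector_space_pair "\<lambda>(c :: 'k::field) (f :: 'x \<Rightarrow> 'k) x. c * f x"
  "\<lambda>(c :: 'k::field) (f :: 'y \<Rightarrow> 'k) x. c * f x"
  by unfold_locales

definition restr :: "'x set \<Rightarrow> ('x \<Rightarrow> 'k::zero) \<Rightarrow> 'x \<Rightarrow> 'k" where
  "restr S f = (\<lambda>x. if x \<in> S then f x else 0)"

text \<open>Functions in \<open>W\<close> are determined on \<open>S\<close> by finitely many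
  values. Removing a point \<open>a\<close> from \<open>X\<close> restricts to the functions
  vanishing at \<open>a\<close>, at the price of one further spanning function that does not vanish
  there.\<close>

lemma finite_span_restr:
  fixes W :: "('x \<Rightarrow> 'k::field) set"
  assumes "finite X" "fv.subspace W" "\<And>f. f \<in> W \<Longrightarrow> \<forall>x\<in>X. f x = 0 \<Longrightarrow> \<forall>x\<in>S. f x = 0"
  shows "\<exists>B. finite B \<and> restr S ` W \<subseteq> fv.span B"
  using assms
proof (induction X arbitrary: W rule: finite_induct)
  case empty
  then have "restr S ` W \<subseteq> {0}" by (auto simp: restr_def fun_eq_iff)
  then show ?case by (intro exI[of _ "{}"]) auto
next
  case (insert a X)
  let ?W' = "{f \<in> W. f a = 0}"
  note W = fv.subspace_0[OF insert.prems(1)] fv.subspace_add[OF insert.prems(1)] fv.subspace_scale[OF insert.prems(1)]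
    fv.subspace_diff[OF insert.prems(1)]
  have W': "fv.subspace ?W'"
    by (rule fv.subspaceI) (simp_all add: W(1-3))
  obtain B where B: "finite B" "restr S ` ?W' \<subseteq> fv.span B"
  proof -
    have "\<forall>x\<in>S. f x = 0" if "f \<in> ?W'" "\<forall>x\<in>X. f x = 0" for f
      using insert.prems(2)[of f] that by simp
    from insert.IH[OF W' this] show thesis using that by blast
  qed
  show ?case
  proof (cases "\<forall>f\<in>W. f a = 0")
    case True
    then have "?W' = W" by blast
    then show ?thesis using B by metis
  next
    case False
    then obtain g where g: "g \<in> W" "g a \<noteq> 0" by blast
    have "restr S f \<in> fv.span (insert (restr S g) B)" if f: "f \<in> W" for f
    proof -
      define c where "c = f a / g a"
      have "f - (\<lambda>x. c * g x) \<in> W" by (rule W(4)[OF f W(3)[OF g(1)]])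
      then have "f - (\<lambda>x. c * g x) \<in> ?W'" using g(2) by (simp add: c_def)
      then have "restr S (f - (\<lambda>x. c * g x)) \<in> fv.span (insert (restr S g) B)"
        using B(2) fv.span_mono[of B "insert (restr S g) B"] by blast
      moreover have "(\<lambda>x. c * restr S g x) \<in> fv.span (insert (restr S g) B)"
        by (intro fv.span_scale fv.span_base) simp
      ultimately have "restr S (f - (\<lambda>x. c * g x)) + (\<lambda>x. c * restr S g x) \<in> fv.span (insert (restr S g) B)"
        by (rule fv.span_add)
      moreover have "restr S (f - (\<lambda>x. c * g x)) + (\<lambda>x. c * restr S g x) = restr S f"
        by (auto simp: restr_def fun_eq_iff)
      ultimately show ?thesis by simp
    qed
    then show ?thesis using B(1) by (intro exI[of _ "insert (restr S g) B"]) auto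
  qed
qed

lemma fv_dim_direct_sum:
  fixes A B :: "('x \<Rightarrow> 'k::field) set"
  assumes A: "fv.subspace A" "A \<subseteq> fv.span SA" "finite SA"
    and B: "fv.subspace B" "B \<subseteq> fv.span SB" "finite SB" and AB: "A \<inter> B \<subseteq> {0}"
  shows "fv.dim {a + b | a b. a \<in> A \<and> b \<in> B} = fv.dim A + fv.dim B"
proof -
  obtain BA where BA: "BA \<subseteq> A" "fv.independent BA" "A \<subseteq> fv.span BA" "card BA = fv.dim A"
    using fv.basis_exists by blast
  obtain BB where BB: "BB \<subseteq> B" "fv.independent BB" "B \<subseteq> fv.span BB" "card BB = fv.dim B"
    using fv.basis_exists by blast
  have fin: "finite BA" "finite BB"
    using fv.independent_span_bound[OF A(3) BA(2)] fv.independent_span_bound[OF B(3) BB(2)] A(2) B(2) BA(1) BB(1)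
    by blast+
  have spA: "fv.span BA = A" "fv.span BB = B"
    using fv.span_subspace[OF BA(1,3) A(1)] fv.span_subspace[OF BB(1,3) B(1)] .
  have indep: "fv.independent (BA \<union> BB)"
  proof
    assume "fv.dependent (BA \<union> BB)"
    then obtain x where x: "x \<in> BA \<union> BB" "x \<in> fv.span ((BA \<union> BB) - {x})"
      unfolding fv.dependent_def by blast
    have *: False if "x \<in> P" "fv.independent P" "fv.span P \<inter> fv.span Q \<subseteq> {0}" "x \<in> fv.span ((P \<union> Q) - {x})"
      for P Q :: "('x \<Rightarrow> 'k) set"
    proof -
      have "x \<in> fv.span ((P - {x}) \<union> Q)" using that(4) fv.span_mono[of "(P \<union> Q) - {x}" "(P - {x}) \<union> Q"] by blast
      then obtain a b where ab: "a \<in> fv.span (P - {x})" "b \<in> fv.span Q" "x = a + b"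
        unfolding fv.span_Un by blast
      have "a \<in> fv.span P" using ab(1) fv.span_mono[of "P - {x}" P] by blast
      then have "x - a \<in> fv.span P" by (rule fv.span_diff[OF fv.span_base[OF that(1)]])
      moreover have "x - a = b" using ab(3) by simp
      ultimately have "b = 0" using ab(2) that(3) by blast
      then have "x \<in> fv.span (P - {x})" using ab by simp
      then show False using that(1,2) unfolding fv.dependent_def by blast
    qed
    show False
      using x(1)
    proof
      assume "x \<in> BA" then show False using *[OF _ BA(2) _ x(2)] AB spA by simp
    next
      assume "x \<in> BB" then show False using *[of BB BA] BB(2) AB spA x(2) by (simp add: Int_commute Un_commute)
    qed
  qed
  have "0 \<notin> BA" using BA(2) fv.dependent_zero by blast
  then have disj: "BA \<inter> BB = {}" using BA(1) BB(1) AB by blast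
  have sp: "fv.span (BA \<union> BB) = {a + b | a b. a \<in> A \<and> b \<in> B}"
    unfolding fv.span_Un spA by blast
  have "fv.dim (fv.span (BA \<union> BB)) = card (BA \<union> BB)"
    by (rule fv.dim_span_eq_card_independent[OF indep])
  then show ?thesis using sp card_Un_disjoint[OF fin disj] BA(4) BB(4) by simp
qed

lemma fv_dim_inj_image:
  fixes L :: "('x \<Rightarrow> 'k::field) \<Rightarrow> ('y \<Rightarrow> 'k)"
  assumes L: "\<And>f g. L (f + g) = L f + L g" "\<And>c f. L (\<lambda>x. c * f x) = (\<lambda>x. c * L f x)"
    and A: "fv.subspace A" "\<And>f. f \<in> A \<Longrightarrow> L f = 0 \<Longrightarrow> f = 0"
  shows "fv.dim (L ` A) = fv.dim A" "fv.subspace (L ` A)"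
    "A \<subseteq> fv.span S \<Longrightarrow> L ` A \<subseteq> fv.span (L ` S)"
proof -
  have lin: "Vector_Spaces.linear (\<lambda>c f x. c * f x) (\<lambda>c f x. c * f x) L"
    by unfold_locales (use L in auto)
  interpret L: Vector_Spaces.linear "\<lambda>c f x. c * f x" "\<lambda>c f x. c * f x" L by (rule lin)
  obtain B where B: "B \<subseteq> A" "fv.independent B" "A \<subseteq> fv.span B" "card B = fv.dim A"
    using fv.basis_exists by blast
  have sp: "fv.span B = A" using fv.span_subspace[OF B(1,3) A(1)] .
  have inj: "inj_on L A"
    unfolding fvp.linear_inj_on_iff_eq_0[OF lin A(1)] using A(2) by blast
  have "fv.independent (L ` B)"
    using fvp.linear_independent_injective_image[OF lin B(2)] inj sp by simp
  moreover have "fv.span (L ` B) = L ` A" using L.span_image[of B] sp by simp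
  ultimately have "fv.dim (L ` A) = card (L ` B)" using fv.dim_span_eq_card_independent by metis
  then show "fv.dim (L ` A) = fv.dim A" using B(4) card_image[OF inj_on_subset[OF inj B(1)]] by simp
  show "fv.subspace (L ` A)" using L.subspace_image[OF A(1)] .
  show "A \<subseteq> fv.span S \<Longrightarrow> L ` A \<subseteq> fv.span (L ` S)" using L.span_image[of S] by blast
qed

context rad_square_zero
begin

section \<open>The multiplicity of a simple summand\<close>

lemma cv_minus: "r \<in> carrier R \<Longrightarrow> v \<in> V \<Longrightarrow> cv (\<ominus> r) v = - cv r v"
  using cv_add[of "\<ominus> r" r v] by (simp add: R.l_neg eq_neg_iff_add_eq_0)

lemma soc_subset: "soc M j \<subseteq> carrier M"
  by (auto simp: soc_def)

text \<open>\<open>homS M j\<close> is \<open>Hom(M, S\<^sub>j)\<close> and \<open>soc M j\<close> is the \<open>S\<^sub>j\<close>-isotypic part of the socle, so \<open>simp_mult M j\<close>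
  is the rank of the composition pairing, that is, the multiplicity of \<open>S\<^sub>j\<close> as a direct
  summand of \<open>M\<close>.\<close>

definition homS :: "'r fg_module \<Rightarrow> 'v \<Rightarrow> ((nat \<Rightarrow> 'r) \<Rightarrow> 'k) set" where
  "homS M j = {f. (\<forall>x\<in>carrier M. \<forall>y\<in>carrier M. f (x \<oplus>\<^bsub>M\<^esub> y) = f x + f y) \<and>
     (\<forall>x\<in>carrier M. \<forall>r\<in>carrier R. f (x \<ltimes>\<^bsub>M\<^esub> r) = f x * cv r j)}"

definition simp_mult :: "'r fg_module \<Rightarrow> 'v \<Rightarrow> nat" where
  "simp_mult M j = fv.dim (restr (soc M j) ` homS M j)"

lemma homS_subspace: "fv.subspace (homS M j)"
  unfolding fv.subspace_def by (auto simp: homS_def algebra_simps)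

lemma restr_homS_subspace: "fv.subspace (restr S ` homS M j)"
proof -
  have "Vector_Spaces.linear (\<lambda>c f x. c * f x) (\<lambda>c f x. c * f x) (restr S :: ((nat \<Rightarrow> 'r) \<Rightarrow> 'k) \<Rightarrow> _)"
    by unfold_locales (auto simp: restr_def fun_eq_iff)
  then show ?thesis using fvp.linear_subspace_image homS_subspace by blast
qed

lemma homS_zero:
  assumes "right_module R M" "f \<in> homS M j" "j \<in> V" shows "f \<zero>\<^bsub>M\<^esub> = 0"
proof -
  interpret M: right_module R M by fact
  have "f (\<zero>\<^bsub>M\<^esub> \<ltimes>\<^bsub>M\<^esub> \<zero>) = f \<zero>\<^bsub>M\<^esub> * cv \<zero> j"
    using assms(2) M.M.zero_closed R.zero_closed unfolding homS_def by blast
  then show ?thesis using assms(3) by simp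
qed

text \<open>A homomorphism to a simple module is determined by its values on finitely many
  generators, so the dimension in \<open>simp_mult\<close> is a true finite dimension.\<close>

lemma restr_homS_finite:
  assumes M: "M \<in> fg_modules R" and j: "j \<in> V"
  shows "\<exists>B. finite B \<and> restr (soc M j) ` homS M j \<subseteq> fv.span B"
proof -
  interpret M: right_module R M using fg_modulesD(1)[OF M] .
  obtain X where X: "finite X" "X \<subseteq> carrier M" "\<And>L. rsubmodule R L M \<Longrightarrow> X \<subseteq> L \<Longrightarrow> L = carrier M"
    using fg_modulesD(2)[OF M] unfolding rfin_gen_def by blast
  show ?thesis
  proof (rule finite_span_restr[OF X(1) homS_subspace])
    fix f assume f: "f \<in> homS M j" "\<forall>x\<in>X. f x = 0"
    have "rsubmodule R {x \<in> carrier M. f x = 0} M"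
      using f(1) homS_zero[OF M.right_module_axioms f(1) j]
      by (intro M.rsubmoduleI) (simp_all add: homS_def M.ract_closed subset_iff)
    moreover have "X \<subseteq> {x \<in> carrier M. f x = 0}" using X(2) f(2) by blast
    ultimately have e: "{x \<in> carrier M. f x = 0} = carrier M" by (rule X(3))
    have f0: "f x = 0" if "x \<in> carrier M" for x using subsetD[OF equalityD2[OF e] that] by simp
    show "\<forall>x\<in>soc M j. f x = 0" by (intro ballI f0) (rule subsetD[OF soc_subset])
  qed
qed

lemma simp_mult_zero:
  assumes "\<And>f x. f \<in> homS M j \<Longrightarrow> x \<in> soc M j \<Longrightarrow> f x = 0"
  shows "simp_mult M j = 0"
proof -
  have "restr (soc M j) ` homS M j \<subseteq> fv.span {}"
    using assms by (auto simp: restr_def fun_eq_iff)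
  then have "fv.dim (restr (soc M j) ` homS M j) \<le> card ({} :: ((nat \<Rightarrow> 'r) \<Rightarrow> 'k) set)"
    by (rule fv.dim_le_card) simp
  then show ?thesis by (simp add: simp_mult_def)
qed

lemma soc_rhom:
  assumes "f \<in> rhom R M N" "x \<in> soc M j" shows "f x \<in> soc N j"
proof -
  note x = socD[OF assms(2)]
  have "f x \<ltimes>\<^bsub>N\<^esub> r = f x \<ltimes>\<^bsub>N\<^esub> sc (cv r j)" if "r \<in> carrier R" for r
    using rhomD(3)[OF assms(1) x(1) that] rhomD(3)[OF assms(1) x(1) gen_closed(3)] x(2)[OF that] by metis
  then show ?thesis using rhomD(1)[OF assms(1) x(1)] unfolding soc_def by blast
qed

lemma homS_comp: "f \<in> homS N j \<Longrightarrow> h \<in> rhom R M N \<Longrightarrow> (\<lambda>x. f (h x)) \<in> homS M j"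
  using rhomD[of h R M N] by (simp add: homS_def)

text \<open>Both sides of the pairing split along the decomposition and the mixed terms vanish.
  Pulling functionals back along the two projections embeds the spaces for \<open>M1\<close> and
  \<open>M2\<close> as complementary subspaces of the one for \<open>M\<close>.\<close>

lemma simp_mult_rsum:
  assumes M: "M \<in> fg_modules R" and M1: "M1 \<in> fg_modules R" and M2: "M2 \<in> fg_modules R"
    and iso: "riso R M (rsum M1 M2)" and j: "j \<in> V"
  shows "simp_mult M j = simp_mult M1 j + simp_mult M2 j"
proof -
  note mM = fg_modulesD(1)[OF M] and mM1 = fg_modulesD(1)[OF M1] and mM2 = fg_modulesD(1)[OF M2]
  interpret M1: right_module R M1 by (rule mM1)
  interpret M2: right_module R M2 by (rule mM2)
  obtain h where h: "h \<in> rhom R M (rsum M1 M2)" "bij_betw h (carrier M) (carrier (rsum M1 M2))"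
    using iso by (auto simp: riso_def)
  let ?g = "inv_into (carrier M) h"
  have g: "?g \<in> rhom R (rsum M1 M2) M" by (rule rhom_inv[OF mM h])
  have hg: "h (?g y) = y" if "y \<in> carrier (rsum M1 M2)" for y
    by (rule bij_betw_inv_into_right[OF h(2) that])
  have gh: "?g (h x) = x" if "x \<in> carrier M" for x
    by (rule bij_betw_inv_into_left[OF h(2) that])
  define p1 p2 \<iota>1 \<iota>2 where "p1 = (\<lambda>x. fst (h x))" and "p2 = (\<lambda>x. snd (h x))"
    and "\<iota>1 = (\<lambda>a. ?g (a, \<zero>\<^bsub>M2\<^esub>))" and "\<iota>2 = (\<lambda>b. ?g (\<zero>\<^bsub>M1\<^esub>, b))"
  have p1: "p1 \<in> rhom R M M1"
    using rhom_comp[OF h(1) repiD(1)[OF fst_repi[OF mM1 mM2]]] by (simp add: p1_def comp_def)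
  have p2: "p2 \<in> rhom R M M2"
    using rhom_comp[OF h(1) repiD(1)[OF snd_repi[OF mM1 mM2]]] by (simp add: p2_def comp_def)
  have "(\<lambda>a. (a, \<zero>\<^bsub>M2\<^esub>)) \<in> rhom R M1 (rsum M1 M2)" by (auto intro!: rhomI)
  from rhom_comp[OF this g] have \<iota>1: "\<iota>1 \<in> rhom R M1 M" by (simp add: \<iota>1_def comp_def)
  have "(\<lambda>b. (\<zero>\<^bsub>M1\<^esub>, b)) \<in> rhom R M2 (rsum M1 M2)" by (auto intro!: rhomI)
  from rhom_comp[OF this g] have \<iota>2: "\<iota>2 \<in> rhom R M2 M" by (simp add: \<iota>2_def comp_def)
  have p\<iota>: "p1 (\<iota>1 a) = a" "p2 (\<iota>1 a) = \<zero>\<^bsub>M2\<^esub>" if "a \<in> carrier M1" for a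
    using hg[of "(a, \<zero>\<^bsub>M2\<^esub>)"] that by (auto simp: p1_def p2_def \<iota>1_def)
  have p\<iota>2: "p2 (\<iota>2 b) = b" if "b \<in> carrier M2" for b
    using hg[of "(\<zero>\<^bsub>M1\<^esub>, b)"] that by (auto simp: p2_def \<iota>2_def)
  have dec: "x = \<iota>1 (p1 x) \<oplus>\<^bsub>M\<^esub> \<iota>2 (p2 x)" if x: "x \<in> carrier M" for x
  proof -
    have c: "p1 x \<in> carrier M1" "p2 x \<in> carrier M2" using rhomD(1)[OF p1 x] rhomD(1)[OF p2 x] .
    have "\<iota>1 (p1 x) \<oplus>\<^bsub>M\<^esub> \<iota>2 (p2 x) = ?g ((p1 x, \<zero>\<^bsub>M2\<^esub>) \<oplus>\<^bsub>rsum M1 M2\<^esub> (\<zero>\<^bsub>M1\<^esub>, p2 x))"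
      unfolding \<iota>1_def \<iota>2_def using c by (intro rhomD(2)[OF g, symmetric]) auto
    also have "\<dots> = ?g (h x)" using c by (simp add: p1_def p2_def)
    finally show ?thesis using gh[OF x] by simp
  qed
  define S S1 S2 where "S = soc M j" and "S1 = soc M1 j" and "S2 = soc M2 j"
  define F F1 F2 where "F = restr S ` homS M j" and "F1 = restr S1 ` homS M1 j" and "F2 = restr S2 ` homS M2 j"
  \<comment> \<open>Pullback along the projections, cut off outside the socle part so that equality
    of functions is equality on that part.\<close>
  define E1 E2 :: "((nat \<Rightarrow> 'r) \<Rightarrow> 'k) \<Rightarrow> (nat \<Rightarrow> 'r) \<Rightarrow> 'k"
    where "E1 = (\<lambda>f. restr S (\<lambda>x. f (p1 x)))" and "E2 = (\<lambda>f. restr S (\<lambda>x. f (p2 x)))"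
  have Sp: "p1 x \<in> S1" "p2 x \<in> S2" "x \<in> carrier M" if "x \<in> S" for x
    using soc_rhom[OF p1] soc_rhom[OF p2] subsetD[OF soc_subset] that unfolding S_def S1_def S2_def by simp_all
  have S\<iota>: "a \<in> S1 \<Longrightarrow> \<iota>1 a \<in> S" "b \<in> S2 \<Longrightarrow> \<iota>2 b \<in> S" for a b
    using soc_rhom[OF \<iota>1] soc_rhom[OF \<iota>2] unfolding S_def S1_def S2_def by simp_all
  have Sc: "S1 \<subseteq> carrier M1" "S2 \<subseteq> carrier M2" unfolding S1_def S2_def by (rule soc_subset)+
  have E1r: "E1 (restr S1 f) = restr S (\<lambda>x. f (p1 x))" and E2r: "E2 (restr S2 f) = restr S (\<lambda>x. f (p2 x))" for f
    using Sp by (auto simp: E1_def E2_def restr_def fun_eq_iff)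
  have lin: "E1 (f + f') = E1 f + E1 f'" "E1 (\<lambda>x. c * f x) = (\<lambda>x. c * E1 f x)"
    "E2 (f + f') = E2 f + E2 f'" "E2 (\<lambda>x. c * f x) = (\<lambda>x. c * E2 f x)" for f f' c
    by (auto simp: E1_def E2_def restr_def fun_eq_iff)
  have sub: "fv.subspace F" "fv.subspace F1" "fv.subspace F2"
    unfolding F_def F1_def F2_def by (rule restr_homS_subspace)+
  have inj1: "f = 0" if f: "f \<in> F1" "E1 f = 0" for f
  proof
    fix y
    show "f y = 0 y"
    proof (cases "y \<in> S1")
      case True
      then have "E1 f (\<iota>1 y) = f y" using S\<iota>(1) p\<iota>(1) Sc by (auto simp: E1_def restr_def)
      then show ?thesis using f(2) by simp
    qed (use f in \<open>auto simp: F1_def restr_def\<close>)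
  qed
  have inj2: "f = 0" if f: "f \<in> F2" "E2 f = 0" for f
  proof
    fix y
    show "f y = 0 y"
    proof (cases "y \<in> S2")
      case True
      then have "E2 f (\<iota>2 y) = f y" using S\<iota>(2) p\<iota>2 Sc by (auto simp: E2_def restr_def)
      then show ?thesis using f(2) by simp
    qed (use f in \<open>auto simp: F2_def restr_def\<close>)
  qed
  have zero2: "f \<zero>\<^bsub>M2\<^esub> = 0" if "f \<in> F2" for f
    using that homS_zero[OF mM2 _ j] by (auto simp: F2_def restr_def)
  \<comment> \<open>A function of the first type depends only on the first component, one of the
    second type vanishes when the second component is zero; evaluation at the embedded first
    component gives zero.\<close>
  have int: "E1 ` F1 \<inter> E2 ` F2 \<subseteq> {0}"
  proof
    fix f assume "f \<in> E1 ` F1 \<inter> E2 ` F2"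
    then obtain f1 f2 where f: "f1 \<in> F1" "f2 \<in> F2" "f = E1 f1" "f = E2 f2" by blast
    have "f x = 0" for x
    proof (cases "x \<in> S")
      case True
      have c: "p1 x \<in> S1" "p1 x \<in> carrier M1" using Sp[OF True] Sc by auto
      have "f x = f (\<iota>1 (p1 x))"
        using True S\<iota>(1)[OF c(1)] p\<iota>(1)[OF c(2)] unfolding f(3) by (simp add: E1_def restr_def)
      also have "\<dots> = f2 \<zero>\<^bsub>M2\<^esub>"
        using S\<iota>(1)[OF c(1)] p\<iota>(2)[OF c(2)] unfolding f(4) by (simp add: E2_def restr_def)
      finally show ?thesis using zero2[OF f(2)] by simp
    next
      case False
      then show ?thesis unfolding f(3) by (simp add: E1_def restr_def)
    qed
    then show "f \<in> {0}" by (auto simp: fun_eq_iff)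
  qed
  have F: "F = {a + b | a b. a \<in> E1 ` F1 \<and> b \<in> E2 ` F2}"
  proof
    show "F \<subseteq> {a + b | a b. a \<in> E1 ` F1 \<and> b \<in> E2 ` F2}"
    proof
      fix f' assume "f' \<in> F"
      then obtain f where f: "f \<in> homS M j" "f' = restr S f" by (auto simp: F_def)
      let ?f1 = "\<lambda>a. f (\<iota>1 a)" and ?f2 = "\<lambda>b. f (\<iota>2 b)"
      have "f' = E1 (restr S1 ?f1) + E2 (restr S2 ?f2)"
      proof
        fix x
        show "f' x = (E1 (restr S1 ?f1) + E2 (restr S2 ?f2)) x"
        proof (cases "x \<in> S")
          case True
          have xc: "x \<in> carrier M" using Sp(3)[OF True] .
          have "f x = f (\<iota>1 (p1 x) \<oplus>\<^bsub>M\<^esub> \<iota>2 (p2 x))" using dec[OF xc] by simp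
          also have "\<dots> = f (\<iota>1 (p1 x)) + f (\<iota>2 (p2 x))"
            using f(1) rhomD(1)[OF \<iota>1 rhomD(1)[OF p1 xc]] rhomD(1)[OF \<iota>2 rhomD(1)[OF p2 xc]]
            by (simp add: homS_def)
          finally show ?thesis using True unfolding E1r E2r f(2) by (simp add: restr_def)
        next
          case False
          then show ?thesis unfolding E1r E2r f(2) by (simp add: restr_def)
        qed
      qed
      moreover have "restr S1 ?f1 \<in> F1" "restr S2 ?f2 \<in> F2"
        unfolding F1_def F2_def using homS_comp[OF f(1) \<iota>1] homS_comp[OF f(1) \<iota>2] by blast+
      ultimately show "f' \<in> {a + b | a b. a \<in> E1 ` F1 \<and> b \<in> E2 ` F2}" by blast
    qed
    have "E1 ` F1 \<subseteq> F"
      unfolding F1_def F_def using homS_comp[OF _ p1] by (auto simp: E1r)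
    moreover have "E2 ` F2 \<subseteq> F"
      unfolding F2_def F_def using homS_comp[OF _ p2] by (auto simp: E2r)
    ultimately show "{a + b | a b. a \<in> E1 ` F1 \<and> b \<in> E2 ` F2} \<subseteq> F"
      using fv.subspace_add[OF sub(1)] by blast
  qed
  obtain B1 where B1: "finite B1" "F1 \<subseteq> fv.span B1" using restr_homS_finite[OF M1 j] unfolding F1_def S1_def by blast
  obtain B2 where B2: "finite B2" "F2 \<subseteq> fv.span B2" using restr_homS_finite[OF M2 j] unfolding F2_def S2_def by blast
  have I1: "fv.dim (E1 ` F1) = fv.dim F1" "fv.subspace (E1 ` F1)" "E1 ` F1 \<subseteq> fv.span (E1 ` B1)"
    by (rule fv_dim_inj_image[of E1 F1], (rule lin sub inj1 B1; assumption?)+)+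
  have I2: "fv.dim (E2 ` F2) = fv.dim F2" "fv.subspace (E2 ` F2)" "E2 ` F2 \<subseteq> fv.span (E2 ` B2)"
    by (rule fv_dim_inj_image[of E2 F2], (rule lin sub inj2 B2; assumption?)+)+
  have "fv.dim F = fv.dim (E1 ` F1) + fv.dim (E2 ` F2)"
    unfolding F by (rule fv_dim_direct_sum[OF I1(2,3) _ I2(2,3) _ int]) (simp_all add: B1 B2)
  then show ?thesis
    using I1(1) I2(1) by (simp add: simp_mult_def F_def F1_def F2_def S_def S1_def S2_def)
qed

text \<open>A standard cover of a projective module is injective. A socle element at the source of
  \<open>e\<close> is killed by \<open>e\<close>, so its lift is killed by \<open>e\<close> too, and
  this forces the vertex coefficients at the source to vanish. These are all that a homomorphism to
  the simple module at that vertex can see.\<close>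

lemma simp_mult_projective:
  assumes P: "projective R P" and e: "e \<in> E"
  shows "simp_mult P (src e) = 0"
proof (rule simp_mult_zero)
  fix f x assume f: "f \<in> homS P (src e)" and x: "x \<in> soc P (src e)"
  have fg: "P \<in> fg_modules R" using P by (simp add: projective_def)
  note mP = fg_modulesD(1)[OF fg]
  interpret P: right_module R P by (rule mP)
  obtain t i m where S: "std_cover P t i m" using std_cover_fg[OF fg] by metis
  have G: "gen_family P t i m" using S by (simp add: std_cover_def)
  note cov = std_cover_projective_cover[OF fg S]
  note epi = gen_family_repi[OF mP G]
  let ?K = "a_kernel (Proj t i) P (pmap P t m)"
  have "a_kernel P P id = {\<zero>\<^bsub>P\<^esub>}" by (auto simp: a_kernel_eq)
  then have "riso R ((Proj t i)\<lparr>carrier := ?K\<rparr>) (P\<lparr>carrier := {\<zero>\<^bsub>P\<^esub>}\<rparr>)"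
    using projective_cover_unique[OF cov projective_cover_id[OF P] fg] by simp
  then obtain h where "bij_betw h ?K {\<zero>\<^bsub>P\<^esub>}" by (auto simp: riso_def)
  then have "inj_on h ?K" "h ` ?K = {\<zero>\<^bsub>P\<^esub>}" by (auto simp: bij_betw_def)
  \<comment> \<open>Comparison with the identity cover of \<open>P\<close> leaves only one element
    in the kernel.\<close>
  then have one: "u = w" if "u \<in> ?K" "w \<in> ?K" for u w using that by (metis imageI inj_onD singletonD)
  have zK: "\<zero>\<^bsub>Proj t i\<^esub> \<in> ?K"
    using Pj.rsubmoduleD(2)[OF a_kernel_rsubmodule[OF right_module_Proj mP repiD(1)[OF epi]]] .
  have xc: "x \<in> carrier P" by (rule socD(1)[OF x])
  obtain y where y: "y \<in> carrier (Proj t i)" "x = pmap P t m y"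
    using xc unfolding repiD(2)[OF epi, symmetric] by blast
  have yc: "y k \<in> carrier R" for k using y by (simp add: Proj_carrier)
  have "x \<ltimes>\<^bsub>P\<^esub> arr e = \<zero>\<^bsub>P\<^esub>" using socD(2)[OF x gen_closed(2), of e] xc e by (simp add: sc_zero)
  then have "y \<ltimes>\<^bsub>Proj t i\<^esub> arr e \<in> ?K"
    using rhomD(3)[OF repiD(1)[OF epi] y(1) gen_closed(2), of e] Pj.ract_closed[OF y(1) gen_closed(2)] y(2)
    by (simp add: a_kernel_eq del: Proj_simps)
  then have "y \<ltimes>\<^bsub>Proj t i\<^esub> arr e = \<zero>\<^bsub>Proj t i\<^esub>" using one zK by blast
  then have "y k \<otimes> arr e = \<zero>" for k by (auto simp: fun_eq_iff)
  then have "ca (y k \<otimes> arr e) e = 0" for k using e by simp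
  then have y0: "cv (y k) (src e) = 0" for k using e yc by simp
  have "f (lsum P (\<lambda>k. m k \<ltimes>\<^bsub>P\<^esub> y k) s) = 0" if "s \<le> t" for s
    using that
  proof (induction s)
    case 0
    then show ?case using homS_zero[OF mP f] e by simp
  next
    case (Suc s)
    have c: "m k \<in> carrier P" if "k \<le> s" for k using gen_familyD(2)[OF G, of k] that Suc.prems by simp
    have "lsum P (\<lambda>k. m k \<ltimes>\<^bsub>P\<^esub> y k) s \<in> carrier P"
      by (rule P.M.lsum_closed) (simp add: c yc P.ract_closed)
    then show ?case using Suc f c[of s] yc y0 by (simp add: homS_def P.ract_closed)
  qed
  then show "f x = 0" using y(2) by (simp add: pmap_def)
qed

text \<open>For \<open>i \<noteq> j\<close> the generator is sent to zero by its idempotent. For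
  \<open>i = j\<close> a surviving arrow \<open>e\<close> kills every socle element, so such an
  element has no component at the top and is sent to zero.\<close>

lemma simp_mult_Cyc:
  assumes i: "i \<in> V" and j: "j \<in> V" and ne: "i \<noteq> j \<or> (\<exists>e\<in>E - D. src e = i)"
  shows "simp_mult (Cyc i D) j = 0"
proof (rule simp_mult_zero)
  fix f x assume f: "f \<in> homS (Cyc i D) j" and x: "x \<in> soc (Cyc i D) j"
  obtain c where c: "cyc_gen (Cyc i D) i D c" using Cyc_gen[OF i] .
  interpret C: right_module R "Cyc i D" using fg_modulesD(1)[OF Cyc_cover(1)[OF i]] .
  have cc: "c \<in> carrier (Cyc i D)" "c \<ltimes>\<^bsub>Cyc i D\<^esub> idem i = c" using c by (auto simp: cyc_gen_def)
  obtain r where r: "r \<in> carrier R" "x = c \<ltimes>\<^bsub>Cyc i D\<^esub> r" using c socD(1)[OF x] unfolding cyc_gen_def by blast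
  have fx: "f x = f c * cv r j" using f cc r by (simp add: homS_def)
  show "f x = 0"
  proof (cases "i = j")
    case False
    have "f c = f c * cv (idem i) j" using f cc gen_closed(1)[of i] unfolding homS_def by (metis (mono_tags, lifting) mem_Collect_eq)
    then show ?thesis using fx False j by simp
  next
    case True
    then obtain e where e: "e \<in> E" "e \<notin> D" "src e = i" using ne by blast
    have "x \<ltimes>\<^bsub>Cyc i D\<^esub> arr e = \<zero>\<^bsub>Cyc i D\<^esub>"
      using socD(2)[OF x gen_closed(2), of e] socD(1)[OF x] j by (simp add: sc_zero)
    then have "c \<ltimes>\<^bsub>Cyc i D\<^esub> (r \<otimes> arr e) = \<zero>\<^bsub>Cyc i D\<^esub>" using r cc by (simp add: C.ract_mult)
    then have "ca (r \<otimes> arr e) e = 0"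
      using c e r(1) R.m_closed[OF r(1) gen_closed(2)] unfolding cyc_gen_def by blast
    then show ?thesis using fx e r True by simp
  qed
qed

lemma simp_mult_Sim:
  assumes i: "i \<in> V" shows "simp_mult (Sim i) i = 1"
proof -
  obtain c where c: "cyc_gen (Sim i) i E c" using Cyc_gen[OF i] .
  interpret C: right_module R "Sim i" using fg_modulesD(1)[OF Cyc_cover(1)[OF i]] .
  have cc: "c \<in> carrier (Sim i)" "c \<ltimes>\<^bsub>Sim i\<^esub> idem i = c" using c by (auto simp: cyc_gen_def)
  have gen: "\<exists>r\<in>carrier R. x = c \<ltimes>\<^bsub>Sim i\<^esub> r" if "x \<in> carrier (Sim i)" for x
    using c that by (auto simp: cyc_gen_def)
  have k: "c \<ltimes>\<^bsub>Sim i\<^esub> r = \<zero>\<^bsub>Sim i\<^esub> \<longleftrightarrow> cv r i = 0" if "r \<in> carrier R" for r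
    using c that by (auto simp: cyc_gen_def)
  have wd: "c \<ltimes>\<^bsub>Sim i\<^esub> r = c \<ltimes>\<^bsub>Sim i\<^esub> s \<longleftrightarrow> cv r i = cv s i" if "r \<in> carrier R" "s \<in> carrier R" for r s
  proof -
    have "c \<ltimes>\<^bsub>Sim i\<^esub> r = c \<ltimes>\<^bsub>Sim i\<^esub> s \<longleftrightarrow> c \<ltimes>\<^bsub>Sim i\<^esub> (r \<oplus> \<ominus> s) = \<zero>\<^bsub>Sim i\<^esub>"
      using C.minus_eq_zero_iff[of "c \<ltimes>\<^bsub>Sim i\<^esub> r" "c \<ltimes>\<^bsub>Sim i\<^esub> s"] that cc(1)
      by (simp add: C.ract_closed C.ract_add_right C.ract_minus a_minus_def)
    then show ?thesis using k[of "r \<oplus> \<ominus> s"] that i by (simp add: cv_minus)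
  qed
  \<comment> \<open>Reads off the vertex coefficient of any ring element carrying the generator to
    \<open>x\<close>; by \<open>wd\<close> the choice does not matter.\<close>
  define f0 where "f0 x = cv (SOME r. r \<in> carrier R \<and> x = c \<ltimes>\<^bsub>Sim i\<^esub> r) i" for x
  have f0: "f0 (c \<ltimes>\<^bsub>Sim i\<^esub> r) = cv r i" if r: "r \<in> carrier R" for r
  proof -
    have "\<exists>s. s \<in> carrier R \<and> c \<ltimes>\<^bsub>Sim i\<^esub> r = c \<ltimes>\<^bsub>Sim i\<^esub> s" using r by blast
    note * = someI_ex[OF this]
    show ?thesis
      unfolding f0_def using * wd[OF r conjunct1[OF *]] by simp
  qed
  have H0: "f0 \<in> homS (Sim i) i" unfolding homS_def
  proof (intro CollectI conjI ballI)
    fix x y assume "x \<in> carrier (Sim i)" "y \<in> carrier (Sim i)"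
    then obtain r s where rs: "r \<in> carrier R" "x = c \<ltimes>\<^bsub>Sim i\<^esub> r" "s \<in> carrier R" "y = c \<ltimes>\<^bsub>Sim i\<^esub> s" using gen by metis
    then have "x \<oplus>\<^bsub>Sim i\<^esub> y = c \<ltimes>\<^bsub>Sim i\<^esub> (r \<oplus> s)" using cc by (simp add: C.ract_add_right)
    then show "f0 (x \<oplus>\<^bsub>Sim i\<^esub> y) = f0 x + f0 y" using rs f0 i by simp
  next
    fix x s assume "x \<in> carrier (Sim i)" and s: "s \<in> carrier R"
    then obtain r where r: "r \<in> carrier R" "x = c \<ltimes>\<^bsub>Sim i\<^esub> r" using gen by metis
    then have "x \<ltimes>\<^bsub>Sim i\<^esub> s = c \<ltimes>\<^bsub>Sim i\<^esub> (r \<otimes> s)" using cc s by (simp add: C.ract_mult)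
    then show "f0 (x \<ltimes>\<^bsub>Sim i\<^esub> s) = f0 x * cv s i" using r s f0 i by simp
  qed
  have soc: "soc (Sim i) i = carrier (Sim i)"
  proof (intro equalityI subsetI)
    fix x assume x: "x \<in> carrier (Sim i)"
    then obtain r where r: "r \<in> carrier R" "x = c \<ltimes>\<^bsub>Sim i\<^esub> r" using gen by metis
    have "x \<ltimes>\<^bsub>Sim i\<^esub> s = x \<ltimes>\<^bsub>Sim i\<^esub> sc (cv s i)" if s: "s \<in> carrier R" for s
      using wd[of "r \<otimes> s" "r \<otimes> sc (cv s i)"] r s cc i by (simp add: C.ract_mult)
    then show "x \<in> soc (Sim i) i" using x unfolding soc_def by blast
  qed (rule socD(1))
  let ?g = "restr (soc (Sim i) i) f0"
  have "?g c = 1" using f0[of \<one>] cc(1) i unfolding soc by (simp add: restr_def C.ract_one)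
  then have g0: "?g \<noteq> 0" by auto
  have "restr (soc (Sim i) i) f \<in> fv.span {?g}" if f: "f \<in> homS (Sim i) i" for f
  proof -
    have "f x = f c * f0 x" if "x \<in> carrier (Sim i)" for x
    proof -
      from gen[OF that] obtain r where r: "r \<in> carrier R" "x = c \<ltimes>\<^bsub>Sim i\<^esub> r" by blast
      then show ?thesis using f f0 cc by (simp add: homS_def)
    qed
    then have "restr (soc (Sim i) i) f = (\<lambda>x. f c * ?g x)" unfolding soc by (auto simp: restr_def)
    then show ?thesis using fv.span_scale[OF fv.span_base[of ?g "{?g}"], of "f c"] by simp
  qed
  then have "fv.dim (restr (soc (Sim i) i) ` homS (Sim i) i) = card {?g}"
    using H0 g0 by (intro fv.basis_card_eq_dim[symmetric]) auto
  then show ?thesis by (simp add: simp_mult_def)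
qed

text \<open>The linear extension of the multiplicity to formal combinations. As
  \<open>frag_extend\<close> has values in free abelian groups, integers are written as multiples of
  the single generator \<open>()\<close>.\<close>

definition mult_frag :: "'v \<Rightarrow> ('r fg_module \<Rightarrow>\<^sub>0 int) \<Rightarrow> int" where
  "mult_frag j c = Poly_Mapping.lookup (frag_extend (\<lambda>M. frag_cmul (int (simp_mult M j)) (frag_of ())) c) ()"

lemma mult_frag_simps:
  "mult_frag j (a + b) = mult_frag j a + mult_frag j b" "mult_frag j (a - b) = mult_frag j a - mult_frag j b"
  "mult_frag j 0 = 0" "mult_frag j (frag_cmul k a) = k * mult_frag j a"
  "mult_frag j (frag_of M) = int (simp_mult M j)"
  by (simp_all add: mult_frag_def frag_extend_add frag_extend_diff lookup_add lookup_minus frag_extend_cmul)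

lemma mult_frag_K0_eq:
  assumes "K0_eq R x y" "e \<in> E" shows "mult_frag (src e) x = mult_frag (src e) y"
proof -
  have "mult_frag (src e) c \<in> {0}" if "c \<in> K0_rel R" for c
    using that
  proof (rule K0_rel_hom[where f = "mult_frag (src e)", rotated -1])
    fix M M' M'' assume "M \<in> fg_modules R" "M' \<in> fg_modules R" "M'' \<in> fg_modules R" "riso R M (rsum M' M'')"
    from simp_mult_rsum[OF this, of "src e"]
    show "mult_frag (src e) (frag_of M) - mult_frag (src e) (frag_of M') - mult_frag (src e) (frag_of M'') \<in> {0}"
      using assms(2) by (simp add: mult_frag_simps)
  next
    fix P assume "projective R P"
    then show "mult_frag (src e) (frag_of P) \<in> {0}"
      using simp_mult_projective assms(2) by (simp add: mult_frag_simps)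
  qed (auto simp: mult_frag_simps)
  from this[OF assms(1)[unfolded K0_eq_def]] show ?thesis by (simp add: mult_frag_simps)
qed

lemma mult_frag_Sx:
  assumes "Poly_Mapping.keys z \<subseteq> V" "j \<in> V" "j \<in> src ` E"
  shows "mult_frag j (Sx z) = Poly_Mapping.lookup z j"
  using assms(1)
proof (induction z rule: frag_induction)
  case (one i)
  show ?case
  proof (cases "i = j")
    case True
    then show ?thesis using simp_mult_Sim[OF assms(2)] by (simp add: mult_frag_simps)
  next
    case False
    then show ?thesis using simp_mult_Cyc[of i j E] one assms(2) by (simp add: mult_frag_simps)
  qed
qed (simp_all add: mult_frag_simps frag_extend_diff lookup_minus)

lemma Sx_eq_zero:
  assumes "Poly_Mapping.keys z \<subseteq> V" "K0_eq R (Sx z) 0"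
  shows "Poly_Mapping.keys z \<subseteq> V - src ` E"
proof
  fix j assume j: "j \<in> Poly_Mapping.keys z"
  then have jV: "j \<in> V" using assms(1) by blast
  have False if "j \<in> src ` E"
  proof -
    from that obtain e where e: "e \<in> E" "j = src e" by blast
    have "mult_frag j (Sx z) = 0"
      using mult_frag_K0_eq[OF assms(2) e(1)] e(2) by (simp add: mult_frag_simps)
    then show False using mult_frag_Sx[OF assms(1) jV that] j by (simp add: in_keys_iff)
  qed
  then show "j \<in> V - src ` E" using jV by blast
qed

section \<open>A single vertex with at most one loop\<close>

text \<open>The algebra is the field or the dual numbers, and a module that is not projective splits
  off a simple summand. The induction on the number of generators constructs this summand from a
  relation between minimal generators.\<close>

lemma one_loop_K0:
  assumes V: "V = {v}" and E: "card E \<le> 1" and "M \<in> fg_modules R" "gen_family M t i m"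
  shows "\<exists>z. Poly_Mapping.keys z \<subseteq> V \<and> K0_eq R (frag_of M) (Sx z)"
  using assms(3,4)
proof (induction t arbitrary: M i m rule: less_induct)
  case (less t' M i' m')
  have vV: "v \<in> V" using V by simp
  note mM = fg_modulesD(1)[OF less.prems(1)]
  interpret M: right_module R M by (rule mM)
  obtain t i m where S: "std_cover M t i m" and min: "\<And>s i' m'. gen_family M s i' m' \<Longrightarrow> t \<le> s"
    using std_cover_fg[OF less.prems(1)] by metis
  have G: "gen_family M t i m" using S by (simp add: std_cover_def)
  have mc: "m l \<in> carrier M" if "l < t" for l using gen_familyD(2)[OF G that] .
  have tt': "t \<le> t'" by (rule min[OF less.prems(2)])
  note epi = gen_family_repi[OF mM G]
  show ?case
  proof (cases "\<forall>x\<in>carrier (Proj t i). pmap M t m x = \<zero>\<^bsub>M\<^esub> \<longrightarrow> x = \<zero>\<^bsub>Proj t i\<^esub>")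
    case True
    then have "inj_on (pmap M t m) (carrier (Proj t i))"
      using rhom_inj_iff[OF right_module_Proj mM repiD(1)[OF epi]] by blast
    then have "riso R (Proj t i) M" using epi by (auto simp: riso_def repi_def bij_betw_def)
    then have "projective R M"
      using projective_iso[OF Proj_projective less.prems(1)] riso_sym right_module_Proj by blast
    then show ?thesis using K0_eq_projective by (intro exI[of _ 0]) simp
  next
    case False
    then obtain x where x: "x \<in> carrier (Proj t i)" "pmap M t m x = \<zero>\<^bsub>M\<^esub>" "x \<noteq> (\<lambda>_. \<zero>)" by auto
    have xc: "x l \<in> carrier R" for l using x by (simp add: Proj_carrier)
    obtain k where "x k \<noteq> \<zero>" using x(3) by auto
    then have kt: "k < t" using x(1) unfolding Proj_carrier by (meson not_less)
    have cv0: "cv (x l) u = 0" if "l < t" "u \<in> V" for l u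
      using S x(1,2) that unfolding std_cover_def by blast
    have "\<exists>e\<in>E. ca (x k) e \<noteq> 0"
    proof (rule ccontr)
      assume "\<not> (\<exists>e\<in>E. ca (x k) e \<noteq> 0)"
      then have "x k = \<zero>" by (intro coords_ext) (use xc cv0 kt in auto)
      then show False using \<open>x k \<noteq> \<zero>\<close> by simp
    qed
    then obtain e where e: "e \<in> E" "ca (x k) e \<noteq> 0" by blast
    have Ee: "E = {e}" using E e(1) finite_E by (metis One_nat_def card_le_Suc0_iff_eq insertI1 singleton_iff subsetI subset_antisym)
    have st: "src e = v" "tgt e = v" using src_V[OF e(1)] tgt_V[OF e(1)] V by auto
    define c where "c l = ca (x l) e" for l
    have xl: "sc (c l) \<otimes> arr e = x l" if "l < t" for l
      by (rule coords_ext) (use xc cv0[OF that] Ee st in \<open>auto simp: c_def V\<close>)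
    \<comment> \<open>The relation \<open>x\<close> is \<open>w\<close> times the loop, so
      \<open>w\<close> is killed by the loop and lies in the socle.\<close>
    define w where "w = lsum M (\<lambda>l. m l \<ltimes>\<^bsub>M\<^esub> sc (c l)) t"
    have wc: "w \<in> carrier M" unfolding w_def by (rule M.M.lsum_closed) (simp add: mc M.ract_closed)
    have we: "w \<ltimes>\<^bsub>M\<^esub> arr e = \<zero>\<^bsub>M\<^esub>"
    proof -
      have "w \<ltimes>\<^bsub>M\<^esub> arr e = lsum M (\<lambda>l. (m l \<ltimes>\<^bsub>M\<^esub> sc (c l)) \<ltimes>\<^bsub>M\<^esub> arr e) t"
        unfolding w_def by (rule M.lsum_ract) (auto simp: mc M.ract_closed)
      also have "\<dots> = pmap M t m x"
        unfolding pmap_def by (rule M.M.lsum_cong) (simp add: mc xl flip: M.ract_mult)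
      finally show ?thesis using x(2) by simp
    qed
    have wsoc: "w \<in> soc M v"
    proof -
      have "w \<ltimes>\<^bsub>M\<^esub> r = w \<ltimes>\<^bsub>M\<^esub> sc (cv r v)" if r: "r \<in> carrier R" for r
      proof -
        have "r = sc (cv r v) \<oplus> arr e \<otimes> sc (ca r e)"
          by (rule coords_ext) (use r Ee V in auto)
        then have "w \<ltimes>\<^bsub>M\<^esub> r = w \<ltimes>\<^bsub>M\<^esub> sc (cv r v) \<oplus>\<^bsub>M\<^esub> (w \<ltimes>\<^bsub>M\<^esub> arr e) \<ltimes>\<^bsub>M\<^esub> sc (ca r e)"
          using wc M.ract_add_right[of w "sc (cv r v)" "arr e \<otimes> sc (ca r e)"] by (simp add: M.ract_mult)
        then show ?thesis using we wc by (simp add: M.ract_closed)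
      qed
      then show ?thesis using wc unfolding soc_def by blast
    qed
    obtain N j p where N: "rsubmodule R N M" "gen_family (M\<lparr>carrier := N\<rparr>) (t - 1) j p"
      and other: "\<And>l. l < t \<Longrightarrow> l \<noteq> k \<Longrightarrow> m l \<in> N"
      using skip_family[OF mM kt, of i m] gen_familyD[OF G] by metis
    note N' = M.rsubmoduleD[OF N(1)]
    note mN = M.submodule_right_module[OF N(1)]
    have Nfg: "M\<lparr>carrier := N\<rparr> \<in> fg_modules R"
      by (rule fg_modules_epi[OF Proj_fg mN gen_family_repi[OF mN N(2)]])
    have IH: "\<exists>z. Poly_Mapping.keys z \<subseteq> V \<and> K0_eq R (frag_of (M\<lparr>carrier := N\<rparr>)) (Sx z)"
      by (rule less.IH[OF _ Nfg N(2)]) (use kt tt' in simp)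
    let ?L = "{y \<oplus>\<^bsub>M\<^esub> w \<ltimes>\<^bsub>M\<^esub> r | y r. y \<in> N \<and> r \<in> carrier R}"
    note L = M.adjoin_rsubmodule[OF N(1) wc]
    note L' = M.rsubmoduleD[OF L(1)]
    have wL: "w \<in> ?L" using L(3)[OF R.one_closed] M.ract_one[OF wc] by simp
    \<comment> \<open>As \<open>c k\<close> is nonzero, \<open>m k\<close> can be recovered from
      \<open>w\<close> and the other generators; so \<open>w\<close> replaces \<open>m k\<close> as
      a generator.\<close>
    have mkL: "m k \<in> ?L"
    proof -
      obtain s where s: "t = Suc s" using kt by (cases t) auto
      let ?sk = "\<lambda>l. if l < k then l else Suc l"
      let ?rest = "lsum M (\<lambda>l. m (?sk l) \<ltimes>\<^bsub>M\<^esub> sc (c (?sk l))) s"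
      have w: "w = ?rest \<oplus>\<^bsub>M\<^esub> m k \<ltimes>\<^bsub>M\<^esub> sc (c k)"
        using M.M.lsum_skip[of k s "\<lambda>l. m l \<ltimes>\<^bsub>M\<^esub> sc (c l)"] kt s mc
        by (simp add: w_def M.ract_closed)
      have rest: "?rest \<in> N"
        by (rule M.lsum_rsubmodule[OF N(1)]) (use other s N'(4) in auto)
      have rc: "?rest \<in> carrier M" using rest N'(1) by blast
      have mk: "m k \<ltimes>\<^bsub>M\<^esub> sc (c k) \<in> carrier M" using mc[OF kt] by (simp add: M.ract_closed)
      have "m k \<ltimes>\<^bsub>M\<^esub> sc (c k) = w \<ominus>\<^bsub>M\<^esub> ?rest"
        unfolding w a_minus_def using rc mk by (simp add: M.M.a_comm[of ?rest] M.M.a_assoc M.M.r_neg)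
      then have "m k \<ltimes>\<^bsub>M\<^esub> sc (c k) \<in> ?L" using L'(6)[OF wL subsetD[OF L(2) rest]] by simp
      then have "(m k \<ltimes>\<^bsub>M\<^esub> sc (c k)) \<ltimes>\<^bsub>M\<^esub> sc (inverse (c k)) \<in> ?L" using L'(4) gen_closed(3) by blast
      moreover have "(m k \<ltimes>\<^bsub>M\<^esub> sc (c k)) \<ltimes>\<^bsub>M\<^esub> sc (inverse (c k)) = m k"
        using e(2) mc[OF kt] by (simp add: M.ract_mult[symmetric] sc_mult c_def sc_one M.ract_one)
      ultimately show ?thesis by simp
    qed
    have Lall: "?L = carrier M"
    proof (rule gen_family_submodule[OF mM G L(1)])
      fix l assume "l < t"
      then show "m l \<in> ?L" using mkL other L(2) by (cases "l = k") blast+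
    qed
    \<comment> \<open>Otherwise the \<open>t - 1\<close> generators of \<open>N\<close> would
      already generate \<open>M\<close>, against the minimality of \<open>t\<close>.\<close>
    have wN: "w \<notin> N"
    proof
      assume "w \<in> N"
      then have "?L \<subseteq> N" using N'(3,4) by blast
      then have "N = carrier M" using Lall N'(1) by blast
      then show False using min[of "t - 1" j p] N(2) kt by simp
    qed
    let ?X = "{w \<ltimes>\<^bsub>M\<^esub> r | r. r \<in> carrier R}"
    have int: "N \<inter> ?X \<subseteq> {\<zero>\<^bsub>M\<^esub>}"
    proof
      fix u assume "u \<in> N \<inter> ?X"
      then obtain r where r: "r \<in> carrier R" "u = w \<ltimes>\<^bsub>M\<^esub> r" "u \<in> N" by blast
      note wr = socD(2)[OF wsoc r(1)]
      have "cv r v = 0"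
      proof (rule ccontr)
        assume nz: "cv r v \<noteq> 0"
        have "w = w \<ltimes>\<^bsub>M\<^esub> (sc (cv r v) \<otimes> sc (inverse (cv r v)))"
          using nz wc by (simp add: sc_mult sc_one M.ract_one)
        also have "\<dots> = u \<ltimes>\<^bsub>M\<^esub> sc (inverse (cv r v))" unfolding r(2) wr using wc by (simp add: M.ract_mult)
        finally show False using wN N'(4)[OF r(3), of "sc (inverse (cv r v))"] by simp
      qed
      then show "u \<in> {\<zero>\<^bsub>M\<^esub>}" using wr r(2) wc by (simp add: sc_zero)
    qed
    have w0: "w \<noteq> \<zero>\<^bsub>M\<^esub>" using wN N'(2) by blast
    note cyc = soc_cyclic[OF mM wsoc w0 vV]
    have all: "carrier M = {a \<oplus>\<^bsub>M\<^esub> b | a b. a \<in> N \<and> b \<in> ?X}" using Lall by blast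
    note I = internal_sum_fg[OF mM N(1) M.rsubmodule_cyclic[OF wc] M.rsubmodule_carrier int all Nfg cyc(1)]
    obtain z where z: "Poly_Mapping.keys z \<subseteq> V" "K0_eq R (frag_of (M\<lparr>carrier := N\<rparr>)) (Sx z)" using IH by blast
    have "K0_eq R (frag_of M) (Sx (z + frag_of v))"
      using K0_eq_trans[OF I(2) K0_eq_add[OF z(2) cyc(3)]] by (simp add: frag_extend_add)
    moreover have "Poly_Mapping.keys (z + frag_of v) \<subseteq> V"
      using z(1) keys_add[of z "frag_of v"] vV by (auto simp: keys_frag_of)
    ultimately show ?thesis by blast
  qed
qed

lemma one_loop_K0_frag:
  assumes V: "V = {v}" and E: "card E \<le> 1" and "Poly_Mapping.keys c \<subseteq> fg_modules R"
  shows "\<exists>z. Poly_Mapping.keys z \<subseteq> V \<and> K0_eq R c (Sx z)"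
  using assms(3)
proof (induction c rule: frag_induction)
  case zero
  then show ?case by (intro exI[of _ 0]) simp
next
  case (one M)
  then have M: "M \<in> fg_modules R" by simp
  obtain t i m where "std_cover M t i m" using std_cover_fg[OF M] by metis
  then have G: "gen_family M t i m" by (simp add: std_cover_def)
  show ?case by (rule one_loop_K0[OF V E M G])
next
  case (diff a b)
  then obtain y z where "Poly_Mapping.keys y \<subseteq> V" "K0_eq R a (Sx y)"
    "Poly_Mapping.keys z \<subseteq> V" "K0_eq R b (Sx z)" by blast
  then show ?case using keys_diff[of y z]
    by (intro exI[of _ "y - z"]) (auto simp: frag_extend_diff intro: K0_eq_diff)
qed

end

section \<open>The Igusa--Todorov function in terms of representatives\<close>

definition K0_coset :: "('r, 'z) ring_scheme \<Rightarrow> ('r fg_module \<Rightarrow>\<^sub>0 int) \<Rightarrow> ('r fg_module \<Rightarrow>\<^sub>0 int) set" where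
  "K0_coset R c = K0_rel R #>\<^bsub>K0_free R\<^esub> c"

lemma K0_coset_eq: "K0_coset R c = {h + c | h. h \<in> K0_rel R}"
  by (auto simp: K0_coset_def r_coset_def)

lemma K0_coset_mem: "x \<in> K0_coset R c \<longleftrightarrow> K0_eq R x c"
  by (auto simp: K0_coset_eq K0_eq_def) (metis diff_add_cancel)

lemma K0_coset_eq_iff: "K0_coset R c = K0_coset R d \<longleftrightarrow> K0_eq R c d"
proof
  assume "K0_coset R c = K0_coset R d"
  moreover have "c \<in> K0_coset R c" by (simp add: K0_coset_mem)
  ultimately show "K0_eq R c d" by (simp add: K0_coset_mem)
next
  assume "K0_eq R c d"
  then have "K0_eq R x c \<longleftrightarrow> K0_eq R x d" for x using K0_eq_trans K0_eq_sym by metis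
  then show "K0_coset R c = K0_coset R d" by (auto simp: K0_coset_mem)
qed

text \<open>Contains whole isomorphism classes rather than representatives; this is harmless because
  isomorphic modules have equal classes.\<close>

definition summands :: "('r, 'z) ring_scheme \<Rightarrow> 'r fg_module \<Rightarrow> 'r fg_module set" where
  "summands R M = {N. indecomposable R N \<and> direct_summand R N M}"

lemma summands_fg: "summands R M \<subseteq> fg_modules R"
  by (auto simp: summands_def indecomposable_def)

lemma generate_frag:
  assumes "S \<subseteq> A"
  shows "generate (free_Abelian_group A) (frag_of ` S) = {c. Poly_Mapping.keys c \<subseteq> S}"
proof
  interpret G: group "free_Abelian_group A" by simp
  have car: "frag_of ` S \<subseteq> carrier (free_Abelian_group A)" using assms by auto
  show "generate (free_Abelian_group A) (frag_of ` S) \<subseteq> {c. Poly_Mapping.keys c \<subseteq> S}"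
  proof
    fix c assume "c \<in> generate (free_Abelian_group A) (frag_of ` S)"
    then show "c \<in> {c. Poly_Mapping.keys c \<subseteq> S}"
    proof (induction rule: generate.induct)
      case (inv h)
      then show ?case using assms by (auto simp: keys_frag_of)
    next
      case (eng h1 h2)
      then show ?case using keys_add[of h1 h2] by auto
    qed (auto simp: keys_frag_of)
  qed
  interpret H: subgroup "generate (free_Abelian_group A) (frag_of ` S)" "free_Abelian_group A"
    by (rule G.generate_is_subgroup[OF car])
  show "{c. Poly_Mapping.keys c \<subseteq> S} \<subseteq> generate (free_Abelian_group A) (frag_of ` S)"
  proof
    fix c :: "'a \<Rightarrow>\<^sub>0 int" assume "c \<in> {c. Poly_Mapping.keys c \<subseteq> S}"
    then have "Poly_Mapping.keys c \<subseteq> S" by simp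
    then show "c \<in> generate (free_Abelian_group A) (frag_of ` S)"
    proof (induction c rule: frag_induction)
      case zero
      then show ?case using H.one_closed by simp
    next
      case (one x)
      then show ?case by (intro generate.incl) simp
    next
      case (diff a b)
      have "Poly_Mapping.keys b \<subseteq> A" using H.mem_carrier[OF diff(2)] by simp
      then have "- b \<in> generate (free_Abelian_group A) (frag_of ` S)"
        using H.m_inv_closed[OF diff(2)] by simp
      then show ?case using H.m_closed[OF diff(1)] by fastforce
    qed
  qed
qed

text \<open>Generation commutes with the quotient homomorphism, so every element of the subgroup has
  a representative supported on the summands.\<close>

lemma add_subgroup_eq: "add_subgroup R M = K0_coset R ` {c. Poly_Mapping.keys c \<subseteq> summands R M}"
proof -
  interpret G: comm_group "K0_free R" by (rule abelian_free_Abelian_group)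
  interpret N: normal "K0_rel R" "K0_free R"
    by (rule G.subgroup_imp_normal[OF K0_rel_subgroup])
  have coset: "K0_coset R = (#>\<^bsub>K0_free R\<^esub>) (K0_rel R)" by (rule ext) (simp add: K0_coset_def)
  interpret H: group_hom "K0_free R" "K0 R" "K0_coset R"
    unfolding group_hom_def group_hom_axioms_def K0_def
    using N.factorgroup_is_group N.r_coset_hom_Mod G.is_group by (simp add: coset)
  have "{K0_class R N | N. indecomposable R N \<and> direct_summand R N M} = K0_coset R ` frag_of ` summands R M"
    by (auto simp: K0_class_def K0_coset_def summands_def)
  moreover have "frag_of ` summands R M \<subseteq> carrier (K0_free R)"
    using summands_fg[of R M] by auto
  ultimately show ?thesis
    unfolding add_subgroup_def using H.generate_img[of "frag_of ` summands R M"] generate_frag[OF summands_fg]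
    by metis
qed

section \<open>Injectivity of the iterated syzygy map on representatives\<close>

context rad_square_zero
begin

lemma Omega_bar_coset: "Omega_bar R (K0_coset R c) = K0_coset R (Om c)"
proof -
  have "Omega_bar R (K0_coset R c) = (\<Union>x\<in>K0_coset R c. K0_coset R (Om x))"
    by (simp add: Omega_bar_def K0_coset_def)
  also have "\<dots> = (\<Union>x\<in>K0_coset R c. K0_coset R (Om c))"
    using Om_K0_eq by (intro SUP_cong refl) (auto simp: K0_coset_eq_iff K0_coset_mem)
  also have "\<dots> = K0_coset R (Om c)"
    using K0_coset_mem[of c R c] by auto
  finally show ?thesis .
qed

lemma Omega_bar_iter: "(Omega_bar R ^^ k) (K0_coset R c) = K0_coset R ((Om ^^ k) c)"
  by (induction k) (simp_all add: Omega_bar_coset)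

lemma Om_iter_diff: "(Om ^^ k) (a - b) = (Om ^^ k) a - (Om ^^ k) b"
  by (induction k) (simp_all add: frag_extend_diff)

lemma Om_iter_K0_eq: "K0_eq R a b \<Longrightarrow> K0_eq R ((Om ^^ k) a) ((Om ^^ k) b)"
  by (induction k) (simp_all add: Om_K0_eq)

lemma K0_eq_diff_iff: "K0_eq R a b \<longleftrightarrow> K0_eq R (a - b) 0"
  by (simp add: K0_eq_def)

lemma inj_on_Omega_bar:
  "inj_on (Omega_bar R) ((Omega_bar R ^^ k) ` add_subgroup R M) \<longleftrightarrow>
    (\<forall>c. Poly_Mapping.keys c \<subseteq> summands R M \<longrightarrow> K0_eq R ((Om ^^ Suc k) c) 0 \<longrightarrow> K0_eq R ((Om ^^ k) c) 0)"
  (is "?L \<longleftrightarrow> ?R")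
proof -
  have im: "(Omega_bar R ^^ k) ` add_subgroup R M
      = (\<lambda>c. K0_coset R ((Om ^^ k) c)) ` {c. Poly_Mapping.keys c \<subseteq> summands R M}"
    unfolding add_subgroup_eq image_image by (simp add: Omega_bar_iter)
  have val: "Omega_bar R (K0_coset R ((Om ^^ k) c)) = K0_coset R ((Om ^^ Suc k) c)" for c
    by (simp add: Omega_bar_coset)
  have L: "?L \<longleftrightarrow> (\<forall>a b. Poly_Mapping.keys a \<subseteq> summands R M \<longrightarrow> Poly_Mapping.keys b \<subseteq> summands R M \<longrightarrow>
     K0_eq R ((Om ^^ Suc k) a) ((Om ^^ Suc k) b) \<longrightarrow> K0_eq R ((Om ^^ k) a) ((Om ^^ k) b))"
    unfolding im inj_on_def by (simp add: Omega_bar_coset K0_coset_eq_iff)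
  have d: "K0_eq R ((Om ^^ l) a) ((Om ^^ l) b) \<longleftrightarrow> K0_eq R ((Om ^^ l) (a - b)) 0" for l a b
    unfolding Om_iter_diff by (rule K0_eq_diff_iff)
  show ?thesis
    unfolding L d
  proof (intro iffI allI impI)
    fix c assume *: "\<forall>a b. Poly_Mapping.keys a \<subseteq> summands R M \<longrightarrow> Poly_Mapping.keys b \<subseteq> summands R M \<longrightarrow>
      K0_eq R ((Om ^^ Suc k) (a - b)) 0 \<longrightarrow> K0_eq R ((Om ^^ k) (a - b)) 0"
      "Poly_Mapping.keys c \<subseteq> summands R M" "K0_eq R ((Om ^^ Suc k) c) 0"
    show "K0_eq R ((Om ^^ k) c) 0" using *(1)[rule_format, of c 0] *(2,3) by simp
  next
    fix a b assume *: "\<forall>c. Poly_Mapping.keys c \<subseteq> summands R M \<longrightarrow> K0_eq R ((Om ^^ Suc k) c) 0 \<longrightarrow> K0_eq R ((Om ^^ k) c) 0"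
      "Poly_Mapping.keys a \<subseteq> summands R M" "Poly_Mapping.keys b \<subseteq> summands R M" "K0_eq R ((Om ^^ Suc k) (a - b)) 0"
    have "Poly_Mapping.keys (a - b) \<subseteq> summands R M" using *(2,3) keys_diff[of a b] by blast
    then show "K0_eq R ((Om ^^ k) (a - b)) 0" using * by blast
  qed
qed

text \<open>Injectivity of the induced map on the \<open>k\<close>-th image of the subgroup of
  \<open>M\<close>, in the kernel form given by \<open>inj_on_Omega_bar\<close>.\<close>

definition stable :: "'r fg_module \<Rightarrow> nat \<Rightarrow> bool" where
  "stable M k \<longleftrightarrow> (\<forall>c. Poly_Mapping.keys c \<subseteq> summands R M \<longrightarrow> K0_eq R ((Om ^^ Suc k) c) 0 \<longrightarrow> K0_eq R ((Om ^^ k) c) 0)"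

lemma phi_eq: "phi R M = (LEAST l. \<forall>s. stable M (l + s))"
  unfolding phi_def inj_on_Omega_bar stable_def ..

lemma phi_le: "(\<And>s. stable M (l + s)) \<Longrightarrow> phi R M \<le> l"
  unfolding phi_eq by (rule Least_le) blast

text \<open>Stability from some point on is what guarantees that the \<open>LEAST\<close> in
  \<open>phi\<close> is attained.\<close>

lemma phi_ge:
  assumes "\<And>s. stable M (l + s)" "\<not> stable M k"
  shows "Suc k \<le> phi R M"
proof -
  have *: "\<forall>s. stable M (phi R M + s)"
    unfolding phi_eq by (rule LeastI[of _ l]) (use assms(1) in blast)
  show ?thesis
  proof (rule ccontr)
    assume "\<not> Suc k \<le> phi R M"
    then have "stable M (phi R M + (k - phi R M))" using * by blast
    then show False using \<open>\<not> Suc k \<le> phi R M\<close> assms(2) by simp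
  qed
qed

lemma phi_dim_eqI:
  assumes "\<And>M s. M \<in> fg_modules R \<Longrightarrow> stable M (n + s)" "M \<in> fg_modules R" "\<not> stable M k" "n = Suc k"
  shows "phi_dim R = enat n"
  unfolding phi_dim_def
proof (rule antisym)
  show "(SUP M\<in>fg_modules R. enat (phi R M)) \<le> enat n"
    by (rule SUP_least) (simp add: phi_le assms(1))
  have "enat n \<le> enat (phi R M)" using phi_ge[OF assms(1)[OF assms(2)] assms(3)] assms(4) by simp
  also have "\<dots> \<le> (SUP M\<in>fg_modules R. enat (phi R M))" by (rule SUP_upper[OF assms(2)])
  finally show "enat n \<le> (SUP M\<in>fg_modules R. enat (phi R M))" .
qed

lemma phi_dim_unstable:
  assumes "phi_dim R = enat (Suc k)"
  obtains M s where "M \<in> fg_modules R" "\<not> stable M (k + s)"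
proof -
  have "\<exists>M\<in>fg_modules R. \<exists>s. \<not> stable M (k + s)"
  proof (rule ccontr)
    assume "\<not> ?thesis"
    then have "phi R M \<le> k" if "M \<in> fg_modules R" for M using that by (intro phi_le) blast
    then have "phi_dim R \<le> enat k" unfolding phi_dim_def by (intro SUP_least) simp
    then show False using assms by simp
  qed
  then show thesis using that by blast
qed

lemma Tz_iter_keys: "Poly_Mapping.keys z \<subseteq> tgt ` E \<Longrightarrow> Poly_Mapping.keys ((Tz ^^ k) z) \<subseteq> tgt ` E"
  by (induction k) (simp_all add: Tz_keys)

lemma Tz_iter_keys_V: "Poly_Mapping.keys z \<subseteq> V \<Longrightarrow> Poly_Mapping.keys ((Tz ^^ k) z) \<subseteq> V"
  using Tz_keys tgt_V by (cases k) force+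

lemma Om_iter_Sx:
  assumes "Poly_Mapping.keys z \<subseteq> V"
  shows "K0_eq R ((Om ^^ k) (Sx z)) (Sx ((Tz ^^ k) z))"
proof (induction k)
  case (Suc k)
  have "K0_eq R (Om ((Om ^^ k) (Sx z))) (Om (Sx ((Tz ^^ k) z)))" by (rule Om_K0_eq[OF Suc])
  also have "K0_eq R (Om (Sx ((Tz ^^ k) z))) (Sx (Tz ((Tz ^^ k) z)))"
    by (rule Om_Sx[OF Tz_iter_keys_V[OF assms]])
  finally show ?case by simp
qed simp

text \<open>The first syzygy turns any class into a semisimple one; every later one is a step of
  \<open>Tz\<close>. This shift by one is the reason for \<open>Suc\<close> in the lemmas
  below.\<close>

lemma Om_iter_Suc:
  assumes "K0_eq R (Om c) (Sx z)" "Poly_Mapping.keys z \<subseteq> V"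
  shows "K0_eq R ((Om ^^ Suc k) c) (Sx ((Tz ^^ k) z))"
  using K0_eq_trans[OF Om_iter_K0_eq[OF assms(1), of k] Om_iter_Sx[OF assms(2)]]
  by (simp add: funpow_Suc_right del: funpow.simps)

lemma Sx_zero_iff:
  assumes "Poly_Mapping.keys z \<subseteq> V"
  shows "K0_eq R (Sx z) 0 \<longleftrightarrow> Poly_Mapping.keys z \<subseteq> V - src ` E"
  using Sx_eq_zero[OF assms] Sx_sinks by blast

lemma K0_eq_zero_cong: "K0_eq R a b \<Longrightarrow> K0_eq R a 0 \<longleftrightarrow> K0_eq R b 0"
  using K0_eq_trans K0_eq_sym by metis

text \<open>Stability of all modules at once becomes a statement about integer vectors: first
  syzygies range over vectors on the targets of arrows, and a semisimple class vanishes exactly when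
  it is supported on sinks.\<close>

lemma stable_SucI:
  assumes "\<And>z. Poly_Mapping.keys z \<subseteq> tgt ` E \<Longrightarrow> Poly_Mapping.keys ((Tz ^^ Suc k) z) \<subseteq> V - src ` E \<Longrightarrow>
    Poly_Mapping.keys ((Tz ^^ k) z) \<subseteq> V - src ` E"
  shows "stable M (Suc k)"
  unfolding stable_def
proof (intro allI impI)
  fix c assume c: "Poly_Mapping.keys c \<subseteq> summands R M" "K0_eq R ((Om ^^ Suc (Suc k)) c) 0"
  then obtain z where z: "Poly_Mapping.keys z \<subseteq> tgt ` E" "K0_eq R (Om c) (Sx z)"
    using Om_semisimple[of c] summands_fg by blast
  have zV: "Poly_Mapping.keys z \<subseteq> V" using z(1) tgt_V by blast
  have "K0_eq R (Sx ((Tz ^^ Suc k) z)) 0" using c(2) K0_eq_zero_cong[OF Om_iter_Suc[OF z(2) zV, of "Suc k"]] by blast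
  then have "Poly_Mapping.keys ((Tz ^^ Suc k) z) \<subseteq> V - src ` E"
    using Sx_zero_iff[OF Tz_iter_keys_V[OF zV]] by blast
  then have "Poly_Mapping.keys ((Tz ^^ k) z) \<subseteq> V - src ` E" by (rule assms[OF z(1)])
  then have "K0_eq R (Sx ((Tz ^^ k) z)) 0" using Sx_zero_iff[OF Tz_iter_keys_V[OF zV]] by blast
  then show "K0_eq R ((Om ^^ Suc k) c) 0" using K0_eq_zero_cong[OF Om_iter_Suc[OF z(2) zV, of k]] by blast
qed

lemma unstable_SucD:
  assumes "M \<in> fg_modules R" "\<not> stable M (Suc k)"
  obtains z where "Poly_Mapping.keys z \<subseteq> tgt ` E" "Poly_Mapping.keys ((Tz ^^ Suc k) z) \<subseteq> V - src ` E"
    "\<not> Poly_Mapping.keys ((Tz ^^ k) z) \<subseteq> V - src ` E"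
  using assms(2) stable_SucI[of k M] by blast

text \<open>Every vertex \<open>j\<close> is the target of an arrow, and the projective at its
  source modulo that arrow has the simple module at \<open>j\<close> as its syzygy. So an arbitrary
  integer vector \<open>z\<close> is the syzygy class of a combination of indecomposables, all of
  which fit into one module.\<close>

lemma unstable_exists:
  assumes nosink: "V \<subseteq> src ` E" and nosource: "V \<subseteq> tgt ` E" and ne: "V \<noteq> {}"
    and z: "Poly_Mapping.keys z \<subseteq> V" "(Tz ^^ Suc k) z = 0" "(Tz ^^ k) z \<noteq> 0"
  obtains M where "M \<in> fg_modules R" "\<not> stable M (Suc k)"
proof -
  have "\<forall>j\<in>V. \<exists>e\<in>E. tgt e = j" using nosource by blast
  then obtain a where a: "\<And>j. j \<in> V \<Longrightarrow> a j \<in> E \<and> tgt (a j) = j" by metis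
  define X where "X j = Cyc (src (a j)) {a j}" for j
  have sV: "src (a j) \<in> V" if "j \<in> V" for j using a[OF that] by simp
  have Xfg: "X ` V \<subseteq> fg_modules R" using Cyc_cover(1) sV by (auto simp: X_def)
  obtain M where M: "M \<in> fg_modules R" "\<And>N. N \<in> X ` V \<Longrightarrow> direct_summand R N M"
    using direct_summands_exist[of "X ` V" R] finite_V Xfg ne by auto
  have sum: "X ` V \<subseteq> summands R M"
    using M(2) Cyc_indecomposable sV by (auto simp: summands_def X_def)
  define c where "c = frag_extend (\<lambda>j. frag_of (X j)) z"
  have cs: "Poly_Mapping.keys c \<subseteq> summands R M"
    unfolding c_def using z(1) sum by (intro keys_frag_extend_subset) (auto simp: keys_frag_of)
  have "K0_eq R (Om (frag_extend (\<lambda>j. frag_of (X j)) y)) (Sx y)" if "Poly_Mapping.keys y \<subseteq> V" for y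
    using that
  proof (induction y rule: frag_induction)
    case (one j)
    then show ?case using syzygy_Cyc[OF sV, of j "{a j}"] a[of j] by (simp add: X_def)
  next
    case (diff a b)
    then show ?case by (simp add: frag_extend_diff K0_eq_diff)
  qed simp
  from this[OF z(1)] have Omc: "K0_eq R (Om c) (Sx z)" by (simp add: c_def)
  have "K0_eq R ((Om ^^ Suc (Suc k)) c) 0"
    using Om_iter_Suc[OF Omc z(1), of "Suc k"] z(2) by simp
  moreover have "\<not> K0_eq R ((Om ^^ Suc k) c) 0"
  proof
    assume "K0_eq R ((Om ^^ Suc k) c) 0"
    then have "K0_eq R (Sx ((Tz ^^ k) z)) 0" using K0_eq_zero_cong[OF Om_iter_Suc[OF Omc z(1), of k]] by blast
    then have "Poly_Mapping.keys ((Tz ^^ k) z) \<subseteq> V - src ` E"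
      using Sx_zero_iff[OF Tz_iter_keys_V[OF z(1)]] by blast
    then have "Poly_Mapping.keys ((Tz ^^ k) z) = {}" using nosink by blast
    then show False using z(3) by simp
  qed
  ultimately have "\<not> stable M (Suc k)" using cs unfolding stable_def by blast
  then show thesis using that M(1) by blast
qed

text \<open>With \<open>d\<close> loops, the simple module \<open>S\<close> has syzygy class
  \<open>d [S]\<close>, and \<open>X\<close>, the projective modulo one loop, has syzygy class
  \<open>[S]\<close>. Hence \<open>[S] - d [X]\<close> is killed. It is nonzero because
  \<open>S\<close> has multiplicity one in \<open>S\<close> and, another loop surviving in
  \<open>X\<close>, multiplicity zero in \<open>X\<close>.\<close>

lemma one_vertex_unstable:
  assumes V: "V = {v}" and E: "card E \<ge> 2"
  obtains M where "M \<in> fg_modules R" "\<not> stable M 0"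
proof -
  have vV: "v \<in> V" using V by simp
  obtain a b where ab: "a \<in> E" "b \<in> E" "a \<noteq> b"
  proof -
    have "\<not> (\<forall>a\<in>E. \<forall>b\<in>E. a = b)" using E card_le_Suc0_iff_eq[OF finite_E] by auto
    then show thesis using that by blast
  qed
  have st: "src e = v" "tgt e = v" if "e \<in> E" for e using src_V[OF that] tgt_V[OF that] V by auto
  let ?X = "Cyc v {a}"
  have fg: "{Sim v, ?X} \<subseteq> fg_modules R" using Cyc_cover(1)[OF vV] by simp
  obtain M where M: "M \<in> fg_modules R" "\<And>N. N \<in> {Sim v, ?X} \<Longrightarrow> direct_summand R N M"
    using direct_summands_exist[OF _ fg] by (metis finite.emptyI finite_insert insert_not_empty)
  have sum: "{Sim v, ?X} \<subseteq> summands R M"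
    using M(2) Cyc_indecomposable[OF vV] by (auto simp: summands_def)
  define c where "c = frag_of (Sim v) - frag_cmul (int (card E)) (frag_of ?X)"
  have cs: "Poly_Mapping.keys c \<subseteq> summands R M"
    unfolding c_def using sum keys_diff[of "frag_of (Sim v)" "frag_cmul (int (card E)) (frag_of ?X)"]
      keys_cmul[of "int (card E)" "frag_of ?X"] by (auto simp: keys_frag_of)
  have "K0_eq R (frag_of (syzygy R (Sim v))) (\<Sum>e\<in>{e \<in> E. src e = v}. frag_of (Sim (tgt e)))"
    unfolding Sim_out[of v] by (rule syzygy_Cyc[OF vV]) simp
  moreover have "(\<Sum>e\<in>{e \<in> E. src e = v}. frag_of (Sim (tgt e))) = frag_cmul (int (card E)) (frag_of (Sim v))"
  proof -
    have E_eq: "{e \<in> E. src e = v} = E" using st by blast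
    have tgt_eq: "(\<Sum>e\<in>E. frag_of (Sim (tgt e))) = (\<Sum>e\<in>E. frag_of (Sim v))"
      by (rule sum.cong) (auto simp: st)
    have cmul: "(\<Sum>e\<in>D. x) = frag_cmul (int (card D)) x" if "finite D" for D :: "'e set" and x :: "'r fg_module \<Rightarrow>\<^sub>0 int"
      using that by (induction D rule: finite_induct) (auto simp: frag_cmul_distrib)
    show ?thesis unfolding E_eq tgt_eq by (rule cmul[OF finite_E])
  qed
  ultimately have 1: "K0_eq R (frag_of (syzygy R (Sim v))) (frag_cmul (int (card E)) (frag_of (Sim v)))" by simp
  have 2: "K0_eq R (frag_of (syzygy R ?X)) (frag_of (Sim v))"
    using syzygy_Cyc[OF vV, of "{a}"] ab st by simp
  have "K0_eq R (Om c) (frag_cmul (int (card E)) (frag_of (Sim v)) - frag_cmul (int (card E)) (frag_of (Sim v)))"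
    unfolding c_def frag_extend_diff frag_extend_cmul frag_extend_of
    by (rule K0_eq_diff[OF 1 K0_eq_cmul[OF 2]])
  then have "K0_eq R ((Om ^^ Suc 0) c) 0" by simp
  moreover have "\<not> K0_eq R ((Om ^^ 0) c) 0"
  proof
    assume "K0_eq R ((Om ^^ 0) c) 0"
    then have "mult_frag (src a) c = mult_frag (src a) 0" by (intro mult_frag_K0_eq[OF _ ab(1)]) simp
    then have "mult_frag (src a) c = 0" by (simp add: mult_frag_simps)
    moreover have "simp_mult ?X v = 0" using simp_mult_Cyc[OF vV vV, of "{a}"] ab st by blast
    ultimately show False using simp_mult_Sim[OF vV] st(1)[OF ab(1)] by (simp add: c_def mult_frag_simps)
  qed
  ultimately have "\<not> stable M 0" using cs unfolding stable_def by blast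
  then show thesis using that M(1) by blast
qed

text \<open>Every class is a multiple of the class of the simple module. Without a loop that class
  is zero; with one loop it is fixed by the syzygy map.\<close>

lemma one_loop_stable:
  assumes V: "V = {v}" and E: "card E \<le> 1" and M: "M \<in> fg_modules R"
  shows "stable M k"
proof -
  have 0: "K0_eq R c 0" if c: "Poly_Mapping.keys c \<subseteq> fg_modules R" "K0_eq R (Om c) 0" for c
  proof -
    obtain z where z: "Poly_Mapping.keys z \<subseteq> V" "K0_eq R c (Sx z)" using one_loop_K0_frag[OF V E c(1)] by blast
    show ?thesis
    proof (cases "E = {}")
      case True
      then have "K0_eq R (Sx z) 0" using z(1) by (intro Sx_sinks) simp
      then show ?thesis using z(2) K0_eq_trans by blast
    next
      case False
      then obtain e where e: "e \<in> E" by blast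
      then have Ee: "E = {e}" using E finite_E by (metis One_nat_def card_le_Suc0_iff_eq insertI1 singleton_iff subsetI subset_antisym)
      have st: "src e = v" "tgt e = v" using src_V[OF e] tgt_V[OF e] V by auto
      have "Tz y = y" if "Poly_Mapping.keys y \<subseteq> V" for y
        using that
      proof (induction y rule: frag_induction)
        case (one i)
        then have "i = v" using V by simp
        moreover have "{e' \<in> E. src e' = v} = {e}" using Ee st by auto
        ultimately show ?case using st by (simp add: Tz_def)
      qed (simp_all add: Tz_def frag_extend_diff)
      then have "K0_eq R (Om c) (Sx z)"
        using K0_eq_trans[OF Om_K0_eq[OF z(2)] Om_Sx[OF z(1)]] z(1) by simp
      then have "K0_eq R (Sx z) 0" using c(2) K0_eq_zero_cong by blast
      then show ?thesis using z(2) K0_eq_trans by blast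
    qed
  qed
  have car: "Poly_Mapping.keys ((Om ^^ k) c) \<subseteq> fg_modules R" if "Poly_Mapping.keys c \<subseteq> fg_modules R" for k c
    using that by (induction k) (auto dest: Om_carrier)
  show ?thesis unfolding stable_def
  proof (intro allI impI)
    fix c assume "Poly_Mapping.keys c \<subseteq> summands R M" "K0_eq R ((Om ^^ Suc k) c) 0"
    then show "K0_eq R ((Om ^^ k) c) 0" using 0[of "(Om ^^ k) c"] car[of c k] summands_fg by fastforce
  qed
qed

lemma lookup_Tz:
  assumes "Poly_Mapping.keys z \<subseteq> V"
  shows "Poly_Mapping.lookup (Tz z) j =
    (\<Sum>i\<in>V. Poly_Mapping.lookup z i * int (card {e \<in> E. src e = i \<and> tgt e = j}))"
  using assms
proof (induction z rule: frag_induction)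
  case (one i)
  have "Poly_Mapping.lookup (\<Sum>e\<in>{e \<in> E. src e = i}. frag_of (tgt e)) j
      = (\<Sum>e\<in>{e \<in> E. src e = i}. if tgt e = j then 1 else 0)"
    unfolding lookup_sum by (intro sum.cong) auto
  also have "\<dots> = int (card {e \<in> E. src e = i \<and> tgt e = j})"
    using finite_E by (simp add: sum.If_cases Int_def conj_assoc)
  finally have 1: "Poly_Mapping.lookup (Tz (frag_of i)) j = int (card {e \<in> E. src e = i \<and> tgt e = j})"
    by (simp add: Tz_def)
  have "(\<Sum>l\<in>V. Poly_Mapping.lookup (frag_of i) l * int (card {e \<in> E. src e = l \<and> tgt e = j}))
      = (\<Sum>l\<in>V. if l = i then int (card {e \<in> E. src e = l \<and> tgt e = j}) else 0)"
    by (intro sum.cong) auto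
  then show ?case using 1 one finite_V by simp
next
  case (diff a b)
  then show ?case by (simp add: Tz_def frag_extend_diff lookup_minus left_diff_distrib sum_subtractf)
qed (simp add: Tz_def)

end

section \<open>The path algebra and its quotient\<close>

lemma poly_mapping_sum_singles:
  fixes f :: "'a \<Rightarrow>\<^sub>0 'k::comm_monoid_add"
  shows "f = (\<Sum>x\<in>Poly_Mapping.keys f. Poly_Mapping.single x (Poly_Mapping.lookup f x))"
proof (rule poly_mapping_eqI)
  fix y
  have "(\<Sum>x\<in>Poly_Mapping.keys f. Poly_Mapping.lookup (Poly_Mapping.single x (Poly_Mapping.lookup f x)) y)
      = (\<Sum>x\<in>Poly_Mapping.keys f. if x = y then Poly_Mapping.lookup f x else 0)"
    by (intro sum.cong) (auto simp: lookup_single when_def)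
  then show "Poly_Mapping.lookup f y
      = Poly_Mapping.lookup (\<Sum>x\<in>Poly_Mapping.keys f. Poly_Mapping.single x (Poly_Mapping.lookup f x)) y"
    by (simp add: lookup_sum in_keys_iff)
qed

text \<open>Reduces the ring laws and the coordinate formulas to products of single paths.
  Restricting to \<open>S\<close> allows the monomials to be genuine paths.\<close>

lemma additive_eqI:
  fixes F H :: "('a \<Rightarrow>\<^sub>0 'k::comm_monoid_add) \<Rightarrow> 'c::ab_group_add"
  assumes F: "\<And>f g. F (f + g) = F f + F g" and H: "\<And>f g. H (f + g) = H f + H g"
    and S: "Poly_Mapping.keys f \<subseteq> S"
    and eq: "\<And>x c. x \<in> S \<Longrightarrow> F (Poly_Mapping.single x c) = H (Poly_Mapping.single x c)"
  shows "F f = H f"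
proof -
  have FH0: "F 0 = 0" "H 0 = 0" using F[of 0 0] H[of 0 0] by auto
  have "F (\<Sum>x\<in>X. Poly_Mapping.single x (Poly_Mapping.lookup f x))
      = H (\<Sum>x\<in>X. Poly_Mapping.single x (Poly_Mapping.lookup f x))" if "finite X" "X \<subseteq> S" for X
    using that by (induction X rule: finite_induct) (auto simp: F H eq FH0)
  then show ?thesis using poly_mapping_sum_singles[of f] S by (metis finite_keys)
qed

section \<open>The path algebra as a ring\<close>

context fin_digraph
begin

text \<open>Product of two monomials with the coefficients as separate arguments. It is additive in
  each of them and zero at zero, so the double sum may run over any finite sets containing the
  supports.\<close>

definition path_mul :: "('a \<times> 'b list) \<Rightarrow> ('a \<times> 'b list) \<Rightarrow> 'k \<Rightarrow> 'k \<Rightarrow> ('a \<times> 'b list \<Rightarrow>\<^sub>0 'k::field)" where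
  "path_mul x y c d = (if awlast (fst x) (snd x) = fst y
     then Poly_Mapping.single (fst x, snd x @ snd y) (c * d) else 0)"

definition pmul :: "('a \<times> 'b list \<Rightarrow>\<^sub>0 'k) \<Rightarrow> ('a \<times> 'b list \<Rightarrow>\<^sub>0 'k) \<Rightarrow> ('a \<times> 'b list \<Rightarrow>\<^sub>0 'k::field)" where
  "pmul f g = (\<Sum>x\<in>Poly_Mapping.keys f. \<Sum>y\<in>Poly_Mapping.keys g.
     path_mul x y (Poly_Mapping.lookup f x) (Poly_Mapping.lookup g y))"

definition pone :: "'a \<times> 'b list \<Rightarrow>\<^sub>0 'k::field" where
  "pone = (\<Sum>v\<in>verts G. Poly_Mapping.single (v, []) 1)"

abbreviation PA :: "('a \<times> 'b list \<Rightarrow>\<^sub>0 'k::field) ring" where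
  "PA \<equiv> path_algebra G"

lemma PA_simps [simp]:
  "carrier PA = {f. Poly_Mapping.keys f \<subseteq> paths G}" "f \<otimes>\<^bsub>PA\<^esub> g = pmul f g" "\<one>\<^bsub>PA\<^esub> = pone"
  "\<zero>\<^bsub>PA\<^esub> = 0" "f \<oplus>\<^bsub>PA\<^esub> g = f + g"
  by (simp_all add: path_algebra_def pmul_def path_mul_def pone_def case_prod_unfold cong: if_cong)

lemma path_mul_simps [simp]: "path_mul x y 0 d = 0" "path_mul x y c 0 = 0"
  "path_mul x y (c + c') d = path_mul x y c d + path_mul x y c' d"
  "path_mul x y c (d + d') = path_mul x y c d + path_mul x y c d'"
  by (auto simp: path_mul_def single_add distrib_right distrib_left)

lemma pmul_superset:
  assumes "finite X" "finite Y" "Poly_Mapping.keys f \<subseteq> X" "Poly_Mapping.keys g \<subseteq> Y"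
  shows "pmul f g = (\<Sum>x\<in>X. \<Sum>y\<in>Y. path_mul x y (Poly_Mapping.lookup f x) (Poly_Mapping.lookup g y))"
proof -
  have "pmul f g = (\<Sum>x\<in>Poly_Mapping.keys f. \<Sum>y\<in>Y. path_mul x y (Poly_Mapping.lookup f x) (Poly_Mapping.lookup g y))"
    unfolding pmul_def by (intro sum.cong refl sum.mono_neutral_left assms) (auto simp: in_keys_iff)
  also have "\<dots> = (\<Sum>x\<in>X. \<Sum>y\<in>Y. path_mul x y (Poly_Mapping.lookup f x) (Poly_Mapping.lookup g y))"
    by (intro sum.mono_neutral_left assms) (auto simp: in_keys_iff)
  finally show ?thesis .
qed

lemma pmul_add_left: "pmul (f + f') g = pmul f g + pmul f' g"
proof -
  let ?X = "Poly_Mapping.keys f \<union> Poly_Mapping.keys f'" and ?Y = "Poly_Mapping.keys g"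
  show ?thesis
    by (simp add: pmul_superset[of ?X ?Y "f + f'"] pmul_superset[of ?X ?Y f] pmul_superset[of ?X ?Y f']
        keys_add lookup_add sum.distrib)
qed

lemma pmul_add_right: "pmul f (g + g') = pmul f g + pmul f g'"
proof -
  let ?X = "Poly_Mapping.keys f" and ?Y = "Poly_Mapping.keys g \<union> Poly_Mapping.keys g'"
  show ?thesis
    by (simp add: pmul_superset[of ?X ?Y f "g + g'"] pmul_superset[of ?X ?Y f g] pmul_superset[of ?X ?Y f g']
        keys_add lookup_add sum.distrib)
qed

lemma pmul_zero [simp]: "pmul 0 g = 0" "pmul f 0 = 0"
  by (simp_all add: pmul_def)

lemma pmul_sum_left: "pmul (\<Sum>x\<in>X. F x) g = (\<Sum>x\<in>X. pmul (F x) g)"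
  by (induction X rule: infinite_finite_induct) (simp_all add: pmul_add_left)

lemma pmul_sum_right: "pmul f (\<Sum>x\<in>X. F x) = (\<Sum>x\<in>X. pmul f (F x))"
  by (induction X rule: infinite_finite_induct) (simp_all add: pmul_add_right)

lemma pmul_single: "pmul (Poly_Mapping.single x c) (Poly_Mapping.single y d) = path_mul x y c d"
  by (subst pmul_superset[of "{x}" "{y}"]) auto

lemma paths_iff: "(u, p) \<in> paths G \<longleftrightarrow> awalk u p (awlast u p)"
  by (auto simp: paths_def)

lemma paths_append: "(u, p) \<in> paths G \<Longrightarrow> (awlast u p, q) \<in> paths G \<Longrightarrow> (u, p @ q) \<in> paths G"
  by (simp add: paths_iff awlast_append)

lemma paths_Nil: "(u, []) \<in> paths G \<longleftrightarrow> u \<in> verts G"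
  by (simp add: paths_iff awalk_Nil_iff)

lemma paths_Cons: "(u, e # p) \<in> paths G \<longleftrightarrow> e \<in> arcs G \<and> u = tail G e \<and> (head G e, p) \<in> paths G"
  by (auto simp: paths_def awalk_Cons_iff)

lemma paths_ends: "(u, p) \<in> paths G \<Longrightarrow> u \<in> verts G" "(u, p) \<in> paths G \<Longrightarrow> awlast u p \<in> verts G"
  by (auto simp: paths_iff intro: awalk_hd_in_verts awalk_last_in_verts)

lemma pmul_closed:
  assumes "Poly_Mapping.keys f \<subseteq> paths G" "Poly_Mapping.keys g \<subseteq> paths G"
  shows "Poly_Mapping.keys (pmul f g) \<subseteq> paths G"
proof -
  have pm: "Poly_Mapping.keys (path_mul x y c d) \<subseteq> paths G" if "x \<in> paths G" "y \<in> paths G" for x y and c d :: 'c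
    using that paths_append by (cases x; cases y) (auto simp: path_mul_def)
  show ?thesis
    unfolding pmul_def
    by (intro order_trans[OF Poly_Mapping.keys_sum] UN_least pm) (use assms in auto)
qed

lemma pmul_assoc:
  fixes f g h :: "'a \<times> 'b list \<Rightarrow>\<^sub>0 'k::field"
  shows "pmul (pmul f g) h = pmul f (pmul g h)"
proof -
  have 3: "pmul (pmul (Poly_Mapping.single x a) (Poly_Mapping.single y b)) (Poly_Mapping.single z c)
      = pmul (Poly_Mapping.single x a) (pmul (Poly_Mapping.single y b) (Poly_Mapping.single z c))" for x y z and a b c :: 'k
    unfolding pmul_single by (auto simp: path_mul_def pmul_single awlast_append mult.assoc)
  have 2: "pmul (pmul (Poly_Mapping.single x a) (Poly_Mapping.single y b)) h
      = pmul (Poly_Mapping.single x a) (pmul (Poly_Mapping.single y b) h)" for x y and a b :: 'k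
    by (rule additive_eqI[where F = "\<lambda>h. pmul (pmul _ _) h" and H = "\<lambda>h. pmul _ (pmul _ h)" and S = UNIV])
       (simp_all add: pmul_add_left pmul_add_right 3)
  have 1: "pmul (pmul (Poly_Mapping.single x a) g) h = pmul (Poly_Mapping.single x a) (pmul g h)" for x and a :: 'k
    by (rule additive_eqI[where F = "\<lambda>g. pmul (pmul _ g) h" and H = "\<lambda>g. pmul _ (pmul g h)" and S = UNIV])
       (simp_all add: pmul_add_left pmul_add_right 2)
  show ?thesis
    by (rule additive_eqI[where F = "\<lambda>f. pmul (pmul f g) h" and H = "\<lambda>f. pmul f (pmul g h)" and S = UNIV])
       (simp_all add: pmul_add_left pmul_add_right 1)
qed

lemma pone_closed: "Poly_Mapping.keys pone \<subseteq> paths G"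
  unfolding pone_def
  by (intro order_trans[OF Poly_Mapping.keys_sum] UN_least) (auto simp: paths_Nil)

lemma pmul_pone:
  fixes f :: "'a \<times> 'b list \<Rightarrow>\<^sub>0 'k::field"
  assumes f: "Poly_Mapping.keys f \<subseteq> paths G"
  shows "pmul pone f = f" "pmul f pone = f"
proof -
  have 1: "pmul pone (Poly_Mapping.single x c) = Poly_Mapping.single x c"
    "pmul (Poly_Mapping.single x c) pone = Poly_Mapping.single x c" if "x \<in> paths G" for x and c :: 'k
  proof -
    obtain u p where x: "x = (u, p)" by force
    have "pmul pone (Poly_Mapping.single x c) = (\<Sum>v\<in>verts G. if v = u then Poly_Mapping.single x c else 0)"
      unfolding pone_def pmul_sum_left pmul_single by (intro sum.cong) (auto simp: x path_mul_def)
    then show "pmul pone (Poly_Mapping.single x c) = Poly_Mapping.single x c"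
      using paths_ends(1) that x by simp
    have "pmul (Poly_Mapping.single x c) pone = (\<Sum>v\<in>verts G. if v = awlast u p then Poly_Mapping.single x c else 0)"
      unfolding pone_def pmul_sum_right pmul_single by (intro sum.cong) (auto simp: x path_mul_def)
    then show "pmul (Poly_Mapping.single x c) pone = Poly_Mapping.single x c"
      using paths_ends(2) that x by simp
  qed
  show "pmul pone f = f"
    by (rule additive_eqI[where F = "pmul pone" and H = "\<lambda>f. f", OF _ _ f]) (simp_all add: pmul_add_right 1)
  show "pmul f pone = f"
    by (rule additive_eqI[where F = "\<lambda>f. pmul f pone" and H = "\<lambda>f. f", OF _ _ f]) (simp_all add: pmul_add_left 1)
qed

lemma ring_PA: "ring (PA :: ('a \<times> 'b list \<Rightarrow>\<^sub>0 'k::field) ring)"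
proof (rule ringI)
  show "abelian_group (PA :: ('a \<times> 'b list \<Rightarrow>\<^sub>0 'k) ring)"
  proof (rule abelian_groupI)
    fix x y :: "'a \<times> 'b list \<Rightarrow>\<^sub>0 'k" assume "x \<in> carrier PA" "y \<in> carrier PA"
    then show "x \<oplus>\<^bsub>PA\<^esub> y \<in> carrier PA" using keys_add[of x y] by auto
  next
    fix x :: "'a \<times> 'b list \<Rightarrow>\<^sub>0 'k" assume "x \<in> carrier PA"
    then show "\<exists>y\<in>carrier PA. y \<oplus>\<^bsub>PA\<^esub> x = \<zero>\<^bsub>PA\<^esub>" by (intro bexI[of _ "- x"]) auto
  qed (auto simp: algebra_simps)
  show "monoid (PA :: ('a \<times> 'b list \<Rightarrow>\<^sub>0 'k) ring)"
    by unfold_locales (simp_all add: pmul_closed pone_closed pmul_assoc pmul_pone)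
qed (simp_all add: pmul_add_left pmul_add_right)

section \<open>The arrow ideal and its square in coordinates\<close>

definition pv :: "('a \<times> 'b list \<Rightarrow>\<^sub>0 'k::field) \<Rightarrow> 'a \<Rightarrow> 'k" where
  "pv f v = Poly_Mapping.lookup f (v, [])"

definition pa :: "('a \<times> 'b list \<Rightarrow>\<^sub>0 'k::field) \<Rightarrow> 'b \<Rightarrow> 'k" where
  "pa f e = Poly_Mapping.lookup f (tail G e, [e])"

lemma pv_pa_add: "pv (f + g) v = pv f v + pv g v" "pa (f + g) e = pa f e + pa g e"
  by (simp_all add: pv_def pa_def lookup_add)

lemma pv_pmul:
  fixes f g :: "'a \<times> 'b list \<Rightarrow>\<^sub>0 'k::field"
  shows "pv (pmul f g) v = pv f v * pv g v"
proof -
  have 2: "pv (pmul (Poly_Mapping.single x a) (Poly_Mapping.single y b)) v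
      = pv (Poly_Mapping.single x a) v * pv (Poly_Mapping.single y b) v" for x y and a b :: 'k
    unfolding pmul_single by (cases x; cases y) (auto simp: path_mul_def pv_def lookup_single when_def)
  have 1: "pv (pmul (Poly_Mapping.single x a) g) v = pv (Poly_Mapping.single x a) v * pv g v" for x and a :: 'k
    by (rule additive_eqI[where F = "\<lambda>g. pv (pmul _ g) v" and H = "\<lambda>g. _ * pv g v" and S = UNIV])
       (simp_all add: pmul_add_right pv_pa_add distrib_left 2)
  show ?thesis
    by (rule additive_eqI[where F = "\<lambda>f. pv (pmul f g) v" and H = "\<lambda>f. pv f v * _" and S = UNIV])
       (simp_all add: pmul_add_left pv_pa_add distrib_right 1)
qed

lemma pa_pmul:
  fixes f g :: "'a \<times> 'b list \<Rightarrow>\<^sub>0 'k::field"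
  assumes "Poly_Mapping.keys f \<subseteq> paths G" "Poly_Mapping.keys g \<subseteq> paths G" "e \<in> arcs G"
  shows "pa (pmul f g) e = pv f (tail G e) * pa g e + pa f e * pv g (head G e)"
proof -
  have 2: "pa (pmul (Poly_Mapping.single x a) (Poly_Mapping.single y b)) e
      = pv (Poly_Mapping.single x a) (tail G e) * pa (Poly_Mapping.single y b) e
        + pa (Poly_Mapping.single x a) e * pv (Poly_Mapping.single y b) (head G e)"
    if "x \<in> paths G" "y \<in> paths G" for x y and a b :: 'k
  proof -
    obtain u p w q where xy: "x = (u, p)" "y = (w, q)" by force
    \<comment> \<open>An arrow has only two factorisations into paths: through the trivial path at
      its tail or at its head.\<close>
    have *: "(u, p @ q) = (tail G e, [e]) \<and> awlast u p = w \<longleftrightarrow>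
      (u = tail G e \<and> p = [] \<and> w = tail G e \<and> q = [e]) \<or> (u = tail G e \<and> p = [e] \<and> w = head G e \<and> q = [])"
      by (auto simp: append_eq_Cons_conv)
    show ?thesis unfolding pmul_single using *
      by (auto simp: xy path_mul_def pv_def pa_def lookup_single when_def)
  qed
  have 1: "pa (pmul (Poly_Mapping.single x a) g) e
      = pv (Poly_Mapping.single x a) (tail G e) * pa g e + pa (Poly_Mapping.single x a) e * pv g (head G e)"
    if "x \<in> paths G" for x and a :: 'k
    by (rule additive_eqI[where F = "\<lambda>g. pa (pmul _ g) e" and H = "\<lambda>g. _ * pa g e + _ * pv g (head G e)", OF _ _ assms(2)])
       (simp_all add: pmul_add_right pv_pa_add distrib_left 2[OF that])
  show ?thesis
    by (rule additive_eqI[where F = "\<lambda>f. pa (pmul f g) e" and H = "\<lambda>f. pv f (tail G e) * _ + pa f e * _", OF _ _ assms(1)])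
       (simp_all add: pmul_add_left pv_pa_add distrib_right 1)
qed

text \<open>\<open>rad1\<close> and \<open>rad2\<close> are the combinations of paths of length at
  least one and at least two, which turn out to be \<open>J\<close> and its square.\<close>

definition rad1 :: "('a \<times> 'b list \<Rightarrow>\<^sub>0 'k::field) set" where
  "rad1 = {f. Poly_Mapping.keys f \<subseteq> paths G \<and> (\<forall>v. pv f v = 0)}"

definition rad2 :: "('a \<times> 'b list \<Rightarrow>\<^sub>0 'k::field) set" where
  "rad2 = {f \<in> rad1. \<forall>e\<in>arcs G. pa f e = 0}"

lemma pv_pa_minus: "pv (- f) v = - pv f v" "pa (- f) e = - pa f e"
  by (simp_all add: pv_def pa_def)

lemma single_closed_sum:
  assumes add: "\<And>f g. f \<in> I \<Longrightarrow> g \<in> I \<Longrightarrow> f + g \<in> I" and 0: "0 \<in> I"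
    and f: "\<And>x. x \<in> Poly_Mapping.keys f \<Longrightarrow> Poly_Mapping.single x (Poly_Mapping.lookup f x) \<in> I"
  shows "(f :: 'x \<Rightarrow>\<^sub>0 'k::comm_monoid_add) \<in> I"
proof -
  have "(\<Sum>x\<in>X. Poly_Mapping.single x (Poly_Mapping.lookup f x)) \<in> I" if "finite X" "X \<subseteq> Poly_Mapping.keys f" for X
    using that by (induction X rule: finite_induct) (auto intro: add 0 f)
  then show ?thesis using poly_mapping_sum_singles[of f] by (metis finite_keys order_refl)
qed

text \<open>A path of positive length is its first arrow times the remaining path, hence lies in the
  ideal generated by the arrows.\<close>

lemma arrow_ideal_eq: "arrow_ideal G = (rad1 :: ('a \<times> 'b list \<Rightarrow>\<^sub>0 'k::field) set)"
proof
  interpret P: ring "PA :: ('a \<times> 'b list \<Rightarrow>\<^sub>0 'k) ring" by (rule ring_PA)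
  let ?A = "(\<lambda>e. Poly_Mapping.single (tail G e, [e]) 1) ` arcs G :: ('a \<times> 'b list \<Rightarrow>\<^sub>0 'k) set"
  have A: "?A \<subseteq> carrier PA" by (auto simp: paths_Cons paths_Nil)
  have "ideal (rad1 :: ('a \<times> 'b list \<Rightarrow>\<^sub>0 'k) set) PA"
  proof (rule idealI[OF ring_PA])
    show "subgroup (rad1 :: ('a \<times> 'b list \<Rightarrow>\<^sub>0 'k) set) (add_monoid PA)"
    proof (rule P.add.subgroupI)
      show "(rad1 :: ('a \<times> 'b list \<Rightarrow>\<^sub>0 'k) set) \<subseteq> carrier PA" by (auto simp: rad1_def)
      show "(rad1 :: ('a \<times> 'b list \<Rightarrow>\<^sub>0 'k) set) \<noteq> {}" by (auto simp: rad1_def pv_def intro!: exI[of _ 0])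
    next
      fix f :: "'a \<times> 'b list \<Rightarrow>\<^sub>0 'k" assume f: "f \<in> rad1"
      have "\<ominus>\<^bsub>PA\<^esub> f = - f" using f by (intro P.minus_equality) (auto simp: rad1_def)
      then show "\<ominus>\<^bsub>PA\<^esub> f \<in> rad1" using f by (simp add: rad1_def pv_pa_minus)
    next
      fix f g :: "'a \<times> 'b list \<Rightarrow>\<^sub>0 'k" assume "f \<in> rad1" "g \<in> rad1"
      then show "f \<oplus>\<^bsub>PA\<^esub> g \<in> rad1" using keys_add[of f g] by (auto simp: rad1_def pv_pa_add)
    qed
  qed (simp_all add: rad1_def pv_pmul pmul_closed)
  moreover have "?A \<subseteq> rad1" using A by (auto simp: rad1_def pv_def lookup_single)
  ultimately show "arrow_ideal G \<subseteq> (rad1 :: ('a \<times> 'b list \<Rightarrow>\<^sub>0 'k) set)"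
    unfolding arrow_ideal_def by (rule P.genideal_minimal)
  interpret I: ideal "arrow_ideal G" "PA :: ('a \<times> 'b list \<Rightarrow>\<^sub>0 'k) ring"
    unfolding arrow_ideal_def by (rule P.genideal_ideal[OF A])
  show "(rad1 :: ('a \<times> 'b list \<Rightarrow>\<^sub>0 'k) set) \<subseteq> arrow_ideal G"
  proof
    fix f :: "'a \<times> 'b list \<Rightarrow>\<^sub>0 'k" assume f: "f \<in> rad1"
    show "f \<in> arrow_ideal G"
    proof (rule single_closed_sum)
      show "f \<in> arrow_ideal G \<Longrightarrow> g \<in> arrow_ideal G \<Longrightarrow> f + g \<in> arrow_ideal G" for f g :: "'a \<times> 'b list \<Rightarrow>\<^sub>0 'k"
        using I.a_closed by simp
      show "0 \<in> (arrow_ideal G :: ('a \<times> 'b list \<Rightarrow>\<^sub>0 'k) set)" using I.zero_closed by simp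
      fix x assume x: "x \<in> Poly_Mapping.keys f"
      obtain u p where up: "x = (u, p)" by force
      have "p \<noteq> []" using f x up by (auto simp: rad1_def pv_def in_keys_iff)
      then obtain e q where p: "p = e # q" by (cases p) auto
      have xp: "(u, e # q) \<in> paths G" using f x up p by (auto simp: rad1_def)
      then have e: "e \<in> arcs G" "u = tail G e" "(head G e, q) \<in> paths G" by (auto simp: paths_Cons)
      have "Poly_Mapping.single x (Poly_Mapping.lookup f x)
          = pmul (Poly_Mapping.single (tail G e, [e]) 1) (Poly_Mapping.single (head G e, q) (Poly_Mapping.lookup f x))"
        unfolding pmul_single by (simp add: path_mul_def up p e)
      moreover have "Poly_Mapping.single (tail G e, [e]) 1 \<in> (arrow_ideal G :: ('a \<times> 'b list \<Rightarrow>\<^sub>0 'k) set)"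
        using P.genideal_self[OF A] e(1) unfolding arrow_ideal_def by blast
      ultimately show "Poly_Mapping.single x (Poly_Mapping.lookup f x) \<in> arrow_ideal G"
        using I.I_r_closed[of "Poly_Mapping.single (tail G e, [e]) 1" "Poly_Mapping.single (head G e, q) (Poly_Mapping.lookup f x)"]
          e(3) by simp
    qed
  qed
qed

lemma arrow_ideal_ideal: "ideal (arrow_ideal G :: ('a \<times> 'b list \<Rightarrow>\<^sub>0 'k::field) set) PA"
  unfolding arrow_ideal_def
  by (rule ring.genideal_ideal[OF ring_PA]) (auto simp: paths_Cons paths_Nil)

text \<open>A path of length at least two is its first arrow times a path of positive length, a
  product of two members of the arrow ideal. The other inclusion follows from the coordinate
  formulas for products.\<close>

lemma arrow_ideal_square:
  "arrow_ideal G \<cdot>\<^bsub>PA\<^esub> arrow_ideal G = (rad2 :: ('a \<times> 'b list \<Rightarrow>\<^sub>0 'k::field) set)"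
proof
  interpret P: ring "PA :: ('a \<times> 'b list \<Rightarrow>\<^sub>0 'k) ring" by (rule ring_PA)
  note sq = P.ideal_prod_is_ideal[OF arrow_ideal_ideal arrow_ideal_ideal]
  interpret S: ideal "arrow_ideal G \<cdot>\<^bsub>PA\<^esub> arrow_ideal G" "PA :: ('a \<times> 'b list \<Rightarrow>\<^sub>0 'k) ring" by (rule sq)
  show "arrow_ideal G \<cdot>\<^bsub>PA\<^esub> arrow_ideal G \<subseteq> (rad2 :: ('a \<times> 'b list \<Rightarrow>\<^sub>0 'k) set)"
  proof
    fix f :: "'a \<times> 'b list \<Rightarrow>\<^sub>0 'k" assume "f \<in> arrow_ideal G \<cdot>\<^bsub>PA\<^esub> arrow_ideal G"
    then show "f \<in> rad2"
    proof (induction rule: ideal_prod.induct)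
      case (prod i j)
      then show ?case unfolding arrow_ideal_eq
        by (auto simp: rad2_def rad1_def pv_pmul pa_pmul dest: pmul_closed[of i j, THEN subsetD])
    next
      case (sum f g)
      then show ?case using keys_add[of f g] by (auto simp: rad2_def rad1_def pv_pa_add)
    qed
  qed
  show "(rad2 :: ('a \<times> 'b list \<Rightarrow>\<^sub>0 'k) set) \<subseteq> arrow_ideal G \<cdot>\<^bsub>PA\<^esub> arrow_ideal G"
  proof
    fix f :: "'a \<times> 'b list \<Rightarrow>\<^sub>0 'k" assume f: "f \<in> rad2"
    show "f \<in> arrow_ideal G \<cdot>\<^bsub>PA\<^esub> arrow_ideal G"
    proof (rule single_closed_sum)
      show "f \<in> arrow_ideal G \<cdot>\<^bsub>PA\<^esub> arrow_ideal G \<Longrightarrow> g \<in> arrow_ideal G \<cdot>\<^bsub>PA\<^esub> arrow_ideal G \<Longrightarrow>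
        f + g \<in> arrow_ideal G \<cdot>\<^bsub>PA\<^esub> arrow_ideal G" for f g :: "'a \<times> 'b list \<Rightarrow>\<^sub>0 'k"
        using S.a_closed by simp
      show "0 \<in> (arrow_ideal G \<cdot>\<^bsub>PA\<^esub> arrow_ideal G :: ('a \<times> 'b list \<Rightarrow>\<^sub>0 'k) set)" using S.zero_closed by simp
      fix x assume x: "x \<in> Poly_Mapping.keys f"
      obtain u p where up: "x = (u, p)" by force
      have xp: "(u, p) \<in> paths G" using f x up by (auto simp: rad1_def rad2_def)
      have "p \<noteq> []" using f x up by (auto simp: rad1_def rad2_def pv_def in_keys_iff)
      then obtain e q where p: "p = e # q" by (cases p) auto
      have e: "e \<in> arcs G" "u = tail G e" "(head G e, q) \<in> paths G" using xp p by (auto simp: paths_Cons)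
      have "q \<noteq> []"
      proof
        assume "q = []"
        then have "pa f e \<noteq> 0" using x up p e(2) by (simp add: pa_def in_keys_iff)
        then show False using f e(1) by (simp add: rad2_def)
      qed
      then have "Poly_Mapping.single (head G e, q) (Poly_Mapping.lookup f x) \<in> (arrow_ideal G :: ('a \<times> 'b list \<Rightarrow>\<^sub>0 'k) set)"
        unfolding arrow_ideal_eq using e(3) by (auto simp: rad1_def pv_def lookup_single)
      moreover have "Poly_Mapping.single (tail G e, [e]) 1 \<in> (arrow_ideal G :: ('a \<times> 'b list \<Rightarrow>\<^sub>0 'k) set)"
        unfolding arrow_ideal_eq using e(1) by (auto simp: rad1_def pv_def lookup_single paths_Cons paths_Nil)
      ultimately have "Poly_Mapping.single (tail G e, [e]) 1 \<otimes>\<^bsub>PA\<^esub> Poly_Mapping.single (head G e, q) (Poly_Mapping.lookup f x)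
          \<in> arrow_ideal G \<cdot>\<^bsub>PA\<^esub> arrow_ideal G" by (intro ideal_prod.prod)
      moreover have "Poly_Mapping.single (tail G e, [e]) 1 \<otimes>\<^bsub>PA\<^esub> Poly_Mapping.single (head G e, q) (Poly_Mapping.lookup f x)
          = Poly_Mapping.single x (Poly_Mapping.lookup f x)"
        by (simp add: pmul_single path_mul_def up p e)
      ultimately show "Poly_Mapping.single x (Poly_Mapping.lookup f x) \<in> arrow_ideal G \<cdot>\<^bsub>PA\<^esub> arrow_ideal G" by simp
    qed
  qed
qed

lemma rad2_ideal: "ideal (rad2 :: ('a \<times> 'b list \<Rightarrow>\<^sub>0 'k::field) set) PA"
  using ring.ideal_prod_is_ideal[OF ring_PA arrow_ideal_ideal arrow_ideal_ideal] arrow_ideal_square by metis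

section \<open>The quotient by the square of the arrow ideal\<close>

definition qcoset :: "('a \<times> 'b list \<Rightarrow>\<^sub>0 'k::field) \<Rightarrow> ('a \<times> 'b list \<Rightarrow>\<^sub>0 'k) set" where
  "qcoset f = rad2 +>\<^bsub>PA\<^esub> f"

lemma qcoset_eq: "qcoset f = {h + f | h. h \<in> rad2}"
  by (auto simp: qcoset_def a_r_coset_def r_coset_def)

definition qv :: "('a \<times> 'b list \<Rightarrow>\<^sub>0 'k::field) set \<Rightarrow> 'a \<Rightarrow> 'k" where
  "qv X = pv (SOME f. f \<in> X)"

definition qa :: "('a \<times> 'b list \<Rightarrow>\<^sub>0 'k::field) set \<Rightarrow> 'b \<Rightarrow> 'k" where
  "qa X = pa (SOME f. f \<in> X)"

definition qmk :: "('a \<Rightarrow> 'k) \<Rightarrow> ('b \<Rightarrow> 'k) \<Rightarrow> ('a \<times> 'b list \<Rightarrow>\<^sub>0 'k::field) set" where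
  "qmk c d = qcoset ((\<Sum>v\<in>verts G. Poly_Mapping.single (v, []) (c v)) +
     (\<Sum>e\<in>arcs G. Poly_Mapping.single (tail G e, [e]) (d e)))"

lemma qv_qcoset: "qv (qcoset f) v = pv f v" and qa_qcoset: "e \<in> arcs G \<Longrightarrow> qa (qcoset f) e = pa f e"
proof -
  have "0 \<in> rad2" by (auto simp: rad2_def rad1_def pv_def pa_def)
  then have "f \<in> qcoset f" by (auto simp: qcoset_eq intro!: exI[of _ 0])
  then have "(SOME g. g \<in> qcoset f) \<in> qcoset f" by (rule someI)
  then obtain h where h: "h \<in> rad2" "(SOME g. g \<in> qcoset f) = h + f" unfolding qcoset_eq by blast
  show "qv (qcoset f) v = pv f v" using h by (simp add: qv_def pv_pa_add rad2_def rad1_def)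
  show "qa (qcoset f) e = pa f e" if "e \<in> arcs G" using h that by (simp add: qa_def pv_pa_add rad2_def)
qed

lemma qcoset_eqI:
  assumes fg: "Poly_Mapping.keys f \<subseteq> paths G" "Poly_Mapping.keys g \<subseteq> paths G"
    and "\<And>v. v \<in> verts G \<Longrightarrow> pv f v = pv g v" "\<And>e. e \<in> arcs G \<Longrightarrow> pa f e = pa g e"
  shows "qcoset f = qcoset g"
proof -
  have *: "qcoset f \<subseteq> qcoset g" if fg: "Poly_Mapping.keys f \<subseteq> paths G" "Poly_Mapping.keys g \<subseteq> paths G"
    and eq: "\<And>v. v \<in> verts G \<Longrightarrow> pv f v = pv g v" "\<And>e. e \<in> arcs G \<Longrightarrow> pa f e = pa g e"
    for f g :: "'a \<times> 'b list \<Rightarrow>\<^sub>0 'c"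
  proof
    fix x assume "x \<in> qcoset f"
    then obtain h where h: "h \<in> rad2" "x = h + f" unfolding qcoset_eq by blast
    have pv0: "pv f v = 0" if "v \<notin> verts G" "Poly_Mapping.keys f \<subseteq> paths G" for v and f :: "'a \<times> 'b list \<Rightarrow>\<^sub>0 'c"
      using that by (metis in_keys_iff paths_Nil pv_def subsetD)
    have eqv: "pv f v = pv g v" for v using eq(1)[of v] pv0[of v f] pv0[of v g] fg by (cases "v \<in> verts G") auto
    have "Poly_Mapping.keys (h + f + - g) \<subseteq> paths G"
    proof -
      have "Poly_Mapping.keys h \<subseteq> paths G" using h(1) by (simp add: rad2_def rad1_def)
      then show ?thesis using fg keys_add[of "h + f" "- g"] keys_add[of h f] unfolding keys_minus by blast
    qed
    then have "h + f + - g \<in> rad2"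
      using h(1) eq(2) eqv by (simp add: rad2_def rad1_def pv_pa_add pv_pa_minus del: add_uminus_conv_diff)
    moreover have "x = (h + f + - g) + g" using h(2) by simp
    ultimately show "x \<in> qcoset g" unfolding qcoset_eq by blast
  qed
  show ?thesis using *[OF assms] *[OF fg(2,1)] assms(3,4) by (intro equalityI) simp_all
qed

lemma rad_square_zero_quotient:
  "rad_square_zero (rad_square_zero_algebra TYPE('k::field) G) (verts G) (arcs G) (tail G) (head G) qv qa
     (qmk :: _ \<Rightarrow> _ \<Rightarrow> ('a \<times> 'b list \<Rightarrow>\<^sub>0 'k) set)"
proof -
  let ?R = "rad_square_zero_algebra TYPE('k) G"
  interpret P: ring "PA :: ('a \<times> 'b list \<Rightarrow>\<^sub>0 'k) ring" by (rule ring_PA)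
  interpret I: ideal rad2 "PA :: ('a \<times> 'b list \<Rightarrow>\<^sub>0 'k) ring" by (rule rad2_ideal)
  have R: "?R = PA Quot rad2" by (simp add: rad_square_zero_algebra_def arrow_ideal_square)
  note hom = I.rcos_ring_hom
  have car: "r \<in> carrier ?R \<longleftrightarrow> (\<exists>f. Poly_Mapping.keys f \<subseteq> paths G \<and> r = qcoset f)" for r
    unfolding R FactRing_def A_RCOSETS_def' qcoset_def by auto
  have add: "qcoset f \<oplus>\<^bsub>?R\<^esub> qcoset g = qcoset (f + g)" and mult: "qcoset f \<otimes>\<^bsub>?R\<^esub> qcoset g = qcoset (pmul f g)"
    if "Poly_Mapping.keys f \<subseteq> paths G" "Poly_Mapping.keys g \<subseteq> paths G" for f g :: "'a \<times> 'b list \<Rightarrow>\<^sub>0 'k"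
    using ring_hom_add[OF hom, of f g] ring_hom_mult[OF hom, of f g] that by (simp_all add: R qcoset_def)
  have one: "\<one>\<^bsub>?R\<^esub> = qcoset pone" using ring_hom_one[OF hom] by (simp add: R qcoset_def)
  have mk: "Poly_Mapping.keys ((\<Sum>v\<in>verts G. Poly_Mapping.single (v, []) (c v)) +
     (\<Sum>e\<in>arcs G. Poly_Mapping.single (tail G e, [e]) (d e))) \<subseteq> paths G" for c and d :: "'b \<Rightarrow> 'k"
    using keys_add Poly_Mapping.keys_sum
    by (intro order_trans[OF keys_add] Un_least order_trans[OF Poly_Mapping.keys_sum] UN_least)
      (auto simp: paths_Nil paths_Cons split: if_splits)
  have pvmk: "pv ((\<Sum>v\<in>verts G. Poly_Mapping.single (v, []) (c v)) +
     (\<Sum>e\<in>arcs G. Poly_Mapping.single (tail G e, [e]) (d e))) v = c v" if "v \<in> verts G" for c v and d :: "'b \<Rightarrow> 'k"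
    using that by (simp add: pv_def lookup_add lookup_sum lookup_single when_def)
  have pamk: "pa ((\<Sum>v\<in>verts G. Poly_Mapping.single (v, []) (c v)) +
     (\<Sum>e\<in>arcs G. Poly_Mapping.single (tail G e, [e]) (d e))) e = d e" if "e \<in> arcs G" for c e and d :: "'b \<Rightarrow> 'k"
  proof -
    have "(\<Sum>e'\<in>arcs G. if tail G e' = tail G e \<and> e' = e then d e' else 0) = (\<Sum>e'\<in>arcs G. if e' = e then d e' else 0)"
      by (intro sum.cong) auto
    then show ?thesis using that by (simp add: pa_def lookup_add lookup_sum lookup_single when_def)
  qed
  have one': "pv pone v = 1" if "v \<in> verts G" for v
    using that by (simp add: pone_def pv_def lookup_sum lookup_single when_def)
  have one_a: "pa pone e = 0" for e by (simp add: pone_def pa_def lookup_sum lookup_single)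
  show ?thesis
  proof (rule rad_square_zero.intro)
    show "ring ?R" unfolding R by (rule I.quotient_is_ring)
    show "qmk f g \<in> carrier ?R" for f and g :: "'b \<Rightarrow> 'k" unfolding car qmk_def using mk by blast
    show "v \<in> verts G \<Longrightarrow> qv (qmk f g) v = f v" for v f and g :: "'b \<Rightarrow> 'k"
      by (simp add: qmk_def qv_qcoset pvmk)
    show "e \<in> arcs G \<Longrightarrow> qa (qmk f g) e = g e" for e f and g :: "'b \<Rightarrow> 'k"
      by (simp add: qmk_def qa_qcoset pamk)
    show "r = s" if rs: "r \<in> carrier ?R" "s \<in> carrier ?R" "\<And>v. v \<in> verts G \<Longrightarrow> qv r v = qv s v"
      "\<And>e. e \<in> arcs G \<Longrightarrow> qa r e = qa s e" for r s
    proof -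
      obtain f g where fg: "Poly_Mapping.keys f \<subseteq> paths G" "r = qcoset f" "Poly_Mapping.keys g \<subseteq> paths G" "s = qcoset g"
        using rs(1,2) unfolding car by auto
      have "qcoset f = qcoset g"
        by (rule qcoset_eqI[OF fg(1,3)]) (use rs(3,4) in \<open>simp_all add: fg(2,4) qv_qcoset qa_qcoset\<close>)
      then show "r = s" by (simp add: fg(2,4))
    qed
    fix r s assume "r \<in> carrier ?R" "s \<in> carrier ?R"
    then obtain f g where fg: "Poly_Mapping.keys f \<subseteq> paths G" "r = qcoset f" "Poly_Mapping.keys g \<subseteq> paths G" "s = qcoset g"
      unfolding car by blast
    show "v \<in> verts G \<Longrightarrow> qv (r \<oplus>\<^bsub>?R\<^esub> s) v = qv r v + qv s v" for v
      by (simp add: fg add qv_qcoset pv_pa_add)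
    show "e \<in> arcs G \<Longrightarrow> qa (r \<oplus>\<^bsub>?R\<^esub> s) e = qa r e + qa s e" for e
      by (simp add: fg add qa_qcoset pv_pa_add)
    show "v \<in> verts G \<Longrightarrow> qv (r \<otimes>\<^bsub>?R\<^esub> s) v = qv r v * qv s v" for v
      by (simp add: fg mult qv_qcoset pv_pmul)
    show "e \<in> arcs G \<Longrightarrow> qa (r \<otimes>\<^bsub>?R\<^esub> s) e = qv r (tail G e) * qa s e + qa r e * qv s (head G e)" for e
      by (simp add: fg mult qv_qcoset qa_qcoset pa_pmul)
  qed (auto simp: one one_a one' qv_qcoset qa_qcoset)
qed

end

section \<open>The matrices of the procedure\<close>

lemma mat_of_cols_comb:
  fixes vs :: "rat vec list"
  assumes "set vs \<subseteq> carrier_vec n" "i < n"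
  shows "(mat_of_cols n vs *\<^sub>v vec (length vs) c) $ i = (\<Sum>k<length vs. c k * (vs ! k) $ i)"
  using assms by (auto simp: scalar_prod_def mat_of_cols_index atLeast0LessThan intro!: sum.cong mult.commute)

lemma orth_compl_subspace:
  assumes "w \<in> carrier_vec n"
  shows "VectorSpace.subspace class_ring (orth_compl n w) (module_vec TYPE(rat) n)"
proof -
  interpret vec_space "TYPE(rat)" n .
  have "LinearCombinations.submodule class_ring (orth_compl n w) V"
    by unfold_locales (use assms in \<open>auto simp: orth_compl_def module_vec_def class_ring_simps
      add_scalar_prod_distrib[of _ n] smult_scalar_prod_distrib\<close>)
  then show ?thesis using vectorspace_axioms by (simp add: VectorSpace.subspace_def)
qed

text \<open>Turns the abstract notion of a basis of a subspace into finite sums over indices.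
  Distinctness makes coefficients indexed by positions the same as coefficients indexed by
  vectors.\<close>

lemma step2_iff:
  assumes w: "w \<in> carrier_vec n" and "length vs = n - 1" "distinct vs" and sub: "set vs \<subseteq> orth_compl n w"
  shows "step2 n w vs \<longleftrightarrow>
    (\<forall>c. (\<forall>i<n. (\<Sum>k<n - 1. c k * (vs ! k) $ i) = 0) \<longrightarrow> (\<forall>k<n - 1. c k = 0)) \<and>
    (\<forall>x\<in>orth_compl n w. \<exists>c. \<forall>i<n. x $ i = (\<Sum>k<n - 1. c k * (vs ! k) $ i))"
proof -
  interpret V: vec_space "TYPE(rat)" n .
  note O = orth_compl_subspace[OF w]
  let ?W = "(module_vec TYPE(rat) n)\<lparr>carrier := orth_compl n w\<rparr>"
  interpret W: vectorspace class_ring ?W by (rule V.subspace_is_vs[OF O])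
  have Om: "LinearCombinations.submodule class_ring (orth_compl n w) (module_vec TYPE(rat) n)" using O by (simp add: VectorSpace.subspace_def)
  have Oc: "orth_compl n w \<subseteq> carrier_vec n" by (auto simp: orth_compl_def)
  have car: "set vs \<subseteq> carrier_vec n" using sub Oc by blast
  have comb: "V.lincomb a (set vs) = mat_of_cols n vs *\<^sub>v vec (n - 1) (\<lambda>k. a (vs ! k))" for a
    using V.lincomb_as_lincomb_list_distinct[OF car assms(3)] V.lincomb_list_as_mat_mult[of vs] car assms(2)
    by (auto simp: subset_iff)
  have comb_i: "V.lincomb a (set vs) $ i = (\<Sum>k<n - 1. a (vs ! k) * (vs ! k) $ i)" if "i < n" for a i
    unfolding comb using mat_of_cols_comb[OF car that] assms(2) by simp
  have comb_c: "V.lincomb a (set vs) \<in> carrier_vec n" for a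
    unfolding comb by (rule mult_mat_vec_carrier[of _ n "n - 1"]) (use assms(2) in auto)
  \<comment> \<open>A family of coefficients on positions becomes a function on vectors by looking
    up the unique position of each vector.\<close>
  have fn: "\<exists>a. \<forall>k<n - 1. a (vs ! k) = c k" for c :: "nat \<Rightarrow> rat"
  proof
    show "\<forall>k<n - 1. (\<lambda>x. c (THE k. k < n - 1 \<and> vs ! k = x)) (vs ! k) = c k"
    proof (intro allI impI)
      fix k assume "k < n - 1"
      then have "(THE k'. k' < n - 1 \<and> vs ! k' = vs ! k) = k"
        using assms(2,3) by (intro the_equality) (auto simp: nth_eq_iff_index_eq)
      then show "c (THE k'. k' < n - 1 \<and> vs ! k' = vs ! k) = c k" by simp
    qed
  qed
  have indpt: "V.lin_indpt (set vs) \<longleftrightarrow>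
    (\<forall>c. (\<forall>i<n. (\<Sum>k<n - 1. c k * (vs ! k) $ i) = 0) \<longrightarrow> (\<forall>k<n - 1. c k = 0))"
  proof (intro iffI allI impI)
    fix c k assume li: "V.lin_indpt (set vs)" and z: "\<forall>i<n. (\<Sum>k<n - 1. c k * (vs ! k) $ i) = 0" and k: "k < n - 1"
    obtain a where a: "\<forall>k<n - 1. a (vs ! k) = c k" using fn[of c] by blast
    have "V.lincomb a (set vs) = 0\<^sub>v n"
      by (rule eq_vecI) (use comb_c[of a] comb_i[of _ a] a z in auto)
    then have "a (vs ! k) = 0"
      using V.lin_dep_crit[where A = "set vs" and S = "set vs" and a = a and v = "vs ! k"] li k assms(2) by (auto simp: class_ring_simps)
    then show "c k = 0" using a k by simp
  next
    assume *: "\<forall>c. (\<forall>i<n. (\<Sum>k<n - 1. c k * (vs ! k) $ i) = 0) \<longrightarrow> (\<forall>k<n - 1. c k = 0)"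
    show "V.lin_indpt (set vs)"
    proof (rule V.finite_lin_indpt2)
      show "set vs \<subseteq> carrier_vec n" by (rule car)
      fix a :: "rat vec \<Rightarrow> rat" assume True and z: "V.lincomb a (set vs) = 0\<^sub>v n"
      have "(\<Sum>k<n - 1. a (vs ! k) * (vs ! k) $ i) = 0" if "i < n" for i
        unfolding comb_i[OF that, symmetric] z by (rule index_zero_vec(1)[OF that])
      then have "\<forall>k<n - 1. a (vs ! k) = 0" using *[rule_format, of "\<lambda>k. a (vs ! k)"] by blast
      then show "\<forall>v\<in>set vs. a v = 0"
        using assms(2) by (auto simp: in_set_conv_nth)
    qed simp
  qed
  have span: "x \<in> V.span (set vs) \<longleftrightarrow> (\<exists>c. \<forall>i<n. x $ i = (\<Sum>k<n - 1. c k * (vs ! k) $ i))"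
    if x: "x \<in> carrier_vec n" for x
  proof
    assume "x \<in> V.span (set vs)"
    then obtain a where "V.lincomb a (set vs) = x" using V.finite_in_span[of "set vs" x] car by auto
    then show "\<exists>c. \<forall>i<n. x $ i = (\<Sum>k<n - 1. c k * (vs ! k) $ i)"
      using comb_i[of _ a] by (intro exI[of _ "\<lambda>k. a (vs ! k)"]) auto
  next
    assume "\<exists>c. \<forall>i<n. x $ i = (\<Sum>k<n - 1. c k * (vs ! k) $ i)"
    then obtain c where c: "\<forall>i<n. x $ i = (\<Sum>k<n - 1. c k * (vs ! k) $ i)" by blast
    obtain a where a: "\<forall>k<n - 1. a (vs ! k) = c k" using fn[of c] by blast
    have "x = V.lincomb a (set vs)"
      by (rule eq_vecI) (use comb_c[of a] comb_i[of _ a] a c x in auto)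
    then show "x \<in> V.span (set vs)" unfolding V.span_def by (auto simp: class_ring_simps)
  qed
  have sp: "V.span (set vs) \<subseteq> orth_compl n w" using V.span_is_subset[OF sub Om] .
  \<comment> \<open>Span and independence computed inside the subspace agree with those in the full
    space.\<close>
  note nd = V.span_li_not_depend[OF sub Om]
  have "step2 n w vs \<longleftrightarrow> V.lin_indpt (set vs) \<and> V.span (set vs) = orth_compl n w"
    unfolding step2_def W.basis_def nd using assms(2,3) sub by simp
  also have "V.span (set vs) = orth_compl n w \<longleftrightarrow>
    (\<forall>x\<in>orth_compl n w. \<exists>c. \<forall>i<n. x $ i = (\<Sum>k<n - 1. c k * (vs ! k) $ i))"
    using sp span Oc by blast
  finally show ?thesis unfolding indpt .
qed

lemma step2D:
  assumes "w \<in> carrier_vec n" "step2 n w vs"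
  shows "length vs = n - 1" "set vs \<subseteq> orth_compl n w"
    "\<forall>c. (\<forall>i<n. (\<Sum>k<n - 1. c k * (vs ! k) $ i) = 0) \<longrightarrow> (\<forall>k<n - 1. c k = 0)"
proof -
  interpret V: vec_space "TYPE(rat)" n .
  interpret W: vectorspace class_ring "(module_vec TYPE(rat) n)\<lparr>carrier := orth_compl n w\<rparr>"
    by (rule V.subspace_is_vs[OF orth_compl_subspace[OF assms(1)]])
  show l: "length vs = n - 1" and s: "set vs \<subseteq> orth_compl n w"
    using assms(2) by (auto simp: step2_def W.basis_def)
  have d: "distinct vs" using assms(2) by (simp add: step2_def)
  show "\<forall>c. (\<forall>i<n. (\<Sum>k<n - 1. c k * (vs ! k) $ i) = 0) \<longrightarrow> (\<forall>k<n - 1. c k = 0)"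
    using step2_iff[OF assms(1) l d s] assms(2) by blast
qed

lemma mat_mult_index:
  assumes "A \<in> carrier_mat n n" "B \<in> carrier_mat n n" "i < n" "j < n"
  shows "(A * B) $$ (i, j) = (\<Sum>k<n. A $$ (i, k) * B $$ (k, j))"
  using assms by (simp add: scalar_prod_def atLeast0LessThan)

text \<open>The row \<open>w\<close> times the matrix is the last unit row, by orthogonality and
  \<open>v \<bullet> w = 1\<close>. So a kernel vector has last coordinate zero and then vanishes by
  independence of \<open>vs\<close>; the same identity shows that \<open>w\<close> is the last row
  of the inverse.\<close>

lemma A_mat_inverse:
  assumes n: "n \<ge> 1" and s1: "step1 n v w" and len: "length vs = n - 1" and sub: "set vs \<subseteq> orth_compl n w"
    and indep: "\<forall>c. (\<forall>i<n. (\<Sum>k<n - 1. c k * (vs ! k) $ i) = 0) \<longrightarrow> (\<forall>k<n - 1. c k = 0)"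
  obtains B where "mat_inverse (A_mat n vs v) = Some B" "B \<in> carrier_mat n n"
    "A_mat n vs v * B = 1\<^sub>m n" "B * A_mat n vs v = 1\<^sub>m n" "\<And>j. j < n \<Longrightarrow> B $$ (n - 1, j) = w $ j"
proof -
  let ?A = "A_mat n vs v"
  have vw: "v \<in> carrier_vec n" "w \<in> carrier_vec n" "v \<bullet> w = 1" using s1 by (auto simp: step1_def)
  have A: "?A \<in> carrier_mat n n" 
    using mat_of_cols_carrier(1)[of n "vs @ [v]"] len n by (simp add: A_mat_def)
  have Aik: "?A $$ (i, k) = (if k < n - 1 then (vs ! k) $ i else v $ i)" if "i < n" "k < n" for i k
    using that len n by (auto simp: A_mat_def mat_of_cols_index nth_append)
  have wA: "(\<Sum>i<n. w $ i * ?A $$ (i, k)) = (if k = n - 1 then 1 else 0)" if "k < n" for k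
  proof (cases "k < n - 1")
    case True
    then have "vs ! k \<in> orth_compl n w" using sub len by auto
    then have "(vs ! k) \<bullet> w = 0" by (simp add: orth_compl_def)
    then have "(\<Sum>i<n. w $ i * (vs ! k) $ i) = 0"
      using vw(2) by (simp add: scalar_prod_def mult.commute atLeast0LessThan)
    moreover have "(\<Sum>i<n. w $ i * ?A $$ (i, k)) = (\<Sum>i<n. w $ i * (vs ! k) $ i)"
      by (intro sum.cong) (use True that in \<open>auto simp: Aik\<close>)
    ultimately show ?thesis using True by simp
  next
    case False
    have "(\<Sum>i<n. w $ i * v $ i) = 1" using vw by (simp add: scalar_prod_def mult.commute atLeast0LessThan)
    moreover have "(\<Sum>i<n. w $ i * ?A $$ (i, k)) = (\<Sum>i<n. w $ i * v $ i)"
      by (intro sum.cong) (use False that in \<open>auto simp: Aik\<close>)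
    ultimately show ?thesis using False that by simp
  qed
  have "det ?A \<noteq> 0"
  proof
    assume "det ?A = 0"
    then obtain x where x: "x \<in> carrier_vec n" "x \<noteq> 0\<^sub>v n" "?A *\<^sub>v x = 0\<^sub>v n"
      using det_0_iff_vec_prod_zero[OF A] by blast
    have Ax: "(\<Sum>k<n. ?A $$ (i, k) * x $ k) = 0" if "i < n" for i
    proof -
      have "(?A *\<^sub>v x) $ i = (\<Sum>k<n. ?A $$ (i, k) * x $ k)"
        using that A x(1) by (simp add: scalar_prod_def atLeast0LessThan)
      then show ?thesis using x(3) that by simp
    qed
    have "0 = (\<Sum>i<n. w $ i * (\<Sum>k<n. ?A $$ (i, k) * x $ k))" using Ax by simp
    also have "\<dots> = (\<Sum>k<n. (\<Sum>i<n. w $ i * ?A $$ (i, k)) * x $ k)"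
      by (simp add: sum_distrib_left sum_distrib_right mult.assoc) (rule sum.swap)
    also have "\<dots> = (\<Sum>k<n. if k = n - 1 then x $ k else 0)" by (intro sum.cong) (auto simp: wA)
    finally have x0: "x $ (n - 1) = 0" using n by simp
    obtain p where p: "n = Suc p" using n by (cases n) auto
    have "(\<Sum>k<n - 1. x $ k * (vs ! k) $ i) = 0" if "i < n" for i
    proof -
      have "(\<Sum>k<n - 1. x $ k * (vs ! k) $ i) = (\<Sum>k<p. ?A $$ (i, k) * x $ k)"
      proof (rule sum.cong)
        show "x $ k * (vs ! k) $ i = ?A $$ (i, k) * x $ k" if "k \<in> {..<p}" for k
          using Aik[OF \<open>i < n\<close>, of k] that p by simp
      qed (simp add: p)
      then show ?thesis using Ax[OF that] x0 unfolding p by simp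
    qed
    then have "x $ k = 0" if "k < n - 1" for k using indep[rule_format, of "\<lambda>k. x $ k"] that by blast
    then have "x $ i = 0" if "i < n" for i using x0 that by (cases "i = n - 1") auto
    then have "x = 0\<^sub>v n" using x(1) by (intro eq_vecI) auto
    then show False using x(2) by simp
  qed
  then have "?A \<in> Units (ring_mat TYPE(rat) n ())" by (rule det_non_zero_imp_unit[OF A])
  then have "mat_inverse ?A \<noteq> None" using mat_inverse(1)[OF A, where b = "()"] by blast
  then obtain B where B: "mat_inverse ?A = Some B" by blast
  note B' = mat_inverse(2)[OF A B]
  have "B $$ (n - 1, j) = w $ j" if j: "j < n" for j
  proof -
    have AB: "(\<Sum>k<n. ?A $$ (i, k) * B $$ (k, j)) = (if i = j then 1 else 0)" if "i < n" for i
    proof -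
      have "(\<Sum>k<n. ?A $$ (i, k) * B $$ (k, j)) = (?A * B) $$ (i, j)"
        by (rule mat_mult_index[symmetric]) (use that j A B' in auto)
      then show ?thesis using B' that j by simp
    qed
    have "B $$ (n - 1, j) = (\<Sum>k<n. if k = n - 1 then B $$ (k, j) else 0)" using n by simp
    also have "\<dots> = (\<Sum>k<n. (\<Sum>i<n. w $ i * ?A $$ (i, k)) * B $$ (k, j))"
      by (intro sum.cong) (auto simp: wA)
    also have "\<dots> = (\<Sum>i<n. w $ i * (\<Sum>k<n. ?A $$ (i, k) * B $$ (k, j)))"
      by (simp add: sum_distrib_left sum_distrib_right mult.assoc) (rule sum.swap)
    also have "\<dots> = (\<Sum>i<n. if i = j then w $ i else 0)" by (intro sum.cong) (auto simp: AB)
    finally show ?thesis using j by simp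
  qed
  then show thesis using that B B' by blast
qed

lemma conj_mat_eq:
  assumes "mat_inverse (A_mat n vs v) = Some B" "B \<in> carrier_mat n n" "length vs = n - 1" "n \<ge> 1"
  shows "conj_mat n vs v l = A_mat n vs v * M_mat n (of_nat l) * B"
    "A_mat n vs v \<in> carrier_mat n n" "M_mat n q \<in> carrier_mat n n"
  using assms mat_of_cols_carrier(1)[of n "vs @ [v]"] by (simp_all add: conj_mat_def A_mat_def M_mat_def)

lemma mat_mult3_index:
  assumes "A \<in> carrier_mat n n" "M \<in> carrier_mat n n" "B \<in> carrier_mat n n" "i < n" "j < n"
  shows "(A * M * B) $$ (i, j) = (\<Sum>k<n. (\<Sum>h<n. A $$ (i, h) * M $$ (h, k)) * B $$ (k, j))"
  unfolding mat_mult_index[OF mult_carrier_mat[OF assms(1,2)] assms(3-5)]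
  by (intro sum.cong refl arg_cong2[of _ _ _ _ "(*)"] mat_mult_index[OF assms(1,2,4)]) simp

text \<open>\<open>M_mat\<close> depends on its parameter only in the last diagonal entry, and
  conjugating that matrix unit gives the last column of the matrix, \<open>v\<close>, times the last
  row of its inverse, \<open>w\<close>.\<close>

lemma conj_mat_affine:
  assumes n: "n \<ge> 1" and s1: "step1 n v w" and s2: "step2 n w vs" and ij: "i < n" "j < n"
  shows "conj_mat n vs v l $$ (i, j) = conj_mat n vs v 0 $$ (i, j) + of_nat l * (v $ i * w $ j)"
proof -
  have w: "w \<in> carrier_vec n" using s1 by (simp add: step1_def)
  note D = step2D[OF w s2]
  obtain B where B: "mat_inverse (A_mat n vs v) = Some B" "B \<in> carrier_mat n n"
    "\<And>j. j < n \<Longrightarrow> B $$ (n - 1, j) = w $ j"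
    using A_mat_inverse[OF n s1 D] by blast
  note C = conj_mat_eq[OF B(1,2) D(1) n]
  let ?A = "A_mat n vs v"
  have Av: "?A $$ (i, n - 1) = v $ i" using ij n D(1) by (simp add: A_mat_def mat_of_cols_index nth_append)
  have M: "M_mat n (of_nat l) $$ (h, k) = M_mat n 0 $$ (h, k) + (if h = n - 1 \<and> k = n - 1 then of_nat l else 0)"
    if "h < n" "k < n" for h k using that n by (auto simp: M_mat_def)
  have inner: "(\<Sum>h<n. ?A $$ (i, h) * M_mat n (of_nat l) $$ (h, k))
      = (\<Sum>h<n. ?A $$ (i, h) * M_mat n 0 $$ (h, k)) + (if k = n - 1 then of_nat l * v $ i else 0)" if k: "k < n" for k
  proof -
    have "(\<Sum>h<n. ?A $$ (i, h) * M_mat n (of_nat l) $$ (h, k))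
      = (\<Sum>h<n. ?A $$ (i, h) * M_mat n 0 $$ (h, k) + (if h = n - 1 then (if k = n - 1 then of_nat l * ?A $$ (i, h) else 0) else 0))"
      using k by (intro sum.cong) (auto simp: M distrib_left)
    then show ?thesis using n Av by (simp add: sum.distrib)
  qed
  have "conj_mat n vs v l $$ (i, j) = (\<Sum>k<n. (\<Sum>h<n. ?A $$ (i, h) * M_mat n (of_nat l) $$ (h, k)) * B $$ (k, j))"
    unfolding C(1) by (rule mat_mult3_index[OF C(2,3) B(2) ij])
  also have "\<dots> = (\<Sum>k<n. (\<Sum>h<n. ?A $$ (i, h) * M_mat n 0 $$ (h, k)) * B $$ (k, j)
      + (if k = n - 1 then of_nat l * v $ i * B $$ (k, j) else 0))"
    by (intro sum.cong) (auto simp: inner distrib_right)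
  also have "\<dots> = (\<Sum>k<n. (\<Sum>h<n. ?A $$ (i, h) * M_mat n 0 $$ (h, k)) * B $$ (k, j)) + of_nat l * v $ i * B $$ (n - 1, j)"
    using n by (simp add: sum.distrib)
  also have "(\<Sum>k<n. (\<Sum>h<n. ?A $$ (i, h) * M_mat n 0 $$ (h, k)) * B $$ (k, j)) = conj_mat n vs v 0 $$ (i, j)"
    using mat_mult3_index[OF C(2) C(3)[of 0] B(2) ij] conj_mat_eq(1)[OF B(1,2) D(1) n, of 0] by simp
  finally show ?thesis using B(3)[OF ij(2)] by simp
qed

section \<open>Existence of the parameters in Steps 3 and 4\<close>

lemma common_denominator:
  assumes "finite (S :: rat set)" "\<And>q. q \<in> S \<Longrightarrow> q \<ge> 0"
  shows "\<exists>m\<ge>1. \<forall>q\<in>S. of_nat m * q \<in> \<nat>"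
  using assms
proof (induction S rule: finite_induct)
  case empty
  then show ?case by (intro exI[of _ 1]) simp
next
  case (insert q S)
  then obtain m where m: "m \<ge> 1" "\<forall>q\<in>S. of_nat m * q \<in> \<nat>" by auto
  obtain a b where ab: "quotient_of q = (a, b)" by force
  have b: "b > 0" using quotient_of_denom_pos[OF ab] .
  have q: "q = of_int a / of_int b" using quotient_of_div[OF ab] .
  have "a \<ge> 0" using insert.prems[of q] b by (simp add: q zero_le_divide_iff)
  then have "of_nat (nat b) * q = of_nat (nat a)" using b by (simp add: q)
  then have 1: "of_nat (m * nat b) * q = of_nat (m * nat a)" by (simp add: mult.assoc)
  have 2: "of_nat (m * nat b) * q' \<in> \<nat>" if "q' \<in> S" for q'
  proof -
    have "of_nat (m * nat b) * q' = of_nat (nat b) * (of_nat m * q')" by (simp add: mult_ac)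
    then show ?thesis using m(2) that Nats_mult of_nat_in_Nats by metis
  qed
  have "m * nat b \<ge> 1" using m(1) b by (simp add: Suc_le_eq)
  moreover have "of_nat (m * nat b) * q \<in> \<nat>" unfolding 1 by (rule of_nat_in_Nats)
  ultimately show ?case using 2 by (intro exI[of _ "m * nat b"]) auto
qed

lemma step3_exists:
  assumes n: "n \<ge> 1" and s1: "step1 n v w" and s2: "step2 n w vs"
  shows "\<exists>l. step3 n vs v l"
proof -
  let ?N = "\<lambda>i j. conj_mat n vs v 0 $$ (i, j)"
  have pos: "v $ i * w $ j > 0" if "i < n" "j < n" for i j using s1 that by (simp add: step1_def)
  \<comment> \<open>A sum rather than a maximum: it bounds each quotient of constant term by slope
    at once.\<close>
  define q where "q = (\<Sum>(i, j)\<in>{..<n} \<times> {..<n}. \<bar>?N i j\<bar> / (v $ i * w $ j))"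
  obtain l0 :: nat where l0: "q \<le> of_nat l0" using real_arch_simple by blast
  \<comment> \<open>Adding 2 secures the requirement \<open>l \<ge> 2\<close> and does not hurt the
    bound, since the slopes are positive.\<close>
  have "step3 n vs v (l0 + 2)" unfolding step3_def
  proof (intro conjI allI impI)
    fix i j assume ij: "i < n" "j < n"
    have "\<bar>?N i j\<bar> / (v $ i * w $ j) \<le> q"
      unfolding q_def
      using member_le_sum[of "(i, j)" "{..<n} \<times> {..<n}" "\<lambda>(i, j). \<bar>?N i j\<bar> / (v $ i * w $ j)"] ij pos
      by (fastforce intro: divide_nonneg_pos)
    also have "\<dots> \<le> of_nat (l0 + 2)" using l0 by simp
    finally have "\<bar>?N i j\<bar> \<le> of_nat (l0 + 2) * (v $ i * w $ j)" using pos[OF ij] by (simp add: pos_divide_le_eq)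
    then show "conj_mat n vs v (l0 + 2) $$ (i, j) \<ge> 0"
      unfolding conj_mat_affine[OF n s1 s2 ij, of "l0 + 2"] by linarith
  qed simp
  then show ?thesis by blast
qed

lemma conj_mat_carrier:
  assumes "n \<ge> 1" "step1 n v w" "step2 n w vs"
  shows "conj_mat n vs v l \<in> carrier_mat n n"
proof -
  have w: "w \<in> carrier_vec n" using assms(2) by (simp add: step1_def)
  note D = step2D[OF w assms(3)]
  obtain B where B: "mat_inverse (A_mat n vs v) = Some B" "B \<in> carrier_mat n n"
    using A_mat_inverse[OF assms(1,2) D] by blast
  note C = conj_mat_eq[OF B D(1) assms(1)]
  show ?thesis unfolding C(1) by (rule mult_carrier_mat[OF mult_carrier_mat[OF C(2,3)] B(2)])
qed

lemma step4_exists: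
  assumes "n \<ge> 1" "step1 n v w" "step2 n w vs" and s3: "step3 n vs v l"
  shows "\<exists>m. step4 n vs v l m"
proof -
  let ?S = "(\<lambda>(i, j). conj_mat n vs v l $$ (i, j)) ` ({..<n} \<times> {..<n})"
  obtain m where m: "m \<ge> 1" "\<forall>q\<in>?S. of_nat m * q \<in> \<nat>"
    using common_denominator[of ?S] s3 by (auto simp: step3_def)
  have "conj_mat n vs v l \<in> carrier_mat n n" by (rule conj_mat_carrier[OF assms(1-3)])
  then have "step4 n vs v l m" using m by (auto simp: step4_def)
  then show ?thesis by blast
qed

section \<open>Nilpotent chains\<close>

lemma funpow_additive:
  fixes U :: "'a::ab_group_add \<Rightarrow> 'a"
  assumes "\<And>f g. U (f + g) = U f + U g"
  shows "(U ^^ k) (f + g) = (U ^^ k) f + (U ^^ k) g"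
  by (induction k) (simp_all add: assms)

lemma funpow_homogeneous:
  fixes U :: "('x \<Rightarrow> 'k::field) \<Rightarrow> 'x \<Rightarrow> 'k"
  assumes "\<And>c f. U (\<lambda>x. c * f x) = (\<lambda>x. c * U f x)"
  shows "(U ^^ k) (\<lambda>x. c * f x) = (\<lambda>x. c * (U ^^ k) f x)"
  by (induction k) (simp_all add: assms)

lemma additive_zero:
  fixes U :: "'a::ab_group_add \<Rightarrow> 'b::ab_group_add"
  assumes "\<And>f g. U (f + g) = U f + U g"
  shows "U 0 = 0"
  using assms[of 0 0] by simp

lemma kernel_span:
  fixes U :: "('x \<Rightarrow> 'k::field) \<Rightarrow> 'y \<Rightarrow> 'k"
  assumes "\<And>f g. U (f + g) = U f + U g" "\<And>c f. U (\<lambda>x. c * f x) = (\<lambda>x. c * U f x)"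
    and "\<And>b. b \<in> B \<Longrightarrow> U b \<in> W" "fv.subspace W" "y \<in> fv.span B"
  shows "U y \<in> W"
proof -
  have "fv.subspace {y. U y \<in> W}"
  proof (rule fv.subspaceI)
    show "0 \<in> {y. U y \<in> W}" using additive_zero[of U] assms(1) fv.subspace_0[OF assms(4)] by simp
    show "x + y \<in> {y. U y \<in> W}" if "x \<in> {y. U y \<in> W}" "y \<in> {y. U y \<in> W}" for x y
      using that fv.subspace_add[OF assms(4)] by (simp add: assms(1))
    show "(\<lambda>i. c * x i) \<in> {y. U y \<in> W}" if "x \<in> {y. U y \<in> W}" for c x
      using that fv.subspace_scale[OF assms(4)] by (simp add: assms(2))
  qed
  moreover have "B \<subseteq> {y. U y \<in> W}" using assms(3) by blast
  ultimately show ?thesis using fv.span_minimal[of B "{y. U y \<in> W}"] assms(5) by blast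
qed

lemma subspace_zero: "fv.subspace ({0} :: ('x \<Rightarrow> 'k::field) set)"
  by (rule fv.subspaceI) (auto simp: fun_eq_iff)

text \<open>The chain is built from its end backwards. Applying \<open>U ^^ (m - p)\<close> kills
  all later members but sends the \<open>p\<close>-th one to the nonzero \<open>(U ^^ m) x\<close>,
  so it is outside their span. The cardinality is carried along because it is compared with
  dimensions.\<close>

lemma chain_independent:
  fixes U :: "('x \<Rightarrow> 'k::field) \<Rightarrow> 'x \<Rightarrow> 'k"
  assumes add: "\<And>f g. U (f + g) = U f + U g" and scale: "\<And>c f. U (\<lambda>x. c * f x) = (\<lambda>x. c * U f x)"
    and nz: "(U ^^ m) x \<noteq> 0" and z: "(U ^^ Suc m) x = 0" and k: "k \<le> m"
  shows "fv.independent ((\<lambda>l. (U ^^ l) x) ` {m - k..m}) \<and> card ((\<lambda>l. (U ^^ l) x) ` {m - k..m}) = Suc k"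
  using k
proof (induction k)
  case 0
  have "fv.independent {(U ^^ m) x}"
    using nz by (simp add: fv.independent_insert)
  then show ?case by simp
next
  case (Suc k)
  let ?f = "\<lambda>l. (U ^^ l) x"
  define p where "p = m - Suc k"
  have p: "m - k = Suc p" "p \<le> m" "{m - Suc k..m} = insert p {m - k..m}" using Suc.prems by (auto simp: p_def)
  have late: "(U ^^ l) x = 0" if "l > m" for l
  proof -
    have "(U ^^ l) x = (U ^^ (l - Suc m)) ((U ^^ Suc m) x)"
      using that funpow_add[of "l - Suc m" "Suc m" U] by (simp add: fun_eq_iff del: funpow.simps)
    then show ?thesis using z additive_zero[of "U ^^ (l - Suc m)"] funpow_additive[of U, OF add] by simp
  qed
  have "?f p \<notin> fv.span (?f ` {m - k..m})"
  proof
    assume "?f p \<in> fv.span (?f ` {m - k..m})"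
    then have "(U ^^ (m - p)) (?f p) \<in> {0}"
    proof (rule kernel_span[of "U ^^ (m - p)", rotated 4])
      fix b assume "b \<in> ?f ` {m - k..m}"
      then obtain l where l: "l \<ge> m - k" "b = ?f l" by auto
      have "(U ^^ (m - p)) (?f l) = (U ^^ (m - p + l)) x" by (simp add: funpow_add)
      then show "(U ^^ (m - p)) b \<in> {0}" using late[of "m - p + l"] l p by simp
    qed (simp_all add: funpow_additive[of U, OF add] funpow_homogeneous[of U, OF scale] subspace_zero)
    moreover have "(U ^^ (m - p)) (?f p) = (U ^^ m) x"
      using p(2) funpow_add[of "m - p" p U] by (simp add: fun_eq_iff)
    ultimately show False using nz by simp
  qed
  note nsp = this
  have nin: "?f p \<notin> ?f ` {m - k..m}" by (rule contra_subsetD[OF fv.span_superset nsp])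
  have IH: "fv.independent (?f ` {m - k..m})" "card (?f ` {m - k..m}) = Suc k"
    using Suc.IH[OF Suc_leD[OF Suc.prems]] by blast+
  have "fv.independent (insert (?f p) (?f ` {m - k..m}))"
    using nsp nin IH(1) unfolding fv.independent_insert by (simp only: if_False simp_thms)
  moreover have "card (insert (?f p) (?f ` {m - k..m})) = Suc (Suc k)"
    using nin IH(2) by (subst card_insert_disjoint) auto
  ultimately show ?case unfolding p(3) image_insert by blast
qed

definition dlt :: "nat \<Rightarrow> nat \<Rightarrow> rat" where
  "dlt j = (\<lambda>i. if i = j then 1 else 0)"

lemma supp_expand:
  assumes "finite L" "\<And>j. j \<notin> L \<Longrightarrow> y j = 0"
  shows "y = (\<Sum>j\<in>L. (\<lambda>i. y j * dlt j i))"
proof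
  fix i
  have "(\<Sum>j\<in>L. (\<lambda>i. y j * dlt j i)) i = (\<Sum>j\<in>L. y j * dlt j i)"
    using assms(1) by (induction L rule: finite_induct) auto
  also have "\<dots> = (\<Sum>j\<in>L. if j = i then y j else 0)" by (intro sum.cong) (auto simp: dlt_def)
  also have "\<dots> = y i" using assms by auto
  finally show "y i = (\<Sum>j\<in>L. (\<lambda>i. y j * dlt j i)) i" by simp
qed

lemma supp_span:
  assumes "finite L" "\<And>j. j \<notin> L \<Longrightarrow> y j = 0"
  shows "y \<in> fv.span (dlt ` L)"
  by (subst supp_expand[OF assms]) (auto intro!: fv.span_sum fv.span_scale intro: fv.span_base)

lemma independent_supp_card:
  assumes "finite L" "fv.independent B" "\<And>b j. b \<in> B \<Longrightarrow> j \<notin> L \<Longrightarrow> (b :: nat \<Rightarrow> rat) j = 0"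
  shows "finite B" "card B \<le> card L"
proof -
  have "B \<subseteq> fv.span (dlt ` L)" using supp_span[OF assms(1)] assms(3) by blast
  then have *: "finite B \<and> card B \<le> card (dlt ` L)"
    using fv.independent_span_bound[of "dlt ` L" B] assms(1,2) by simp
  then show "finite B" by simp
  show "card B \<le> card L" using * card_image_le[OF assms(1), of dlt] by linarith
qed

text \<open>If \<open>y\<close> were outside the span, adjoining it would give more independent
  vectors than there are coordinates in \<open>L\<close>.\<close>

lemma independent_supp_span:
  assumes "finite L" "fv.independent B" "\<And>b j. b \<in> B \<Longrightarrow> j \<notin> L \<Longrightarrow> (b :: nat \<Rightarrow> rat) j = 0"
    and "card B = card L" "\<And>j. j \<notin> L \<Longrightarrow> y j = 0"
  shows "y \<in> fv.span B"
proof (rule ccontr)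
  assume y: "y \<notin> fv.span B"
  then have yB: "y \<notin> B" using fv.span_base by blast
  have "fv.independent (insert y B)" using y yB assms(2) by (simp add: fv.independent_insert)
  then have "card (insert y B) \<le> card L"
    by (rule independent_supp_card(2)[OF assms(1)]) (use assms(3,5) in auto)
  moreover have "finite B" by (rule independent_supp_card(1)[OF assms(1,2)]) (rule assms(3))
  ultimately show False using yB assms(4) by simp
qed

section \<open>Iterates of a non-negative integer matrix\<close>

definition rmul :: "nat \<Rightarrow> (nat \<Rightarrow> nat \<Rightarrow> nat) \<Rightarrow> (nat \<Rightarrow> rat) \<Rightarrow> nat \<Rightarrow> rat" where
  "rmul n T x = (\<lambda>j. if j < n then (\<Sum>i<n. x i * of_nat (T i j)) else 0)"

definition cmul :: "nat \<Rightarrow> (nat \<Rightarrow> nat \<Rightarrow> nat) \<Rightarrow> (nat \<Rightarrow> rat) \<Rightarrow> nat \<Rightarrow> rat" where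
  "cmul n T x = (\<lambda>i. if i < n then (\<Sum>j<n. of_nat (T i j) * x j) else 0)"

definition dot :: "nat \<Rightarrow> (nat \<Rightarrow> rat) \<Rightarrow> (nat \<Rightarrow> rat) \<Rightarrow> rat" where
  "dot n x y = (\<Sum>i<n. x i * y i)"

lemma rmul_apply: "j < n \<Longrightarrow> rmul n T x j = (\<Sum>i<n. x i * of_nat (T i j))"
  by (simp add: rmul_def)

lemma rmul_add: "rmul n T (x + y) = rmul n T x + rmul n T y"
  by (auto simp: rmul_def fun_eq_iff distrib_right sum.distrib)

lemma rmul_scale: "rmul n T (\<lambda>i. c * x i) = (\<lambda>i. c * rmul n T x i)"
  by (auto simp: rmul_def fun_eq_iff sum_distrib_left mult.assoc)

lemma cmul_add: "cmul n T (x + y) = cmul n T x + cmul n T y"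
  by (auto simp: cmul_def fun_eq_iff distrib_left sum.distrib)

lemma cmul_scale: "cmul n T (\<lambda>i. c * x i) = (\<lambda>i. c * cmul n T x i)"
  by (auto simp: cmul_def fun_eq_iff sum_distrib_left mult_ac)

lemmas rmul_iter_add = funpow_additive[of "rmul n T" for n T, OF rmul_add]
lemmas rmul_iter_scale = funpow_homogeneous[of "rmul n T" for n T, OF rmul_scale]

lemma dot_simps:
  "dot n (x + y) v = dot n x v + dot n y v" "dot n (\<lambda>i. c * x i) v = c * dot n x v" "dot n 0 v = 0"
  "dot n v (x + y) = dot n v x + dot n v y" "dot n v (\<lambda>i. c * x i) = c * dot n v x" "dot n v 0 = 0"
  by (simp_all add: dot_def distrib_right distrib_left sum.distrib sum_distrib_left mult_ac)

lemma dot_dlt: "j < n \<Longrightarrow> dot n (dlt j) v = v j" "j < n \<Longrightarrow> dot n v (dlt j) = v j"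
proof -
  assume j: "j < n"
  have "dot n (dlt j) v = (\<Sum>i<n. if i = j then v i else 0)" unfolding dot_def by (intro sum.cong) (auto simp: dlt_def)
  then show "dot n (dlt j) v = v j" using j by simp
  have "dot n v (dlt j) = (\<Sum>i<n. if i = j then v i else 0)" unfolding dot_def by (intro sum.cong) (auto simp: dlt_def)
  then show "dot n v (dlt j) = v j" using j by simp
qed

lemma dot_adjoint: "dot n (rmul n T y) u = dot n y (cmul n T u)"
proof -
  have "dot n (rmul n T y) u = (\<Sum>j<n. \<Sum>i<n. y i * of_nat (T i j) * u j)"
    unfolding dot_def by (intro sum.cong refl) (simp add: rmul_def sum_distrib_right)
  also have "\<dots> = (\<Sum>i<n. \<Sum>j<n. y i * of_nat (T i j) * u j)" by (rule sum.swap)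
  also have "\<dots> = dot n y (cmul n T u)"
    unfolding dot_def by (intro sum.cong refl) (simp add: cmul_def sum_distrib_left mult.assoc)
  finally show ?thesis .
qed

lemma dot_adjoint_iter: "dot n ((rmul n T ^^ k) y) u = dot n y ((cmul n T ^^ k) u)"
proof (induction k arbitrary: y)
  case (Suc k)
  have "dot n ((rmul n T ^^ Suc k) y) u = dot n ((rmul n T ^^ k) (rmul n T y)) u"
    by (simp add: funpow_swap1)
  then show ?case using Suc by (simp add: dot_adjoint)
qed simp

lemma rmul_supp: "j \<ge> n \<Longrightarrow> rmul n T x j = 0"
  by (simp add: rmul_def)

lemma rmul_iter_supp:
  assumes "\<And>j. j \<ge> n \<Longrightarrow> x j = 0" "j \<ge> n" shows "(rmul n T ^^ k) x j = 0"
  using assms by (cases k) (auto simp: rmul_supp)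

lemma rmul_iter_nonneg:
  assumes "\<And>j. x j \<ge> 0" shows "(rmul n T ^^ k) x j \<ge> 0"
proof (induction k arbitrary: j)
  case (Suc k)
  have "rmul n T ((rmul n T ^^ k) x) j \<ge> 0"
    using Suc by (cases "j < n") (auto simp: rmul_apply rmul_supp intro!: sum_nonneg)
  then show ?case by simp
qed (simp add: assms)

text \<open>Every column met inside \<open>L\<close> has a nonzero entry, an integer at least one,
  so entries bounded below by one stay so. This is the test against nilpotency when columns are
  nonzero.\<close>

lemma rmul_iter_ge_one:
  assumes "\<And>j. j \<in> L \<Longrightarrow> j < n \<and> (\<exists>i\<in>L. T i j \<noteq> 0)" "\<And>j. x j \<ge> 0" "\<And>j. j \<in> L \<Longrightarrow> x j \<ge> 1" "j \<in> L"
  shows "(rmul n T ^^ k) x j \<ge> 1"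
  using assms(4)
proof (induction k arbitrary: j)
  case (Suc k)
  let ?y = "(rmul n T ^^ k) x"
  obtain i where i: "i \<in> L" "T i j \<noteq> 0" "j < n" using assms(1)[OF Suc.prems] by blast
  have "i < n" using assms(1)[OF i(1)] by blast
  have "1 * 1 \<le> ?y i * of_nat (T i j)"
    using Suc.IH[OF i(1)] i(2) by (intro mult_mono) auto
  also have "\<dots> \<le> (\<Sum>i<n. ?y i * of_nat (T i j))"
    using \<open>i < n\<close> rmul_iter_nonneg[of x, OF assms(2)]
    by (intro member_le_sum[of i "{..<n}" "\<lambda>i. ?y i * of_nat (T i j)"]) auto
  finally show ?case using i(3) by (simp add: rmul_apply)
qed (use assms in auto)

text \<open>Every row sum over \<open>L\<close> is at least one, so a nonnegative vector does not
  lose total mass. This is the test against nilpotency when rows are nonzero.\<close>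

lemma rmul_sum_mono:
  assumes "\<And>i. i \<in> L \<Longrightarrow> i < n \<and> (\<exists>j\<in>L. T i j \<noteq> 0)" "finite L" "\<And>j. y j \<ge> 0"
  shows "(\<Sum>j\<in>L. y j) \<le> (\<Sum>j\<in>L. rmul n T y j)"
proof -
  have row: "1 \<le> (\<Sum>j\<in>L. of_nat (T i j) :: rat)" if i: "i \<in> L" for i
  proof -
    obtain j where j: "j \<in> L" "T i j \<noteq> 0" using assms(1)[OF i] by blast
    have "(1 :: rat) \<le> of_nat (T i j)" using j(2) by (simp add: Suc_leI)
    also have "\<dots> \<le> (\<Sum>j\<in>L. of_nat (T i j))" using j assms(2) by (intro member_le_sum) auto
    finally show ?thesis .
  qed
  have "(\<Sum>i\<in>L. y i) \<le> (\<Sum>i\<in>L. y i * (\<Sum>j\<in>L. of_nat (T i j)))"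
    using row assms(3) by (intro sum_mono) (metis mult.right_neutral mult_left_mono)
  also have "\<dots> = (\<Sum>j\<in>L. \<Sum>i\<in>L. y i * of_nat (T i j))"
    by (simp add: sum_distrib_left) (rule sum.swap)
  also have "\<dots> \<le> (\<Sum>j\<in>L. rmul n T y j)"
  proof (rule sum_mono)
    fix j assume "j \<in> L"
    then have "j < n" using assms(1) by blast
    have "(\<Sum>i\<in>L. y i * of_nat (T i j)) \<le> (\<Sum>i<n. y i * of_nat (T i j))"
      using assms by (intro sum_mono2) auto
    then show "(\<Sum>i\<in>L. y i * of_nat (T i j)) \<le> rmul n T y j" using \<open>j < n\<close> by (simp add: rmul_def)
  qed
  finally show ?thesis .
qed

text \<open>The relation chain lives on the vertices that are neither sinks nor sources, so at most one
  vertex is missing; if one were missing, the matrix would be nilpotent on the others, although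
  its restriction to them has no zero row or no zero column.\<close>

lemma no_sinks_sources:
  assumes n: "n \<ge> 2" and zs: "\<And>j. j < n \<Longrightarrow> \<forall>i<n. T i j = 0 \<Longrightarrow> z j = 0" "\<And>j. j \<ge> n \<Longrightarrow> z j = 0"
    and nz: "\<exists>i<n. (\<exists>j<n. T i j \<noteq> 0) \<and> (rmul n T ^^ (n - 2)) z i \<noteq> 0"
    and van: "\<And>i. i < n \<Longrightarrow> \<exists>j<n. T i j \<noteq> 0 \<Longrightarrow> (rmul n T ^^ (n - 1)) z i = 0"
  shows "\<forall>i<n. \<exists>j<n. T i j \<noteq> 0" "\<forall>j<n. \<exists>i<n. T i j \<noteq> 0"
proof -
  define L where "L = {i. i < n \<and> (\<exists>j<n. T i j \<noteq> 0) \<and> (\<exists>j<n. T j i \<noteq> 0)}"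
  \<comment> \<open>The compression of the matrix to the vertices that are neither sinks nor
    sources.\<close>
  define U where "U y = restr L (rmul n T y)" for y :: "nat \<Rightarrow> rat"
  have Ladd: "U (f + g) = U f + U g" and Lscale: "U (\<lambda>x. c * f x) = (\<lambda>x. c * U f x)" for f g c
    by (auto simp: U_def rmul_add rmul_scale restr_def fun_eq_iff)
  have finL: "finite L" by (simp add: L_def)
  have srcz: "(rmul n T ^^ k) z j = 0" if "j < n" "\<forall>i<n. T i j = 0" for k j
    using that zs(1) by (cases k) (auto simp: rmul_def)
  \<comment> \<open>Compression loses nothing on this orbit: coordinates at sources are zero
    throughout by \<open>srcz\<close>, and coordinates at sinks meet zero rows.\<close>
  have chain: "(U ^^ k) (restr L z) = restr L ((rmul n T ^^ k) z)" for k
  proof (induction k)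
    case (Suc k)
    let ?y = "(rmul n T ^^ k) z"
    have "rmul n T (restr L ?y) = rmul n T ?y"
    proof
      fix j
      have "restr L ?y i * of_nat (T i j) = ?y i * of_nat (T i j)" if "i < n" "j < n" for i
        using srcz[of i k] that by (auto simp: restr_def L_def)
      then show "rmul n T (restr L ?y) j = rmul n T ?y j"
        by (cases "j < n") (auto simp: rmul_apply rmul_supp intro!: sum.cong)
    qed
    then show ?case using Suc by (simp add: U_def)
  qed simp
  define m where "m = n - 2"
  have m: "Suc m = n - 1" "n = Suc (Suc m)" using n by (auto simp: m_def)
  have nzU: "(U ^^ m) (restr L z) \<noteq> 0"
  proof -
    obtain i where i: "i < n" "\<exists>j<n. T i j \<noteq> 0" "(rmul n T ^^ m) z i \<noteq> 0" using nz by (auto simp: m_def)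
    have "\<exists>j<n. T j i \<noteq> 0" using srcz[OF i(1), of m] i(3) by blast
    then have "i \<in> L" using i(1,2) by (simp add: L_def)
    then have "(U ^^ m) (restr L z) i \<noteq> 0" using i unfolding chain by (simp add: restr_def)
    then show ?thesis by auto
  qed
  have zU: "(U ^^ Suc m) (restr L z) = 0"
    unfolding chain m(1) using van by (auto simp: restr_def L_def fun_eq_iff)
  let ?B = "(\<lambda>l. (U ^^ l) (restr L z)) ` {m - m..m}"
  have ind: "fv.independent ?B" "card ?B = Suc m"
    using chain_independent[of U m "restr L z" m, OF Ladd Lscale nzU zU] by auto
  have supB: "b j = 0" if "b \<in> ?B" "j \<notin> L" for b j
    using that unfolding chain by (auto simp: restr_def)
  have "card ?B \<le> card L" by (rule independent_supp_card(2)[OF finL ind(1)]) (rule supB)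
  then have cardL: "n - 1 \<le> card L" using ind(2) m(1) by simp
  have Lsub: "L \<subseteq> {..<n}" by (auto simp: L_def)
  have "L = {..<n}"
  proof (rule ccontr)
    assume "L \<noteq> {..<n}"
    then obtain s where s: "s < n" "s \<notin> L" using Lsub by blast
    have "L \<subseteq> {..<n} - {s}" using Lsub s by blast
    moreover have "card ({..<n} - {s}) = n - 1" using s by simp
    ultimately have Leq: "L = {..<n} - {s}" using cardL by (intro card_seteq) auto
    have cL: "card L = Suc m" using Leq s m(1) by (simp only: card_Diff_singleton lessThan_iff card_lessThan)
    \<comment> \<open>With exactly \<open>n - 1\<close> vertices in \<open>L\<close>, the chain is a
      basis of the vectors on \<open>L\<close>, so the compressed map is nilpotent.\<close>
    have kill: "(U ^^ Suc m) y = 0" if y: "\<And>j. j \<notin> L \<Longrightarrow> y j = 0" for y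
    proof -
      have "y \<in> fv.span ?B"
      proof (rule independent_supp_span[of L ?B y])
        show "card ?B = card L" unfolding ind(2) cL ..
        show "b j = 0" if "b \<in> ?B" "j \<notin> L" for b j using that by (rule supB)
      qed (fact finL ind(1) y)+
      then have "(U ^^ Suc m) y \<in> {0}"
      proof (rule kernel_span[of "U ^^ Suc m", rotated 4])
        fix b assume "b \<in> ?B"
        then obtain l where "b = (U ^^ l) (restr L z)" by auto
        then have "(U ^^ Suc m) b = (U ^^ l) ((U ^^ Suc m) (restr L z))"
          by (metis comp_apply funpow_add add.commute)
        then show "(U ^^ Suc m) b \<in> {0}"
          using zU additive_zero[of "U ^^ l"] funpow_additive[of U, OF Ladd] by simp
      qed (simp_all add: funpow_additive[of U, OF Ladd] funpow_homogeneous[of U, OF Lscale] subspace_zero del: funpow.simps)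
      then show ?thesis by simp
    qed
    have Ustep: "(U ^^ Suc k) y j = (if j \<in> L then rmul n T ((U ^^ k) y) j else 0)" for k y j
      by (simp add: U_def restr_def)
    \<comment> \<open>A positive vector on \<open>L\<close>, which a nilpotent map would have to
      annihilate in the end.\<close>
    define o1 where "o1 = restr L (\<lambda>_. 1 :: rat)"
    have o1: "(U ^^ Suc m) o1 = 0" by (rule kill) (simp add: o1_def restr_def)
    have Lne: "\<exists>p. p \<in> L" using cL by (metis card.empty ex_in_conv nat.distinct(1))
    have Usupp: "(U ^^ k) o1 j = 0" if "j \<notin> L" for k j
      using that by (cases k) (auto simp: o1_def restr_def Ustep simp del: funpow.simps(2))
    have Unn: "(U ^^ k) o1 j \<ge> 0" for k j
    proof (induction k arbitrary: j)
      case (Suc k)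
      have "rmul n T ((U ^^ k) o1) j \<ge> 0" unfolding rmul_def using Suc by (auto intro!: sum_nonneg)
      then show ?case by (simp add: Ustep del: funpow.simps(2))
    qed (simp add: o1_def restr_def)
    show False
    \<comment> \<open>If the missing vertex \<open>s\<close> is a sink, predecessors of members of
      \<open>L\<close> stay in \<open>L\<close> and the entries of the orbit remain at least one. If
      it is a source, successors stay in \<open>L\<close> and the total mass does not
      decrease.\<close>
    proof (cases "\<exists>j<n. T s j \<noteq> 0")
      case False
      have pred: "\<exists>i\<in>L. T i j \<noteq> 0" if "j \<in> L" for j
      proof -
        from \<open>j \<in> L\<close> obtain i where "i < n" "T i j \<noteq> 0" by (auto simp: L_def)
        moreover have "i \<noteq> s" using False \<open>j \<in> L\<close> calculation by (auto simp: L_def)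
        ultimately show ?thesis using Leq by auto
      qed
      have "(U ^^ k) o1 j \<ge> 1" if "j \<in> L" for k j
        using that
      proof (induction k arbitrary: j)
        case (Suc k)
        have "rmul n T ((U ^^ k) o1) j \<ge> 1"
          using rmul_iter_ge_one[of L n T "(U ^^ k) o1" j 1] pred Lsub Unn Suc by auto
        then show ?case using Suc.prems by (simp add: Ustep del: funpow.simps(2))
      qed (simp add: o1_def restr_def)
      then show False using o1 Lne by (metis not_one_le_zero zero_fun_apply)
    next
      case True
      then have src: "\<forall>j<n. T j s = 0" using s by (auto simp: L_def)
      have succ: "\<exists>j\<in>L. T i j \<noteq> 0" if "i \<in> L" for i
      proof -
        from \<open>i \<in> L\<close> obtain j where "j < n" "T i j \<noteq> 0" by (auto simp: L_def)
        moreover have "j \<noteq> s" using src \<open>i \<in> L\<close> calculation by (auto simp: L_def)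
        ultimately show ?thesis using Leq by auto
      qed
      have "(\<Sum>j\<in>L. (U ^^ k) o1 j) \<ge> of_nat (card L)" for k
      proof (induction k)
        case 0
        have "(\<Sum>j\<in>L. o1 j) = (\<Sum>j\<in>L. 1)" by (intro sum.cong) (auto simp: o1_def restr_def)
        then show ?case by simp
      next
        case (Suc k)
        have "(\<Sum>j\<in>L. (U ^^ k) o1 j) \<le> (\<Sum>j\<in>L. rmul n T ((U ^^ k) o1) j)"
          using succ Lsub finL Unn by (intro rmul_sum_mono) auto
        also have "\<dots> = (\<Sum>j\<in>L. (U ^^ Suc k) o1 j)" by (intro sum.cong) (auto simp: Ustep simp del: funpow.simps(2))
        finally show ?case using Suc by simp
      qed
      from this[of "Suc m"] show False using o1 cL by simp
    qed
  qed
  then show "\<forall>i<n. \<exists>j<n. T i j \<noteq> 0" "\<forall>j<n. \<exists>i<n. T i j \<noteq> 0" unfolding L_def by blast+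
qed

lemma funpow_swap: "(U ^^ k) ((U ^^ l) x) = (U ^^ l) ((U ^^ k) x)"
  using funpow_add[of k l U] funpow_add[of l k U] by (metis add.commute comp_apply)

text \<open>Applied to a relation, \<open>U ^^ (m - k)\<close> kills the terms beyond
  \<open>k\<close>; the coefficients before \<open>k\<close> are zero by induction, which leaves
  \<open>c k\<close> times the nonzero end of the chain. This is independence for an indexed family,
  the form needed in Step 2.\<close>

lemma chain_coeffs:
  fixes U :: "('x \<Rightarrow> 'k::field) \<Rightarrow> 'x \<Rightarrow> 'k"
  assumes add: "\<And>f g. U (f + g) = U f + U g" and scale: "\<And>c f. U (\<lambda>x. c * f x) = (\<lambda>x. c * U f x)"
    and nz: "(U ^^ m) x \<noteq> 0" and z: "(U ^^ Suc m) x = 0"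
    and sum: "(\<Sum>k\<le>m. (\<lambda>i. c k * (U ^^ k) x i)) = 0" and k: "k \<le> m"
  shows "c k = 0"
  using k
proof (induction k rule: less_induct)
  case (less k)
  let ?W = "U ^^ (m - k)"
  note W = funpow_additive[of U, OF add] funpow_homogeneous[of U, OF scale]
  have late: "(U ^^ l) x = 0" if "l > m" for l
  proof -
    have "(U ^^ l) x = (U ^^ (l - Suc m)) ((U ^^ Suc m) x)"
      using that funpow_add[of "l - Suc m" "Suc m" U] by (simp add: fun_eq_iff del: funpow.simps)
    then show ?thesis unfolding z using additive_zero[of "U ^^ (l - Suc m)", OF W(1)] by simp
  qed
  have sumW: "?W (\<Sum>k\<in>S. f k) = (\<Sum>k\<in>S. ?W (f k))" if "finite S" for S and f :: "nat \<Rightarrow> 'x \<Rightarrow> 'k"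
    using that by (induction S rule: finite_induct) (simp_all only: sum.empty sum.insert W(1) additive_zero[of ?W, OF W(1)] not_False_eq_True)
  have "0 = ?W (\<Sum>j\<le>m. (\<lambda>i. c j * (U ^^ j) x i))" using sum additive_zero[of ?W, OF W(1)] by simp
  also have "\<dots> = (\<Sum>j\<le>m. (\<lambda>i. c j * (U ^^ (m - k + j)) x i))"
    by (simp add: sumW W(2) funpow_add)
  also have "\<dots> = (\<Sum>j\<le>m. if j = k then (\<lambda>i. c j * (U ^^ m) x i) else 0)"
  proof (rule sum.cong)
    fix j assume "j \<in> {..m}"
    consider "j < k" | "j = k" | "j > k" by linarith
    then show "(\<lambda>i. c j * (U ^^ (m - k + j)) x i) = (if j = k then (\<lambda>i. c j * (U ^^ m) x i) else 0)"
    proof cases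
      case 1
      then show ?thesis using less by (auto simp: fun_eq_iff)
    next
      case 2
      then show ?thesis using less.prems by simp
    next
      case 3
      then have "m - k + j > m" using less.prems by linarith
      then show ?thesis using 3 late by (auto simp: fun_eq_iff)
    qed
  qed simp
  also have "\<dots> = (\<lambda>i. c k * (U ^^ m) x i)" using less.prems by simp
  finally have *: "c k * (U ^^ m) x i = 0" for i by (metis zero_fun_apply)
  obtain i where "(U ^^ m) x i \<noteq> 0" using nz by (auto simp: fun_eq_iff)
  then show ?case using *[of i] by simp
qed

lemma dlt_independent:
  assumes "finite L" shows "fv.independent (dlt ` L)" "card (dlt ` L) = card L"
proof -
  have inj: "inj dlt" by (rule injI) (metis dlt_def zero_neq_one)
  then show "card (dlt ` L) = card L" by (intro card_image) (auto intro: inj_on_subset)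
  show "fv.independent (dlt ` L)" using assms
  proof (induction L rule: finite_induct)
    case (insert j L)
    have "dlt j \<notin> fv.span (dlt ` L)"
    proof
      assume "dlt j \<in> fv.span (dlt ` L)"
      \<comment> \<open>Evaluation at \<open>j\<close> is viewed as a linear map into functions on
        \<open>unit\<close>, so that \<open>kernel_span\<close> applies to it.\<close>
      then have "(\<lambda>_::unit. dlt j j) \<in> {0}"
      proof (rule kernel_span[of "\<lambda>f _. f j", rotated 4])
        fix b assume "b \<in> dlt ` L"
        then show "(\<lambda>_::unit. b j) \<in> {0}" using insert.hyps by (auto simp: dlt_def fun_eq_iff)
      qed (rule subspace_zero | simp add: fun_eq_iff)+
      then show False by (auto simp: dlt_def fun_eq_iff)
    qed
    moreover have "dlt j \<notin> dlt ` L" using inj insert.hyps by (auto dest: injD)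
    ultimately show ?case using insert.IH by (simp add: fv.independent_insert)
  qed (simp add: fv.independent_empty)
qed

text \<open>In lowest terms the denominator to the \<open>k\<close> divides the numerator to the
  \<open>k\<close> and is coprime to it, so it is one.\<close>

lemma rat_power_Ints:
  assumes "(x :: rat) ^ k \<in> \<int>" "k \<ge> 1"
  shows "x \<in> \<int>"
proof -
  obtain a b where ab: "quotient_of x = (a, b)" by force
  have b: "b > 0" "coprime a b" "x = of_int a / of_int b"
    using quotient_of_denom_pos[OF ab] quotient_of_coprime[OF ab] quotient_of_div[OF ab] by auto
  obtain c where "x ^ k = of_int c" using assms(1) by (auto elim: Ints_cases)
  then have "(of_int (a ^ k) :: rat) = of_int (c * b ^ k)"
    using b(1,3) by (simp add: power_divide field_simps)
  then have "a ^ k = c * b ^ k" by (simp only: of_int_eq_iff)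
  then have "b ^ k dvd a ^ k" by simp
  moreover have "coprime (a ^ k) (b ^ k)" using b(2) by simp
  ultimately have "b ^ k dvd 1" by (metis coprime_common_divisor dvd_refl)
  moreover have "b dvd b ^ k" using assms(2) by (intro dvd_power) simp
  ultimately have "b dvd 1" by (rule dvd_trans[rotated])
  then have "b = 1" using b(1) by simp
  then show ?thesis using b(3) by simp
qed

lemma rmul_iter_Ints:
  assumes "\<And>j. x j \<in> \<int>" shows "(rmul n T ^^ k) x j \<in> \<int>"
proof (induction k arbitrary: j)
  case (Suc k)
  have "rmul n T ((rmul n T ^^ k) x) j \<in> \<int>"
    using Suc by (cases "j < n") (auto simp: rmul_apply rmul_supp intro!: Ints_sum Ints_mult)
  then show ?case by simp
qed (simp add: assms)

section \<open>Perron vectors and the nilpotent chain\<close>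

text \<open>The relation chain spans a hyperplane \<open>C\<close>, whose annihilator \<open>v\<close> is an eigenvector. The
  \<open>(n-1)\<close>-st power of the matrix kills \<open>C\<close>, hence is \<open>v w\<^sub>0\<^sup>T\<close>, and it has neither a zero row nor a
  zero column, so that \<open>v\<close> and \<open>w\<^sub>0\<close> are positive; its trace \<open>\<mu>\<^sup>n\<^sup>-\<^sup>1\<close> is an integer \<open>\<ge> n\<close>.\<close>

lemma perron_data:
  assumes n: "n \<ge> 2" and rows: "\<forall>i<n. \<exists>j<n. T i j \<noteq> 0" and cols: "\<forall>j<n. \<exists>i<n. T i j \<noteq> 0"
    and zs: "\<And>j. j \<ge> n \<Longrightarrow> z j = 0"
    and nz: "(rmul n T ^^ (n - 2)) z \<noteq> 0" and van: "(rmul n T ^^ (n - 1)) z = 0"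
  obtains v w u l where "l \<ge> (2::nat)" "\<And>i. i < n \<Longrightarrow> v i > 0" "\<And>i. i < n \<Longrightarrow> w i > 0" "dot n v w = 1"
    "\<And>i. i < n \<Longrightarrow> cmul n T v i = of_nat l * v i" "\<And>k. dot n w ((cmul n T ^^ k) u) = 0"
    "(cmul n T ^^ (n - 2)) u \<noteq> 0" "(cmul n T ^^ (n - 1)) u = 0" "\<And>j. j \<ge> n \<Longrightarrow> u j = 0"
proof -
  define m where "m = n - 2"
  have m: "Suc m = n - 1" "n = Suc (Suc m)" using n by (auto simp: m_def)
  let ?x = "\<lambda>l. (rmul n T ^^ l) z"
  let ?B = "?x ` {m - m..m}"
  define C where "C = fv.span ?B"
  have nz': "?x m \<noteq> 0" using nz by (simp add: m_def)
  have van': "?x (Suc m) = 0" using van unfolding m(1) by simp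
  have ind: "fv.independent ?B" "card ?B = Suc m"
    using chain_independent[of "rmul n T" m z m, OF rmul_add rmul_scale nz' van'] by blast+
  have Csub: "fv.subspace C" unfolding C_def by (rule fv.subspace_span)
  note Cc = fv.subspace_0[OF Csub] fv.subspace_add[OF Csub] fv.subspace_scale[OF Csub] fv.subspace_diff[OF Csub]
  have xC: "?x l \<in> C" for l
  proof (cases "l \<le> m")
    case True
    then show ?thesis unfolding C_def by (intro fv.span_base) auto
  next
    case False
    then have "?x l = (rmul n T ^^ (l - Suc m)) (?x (Suc m))"
      using funpow_add[of "l - Suc m" "Suc m" "rmul n T"] by (simp add: fun_eq_iff del: funpow.simps)
    then have "?x l = 0"
      using van' additive_zero[of "rmul n T ^^ (l - Suc m)", OF rmul_iter_add] by simp
    then show ?thesis using Cc(1) by simp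
  qed
  have Csupp: "y j = 0" if "y \<in> C" "j \<ge> n" for y j
  proof -
    have "(\<lambda>_::unit. y j) \<in> {0}"
    proof (rule kernel_span[of "\<lambda>f _. f j", rotated 4])
      show "y \<in> fv.span ?B" using that(1) by (simp add: C_def)
      fix b assume "b \<in> ?B"
      then show "(\<lambda>_::unit. b j) \<in> {0}" using rmul_iter_supp[of n z, OF zs that(2)] by (auto simp: fun_eq_iff)
    qed (rule subspace_zero | simp add: fun_eq_iff)+
    then show ?thesis by (auto simp: fun_eq_iff)
  qed
  have Cinv: "rmul n T y \<in> C" if "y \<in> C" for y
    using that unfolding C_def[of]
  proof (rule kernel_span[of "rmul n T", OF rmul_add rmul_scale, rotated 2])
    fix b assume "b \<in> ?B"
    then obtain l where "b = ?x l" by auto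
    then show "rmul n T b \<in> fv.span ?B" using xC[of "Suc l"] by (simp add: C_def)
  qed (rule fv.subspace_span)
  have Ckill: "(rmul n T ^^ Suc m) y = 0" if "y \<in> C" for y
  proof -
    have "(rmul n T ^^ Suc m) y \<in> {0}"
    proof (rule kernel_span[of "rmul n T ^^ Suc m", OF rmul_iter_add rmul_iter_scale _ subspace_zero])
      show "y \<in> fv.span ?B" using that by (simp add: C_def)
      fix b assume "b \<in> ?B"
      then obtain l where "b = ?x l" by auto
      then have "(rmul n T ^^ Suc m) b = (rmul n T ^^ l) (?x (Suc m))"
        by (simp only: funpow_swap)
      then show "(rmul n T ^^ Suc m) b \<in> {0}"
        using van' additive_zero[of "rmul n T ^^ l", OF rmul_iter_add] by simp
    qed
    then show ?thesis by simp
  qed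
  \<comment> \<open>\<open>C\<close> has dimension \<open>n - 1\<close>, so some unit vector lies
    outside and spans a complement.\<close>
  obtain t where t: "t < n" "dlt t \<notin> C"
  proof -
    have "\<not> dlt ` {..<n} \<subseteq> C"
    proof
      assume "dlt ` {..<n} \<subseteq> C"
      then have "card (dlt ` {..<n}) \<le> card ?B"
        using fv.independent_span_bound[of ?B "dlt ` {..<n}"] dlt_independent(1)[of "{..<n}"] unfolding C_def by blast
      then show False using dlt_independent(2)[of "{..<n}"] ind(2) m(2) by simp
    qed
    then show thesis using that by blast
  qed
  have tC: "c = 0" if "(\<lambda>i. c * dlt t i) \<in> C" for c
  proof (rule ccontr)
    assume "c \<noteq> 0"
    then have "dlt t = (\<lambda>i. inverse c * (c * dlt t i))" by auto
    then show False using Cc(3)[OF that, of "inverse c"] t(2) by simp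
  qed
  have ex: "\<exists>c. y - (\<lambda>i. c * dlt t i) \<in> C" if y: "\<And>j. j \<ge> n \<Longrightarrow> y j = 0" for y
  proof -
    have nB: "dlt t \<notin> ?B" by (rule contra_subsetD[OF fv.span_superset t(2)[unfolded C_def]])
    have ind': "fv.independent (insert (dlt t) ?B)"
      using ind(1) t(2) nB unfolding C_def fv.independent_insert by (simp only: if_False simp_thms)
    have "y \<in> fv.span (insert (dlt t) ?B)"
    proof (rule independent_supp_span[of "{..<n}", OF finite_lessThan ind'])
      show "card (insert (dlt t) ?B) = card {..<n}"
        using nB ind(2) m(2) by (subst card_insert_disjoint) auto
      show "b j = 0" if b: "b \<in> insert (dlt t) ?B" and j: "j \<notin> {..<n}" for b j
      proof (cases "b = dlt t")
        case True
        then show ?thesis using t(1) j by (auto simp: dlt_def)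
      next
        case False
        then have "b \<in> C" unfolding C_def using b by (intro fv.span_base) simp
        then show ?thesis using Csupp j by simp
      qed
      show "y j = 0" if "j \<notin> {..<n}" for j using y that by simp
    qed
    then show ?thesis unfolding C_def fv.span_breakdown_eq .
  qed
  \<comment> \<open>The coordinate of the \<open>j\<close>-th unit vector modulo \<open>C\<close>,
    measured in units of \<open>dlt t\<close>; hence \<open>v t = 1\<close>, and pairing with
    \<open>v\<close> is the functional with kernel \<open>C\<close>.\<close>
  define v where "v j = (SOME c. dlt j - (\<lambda>i. c * dlt t i) \<in> C)" for j
  have v: "dlt j - (\<lambda>i. v j * dlt t i) \<in> C" if "j < n" for j
    unfolding v_def by (rule someI_ex, rule ex) (use that in \<open>auto simp: dlt_def\<close>)
  have proj: "y - (\<lambda>i. dot n y v * dlt t i) \<in> C" if y: "\<And>j. j \<ge> n \<Longrightarrow> y j = 0" for y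
  proof -
    have "(\<Sum>j<n. (\<lambda>i. y j * (dlt j - (\<lambda>i. v j * dlt t i)) i)) \<in> C"
      by (rule fv.subspace_sum[OF Csub]) (rule Cc(3)[OF v], simp)
    moreover have "(\<Sum>j<n. (\<lambda>i. y j * (dlt j - (\<lambda>i. v j * dlt t i)) i)) = y - (\<lambda>i. dot n y v * dlt t i)"
    proof
      fix i
      have "(\<Sum>j\<in>S. (\<lambda>i. y j * (dlt j - (\<lambda>i. v j * dlt t i)) i)) i
          = (\<Sum>j\<in>S. y j * dlt j i) - (\<Sum>j\<in>S. y j * v j) * dlt t i" if "finite S" for S
        using that by (induction S rule: finite_induct) (auto simp: algebra_simps)
      moreover have "y = (\<Sum>j<n. (\<lambda>i. y j * dlt j i))" by (rule supp_expand) (auto simp: y)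
      then have "y i = (\<Sum>j<n. (\<lambda>i. y j * dlt j i)) i" by (rule fun_cong)
      moreover have "(\<Sum>j\<in>S. (\<lambda>i. y j * dlt j i)) i = (\<Sum>j\<in>S. y j * dlt j i)" if "finite S" for S
        using that by (induction S rule: finite_induct) auto
      ultimately show "(\<Sum>j<n. (\<lambda>i. y j * (dlt j - (\<lambda>i. v j * dlt t i)) i)) i = (y - (\<lambda>i. dot n y v * dlt t i)) i"
        by (simp add: dot_def)
    qed
    ultimately show ?thesis by simp
  qed
  have dotC: "dot n y v = 0" if "y \<in> C" for y
  proof -
    have "y - (y - (\<lambda>i. dot n y v * dlt t i)) \<in> C"
      using Cc(4)[OF that proj] Csupp[OF that] by blast
    then show ?thesis using tC[of "dot n y v"] by simp
  qed
  have dsupp: "j \<ge> n \<Longrightarrow> dlt i j = 0" if "i < n" for i j using that by (simp add: dlt_def)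
  have vt: "v t = 1"
  proof -
    have "dlt t - (\<lambda>i. v t * dlt t i) = (\<lambda>i. (1 - v t) * dlt t i)" by (auto simp: algebra_simps)
    then show ?thesis using v[OF t(1)] tC[of "1 - v t"] by simp
  qed
  \<comment> \<open>The factor by which the matrix acts on the one-dimensional quotient by
    \<open>C\<close>.\<close>
  define \<mu> where "\<mu> = dot n (rmul n T (dlt t)) v"
  have dec: "y = (\<lambda>i. dot n y v * dlt t i) + (y - (\<lambda>i. dot n y v * dlt t i))" for y by simp
  have step: "dot n (rmul n T y) v = \<mu> * dot n y v" if y: "\<And>j. j \<ge> n \<Longrightarrow> y j = 0" for y
  proof -
    have "rmul n T y = rmul n T (\<lambda>i. dot n y v * dlt t i) + rmul n T (y - (\<lambda>i. dot n y v * dlt t i))"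
      using dec[of y] rmul_add by metis
    then show ?thesis using dotC[OF Cinv[OF proj[OF y]]] by (simp add: dot_simps rmul_scale \<mu>_def)
  qed
  have iter: "dot n ((rmul n T ^^ k) y) v = \<mu> ^ k * dot n y v" if y: "\<And>j. j \<ge> n \<Longrightarrow> y j = 0" for k y
  proof (induction k)
    case (Suc k)
    then show ?case using step[of "(rmul n T ^^ k) y"] rmul_iter_supp[of n y, OF y] by simp
  qed simp
  define w0 where "w0 = (rmul n T ^^ Suc m) (dlt t)"
  have rank1: "(rmul n T ^^ Suc m) y = (\<lambda>i. dot n y v * w0 i)" if y: "\<And>j. j \<ge> n \<Longrightarrow> y j = 0" for y
  proof -
    have "(rmul n T ^^ Suc m) y = (rmul n T ^^ Suc m) (\<lambda>i. dot n y v * dlt t i)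
        + (rmul n T ^^ Suc m) (y - (\<lambda>i. dot n y v * dlt t i))"
      using dec[of y] rmul_iter_add by metis
    then show ?thesis using Ckill[OF proj[OF y]] by (simp add: rmul_iter_scale w0_def del: funpow.simps)
  qed
  have P: "(rmul n T ^^ Suc m) (dlt i) j = v i * w0 j" if "i < n" for i j
    using rank1[of "dlt i"] dsupp[OF that] dot_dlt(1)[OF that, of v] by (simp del: funpow.simps)
  have dnn: "dlt i j \<ge> 0" "dlt i j \<in> \<int>" for i j by (auto simp: dlt_def)
  have Pnn: "v i * w0 j \<ge> 0" if "i < n" for i j
    using rmul_iter_nonneg[of "dlt i" "Suc m" n T j, OF dnn(1)] P[OF that] by (simp del: funpow.simps)
  have PZ: "v i * w0 j \<in> \<int>" if "i < n" for i j
    using rmul_iter_Ints[of "dlt i" "Suc m" n T j, OF dnn(2)] P[OF that] by (simp del: funpow.simps)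
  have w0nn: "w0 j \<ge> 0" for j using Pnn[OF t(1), of j] vt by simp
  \<comment> \<open>The image of the all-ones vector is a multiple of \<open>w0\<close> and has
    entries at least one because no column of \<open>T\<close> vanishes.\<close>
  have w0pos: "w0 j > 0" if j: "j < n" for j
  proof -
    let ?o = "\<lambda>j. if j < n then 1 else 0 :: rat"
    have "(rmul n T ^^ Suc m) ?o j \<ge> 1"
      by (rule rmul_iter_ge_one[of "{..<n}"]) (use cols j in auto)
    then have "dot n ?o v * w0 j \<ge> 1" using rank1[of ?o] by (simp del: funpow.simps)
    then show ?thesis using w0nn[of j] by (cases "w0 j = 0") auto
  qed
  \<comment> \<open>The \<open>i\<close>-th row of the power is \<open>v i\<close> times
    \<open>w0\<close>; its mass is at least one because no row of \<open>T\<close> vanishes.\<close>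
  have vpos: "v i > 0" if i: "i < n" for i
  proof -
    have "(\<Sum>j<n. dlt i j) \<le> (\<Sum>j<n. (rmul n T ^^ k) (dlt i) j)" for k
    proof (induction k)
      case (Suc k)
      have "(\<Sum>j<n. (rmul n T ^^ k) (dlt i) j) \<le> (\<Sum>j<n. rmul n T ((rmul n T ^^ k) (dlt i)) j)"
        by (rule rmul_sum_mono) (use rows rmul_iter_nonneg[of "dlt i" _ n T, OF dnn(1)] in auto)
      then show ?case using Suc by simp
    qed simp
    from this[of "Suc m"] have "(\<Sum>j<n. dlt i j) \<le> (\<Sum>j<n. v i * w0 j)"
      by (simp only: P[OF i])
    moreover have "(\<Sum>j<n. dlt i j) = 1" using i by (simp add: dlt_def)
    ultimately have "v i \<noteq> 0" by auto
    moreover have "v i \<ge> 0" using Pnn[OF i, of t] w0pos[OF t(1)] by (simp add: zero_le_mult_iff)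
    ultimately show ?thesis by simp
  qed
  have cv: "cmul n T v i = \<mu> * v i" if i: "i < n" for i
    using step[of "dlt i"] dsupp[OF i] dot_adjoint[of n T "dlt i" v] dot_dlt(1)[OF i] by simp
  have mupos: "\<mu> > 0"
  proof -
    obtain j where j: "j < n" "T t j \<noteq> 0" using rows t(1) by blast
    have "0 < of_nat (T t j) * v j" using j vpos by simp
    also have "\<dots> \<le> (\<Sum>j<n. of_nat (T t j) * v j)"
      using j vpos by (intro member_le_sum[of j "{..<n}" "\<lambda>j. of_nat (T t j) * v j"]) (auto intro!: mult_nonneg_nonneg intro: less_imp_le)
    also have "\<dots> = \<mu>" using cv[OF t(1)] vt t(1) by (simp add: cmul_def)
    finally show ?thesis .
  qed
  have wv: "dot n w0 v = \<mu> ^ Suc m"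
    using iter[of "dlt t" "Suc m"] dsupp[OF t(1)] dot_dlt(1)[OF t(1), of v] vt by (simp add: w0_def del: funpow.simps power_Suc)
  have wv_sum: "dot n w0 v = (\<Sum>i<n. v i * w0 i)" by (simp add: dot_def mult.commute)
  have "\<mu> ^ Suc m \<in> \<int>" unfolding wv[symmetric] wv_sum using PZ by (intro Ints_sum) simp
  then have "\<mu> \<in> \<int>" by (rule rat_power_Ints) simp
  then obtain a where a: "\<mu> = of_int a" by (auto elim: Ints_cases)
  have a1: "a \<ge> 1" using mupos a by simp
  \<comment> \<open>The diagonal entries of the power are positive integers, so the trace is at
    least \<open>n\<close>; as \<open>n \<ge> 2\<close>, this excludes eigenvalue one.\<close>
  have ge: "1 \<le> v i * w0 i" if i: "i < n" for i
  proof -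
    obtain c where c: "v i * w0 i = of_int c" using PZ[OF i, of i] by (auto elim: Ints_cases)
    have "v i * w0 i > 0" using vpos[OF i] w0pos[OF i] by simp
    then show ?thesis using c by simp
  qed
  have "of_nat n \<le> \<mu> ^ Suc m"
    using sum_mono[of "{..<n}" "\<lambda>_. 1" "\<lambda>i. v i * w0 i"] ge unfolding wv[symmetric] wv_sum by simp
  then have "\<mu> \<noteq> 1" using n by auto
  then have a2: "nat a \<ge> 2" using a a1 by (cases "a = 1") auto
  have mua: "\<mu> = of_nat (nat a)" using a a1 by simp
  \<comment> \<open>Normalised so that the pairing with \<open>v\<close>, which is
    \<open>\<mu> ^ Suc m\<close> for \<open>w0\<close>, becomes one.\<close>
  define w where "w = (\<lambda>i. inverse (\<mu> ^ Suc m) * w0 i)"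
  have mp: "\<mu> ^ Suc m > 0" by (rule zero_less_power[OF mupos])
  have w0s: "j \<ge> n \<Longrightarrow> w0 j = 0" for j
    unfolding w0_def by (rule rmul_iter_supp[OF dsupp[OF t(1)]])
  have rw0: "rmul n T w0 = (\<lambda>i. \<mu> * w0 i)"
  proof -
    have "rmul n T w0 = (rmul n T ^^ Suc m) (rmul n T (dlt t))" unfolding w0_def by (simp add: funpow_swap1)
    then show ?thesis using rank1[of "rmul n T (dlt t)"] rmul_supp by (simp add: \<mu>_def del: funpow.simps)
  qed
  have w0w: "w0 j = \<mu> ^ Suc m * w j" for j
  proof -
    have "\<mu> ^ Suc m * inverse (\<mu> ^ Suc m) = 1" using mupos by (intro right_inverse) simp
    then show ?thesis unfolding w_def mult.assoc[symmetric] by (simp only: mult_1)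
  qed
  have rw1: "rmul n T w = (\<lambda>i. \<mu> * w i)" by (simp only: w_def rmul_scale rw0 mult.left_commute)
  have rw: "(rmul n T ^^ k) w = (\<lambda>i. \<mu> ^ k * w i)" for k
  proof (induction k)
    case (Suc k)
    then show ?case by (simp add: rmul_scale rw1)
  qed simp
  have wvone: "dot n w v = 1" unfolding w_def dot_simps wv using mupos by (intro left_inverse) simp
  \<comment> \<open>A coordinate at which the end of the row chain does not vanish; pairing with it
    will show that the column chain from \<open>u\<close> is long enough.\<close>
  obtain p where p: "?x m p \<noteq> 0" using nz' by (auto simp: fun_eq_iff)
  have pn: "p < n" using p rmul_iter_supp[of n z, OF zs] by (meson not_le)
  \<comment> \<open>\<open>v\<close> is defined on all of \<open>nat\<close>; the cut-off makes
    \<open>u\<close> vanish from \<open>n\<close> on.\<close>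
  define v' where "v' = (\<lambda>j. if j < n then v j else 0)"
  have dv': "dot n y v' = dot n y v" for y by (simp add: dot_def v'_def)
  \<comment> \<open>The unit vector at \<open>p\<close>, projected along \<open>v\<close> to the
    hyperplane orthogonal to \<open>w\<close>. The power \<open>v w^T\<close> kills it, while the
    end of the row chain pairs with it to its \<open>p\<close>-th coordinate, since that end is
    orthogonal to \<open>v\<close>.\<close>
  define u where "u = dlt p + (\<lambda>i. - w p * v' i)"
  have du: "dot n y u = y p - w p * dot n y v" for y
    unfolding u_def dot_simps dot_dlt(2)[OF pn] dv' by simp
  have wu: "dot n w ((cmul n T ^^ k) u) = 0" for k
    unfolding dot_adjoint_iter[symmetric] rw dot_simps du wvone by simp
  have us: "j \<ge> n \<Longrightarrow> u j = 0" for j using dsupp[OF pn] by (simp add: u_def v'_def)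
  have "(cmul n T ^^ Suc m) u = 0"
  proof
    fix i
    show "(cmul n T ^^ Suc m) u i = 0 i"
    proof (cases "i < n")
      case True
      have "(cmul n T ^^ Suc m) u i = dot n ((rmul n T ^^ Suc m) (dlt i)) u"
        unfolding dot_adjoint_iter dot_dlt(1)[OF True] ..
      also have "(rmul n T ^^ Suc m) (dlt i) = (\<lambda>j. v i * (\<mu> ^ Suc m * w j))"
        by (rule ext) (simp only: P[OF True] w0w)
      also have "dot n \<dots> u = 0" using wu[of 0] by (simp add: dot_simps)
      finally show ?thesis by simp
    qed (simp add: cmul_def)
  qed
  moreover have "(cmul n T ^^ m) u \<noteq> 0"
  proof
    assume "(cmul n T ^^ m) u = 0"
    then have "dot n (?x m) u = 0" by (simp add: dot_adjoint_iter dot_simps)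
    then show False using p du dotC[OF xC[of m]] by simp
  qed
  moreover have "dot n v w = 1" using wvone by (simp add: dot_def mult.commute)
  moreover have "w i > 0" if "i < n" for i unfolding w_def by (intro mult_pos_pos positive_imp_inverse_positive mp w0pos[OF that])
  ultimately show thesis
    using that[OF a2, of v w u] vpos cv mua wu us m(1)[symmetric] by (simp add: m_def[symmetric] del: funpow.simps)
qed

section \<open>Quivers produced by the procedure\<close>

definition adj :: "('v, 'e) pre_digraph \<Rightarrow> (nat \<Rightarrow> 'v) \<Rightarrow> nat \<Rightarrow> nat \<Rightarrow> nat" where
  "adj Q \<nu> i j = card {e \<in> arcs Q. tail Q e = \<nu> i \<and> head Q e = \<nu> j}"

lemma sum_M_mat_right:
  assumes "k < n"
  shows "(\<Sum>h<n. f h * M_mat n q $$ (h, k))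
    = (if Suc k = n then f (n - 1) * q else if Suc (Suc k) < n then f (Suc k) else 0)"
proof -
  consider "Suc k = n" | "Suc (Suc k) < n" | "Suc (Suc k) = n" using assms by linarith
  then show ?thesis
  proof cases
    case 1
    then have "(\<Sum>h<n. f h * M_mat n q $$ (h, k)) = (\<Sum>h<n. if h = n - 1 then f h * q else 0)"
      using assms by (intro sum.cong) (auto simp: M_mat_def)
    then show ?thesis using 1 by simp
  next
    case 2
    then have "(\<Sum>h<n. f h * M_mat n q $$ (h, k)) = (\<Sum>h<n. if h = Suc k then f h else 0)"
      using assms by (intro sum.cong) (auto simp: M_mat_def)
    then show ?thesis using 2 by simp
  next
    case 3
    then have "(\<Sum>h<n. f h * M_mat n q $$ (h, k)) = (\<Sum>h<n. 0)"
      using assms by (intro sum.cong) (auto simp: M_mat_def)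
    then show ?thesis using 3 by simp
  qed
qed

lemma sum_M_mat_left:
  assumes "k < n"
  shows "(\<Sum>h<n. M_mat n q $$ (k, h) * f h)
    = (if Suc k = n then q * f (n - 1) else if k = 0 then 0 else f (k - 1))"
proof -
  consider "Suc k = n" | "Suc k < n" "k = 0" | "Suc k < n" "k \<noteq> 0" using assms by linarith
  then show ?thesis
  proof cases
    case 1
    then have "(\<Sum>h<n. M_mat n q $$ (k, h) * f h) = (\<Sum>h<n. if h = n - 1 then q * f h else 0)"
      using assms by (intro sum.cong) (auto simp: M_mat_def)
    then show ?thesis using 1 by simp
  next
    case 2
    then have "(\<Sum>h<n. M_mat n q $$ (k, h) * f h) = (\<Sum>h<n. 0)"
      using assms by (intro sum.cong) (auto simp: M_mat_def)
    then show ?thesis using 2 by simp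
  next
    case 3
    then have "(\<Sum>h<n. M_mat n q $$ (k, h) * f h) = (\<Sum>h<n. if h = k - 1 then f h else 0)"
      using assms by (intro sum.cong) (auto simp: M_mat_def)
    then show ?thesis using 3 by simp
  qed
qed

lemma A_mat_index:
  assumes "length vs = n - 1" "i < n" "k < n"
  shows "A_mat n vs v $$ (i, k) = (if k < n - 1 then (vs ! k) $ i else v $ i)"
proof (cases "k < n - 1")
  case False
  then have "k = n - 1" using assms(3) by simp
  then show ?thesis using assms by (simp add: A_mat_def mat_of_cols_index nth_append)
qed (use assms in \<open>simp add: A_mat_def mat_of_cols_index nth_append\<close>)

text \<open>The coordinates of \<open>x\<close> are its products with the rows of \<open>B\<close>;
  the last row is \<open>w\<close>, so the coordinate along \<open>v\<close> vanishes.\<close>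

lemma orth_compl_spanned:
  assumes n: "n \<ge> 1" and len: "length vs = n - 1" and w: "w \<in> carrier_vec n"
    and B: "B \<in> carrier_mat n n" "A_mat n vs v * B = 1\<^sub>m n" "\<And>j. j < n \<Longrightarrow> B $$ (n - 1, j) = w $ j"
    and A: "A_mat n vs v \<in> carrier_mat n n" and x: "x \<in> orth_compl n w"
  shows "\<exists>c. \<forall>i<n. x $ i = (\<Sum>k<n - 1. c k * (vs ! k) $ i)"
proof -
  let ?A = "A_mat n vs v"
  define b where "b k = (\<Sum>j<n. B $$ (k, j) * x $ j)" for k
  have "b (n - 1) = x \<bullet> w"
    unfolding b_def scalar_prod_def using w B(3) by (intro sum.cong) (auto simp: mult.commute)
  then have b0: "b (n - 1) = 0" using x by (simp add: orth_compl_def)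
  have "x $ i = (\<Sum>k<n - 1. b k * (vs ! k) $ i)" if i: "i < n" for i
  proof -
    have "x $ i = (\<Sum>j<n. if j = i then x $ j else 0)" using i by simp
    also have "\<dots> = (\<Sum>j<n. (?A * B) $$ (i, j) * x $ j)"
      by (intro sum.cong) (auto simp: B(2) i)
    also have "\<dots> = (\<Sum>j<n. \<Sum>k<n. ?A $$ (i, k) * B $$ (k, j) * x $ j)"
      by (intro sum.cong refl) (use mat_mult_index[OF A B(1) i] in \<open>simp add: sum_distrib_right\<close>)
    also have "\<dots> = (\<Sum>k<n. \<Sum>j<n. ?A $$ (i, k) * B $$ (k, j) * x $ j)" by (rule sum.swap)
    also have "\<dots> = (\<Sum>k<n. ?A $$ (i, k) * b k)" by (simp add: b_def sum_distrib_left mult.assoc)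
    also have "\<dots> = (\<Sum>k<n - 1. ?A $$ (i, k) * b k)"
      by (rule sum.mono_neutral_right) (use b0 in \<open>auto simp: not_less dest!: le_antisym\<close>)
    also have "\<dots> = (\<Sum>k<n - 1. b k * (vs ! k) $ i)"
      by (intro sum.cong refl) (use A_mat_index[OF len i] in \<open>simp add: mult.commute\<close>)
    finally show ?thesis .
  qed
  then show ?thesis by blast
qed

text \<open>The hypotheses say column by column that the adjacency matrix times the matrix of
  \<open>u 0, ..., u (n - 2), v\<close> equals that matrix times \<open>M_mat\<close>. Multiplying
  by the inverse gives the conjugate itself, so \<open>m = 1\<close> serves in Step 4.\<close>

lemma producedI:
  assumes n: "n \<ge> 1" and l: "l \<ge> 2"
    and pos: "\<And>i. i < n \<Longrightarrow> v i > 0" "\<And>i. i < n \<Longrightarrow> w i > 0" and vw: "dot n v w = 1"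
    and Tv: "\<And>i. i < n \<Longrightarrow> cmul n (adj Q \<nu>) v i = of_nat l * v i"
    and orth: "\<And>k. k < n - 1 \<Longrightarrow> dot n w (u k) = 0"
    and indep: "\<And>c k. \<lbrakk>\<And>i. i < n \<Longrightarrow> (\<Sum>k<n - 1. c k * u k i) = 0; k < n - 1\<rbrakk> \<Longrightarrow> c k = 0"
    and Tu: "\<And>k i. \<lbrakk>k < n - 1; i < n\<rbrakk> \<Longrightarrow>
      cmul n (adj Q \<nu>) (u k) i = (if Suc k < n - 1 then u (Suc k) i else 0)"
  shows "produced n Q \<nu>"
proof -
  define v' where "v' = vec n v"
  define w' where "w' = vec n w"
  define vs where "vs = map (\<lambda>k. vec n (u k)) [0..<n - 1]"
  have len: "length vs = n - 1" by (simp add: vs_def)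
  have nth: "vs ! k = vec n (u k)" if "k < n - 1" for k using that by (simp add: vs_def)
  have "v' \<bullet> w' = dot n v w"
    unfolding scalar_prod_def dot_def by (rule sum.cong) (auto simp: v'_def w'_def)
  then have s1: "step1 n v' w'" using pos vw by (simp add: step1_def v'_def w'_def)
  have w': "w' \<in> carrier_vec n" by (simp add: w'_def)
  have sub: "set vs \<subseteq> orth_compl n w'"
  proof
    fix x assume "x \<in> set vs"
    then obtain k where k: "k < n - 1" "x = vec n (u k)" by (auto simp: vs_def)
    have "x \<bullet> w' = dot n w (u k)"
      unfolding scalar_prod_def dot_def k(2) by (rule sum.cong) (auto simp: w'_def)
    then show "x \<in> orth_compl n w'" using orth[OF k(1)] k(2) by (simp add: orth_compl_def)
  qed
  have ind: "\<forall>c. (\<forall>i<n. (\<Sum>k<n - 1. c k * (vs ! k) $ i) = 0) \<longrightarrow> (\<forall>k<n - 1. c k = 0)"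
  proof (intro allI impI)
    fix c k assume *: "\<forall>i<n. (\<Sum>k<n - 1. c k * (vs ! k) $ i) = 0" and k: "k < n - 1"
    show "c k = 0"
    proof (rule indep[OF _ k])
      fix i assume i: "i < n"
      have "(\<Sum>k<n - 1. c k * u k i) = (\<Sum>k<n - 1. c k * (vs ! k) $ i)"
        by (rule sum.cong) (use i in \<open>auto simp: nth\<close>)
      then show "(\<Sum>k<n - 1. c k * u k i) = 0" using * i by simp
    qed
  qed
  have dist: "distinct vs"
    unfolding distinct_conv_nth len
  proof (intro allI impI)
    fix a b assume ab: "a < n - 1" "b < n - 1" "a \<noteq> b"
    show "vs ! a \<noteq> vs ! b"
    proof
      assume eq: "vs ! a = vs ! b"
      \<comment> \<open>A repeated vector would give the relation with coefficients 1 and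
        -1.\<close>
      let ?c = "\<lambda>k. if k = a then 1 else if k = b then -1 else 0 :: rat"
      have "(\<Sum>k<n - 1. ?c k * (vs ! k) $ i) = 0" for i
      proof -
        have "(\<Sum>k<n - 1. ?c k * (vs ! k) $ i) = (\<Sum>k\<in>{a, b}. ?c k * (vs ! k) $ i)"
          using ab by (intro sum.mono_neutral_right) auto
        then show ?thesis using ab eq by simp
      qed
      then have "\<forall>k<n - 1. ?c k = 0" using ind[THEN spec, of ?c] by blast
      then have "?c a = 0" using ab(1) by blast
      then show False by simp
    qed
  qed
  obtain B where B: "mat_inverse (A_mat n vs v') = Some B" "B \<in> carrier_mat n n"
    "A_mat n vs v' * B = 1\<^sub>m n" "B * A_mat n vs v' = 1\<^sub>m n" "\<And>j. j < n \<Longrightarrow> B $$ (n - 1, j) = w' $ j"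
    using A_mat_inverse[OF n s1 len sub ind] by blast
  note A = conj_mat_eq(2)[OF B(1,2) len n] and M = conj_mat_eq(3)[OF B(1,2) len n]
  have s2: "step2 n w' vs"
    unfolding step2_iff[OF w' len dist sub]
    using ind orth_compl_spanned[OF n len w' B(2,3,5) A] by blast
  let ?T = "map_mat of_nat (adjacency_matrix n Q \<nu>) :: rat mat"
  let ?A = "A_mat n vs v'" and ?M = "M_mat n (of_nat l)"
  have T: "?T \<in> carrier_mat n n" by (simp add: adjacency_matrix_def)
  have Tij: "?T $$ (i, j) = of_nat (adj Q \<nu> i j)" if "i < n" "j < n" for i j
    using that by (simp add: adjacency_matrix_def adj_def)
  have "?T * ?A = ?A * ?M"
  proof (rule eq_matI)
    show "dim_row (?T * ?A) = dim_row (?A * ?M)" "dim_col (?T * ?A) = dim_col (?A * ?M)"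
      using T A M[of "of_nat l"] by auto
    fix i k assume "i < dim_row (?A * ?M)" "k < dim_col (?A * ?M)"
    then have ik: "i < n" "k < n" using A M[of "of_nat l"] by auto
    have R: "(?A * ?M) $$ (i, k) = (if Suc k = n then ?A $$ (i, n - 1) * of_nat l
        else if Suc (Suc k) < n then ?A $$ (i, Suc k) else 0)"
      unfolding mat_mult_index[OF A M ik] by (rule sum_M_mat_right[OF ik(2)])
    have L: "(?T * ?A) $$ (i, k) = (\<Sum>h<n. of_nat (adj Q \<nu> i h) * ?A $$ (h, k))"
      unfolding mat_mult_index[OF T A ik] by (intro sum.cong refl) (use ik Tij in simp)
    show "(?T * ?A) $$ (i, k) = (?A * ?M) $$ (i, k)"
    proof (cases "Suc k = n")
      case True
      have nk: "\<not> k < n - 1" using True by linarith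
      have "(\<Sum>h<n. of_nat (adj Q \<nu> i h) * ?A $$ (h, k)) = cmul n (adj Q \<nu>) v i"
        unfolding cmul_def using ik nk by (simp add: A_mat_index[OF len _ ik(2)] v'_def)
      then show ?thesis using L R True Tv[OF ik(1)] ik n A_mat_index[OF len ik(1), of "n - 1" v']
        by (simp add: v'_def)
    next
      case False
      then have k: "k < n - 1" using ik by simp
      have "(\<Sum>h<n. of_nat (adj Q \<nu> i h) * ?A $$ (h, k)) = cmul n (adj Q \<nu>) (u k) i"
        unfolding cmul_def using ik k by (simp add: A_mat_index[OF len _ ik(2)] nth)
      moreover have "?A $$ (i, Suc k) = u (Suc k) i" if "Suc k < n - 1"
        using that A_mat_index[OF len ik(1), of "Suc k" v'] nth[OF that] ik by simp
      moreover have "(Suc (Suc k) < n) = (Suc k < n - 1)" by linarith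
      ultimately show ?thesis using L R False Tu[OF k ik(1)] by simp
    qed
  qed
  then have "?A * ?M * B = ?T * ?A * B" by simp
  also have "\<dots> = ?T" using assoc_mult_mat[OF T A B(2)] B(3) T by simp
  finally have conj: "conj_mat n vs v' l = ?T" using conj_mat_eq(1)[OF B(1,2) len n] by simp
  have "1 \<cdot>\<^sub>m ?T = ?T" by (intro eq_matI) auto
  then have "step4 n vs v' l 1" "?T = of_nat 1 \<cdot>\<^sub>m conj_mat n vs v' l"
    unfolding step4_def conj by (simp_all add: Tij)
  moreover have "step3 n vs v' l" unfolding step3_def conj using l by (simp add: Tij)
  ultimately show ?thesis unfolding produced_def using s1 s2 by blast
qed

text \<open>The syzygy map acts on row vectors, so the useful basis consists of the rows
  \<open>r k\<close> of the inverse: \<open>B T = m M B\<close> sends each nilpotent row to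
  \<open>m\<close> times the previous one and scales the last row by \<open>m * l\<close>. The final
  clause expands a row vector \<open>x\<close> as \<open>(x A) B\<close>.\<close>

lemma produced_data:
  assumes n: "n \<ge> 1" and "produced n Q \<nu>"
  obtains l m v r A where "l \<ge> 2" "m \<ge> 1" "\<And>i. i < n \<Longrightarrow> v i > 0" "\<And>i. i < n \<Longrightarrow> r (n - 1) i > (0 :: rat)"
    "\<And>i. i < n \<Longrightarrow> cmul n (adj Q \<nu>) v i = of_nat (m * l) * v i"
    "rmul n (adj Q \<nu>) (r (n - 1)) = (\<lambda>j. of_nat (m * l) * r (n - 1) j)"
    "\<And>k. Suc k < n - 1 \<Longrightarrow> rmul n (adj Q \<nu>) (r (Suc k)) = (\<lambda>j. of_nat m * r k j)"
    "0 < n - 1 \<Longrightarrow> rmul n (adj Q \<nu>) (r 0) = 0"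
    "\<And>k. k < n \<Longrightarrow> r k \<noteq> 0" "\<And>k j. j \<ge> n \<Longrightarrow> r k j = 0"
    "\<And>x. (\<And>j. j \<ge> n \<Longrightarrow> x j = 0) \<Longrightarrow> x = (\<lambda>j. \<Sum>k<n. (\<Sum>i<n. x i * A i k) * r k j)"
proof -
  obtain v w vs l m where s: "step1 n v w" "step2 n w vs" "step3 n vs v l" "step4 n vs v l m"
    "map_mat of_nat (adjacency_matrix n Q \<nu>) = of_nat m \<cdot>\<^sub>m conj_mat n vs v l"
    using assms(2) unfolding produced_def by blast
  have w: "w \<in> carrier_vec n" using s(1) by (simp add: step1_def)
  note st2 = step2D[OF w s(2)]
  obtain B where B: "mat_inverse (A_mat n vs v) = Some B" "B \<in> carrier_mat n n"
    "A_mat n vs v * B = 1\<^sub>m n" "B * A_mat n vs v = 1\<^sub>m n" "\<And>j. j < n \<Longrightarrow> B $$ (n - 1, j) = w $ j"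
    using A_mat_inverse[OF n s(1) st2] by blast
  let ?A = "A_mat n vs v" and ?M = "M_mat n (of_nat l)"
  let ?T = "map_mat of_nat (adjacency_matrix n Q \<nu>) :: rat mat"
  note A = conj_mat_eq(2)[OF B(1,2) st2(1) n]
  have M: "?M \<in> carrier_mat n n" by (rule conj_mat_eq(3)[OF B(1,2) st2(1) n])
  have T: "?T \<in> carrier_mat n n" by (simp add: adjacency_matrix_def)
  have Tij: "?T $$ (i, j) = of_nat (adj Q \<nu> i j)" if "i < n" "j < n" for i j
    using that by (simp add: adjacency_matrix_def adj_def)
  have Teq: "?T = of_nat m \<cdot>\<^sub>m (?A * ?M * B)" using s(5) conj_mat_eq(1)[OF B(1,2) st2(1) n] by simp
  have AM: "?A * ?M \<in> carrier_mat n n" and MB: "?M * B \<in> carrier_mat n n" and AMB: "?A * ?M * B \<in> carrier_mat n n"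
    using A M B(2) by auto
  have "?A * ?M * B * ?A = ?A * ?M"
    using assoc_mult_mat[OF AM B(2) A] B(4) right_mult_one_mat[OF AM] by simp
  then have TA: "?T * ?A = of_nat m \<cdot>\<^sub>m (?A * ?M)" unfolding Teq using mult_smult_assoc_mat[OF AMB A] by simp
  have "B * (?A * ?M * B) = ?M * B"
    using assoc_mult_mat[OF A M B(2)] assoc_mult_mat[OF B(2) A MB] B(4) left_mult_one_mat[OF MB] by simp
  then have BT: "B * ?T = of_nat m \<cdot>\<^sub>m (?M * B)" unfolding Teq using mult_smult_distrib[OF B(2) AMB] by simp
  define r where "r k j = (if j < n then B $$ (k, j) else 0)" for k j
  have last: "Suc (n - 1) = n" "n - 1 < n" using n by simp_all
  have rT: "rmul n (adj Q \<nu>) (r k) j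
      = of_nat m * (if Suc k = n then of_nat l * r (n - 1) j else if k = 0 then 0 else r (k - 1) j)"
    if k: "k < n" for k j
  proof (cases "j < n")
    case True
    have "rmul n (adj Q \<nu>) (r k) j = (B * ?T) $$ (k, j)"
      unfolding mat_mult_index[OF B(2) T k True] rmul_def by (simp add: True Tij r_def)
    also have "\<dots> = of_nat m * (?M * B) $$ (k, j)" unfolding BT
      using k True carrier_matD[OF M] carrier_matD[OF B(2)] by simp
    also have "(?M * B) $$ (k, j) = (\<Sum>h<n. ?M $$ (k, h) * r h j)"
      unfolding mat_mult_index[OF M B(2) k True] by (simp add: r_def True)
    finally show ?thesis unfolding sum_M_mat_left[OF k] .
  qed (simp add: rmul_supp r_def)
  have cv: "cmul n (adj Q \<nu>) (\<lambda>i. v $ i) i = of_nat (m * l) * v $ i" if i: "i < n" for i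
  proof -
    have Av: "?A $$ (h, n - 1) = v $ h" if "h < n" for h
      using A_mat_index[OF st2(1) that last(2), of v] by simp
    have "cmul n (adj Q \<nu>) (\<lambda>i. v $ i) i = (?T * ?A) $$ (i, n - 1)"
      unfolding mat_mult_index[OF T A i last(2)] cmul_def by (simp add: i Tij Av del: One_nat_def)
    also have "\<dots> = of_nat m * (?A * ?M) $$ (i, n - 1)" unfolding TA
      using i last(2) carrier_matD[OF A] carrier_matD[OF M] by simp
    also have "(?A * ?M) $$ (i, n - 1) = v $ i * of_nat l"
      unfolding mat_mult_index[OF A M i last(2)] sum_M_mat_right[OF last(2)] using last(1) Av[OF i] by simp
    finally show ?thesis by simp
  qed
  have nz: "r k \<noteq> 0" if k: "k < n" for k
  proof
    assume "r k = 0"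
    then have "B $$ (k, j) = 0" if "j < n" for j using that by (metis r_def zero_fun_apply)
    then have "(B * ?A) $$ (k, k) = 0" unfolding mat_mult_index[OF B(2) A k k] by simp
    then show False using B(4) k by simp
  qed
  have expand: "x = (\<lambda>j. \<Sum>k<n. (\<Sum>i<n. x i * ?A $$ (i, k)) * r k j)"
    if x: "\<And>j. j \<ge> n \<Longrightarrow> x j = 0" for x
  proof
    fix j
    show "x j = (\<Sum>k<n. (\<Sum>i<n. x i * ?A $$ (i, k)) * r k j)"
    proof (cases "j < n")
      case True
      have "x j = (\<Sum>i<n. if i = j then x i else 0)" using True by simp
      also have "\<dots> = (\<Sum>i<n. x i * (?A * B) $$ (i, j))" by (intro sum.cong) (auto simp: B(3) True)
      also have "\<dots> = (\<Sum>i<n. \<Sum>k<n. x i * ?A $$ (i, k) * r k j)"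
        by (intro sum.cong refl) (simp add: mat_mult_index[OF A B(2) _ True] sum_distrib_left r_def True mult.assoc)
      also have "\<dots> = (\<Sum>k<n. \<Sum>i<n. x i * ?A $$ (i, k) * r k j)" by (rule sum.swap)
      also have "\<dots> = (\<Sum>k<n. (\<Sum>i<n. x i * ?A $$ (i, k)) * r k j)" by (simp add: sum_distrib_right)
      finally show ?thesis .
    qed (use x in \<open>simp add: r_def\<close>)
  qed
  show thesis
  proof (rule that[of l m "\<lambda>i. v $ i" r "\<lambda>i k. ?A $$ (i, k)"])
    show "l \<ge> 2" "m \<ge> 1" using s(3,4) by (simp_all add: step3_def step4_def)
    show "v $ i > 0" if "i < n" for i using s(1) that by (simp add: step1_def)
    show "r (n - 1) i > 0" if "i < n" for i using s(1) that B(5) by (simp add: step1_def r_def)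
    show "rmul n (adj Q \<nu>) (r (n - 1)) = (\<lambda>j. of_nat (m * l) * r (n - 1) j)"
      using rT[OF last(2)] last(1) by (auto simp: fun_eq_iff)
    show "rmul n (adj Q \<nu>) (r (Suc k)) = (\<lambda>j. of_nat m * r k j)" if "Suc k < n - 1" for k
      using rT[of "Suc k"] that by (auto simp: fun_eq_iff)
    show "rmul n (adj Q \<nu>) (r 0) = 0" if "0 < n - 1" using rT[of 0] that by (auto simp: fun_eq_iff)
    show "r k j = 0" if "j \<ge> n" for k j using that by (simp add: r_def)
  qed (fact cv nz expand)+
qed

section \<open>The syzygy map as multiplication by the adjacency matrix\<close>

lemma sum_fun_apply: "(\<Sum>k\<in>S. f k) i = (\<Sum>k\<in>S. f k i)" for f :: "'a \<Rightarrow> 'b \<Rightarrow> 'c::comm_monoid_add"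
  by (induction S rule: infinite_finite_induct) auto

lemma rmul_iter_sum:
  "finite S \<Longrightarrow> (rmul n T ^^ k) (\<lambda>j. \<Sum>h\<in>S. c h * r h j) = (\<lambda>j. \<Sum>h\<in>S. c h * (rmul n T ^^ k) (r h) j)"
proof (induction S rule: finite_induct)
  case empty
  have "(rmul n T ^^ k) 0 = 0" by (rule additive_zero[of "rmul n T ^^ k", OF rmul_iter_add])
  then show ?case by (simp add: zero_fun_def)
next
  case (insert h S)
  have "(\<lambda>j. \<Sum>h\<in>insert h S. c h * r h j) = (\<lambda>j. c h * r h j) + (\<lambda>j. \<Sum>h\<in>S. c h * r h j)"
    using insert.hyps by (auto simp: fun_eq_iff)
  then have "(rmul n T ^^ k) (\<lambda>j. \<Sum>h\<in>insert h S. c h * r h j)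
      = (rmul n T ^^ k) (\<lambda>j. c h * r h j) + (rmul n T ^^ k) (\<lambda>j. \<Sum>h\<in>S. c h * r h j)"
    by (simp only: rmul_iter_add)
  also have "\<dots> = (\<lambda>j. \<Sum>h\<in>insert h S. c h * (rmul n T ^^ k) (r h) j)"
    unfolding insert.IH rmul_iter_scale using insert.hyps by (auto simp: fun_eq_iff)
  finally show ?case .
qed

locale numbered_quiver = rad_square_zero R V E src tgt cv ca mk
  for R :: "('r, 'z) ring_scheme" (structure) and V :: "'v set" and E :: "'e set"
    and src tgt and cv :: "'r \<Rightarrow> 'v \<Rightarrow> 'k::field" and ca mk +
  fixes n :: nat and \<nu> :: "nat \<Rightarrow> 'v"
  assumes bij: "bij_betw \<nu> {0..<n} V" and n: "n \<ge> 1"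
begin

definition T :: "nat \<Rightarrow> nat \<Rightarrow> nat" where
  "T i j = card {e \<in> E. src e = \<nu> i \<and> tgt e = \<nu> j}"

definition rvec :: "('v \<Rightarrow>\<^sub>0 int) \<Rightarrow> nat \<Rightarrow> rat" where
  "rvec z j = (if j < n then of_int (Poly_Mapping.lookup z (\<nu> j)) else 0)"

lemma nu_V: "i < n \<Longrightarrow> \<nu> i \<in> V"
  using bij by (auto simp: bij_betw_def)

lemma V_nu: assumes "p \<in> V" obtains i where "i < n" "p = \<nu> i"
  using assms bij by (auto simp: bij_betw_def)

lemma V_nonempty: "V \<noteq> {}"
  using nu_V[of 0] n by auto

lemma src_T: assumes "i < n" shows "(\<exists>j<n. T i j \<noteq> 0) \<longleftrightarrow> \<nu> i \<in> src ` E"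
proof
  assume "\<exists>j<n. T i j \<noteq> 0"
  then show "\<nu> i \<in> src ` E" unfolding T_def by (metis (mono_tags, lifting) card.empty empty_Collect_eq image_eqI)
next
  assume "\<nu> i \<in> src ` E"
  then obtain e where e: "e \<in> E" "src e = \<nu> i" by auto
  obtain j where j: "j < n" "tgt e = \<nu> j" using V_nu[OF tgt_V[OF e(1)]] by blast
  have "e \<in> {e \<in> E. src e = \<nu> i \<and> tgt e = \<nu> j}" using e j by simp
  then have "T i j \<noteq> 0" unfolding T_def using finite_E by (subst card_0_eq) auto
  then show "\<exists>j<n. T i j \<noteq> 0" using j(1) by blast
qed

lemma tgt_T: assumes "j < n" shows "(\<exists>i<n. T i j \<noteq> 0) \<longleftrightarrow> \<nu> j \<in> tgt ` E"
proof
  assume "\<exists>i<n. T i j \<noteq> 0"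
  then show "\<nu> j \<in> tgt ` E" unfolding T_def by (metis (mono_tags, lifting) card.empty empty_Collect_eq image_eqI)
next
  assume "\<nu> j \<in> tgt ` E"
  then obtain e where e: "e \<in> E" "tgt e = \<nu> j" by auto
  obtain i where i: "i < n" "src e = \<nu> i" using V_nu[OF src_V[OF e(1)]] by blast
  have "e \<in> {e \<in> E. src e = \<nu> i \<and> tgt e = \<nu> j}" using e i by simp
  then have "T i j \<noteq> 0" unfolding T_def using finite_E by (subst card_0_eq) auto
  then show "\<exists>i<n. T i j \<noteq> 0" using i(1) by blast
qed

lemma rvec_Tz:
  assumes "Poly_Mapping.keys z \<subseteq> V" shows "rvec (Tz z) = rmul n T (rvec z)"
proof
  fix j
  show "rvec (Tz z) j = rmul n T (rvec z) j"
  proof (cases "j < n")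
    case True
    have "Poly_Mapping.lookup (Tz z) (\<nu> j)
        = (\<Sum>i\<in>{0..<n}. Poly_Mapping.lookup z (\<nu> i) * int (T i j))"
      unfolding lookup_Tz[OF assms] T_def by (rule sum.reindex_bij_betw[OF bij, symmetric])
    then show ?thesis using True by (simp add: rvec_def rmul_def atLeast0LessThan)
  qed (simp add: rvec_def rmul_def)
qed

lemma rvec_Tz_iter:
  assumes "Poly_Mapping.keys z \<subseteq> V" shows "rvec ((Tz ^^ k) z) = (rmul n T ^^ k) (rvec z)"
  by (induction k) (simp_all add: rvec_Tz Tz_iter_keys_V[OF assms])

lemma rvec_zero: "rvec 0 = 0"
  by (simp add: rvec_def fun_eq_iff)

lemma rvec_eq_zero:
  assumes "Poly_Mapping.keys z \<subseteq> V" "rvec z = 0" shows "z = 0"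
proof (rule poly_mapping_eqI)
  fix p
  show "Poly_Mapping.lookup z p = Poly_Mapping.lookup 0 p"
  proof (cases "p \<in> V")
    case True
    then obtain i where i: "i < n" "p = \<nu> i" by (rule V_nu)
    have "rvec z i = 0" using assms(2) by simp
    then show ?thesis using i by (simp add: rvec_def)
  next
    case False
    then show ?thesis using assms(1) by (auto simp: in_keys_iff)
  qed
qed

lemma rvec_surj:
  assumes "\<And>j. j < n \<Longrightarrow> x j \<in> \<int>" "\<And>j. j \<ge> n \<Longrightarrow> x j = 0"
  obtains z where "Poly_Mapping.keys z \<subseteq> V" "rvec z = x"
proof -
  define f where "f p = (if p \<in> V then \<lfloor>x (the_inv_into {0..<n} \<nu> p)\<rfloor> else 0)" for p
  have "{p. f p \<noteq> 0} \<subseteq> V" by (auto simp: f_def split: if_splits)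
  then have fin: "finite {p. f p \<noteq> 0}" by (rule finite_subset) (rule finite_V)
  define z where "z = Abs_poly_mapping f"
  have z: "Poly_Mapping.lookup z = f" unfolding z_def by (rule lookup_Abs_poly_mapping) (use fin in simp)
  have "Poly_Mapping.keys z \<subseteq> V" by (auto simp: in_keys_iff z f_def split: if_splits)
  moreover have "rvec z j = x j" for j
  proof (cases "j < n")
    case True
    have "the_inv_into {0..<n} \<nu> (\<nu> j) = j"
      using bij True by (intro the_inv_into_f_f) (auto simp: bij_betw_def)
    then have "f (\<nu> j) = \<lfloor>x j\<rfloor>" using nu_V[OF True] by (simp add: f_def)
    then show ?thesis using True assms(1)[OF True] by (auto simp: rvec_def z elim: Ints_cases)
  qed (simp add: rvec_def assms(2))
  ultimately show thesis using that by blast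
qed

text \<open>Upper bound: after \<open>n - 1\<close> steps only the component along the last row
  survives, where the map is multiplication by the nonzero \<open>m * l\<close>; the first syzygy
  adds one. Lower bound: an integral multiple of the top of the nilpotent chain dies after exactly
  \<open>n - 1\<close> steps, and it is a syzygy class.\<close>

lemma phi_dim_of_decomposition:
  assumes l: "l \<ge> (2::nat)" and m: "m \<ge> (1::nat)" and v: "\<And>i. i < n \<Longrightarrow> v i > 0" and rpos: "\<And>i. i < n \<Longrightarrow> r (n - 1) i > (0 :: rat)"
    and Tv: "\<And>i. i < n \<Longrightarrow> cmul n T v i = of_nat (m * l) * v i"
    and rlast: "rmul n T (r (n - 1)) = (\<lambda>j. of_nat (m * l) * r (n - 1) j)"
    and rSuc: "\<And>k. Suc k < n - 1 \<Longrightarrow> rmul n T (r (Suc k)) = (\<lambda>j. of_nat m * r k j)"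
    and r0: "0 < n - 1 \<Longrightarrow> rmul n T (r 0) = 0"
    and rne: "\<And>k. k < n \<Longrightarrow> r k \<noteq> 0" and rs: "\<And>k j. j \<ge> n \<Longrightarrow> r k j = 0"
    and expand: "\<And>x. (\<And>j. j \<ge> n \<Longrightarrow> x j = 0) \<Longrightarrow> x = (\<lambda>j. \<Sum>k<n. (\<Sum>i<n. x i * A i k) * r k j)"
  shows "phi_dim R = enat n"
proof -
  have ml: "of_nat (m * l) > (0 :: rat)" using l m by simp
  \<comment> \<open>A zero row or column would contradict a positive eigenvector with positive
    eigenvalue, so the quiver has neither sinks nor sources.\<close>
  have rows: "\<exists>j<n. T i j \<noteq> 0" if i: "i < n" for i
  proof (rule ccontr)
    assume "\<not> ?thesis"
    then have "cmul n T v i = 0" using i by (simp add: cmul_def)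
    then show False using Tv[OF i] mult_pos_pos[OF ml v[OF i]] by linarith
  qed
  have cols: "\<exists>i<n. T i j \<noteq> 0" if j: "j < n" for j
  proof (rule ccontr)
    assume "\<not> ?thesis"
    then have "rmul n T (r (n - 1)) j = 0" using j by (simp add: rmul_def)
    moreover have "rmul n T (r (n - 1)) j = of_nat (m * l) * r (n - 1) j" unfolding rlast ..
    ultimately show False using mult_pos_pos[OF ml rpos[OF j]] by linarith
  qed
  have nosink: "V \<subseteq> src ` E" using src_T rows by (auto elim: V_nu)
  have nosource: "V \<subseteq> tgt ` E" using tgt_T cols by (auto elim: V_nu)
  have kill: "(rmul n T ^^ Suc k) (r k) = 0" if "k < n - 1" for k
    using that
  proof (induction k)
    case (Suc k)
    have "(rmul n T ^^ Suc (Suc k)) (r (Suc k)) = (rmul n T ^^ Suc k) (\<lambda>j. of_nat m * r k j)"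
      using rSuc[OF Suc.prems] by (simp add: funpow_Suc_right del: funpow.simps)
    also have "\<dots> = 0"
      unfolding rmul_iter_scale using Suc by (simp add: fun_eq_iff del: funpow.simps)
    finally show ?case .
  qed (simp add: r0)
  have chain: "(rmul n T ^^ k) (r k) = (\<lambda>j. of_nat m ^ k * r 0 j)" if "k < n - 1" for k
    using that
  proof (induction k)
    case (Suc k)
    have "(rmul n T ^^ Suc k) (r (Suc k)) = (rmul n T ^^ k) (\<lambda>j. of_nat m * r k j)"
      using rSuc[OF Suc.prems] by (simp add: funpow_Suc_right del: funpow.simps)
    also have "\<dots> = (\<lambda>j. of_nat m ^ Suc k * r 0 j)"
      unfolding rmul_iter_scale Suc.IH[OF Suc_lessD[OF Suc.prems]] by (simp only: power_Suc mult.assoc)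
    finally show ?case .
  qed simp
  have eig_iter: "(rmul n T ^^ k) y = (\<lambda>j. q ^ k * y j)" if "rmul n T y = (\<lambda>j. q * y j)" for q y k
  proof (induction k)
    case (Suc k)
    have "(rmul n T ^^ Suc k) y = rmul n T (\<lambda>j. q ^ k * y j)" using Suc by simp
    also have "\<dots> = (\<lambda>j. q ^ Suc k * y j)" unfolding rmul_scale that by (simp only: power_Suc2 mult.assoc)
    finally show ?case .
  qed simp
  have stab: "stable M (n + s)" for M s
  proof -
    \<comment> \<open>One step of the \<open>n + s\<close> is the passage to the first syzygy, which
      \<open>stable_SucI\<close> absorbs.\<close>
    let ?k = "n - 1 + s"
    have "stable M (Suc ?k)"
    proof (rule stable_SucI)
      fix z assume z: "Poly_Mapping.keys z \<subseteq> tgt ` E" "Poly_Mapping.keys ((Tz ^^ Suc ?k) z) \<subseteq> V - src ` E"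
      have zV: "Poly_Mapping.keys z \<subseteq> V" using z(1) tgt_V by auto
      have "Poly_Mapping.keys ((Tz ^^ Suc ?k) z) = {}" using z(2) nosink by blast
      then have Tz0: "(Tz ^^ Suc ?k) z = 0" by (simp only: keys_eq_empty)
      have 0: "(rmul n T ^^ Suc ?k) (rvec z) = 0"
        unfolding rvec_Tz_iter[OF zV, symmetric] Tz0 rvec_zero ..
      define y where "y = (rmul n T ^^ (n - 1)) (rvec z)"
      define c where "c k = (\<Sum>i<n. rvec z i * A i k)" for k
      have "rvec z = (\<lambda>j. \<Sum>k<n. c k * r k j)" unfolding c_def by (rule expand) (simp add: rvec_def)
      then have "y = (\<lambda>j. \<Sum>k<n. c k * (rmul n T ^^ (n - 1)) (r k) j)"
        unfolding y_def by (simp only: rmul_iter_sum[OF finite_lessThan])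
      also have "\<dots> = (\<lambda>j. c (n - 1) * (rmul n T ^^ (n - 1)) (r (n - 1)) j)"
      proof
        fix j
        have "(rmul n T ^^ (n - 1)) (r k) = 0" if k: "k < n - 1" for k
        proof -
          have e: "n - 1 - Suc k + Suc k = n - 1" using k by simp
          have "(rmul n T ^^ (n - 1)) (r k) = (rmul n T ^^ (n - 1 - Suc k)) ((rmul n T ^^ Suc k) (r k))"
            using funpow_add[of "n - 1 - Suc k" "Suc k" "rmul n T"] unfolding e by (simp only: comp_apply)
          then show ?thesis unfolding kill[OF k]
            using additive_zero[of "rmul n T ^^ (n - 1 - Suc k)", OF rmul_iter_add] by simp
        qed
        then have "(\<Sum>k\<in>{..<n} - {n - 1}. c k * (rmul n T ^^ (n - 1)) (r k) j) = 0"
          by (intro sum.neutral) auto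
        then show "(\<Sum>k<n. c k * (rmul n T ^^ (n - 1)) (r k) j) = c (n - 1) * (rmul n T ^^ (n - 1)) (r (n - 1)) j"
          using n by (subst sum.remove[of _ "n - 1"]) auto
      qed
      finally have y: "y = (\<lambda>j. c (n - 1) * of_nat (m * l) ^ (n - 1) * r (n - 1) j)"
        unfolding eig_iter[OF rlast] by (simp only: mult.assoc)
      have "rmul n T y = (\<lambda>j. of_nat (m * l) * y j)"
        unfolding y rmul_scale rlast by (simp only: mult_ac)
      note yit = eig_iter[OF this]
      have ks: "(rmul n T ^^ (n - 1 + t)) (rvec z) = (rmul n T ^^ t) y" for t
        unfolding y_def using funpow_add[of t "n - 1" "rmul n T"] by (simp only: add.commute[of "n - 1" t] comp_apply)
      have "(rmul n T ^^ Suc s) y = 0" unfolding ks[symmetric] add_Suc_right by (rule 0)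
      then have "(\<lambda>j. of_nat (m * l) ^ Suc s * y j) = 0" unfolding yit .
      then have "of_nat (m * l) ^ Suc s * y j = 0" for j by (rule fun_cong[THEN trans]) simp
      moreover have "of_nat (m * l) ^ Suc s \<noteq> (0 :: rat)"
        by (rule power_not_zero) (rule less_imp_neq[OF ml, symmetric])
      ultimately have "y j = 0" for j by (metis mult_eq_0_iff)
      then have y0: "y = 0" by (intro ext) simp
      have "(rmul n T ^^ ?k) (rvec z) = 0"
        unfolding ks y0 by (rule additive_zero[of "rmul n T ^^ s", OF rmul_iter_add])
      then have "(Tz ^^ ?k) z = 0"
        using rvec_eq_zero[OF Tz_iter_keys_V[OF zV]] rvec_Tz_iter[OF zV] by metis
      then show "Poly_Mapping.keys ((Tz ^^ ?k) z) \<subseteq> V - src ` E" by simp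
    qed
    moreover have "Suc ?k = n + s" using n by simp
    ultimately show ?thesis by simp
  qed
  have "\<exists>M\<in>fg_modules R. \<not> stable M (n - 1)"
  \<comment> \<open>With one vertex the nilpotent chain is empty; the instability comes instead from
    the \<open>m * l \<ge> 2\<close> loops.\<close>
  proof (cases "n = 1")
    case True
    have V: "V = {\<nu> 0}" using bij True by (auto simp: bij_betw_def)
    have "{e \<in> E. src e = \<nu> 0 \<and> tgt e = \<nu> 0} = E" using src_V tgt_V V by auto
    then have "T 0 0 = card E" by (simp add: T_def)
    moreover have "(of_nat (T 0 0) :: rat) = of_nat (m * l)"
      using Tv[of 0] v[of 0] True by (simp add: cmul_def)
    moreover have "m * l \<ge> 2" using l m mult_le_mono[of 1 m 2 l] by simp
    ultimately have "card E \<ge> 2" by (simp only: of_nat_eq_iff)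
    then show ?thesis using one_vertex_unstable[OF V] True by (metis diff_self_eq_0)
  next
    case False
    define k where "k = n - 2"
    have k: "n - 1 = Suc k" "k < n - 1" "k < n" using False n by (auto simp: k_def)
    \<comment> \<open>Clearing denominators makes the rational chain vector an integral one;
      absolute values are used because \<open>common_denominator\<close> is about nonnegative
      numbers.\<close>
    have "\<exists>D\<ge>1. \<forall>q\<in>(\<lambda>j. \<bar>r k j\<bar>) ` {..<n}. of_nat D * q \<in> \<nat>"
      by (rule common_denominator) (simp, elim imageE, simp)
    then obtain D where D: "D \<ge> 1" "\<forall>q\<in>(\<lambda>j. \<bar>r k j\<bar>) ` {..<n}. of_nat D * q \<in> \<nat>" by blast
    have "of_nat D * r k j \<in> \<int>" if "j < n" for j
    proof -
      have "of_nat D * \<bar>r k j\<bar> \<in> \<nat>" by (rule bspec[OF D(2)]) (rule imageI, simp add: that)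
      then have "of_nat D * \<bar>r k j\<bar> \<in> \<int>" by (rule subsetD[OF Nats_subset_Ints])
      then show ?thesis by (cases "r k j \<ge> 0") (auto simp: minus_in_Ints_iff)
    qed
    moreover have supp: "of_nat D * r k j = 0" if "j \<ge> n" for j unfolding rs[OF that] by simp
    ultimately obtain z where z: "Poly_Mapping.keys z \<subseteq> V" "rvec z = (\<lambda>j. of_nat D * r k j)"
      by (rule rvec_surj)
    have "rvec ((Tz ^^ Suc k) z) = 0"
      unfolding rvec_Tz_iter[OF z(1)] z(2) rmul_iter_scale kill[OF k(2)] by (simp add: fun_eq_iff)
    then have z0: "(Tz ^^ Suc k) z = 0" by (rule rvec_eq_zero[OF Tz_iter_keys_V[OF z(1)]])
    have z1: "(Tz ^^ k) z \<noteq> 0"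
    proof
      assume "(Tz ^^ k) z = 0"
      then have "rvec ((Tz ^^ k) z) = 0" by (simp add: rvec_def fun_eq_iff)
      then have *: "(\<lambda>j. of_nat D * (of_nat m ^ k * r 0 j)) = 0"
        unfolding rvec_Tz_iter[OF z(1)] z(2) rmul_iter_scale chain[OF k(2)] .
      have "r 0 j = 0" for j using fun_cong[OF *, of j] D(1) m by simp
      then have "r 0 = 0" by (intro ext) simp
      then show False using rne[of 0] n by simp
    qed
    show ?thesis using unstable_exists[OF nosink nosource V_nonempty z(1) z0 z1] k(1) by metis
  qed
  then obtain M where "M \<in> fg_modules R" "\<not> stable M (n - 1)" by blast
  then show ?thesis by (rule phi_dim_eqI[OF stab]) (use n in simp)
qed

lemma decomposition_of_phi_dim:
  assumes phi: "phi_dim R = enat n"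
  obtains l v w u where "l \<ge> (2::nat)" "\<And>i. i < n \<Longrightarrow> v i > 0" "\<And>i. i < n \<Longrightarrow> w i > 0" "dot n v w = 1"
    "\<And>i. i < n \<Longrightarrow> cmul n T v i = of_nat l * v i" "\<And>k. k < n - 1 \<Longrightarrow> dot n w (u k) = 0"
    "\<And>c k. \<lbrakk>\<And>i. i < n \<Longrightarrow> (\<Sum>k<n - 1. c k * u k i) = 0; k < n - 1\<rbrakk> \<Longrightarrow> c k = 0"
    "\<And>k i. \<lbrakk>k < n - 1; i < n\<rbrakk> \<Longrightarrow> cmul n T (u k) i = (if Suc k < n - 1 then u (Suc k) i else 0)"
proof (cases "n = 1")
  case True
  have V: "V = {\<nu> 0}" using bij True by (auto simp: bij_betw_def)
  have "{e \<in> E. src e = \<nu> 0 \<and> tgt e = \<nu> 0} = E" using src_V tgt_V V by auto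
  then have T0: "T 0 0 = card E" by (simp add: T_def)
  obtain M s where M: "M \<in> fg_modules R" "\<not> stable M (0 + s)"
    \<comment> \<open>Dimension one means instability at some level, which a single vertex with at
      most one loop excludes.\<close>
    using phi_dim_unstable[of 0] phi True by auto
  have "card E \<ge> 2"
  proof (rule ccontr)
    assume "\<not> card E \<ge> 2"
    then show False using one_loop_stable[OF V _ M(1)] M(2) by simp
  qed
  then show thesis
    by (rule that[of "card E" "\<lambda>_. 1" "\<lambda>_. 1"]) (simp_all add: True dot_def cmul_def T0)
next
  case False
  then have n2: "n \<ge> 2" using n by simp
  define k where "k = n - 2"
  have k: "Suc k = n - 1" "k = n - 2" using n2 by (auto simp: k_def)
  have "phi_dim R = enat (Suc (n - 1))" using phi n by simp
  then obtain M s where M: "M \<in> fg_modules R" "\<not> stable M (n - 1 + s)" by (rule phi_dim_unstable)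
  have "n - 1 + s = Suc (k + s)" using k(1) by simp
  then have "\<not> stable M (Suc (k + s))" using M(2) by simp
  then obtain z where z: "Poly_Mapping.keys z \<subseteq> tgt ` E"
      "Poly_Mapping.keys ((Tz ^^ Suc (k + s)) z) \<subseteq> V - src ` E"
      "\<not> Poly_Mapping.keys ((Tz ^^ (k + s)) z) \<subseteq> V - src ` E"
    using unstable_SucD[OF M(1)] by blast
  \<comment> \<open>Instability is known only at some level \<open>n - 1 + s\<close>; the first
    \<open>s\<close> steps of \<open>Tz\<close> are absorbed into the vector, which stays supported
    on targets of arrows.\<close>
  define y where "y = (Tz ^^ s) z"
  have yt: "Poly_Mapping.keys y \<subseteq> tgt ` E" unfolding y_def by (rule Tz_iter_keys[OF z(1)])
  have yV: "Poly_Mapping.keys y \<subseteq> V" using yt tgt_V by auto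
  have y1: "Poly_Mapping.keys ((Tz ^^ Suc k) y) \<subseteq> V - src ` E"
    using z(2) unfolding y_def by (simp add: funpow_add)
  have y2: "\<not> Poly_Mapping.keys ((Tz ^^ k) y) \<subseteq> V - src ` E"
    using z(3) unfolding y_def by (simp add: funpow_add)
  let ?x = "rvec y"
  have xs: "?x j = 0" if "j \<ge> n" for j using that by (simp add: rvec_def)
  \<comment> \<open>This is the use of the support on targets: a vertex with zero column is not the
    target of any arrow.\<close>
  have x0: "?x j = 0" if "j < n" "\<forall>i<n. T i j = 0" for j
  proof -
    have "\<nu> j \<notin> tgt ` E" unfolding tgt_T[OF that(1), symmetric] using that(2) by simp
    then have "\<nu> j \<notin> Poly_Mapping.keys y" using yt by blast
    then show ?thesis by (simp add: rvec_def in_keys_iff)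
  qed
  have van: "(rmul n T ^^ (n - 1)) ?x i = 0" if i: "i < n" "\<exists>j<n. T i j \<noteq> 0" for i
  proof -
    have "\<nu> i \<notin> Poly_Mapping.keys ((Tz ^^ Suc k) y)" using y1 iffD1[OF src_T[OF i(1)] i(2)] by (metis DiffE subsetD)
    then have "rvec ((Tz ^^ Suc k) y) i = 0" by (simp add: rvec_def in_keys_iff del: funpow.simps)
    then show ?thesis unfolding rvec_Tz_iter[OF yV] k(1) .
  qed
  have nz: "\<exists>i<n. (\<exists>j<n. T i j \<noteq> 0) \<and> (rmul n T ^^ (n - 2)) ?x i \<noteq> 0"
  proof -
    obtain p where p: "p \<in> Poly_Mapping.keys ((Tz ^^ k) y)" "p \<notin> V - src ` E" using y2 by blast
    have "p \<in> V" using p(1) Tz_iter_keys_V[OF yV] by blast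
    then obtain i where i: "i < n" "p = \<nu> i" by (rule V_nu)
    have "\<nu> i \<in> src ` E" using p(2) \<open>p \<in> V\<close> i(2) by (metis DiffI)
    then have "\<exists>j<n. T i j \<noteq> 0" unfolding src_T[OF i(1)] .
    moreover have "rvec ((Tz ^^ k) y) i \<noteq> 0" using p(1) i by (simp add: rvec_def in_keys_iff)
    then have "(rmul n T ^^ (n - 2)) ?x i \<noteq> 0" unfolding rvec_Tz_iter[OF yV] k(2) .
    ultimately show ?thesis using i(1) by blast
  qed
  have ns: "\<forall>i<n. \<exists>j<n. T i j \<noteq> 0" "\<forall>j<n. \<exists>i<n. T i j \<noteq> 0"
    by (rule no_sinks_sources[of n T ?x]; fact n2 x0 xs nz van)+
  have nz': "(rmul n T ^^ (n - 2)) ?x \<noteq> 0" using nz by (metis zero_fun_apply)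
  have van': "(rmul n T ^^ (n - 1)) ?x = 0"
  proof
    fix i show "(rmul n T ^^ (n - 1)) ?x i = 0 i"
    proof (cases "i < n")
      case True
      then show ?thesis using van[OF True ns(1)[rule_format, OF True]] by simp
    next
      case False
      then show ?thesis using rmul_iter_supp[of n ?x i, OF xs] by simp
    qed
  qed
  show thesis
  proof (rule perron_data[of n T ?x], goal_cases)
    case (7 v w u l)
    note P = 7
    show thesis
    \<comment> \<open>The orbit of the single column vector \<open>u\<close> supplies the basis for
      Step 2, already in the order in which \<open>M_mat\<close> shifts it.\<close>
    proof (rule that[of l v w "\<lambda>k. (cmul n T ^^ k) u"])
      fix c :: "nat \<Rightarrow> rat" and h
      assume c: "\<And>i. i < n \<Longrightarrow> (\<Sum>k<n - 1. c k * (cmul n T ^^ k) u i) = 0" and h: "h < n - 1"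
      have us: "(cmul n T ^^ a) u i = 0" if "i \<ge> n" for a i
        using that P(9) by (cases a) (simp_all add: cmul_def)
      have "(\<Sum>a\<le>k. (\<lambda>i. c a * (cmul n T ^^ a) u i)) = 0"
      proof
        fix i
        have "{..k} = {..<n - 1}" using k(1) by auto
        then show "(\<Sum>a\<le>k. (\<lambda>i. c a * (cmul n T ^^ a) u i)) i = 0 i"
          unfolding sum_fun_apply using c[of i] us[of i] by (cases "i < n") auto
      qed
      then show "c h = 0"
        by (rule chain_coeffs[of "cmul n T" k u c h, OF cmul_add cmul_scale, rotated 2])
          (use h k P(7,8) in \<open>simp_all del: funpow.simps\<close>)
    next
      fix h i assume h: "h < n - 1" "i < n"
      have "cmul n T ((cmul n T ^^ h) u) = (cmul n T ^^ Suc h) u" by simp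
      moreover have "Suc h = n - 1" if "\<not> Suc h < n - 1" using that h(1) by simp
      ultimately show "cmul n T ((cmul n T ^^ h) u) i = (if Suc h < n - 1 then (cmul n T ^^ Suc h) u i else 0)"
        using P(8) by (auto simp del: funpow.simps)
    qed (rule P(6) | fact P)+
  qed (fact n2 ns xs nz' van')+
qed

end

section \<open>From coordinates back to the path algebra of a finite quiver\<close>

context fin_digraph
begin

lemma numbered_quiver_algebra:
  assumes "bij_betw \<nu> {0..<n} (verts G)" "n \<ge> 1"
  shows "numbered_quiver (rad_square_zero_algebra TYPE('k::field) G) (verts G) (arcs G) (tail G) (head G) qv qa
    (qmk :: _ \<Rightarrow> _ \<Rightarrow> ('a \<times> 'b list \<Rightarrow>\<^sub>0 'k) set) n \<nu>"
  by (intro numbered_quiver.intro numbered_quiver_axioms.intro rad_square_zero_quotient assms)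

lemma produced_phi_dim:
  assumes "bij_betw \<nu> {0..<n} (verts G)" "n \<ge> 1" "produced n G \<nu>"
  shows "phi_dim (rad_square_zero_algebra TYPE('k::field) G) = enat n"
proof -
  interpret N: numbered_quiver "rad_square_zero_algebra TYPE('k) G" "verts G" "arcs G" "tail G" "head G"
    qv qa "qmk :: _ \<Rightarrow> _ \<Rightarrow> ('a \<times> 'b list \<Rightarrow>\<^sub>0 'k) set" n \<nu>
    by (rule numbered_quiver_algebra[OF assms(1,2)])
  have T: "adj G \<nu> = N.T" by (simp add: fun_eq_iff adj_def N.T_def)
  show ?thesis
  proof (rule produced_data[OF assms(2,3), unfolded T], goal_cases)
    case (1 l m v r A)
    show ?case by (rule N.phi_dim_of_decomposition[of l m v r A]) (fact 1)+
  qed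
qed

lemma phi_dim_produced:
  assumes "bij_betw \<nu> {0..<n} (verts G)" "n \<ge> 1"
    and phi: "phi_dim (rad_square_zero_algebra TYPE('k::field) G) = enat n"
  shows "produced n G \<nu>"
proof -
  interpret N: numbered_quiver "rad_square_zero_algebra TYPE('k) G" "verts G" "arcs G" "tail G" "head G"
    qv qa "qmk :: _ \<Rightarrow> _ \<Rightarrow> ('a \<times> 'b list \<Rightarrow>\<^sub>0 'k) set" n \<nu>
    by (rule numbered_quiver_algebra[OF assms(1,2)])
  have T: "N.T = adj G \<nu>" by (simp add: fun_eq_iff adj_def N.T_def)
  show ?thesis
  proof (rule N.decomposition_of_phi_dim[OF phi, unfolded T], goal_cases)
    case (1 l v w u)
    show ?case by (rule producedI[of n l v w G \<nu> u]) (fact assms(2) 1)+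
  qed
qed

end

theorem mainTheorem1:
  fixes n :: nat
  assumes "n \<ge> 1"
  shows
    "(\<forall>v w vs. step1 n v w \<and> step2 n w vs \<longrightarrow>
        (\<exists>l. step3 n vs v l) \<and> (\<forall>l. step3 n vs v l \<longrightarrow> (\<exists>m. step4 n vs v l m))) \<and>
     (\<forall>(Q :: ('v, 'e) pre_digraph) \<nu>.
        fin_digraph Q \<and> bij_betw \<nu> {0..<n} (verts Q) \<and> produced n Q \<nu> \<longrightarrow>
        phi_dim (rad_square_zero_algebra TYPE('k::field) Q) = enat n) \<and>
     (\<forall>(Q :: ('v, 'e) pre_digraph) \<nu>.
        fin_digraph Q \<and> Digraph_Component.connected Q \<and> bij_betw \<nu> {0..<n} (verts Q) \<and>
        phi_dim (rad_square_zero_algebra TYPE('k::field) Q) = enat n \<longrightarrow>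
        produced n Q \<nu>)"
  using step3_exists[OF assms] step4_exists[OF assms] fin_digraph.produced_phi_dim[OF _ _ assms]
    fin_digraph.phi_dim_produced[OF _ _ assms]
  by blast

end
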